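(* Let $R$ be an LG-ring. (a) Let $M_1$ and $M_2$ be finite projective $R$-modules, and let $N$ be a faithfully projective $R$-module. Then $$M_1\otimes_R N\cong M_2\otimes_R N \implies M_1\cong M_2$$ (isomorphisms of $R$-modules). In particular, for any positive integer $n$, $M_1^{(n)}\cong M_2^{(n)}$ implies $M_1\cong M_2$, where $M_i^{(n)}$ is the direct sum of $n$ copies of $M_i$. (b) Let $A$, $B$ and $C$ be Azumaya $R$-algebras. Then $$A\otimes_R C\cong B\otimes_R C\implies A\cong B$$ (isomorphisms of $R$-algebras). In particular, for any positive integer $n$, $\mathrm{M}_n(A)\cong \mathrm{M}_n(B)$ implies $A\cong B$.
   Context: A commutative ring $R$ is an LG-ring if for every $n$ and every $f\in R[X_1,\dots,X_n]$ the following holds: there exists $r\in R^n$ with $f(r)\in R^\times$ if and only if for every maximal ideal $\mathfrak{m}$ of $R$ there exists $x\in (R/\mathfrak{m})^n$ with $f(x)\neq 0$ in $R/\mathfrak{m}$. "Finite projective" means finitely generated projective. A finite projective $R$-module $N$ is faithfully projective if it is faithful, equivalently $N\otimes_R R/\mathfrak{m}\ne 0$ for every maximal ideal $\mathfrak{m}$ of $R$. *)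

theory Defs
  imports "HOL-Algebra.Indexed_Polynomials" "HOL-Algebra.QuotRing" "HOL-Algebra.Module"
begin

section \<open>LG-rings\<close>

text \<open>\<open>P\<close> maps a monomial (a multiset of variables) to its coefficient, as in
  \<^theory>\<open>HOL-Algebra.Indexed_Polynomials\<close>.\<close>

definition poly_eval :: "('a, 'r) ring_scheme \<Rightarrow> ('i multiset \<Rightarrow> 'a) \<Rightarrow> ('i \<Rightarrow> 'a) \<Rightarrow> 'a" where
  "poly_eval R P x =
     (\<Oplus>\<^bsub>R\<^esub>m\<in>{m. P m \<noteq> \<zero>\<^bsub>R\<^esub>}. P m \<otimes>\<^bsub>R\<^esub> (\<Otimes>\<^bsub>R\<^esub>i\<in>set_mset m. x i [^]\<^bsub>R\<^esub> count m i))"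

definition LG_ring :: "('a, 'r) ring_scheme \<Rightarrow> bool" where
  "LG_ring R \<longleftrightarrow> cring R \<and>
     (\<forall>n::nat. \<forall>f\<in>ring.indexed_pset R {..<n} (carrier R).
        (\<exists>r\<in>{..<n} \<rightarrow> carrier R. poly_eval R f r \<in> Units R) \<longleftrightarrow>
        (\<forall>I. maximalideal I R \<longrightarrow>
           (\<exists>x\<in>{..<n} \<rightarrow> carrier (R Quot I).
              poly_eval (R Quot I) (\<lambda>m. I +>\<^bsub>R\<^esub> f m) x \<noteq> \<zero>\<^bsub>R Quot I\<^esub>)))"


section \<open>Modules\<close>

text \<open>The locale \<open>module\<close> ignores the fields \<open>mult\<close> and \<open>one\<close> of a \<open>module\<close> record;
  they matter only when the record is used as an algebra.\<close>

definition module_hom ::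
    "('a, 'r) ring_scheme \<Rightarrow> ('a, 'm) module \<Rightarrow> ('a, 'n) module \<Rightarrow> ('m \<Rightarrow> 'n) set" where
  "module_hom R M N = {h. h \<in> carrier M \<rightarrow> carrier N \<and>
     (\<forall>x\<in>carrier M. \<forall>y\<in>carrier M. h (x \<oplus>\<^bsub>M\<^esub> y) = h x \<oplus>\<^bsub>N\<^esub> h y) \<and>
     (\<forall>r\<in>carrier R. \<forall>x\<in>carrier M. h (r \<odot>\<^bsub>M\<^esub> x) = r \<odot>\<^bsub>N\<^esub> h x)}"

definition module_iso :: "('a, 'r) ring_scheme \<Rightarrow> ('a, 'm) module \<Rightarrow> ('a, 'n) module \<Rightarrow> bool" where
  "module_iso R M N \<longleftrightarrow> (\<exists>h\<in>module_hom R M N. bij_betw h (carrier M) (carrier N))"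

definition submodule_span ::
    "('a, 'r) ring_scheme \<Rightarrow> ('a, 'm) module \<Rightarrow> 'm set \<Rightarrow> 'm set" where
  "submodule_span R M S = \<Inter> {K. submodule K R M \<and> S \<subseteq> K}"

definition finitely_generated :: "('a, 'r) ring_scheme \<Rightarrow> ('a, 'm) module \<Rightarrow> bool" where
  "finitely_generated R M \<longleftrightarrow>
     (\<exists>S. finite S \<and> S \<subseteq> carrier M \<and> submodule_span R M S = carrier M)"

text \<open>The lifting property. A definition cannot quantify over types, so it is imposed for test
  modules in two fixed types, which accommodate the canonical surjection from the free module on
  the set \<open>M\<close> onto \<open>M\<close>; lemma \<open>projective_lift\<close> below extends it to all types.\<close>

definition projective :: "('a, 'r) ring_scheme \<Rightarrow> ('a, 'm) module \<Rightarrow> bool" where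
  "projective R M \<longleftrightarrow> module R M \<and>
     (\<forall>P :: ('a, 'm \<Rightarrow> 'a) module. \<forall>Q :: ('a, 'm) module. module R P \<longrightarrow> module R Q \<longrightarrow>
       (\<forall>g\<in>module_hom R P Q. \<forall>f\<in>module_hom R M Q. g ` carrier P = carrier Q \<longrightarrow>
          (\<exists>h\<in>module_hom R M P. \<forall>x\<in>carrier M. g (h x) = f x)))"

definition finite_projective :: "('a, 'r) ring_scheme \<Rightarrow> ('a, 'm) module \<Rightarrow> bool" where
  "finite_projective R M \<longleftrightarrow> finitely_generated R M \<and> projective R M"

definition faithful :: "('a, 'r) ring_scheme \<Rightarrow> ('a, 'm) module \<Rightarrow> bool" where
  "faithful R M \<longleftrightarrow>
     (\<forall>r\<in>carrier R. (\<forall>x\<in>carrier M. r \<odot>\<^bsub>M\<^esub> x = \<zero>\<^bsub>M\<^esub>) \<longrightarrow> r = \<zero>\<^bsub>R\<^esub>)"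

definition faithfully_projective :: "('a, 'r) ring_scheme \<Rightarrow> ('a, 'm) module \<Rightarrow> bool" where
  "faithfully_projective R M \<longleftrightarrow> finite_projective R M \<and> faithful R M"

definition direct_power :: "nat \<Rightarrow> ('a, 'm) module \<Rightarrow> ('a, nat \<Rightarrow> 'm) module" where
  "direct_power n M =
     \<lparr>carrier = {..<n} \<rightarrow>\<^sub>E carrier M,
      monoid.mult = (\<lambda>x y. \<lambda>i\<in>{..<n}. x i \<otimes>\<^bsub>M\<^esub> y i),
      one = (\<lambda>i\<in>{..<n}. \<one>\<^bsub>M\<^esub>),
      zero = (\<lambda>i\<in>{..<n}. \<zero>\<^bsub>M\<^esub>),
      add = (\<lambda>x y. \<lambda>i\<in>{..<n}. x i \<oplus>\<^bsub>M\<^esub> y i),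
      smult = (\<lambda>r x. \<lambda>i\<in>{..<n}. r \<odot>\<^bsub>M\<^esub> x i)\<rparr>"

definition quotient_module :: "('a, 'm) module \<Rightarrow> 'm set \<Rightarrow> ('a, 'm set) module" where
  "quotient_module M K =
     \<lparr>carrier = carrier (M Quot K), monoid.mult = monoid.mult (M Quot K), one = one (M Quot K),
      zero = zero (M Quot K), add = add (M Quot K),
      smult = (\<lambda>r Z. \<Union>x\<in>Z. K +>\<^bsub>M\<^esub> (r \<odot>\<^bsub>M\<^esub> x))\<rparr>"


section \<open>Free modules\<close>

definition single :: "('a, 'r) ring_scheme \<Rightarrow> 'g \<Rightarrow> 'g \<Rightarrow> 'a" where
  "single R u = (\<lambda>v. if v = u then \<one>\<^bsub>R\<^esub> else \<zero>\<^bsub>R\<^esub>)"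

text \<open>As a module this is the free \<open>R\<close>-module on the set \<open>carrier G\<close>, whatever the operations
  of \<open>G\<close>; the convolution product makes it the monoid algebra \<open>R[G]\<close> when \<open>G\<close> is a monoid.\<close>

definition monoid_algebra ::
    "('a, 'r) ring_scheme \<Rightarrow> ('g, 'k) monoid_scheme \<Rightarrow> ('a, 'g \<Rightarrow> 'a) module" where
  "monoid_algebra R G =
     \<lparr>carrier = {f. (\<forall>u. f u \<in> carrier R) \<and> finite {u. f u \<noteq> \<zero>\<^bsub>R\<^esub>} \<and> {u. f u \<noteq> \<zero>\<^bsub>R\<^esub>} \<subseteq> carrier G},
      monoid.mult = (\<lambda>f g w. \<Oplus>\<^bsub>R\<^esub>p\<in>{(u, v). f u \<noteq> \<zero>\<^bsub>R\<^esub> \<and> g v \<noteq> \<zero>\<^bsub>R\<^esub> \<and> u \<otimes>\<^bsub>G\<^esub> v = w}. f (fst p) \<otimes>\<^bsub>R\<^esub> g (snd p)),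
      one = single R \<one>\<^bsub>G\<^esub>,
      zero = (\<lambda>u. \<zero>\<^bsub>R\<^esub>),
      add = (\<lambda>f g u. f u \<oplus>\<^bsub>R\<^esub> g u),
      smult = (\<lambda>r f u. r \<otimes>\<^bsub>R\<^esub> f u)\<rparr>"

lemma monoid_algebra_module:
  assumes "cring R" shows "module R (monoid_algebra R G)"
proof -
  interpret R: cring R by fact
  have fin: "finite {u. h u \<noteq> \<zero>\<^bsub>R\<^esub>} \<and> {u. h u \<noteq> \<zero>\<^bsub>R\<^esub>} \<subseteq> carrier G"
    if "\<And>u. f u = \<zero>\<^bsub>R\<^esub> \<Longrightarrow> g u = \<zero>\<^bsub>R\<^esub> \<Longrightarrow> h u = \<zero>\<^bsub>R\<^esub>"
      "finite {u. f u \<noteq> \<zero>\<^bsub>R\<^esub>}" "finite {u. g u \<noteq> \<zero>\<^bsub>R\<^esub>}"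
      "{u. f u \<noteq> \<zero>\<^bsub>R\<^esub>} \<subseteq> carrier G" "{u. g u \<noteq> \<zero>\<^bsub>R\<^esub>} \<subseteq> carrier G" for f g h
  proof -
    have sub: "{u. h u \<noteq> \<zero>\<^bsub>R\<^esub>} \<subseteq> {u. f u \<noteq> \<zero>\<^bsub>R\<^esub>} \<union> {u. g u \<noteq> \<zero>\<^bsub>R\<^esub>}" using that(1) by blast
    with that show ?thesis by (meson finite_UnI finite_subset le_sup_iff order_trans)
  qed
  show ?thesis
  proof (rule moduleI)
    show "abelian_group (monoid_algebra R G)"
    proof (rule abelian_groupI)
      fix f g assume "f \<in> carrier (monoid_algebra R G)" "g \<in> carrier (monoid_algebra R G)"
      then show "f \<oplus>\<^bsub>monoid_algebra R G\<^esub> g \<in> carrier (monoid_algebra R G)"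
        using fin[of f g "\<lambda>u. f u \<oplus>\<^bsub>R\<^esub> g u"] by (auto simp: monoid_algebra_def)
    next
      fix f assume f: "f \<in> carrier (monoid_algebra R G)"
      then have "(\<lambda>u. \<ominus>\<^bsub>R\<^esub> f u) \<in> carrier (monoid_algebra R G)"
        using fin[of f f "\<lambda>u. \<ominus>\<^bsub>R\<^esub> f u"] by (auto simp: monoid_algebra_def)
      moreover have "(\<lambda>u. \<ominus>\<^bsub>R\<^esub> f u) \<oplus>\<^bsub>monoid_algebra R G\<^esub> f = \<zero>\<^bsub>monoid_algebra R G\<^esub>"
        using f by (auto simp: monoid_algebra_def R.l_neg)
      ultimately show "\<exists>g\<in>carrier (monoid_algebra R G). g \<oplus>\<^bsub>monoid_algebra R G\<^esub> f = \<zero>\<^bsub>monoid_algebra R G\<^esub>"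
        by blast
    qed (auto simp: monoid_algebra_def R.a_ac)
  next
    fix r f assume "r \<in> carrier R" "f \<in> carrier (monoid_algebra R G)"
    then show "r \<odot>\<^bsub>monoid_algebra R G\<^esub> f \<in> carrier (monoid_algebra R G)"
      using fin[of f f "\<lambda>u. r \<otimes>\<^bsub>R\<^esub> f u"] by (auto simp: monoid_algebra_def)
  qed (auto simp: monoid_algebra_def R.l_distr R.r_distr R.m_assoc assms)
qed

definition linear_extension where
  "linear_extension R M c f = (\<Oplus>\<^bsub>M\<^esub>u\<in>{u. f u \<noteq> \<zero>\<^bsub>R\<^esub>}. f u \<odot>\<^bsub>M\<^esub> c u)"

lemma linear_extension:
  fixes M :: "('a, 'm) module"
  assumes "module R M" and c: "c \<in> carrier G \<rightarrow> carrier M"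
  shows "linear_extension R M c \<in> module_hom R (monoid_algebra R G) M"
    and "u \<in> carrier G \<Longrightarrow> linear_extension R M c (single R u) = c u"
proof -
  interpret module R M by fact
  let ?F = "monoid_algebra R G"
  have ext: "linear_extension R M c f = (\<Oplus>\<^bsub>M\<^esub>u\<in>S. f u \<odot>\<^bsub>M\<^esub> c u)"
    if "\<And>u. f u \<in> carrier R" "{u. f u \<noteq> \<zero>\<^bsub>R\<^esub>} \<subseteq> S" "finite S" "S \<subseteq> carrier G" for f S
    unfolding linear_extension_def
    by (rule M.add.finprod_mono_neutral_cong_left) (use that c in \<open>auto simp: Pi_iff subset_iff\<close>)
  show "linear_extension R M c (single R u) = c u" if u: "u \<in> carrier G"
  proof -
    have "linear_extension R M c (single R u) = (\<Oplus>\<^bsub>M\<^esub>v\<in>{u}. single R u v \<odot>\<^bsub>M\<^esub> c v)"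
      by (rule ext) (use u in \<open>auto simp: single_def split: if_splits\<close>)
    then show ?thesis using u c by (simp add: single_def Pi_iff)
  qed
  show "linear_extension R M c \<in> module_hom R ?F M"
    unfolding module_hom_def
  proof (intro CollectI conjI ballI Pi_I)
    fix f assume f: "f \<in> carrier ?F"
    then show "linear_extension R M c f \<in> carrier M"
      unfolding linear_extension_def using c
      by (intro M.finsum_closed) (auto simp: monoid_algebra_def)
    fix r assume r: "r \<in> carrier R"
    let ?S = "{u. f u \<noteq> \<zero>\<^bsub>R\<^esub>}"
    have "linear_extension R M c (r \<odot>\<^bsub>?F\<^esub> f) = (\<Oplus>\<^bsub>M\<^esub>u\<in>?S. (r \<otimes>\<^bsub>R\<^esub> f u) \<odot>\<^bsub>M\<^esub> c u)"
    proof -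
      have "{u. (r \<odot>\<^bsub>?F\<^esub> f) u \<noteq> \<zero>\<^bsub>R\<^esub>} \<subseteq> ?S" using r by (auto simp: monoid_algebra_def)
      then show ?thesis
        using f r ext[of "r \<odot>\<^bsub>?F\<^esub> f" ?S] by (simp add: monoid_algebra_def)
    qed
    also have "\<dots> = (\<Oplus>\<^bsub>M\<^esub>u\<in>?S. r \<odot>\<^bsub>M\<^esub> (f u \<odot>\<^bsub>M\<^esub> c u))"
      using f r c by (intro M.finsum_cong') (auto simp: monoid_algebra_def smult_assoc1 Pi_iff subset_iff)
    also have "\<dots> = r \<odot>\<^bsub>M\<^esub> (\<Oplus>\<^bsub>M\<^esub>u\<in>?S. f u \<odot>\<^bsub>M\<^esub> c u)"
      using f r c by (subst finsum_smult_ldistr) (auto simp: monoid_algebra_def)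
    finally show "linear_extension R M c (r \<odot>\<^bsub>?F\<^esub> f) = r \<odot>\<^bsub>M\<^esub> linear_extension R M c f"
      by (simp add: linear_extension_def)
  next
    fix f g assume f: "f \<in> carrier ?F" and g: "g \<in> carrier ?F"
    let ?S = "{u. f u \<noteq> \<zero>\<^bsub>R\<^esub>} \<union> {u. g u \<noteq> \<zero>\<^bsub>R\<^esub>}"
    have S: "finite ?S" "?S \<subseteq> carrier G" and fg: "\<And>u. f u \<in> carrier R" "\<And>u. g u \<in> carrier R"
      using f g by (auto simp: monoid_algebra_def)
    have "linear_extension R M c (f \<oplus>\<^bsub>?F\<^esub> g) = (\<Oplus>\<^bsub>M\<^esub>u\<in>?S. (f u \<oplus>\<^bsub>R\<^esub> g u) \<odot>\<^bsub>M\<^esub> c u)"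
    proof -
      have "{u. (f \<oplus>\<^bsub>?F\<^esub> g) u \<noteq> \<zero>\<^bsub>R\<^esub>} \<subseteq> ?S" by (auto simp: monoid_algebra_def)
      then show ?thesis
        using S fg ext[of "f \<oplus>\<^bsub>?F\<^esub> g" ?S] by (simp add: monoid_algebra_def)
    qed
    also have "\<dots> = (\<Oplus>\<^bsub>M\<^esub>u\<in>?S. f u \<odot>\<^bsub>M\<^esub> c u \<oplus>\<^bsub>M\<^esub> g u \<odot>\<^bsub>M\<^esub> c u)"
      using S fg c by (intro M.finsum_cong') (auto simp: smult_l_distr Pi_iff subset_iff)
    also have "\<dots> = (\<Oplus>\<^bsub>M\<^esub>u\<in>?S. f u \<odot>\<^bsub>M\<^esub> c u) \<oplus>\<^bsub>M\<^esub> (\<Oplus>\<^bsub>M\<^esub>u\<in>?S. g u \<odot>\<^bsub>M\<^esub> c u)"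
      using S fg c by (intro M.finsum_addf) (auto simp: Pi_iff subset_iff)
    also have "\<dots> = linear_extension R M c f \<oplus>\<^bsub>M\<^esub> linear_extension R M c g"
      using S fg by (simp add: ext[symmetric])
    finally show "linear_extension R M c (f \<oplus>\<^bsub>?F\<^esub> g) = \<dots>" .
  qed
qed

lemma module_hom_eqI:
  fixes M :: "('a, 'm) module"
  assumes "module R M" "h \<in> module_hom R (monoid_algebra R G) M" "h' \<in> module_hom R (monoid_algebra R G) M"
    and eq: "\<And>u. u \<in> carrier G \<Longrightarrow> h (single R u) = h' (single R u)"
    and "f \<in> carrier (monoid_algebra R G)"
  shows "h f = h' f"
proof -
  interpret module R M by fact
  let ?F = "monoid_algebra R G"
  interpret F: module R ?F by (rule monoid_algebra_module) unfold_locales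
  have single: "single R u \<in> carrier ?F" if "u \<in> carrier G" for u
    using that finite_subset[of "{v. single R u v \<noteq> \<zero>\<^bsub>R\<^esub>}" "{u}"]
    by (auto simp: monoid_algebra_def single_def)
  have hz: "k \<zero>\<^bsub>?F\<^esub> = \<zero>\<^bsub>M\<^esub>" if k: "k \<in> module_hom R ?F M" for k
  proof -
    have "k (\<zero>\<^bsub>R\<^esub> \<odot>\<^bsub>?F\<^esub> \<zero>\<^bsub>?F\<^esub>) = \<zero>\<^bsub>R\<^esub> \<odot>\<^bsub>M\<^esub> k \<zero>\<^bsub>?F\<^esub>"
      using k F.zero_closed R.zero_closed unfolding module_hom_def by blast
    moreover have "k \<zero>\<^bsub>?F\<^esub> \<in> carrier M" using k by (auto simp: module_hom_def)
    ultimately show ?thesis by simp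
  qed
  have "finite S \<Longrightarrow> (\<forall>f\<in>carrier ?F. {u. f u \<noteq> \<zero>\<^bsub>R\<^esub>} = S \<longrightarrow> h f = h' f)" for S
  proof (induction S rule: finite_induct)
    case empty
    have "f = \<zero>\<^bsub>?F\<^esub>" if "{u. f u \<noteq> \<zero>\<^bsub>R\<^esub>} = {}" for f
      using that by (auto simp: monoid_algebra_def fun_eq_iff)
    then show ?case using hz[OF assms(2)] hz[OF assms(3)] by metis
  next
    case (insert u S)
    show ?case
    proof (intro ballI impI)
      fix f assume f: "f \<in> carrier ?F" and S: "{u. f u \<noteq> \<zero>\<^bsub>R\<^esub>} = insert u S"
      let ?g = "f(u := \<zero>\<^bsub>R\<^esub>)"
      have supp: "{v. ?g v \<noteq> \<zero>\<^bsub>R\<^esub>} = S" using S insert.hyps by (auto simp: set_eq_iff)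
      have g: "?g \<in> carrier ?F" 
      proof -
        have "\<forall>v. ?g v \<in> carrier R" "S \<subseteq> carrier G" using f S by (auto simp: monoid_algebra_def)
        then show ?thesis using supp insert.hyps(1) by (simp add: monoid_algebra_def)
      qed
      have u: "u \<in> carrier G" "f u \<in> carrier R" using f S by (auto simp: monoid_algebra_def)
      have "f = ?g \<oplus>\<^bsub>?F\<^esub> f u \<odot>\<^bsub>?F\<^esub> single R u"
        using f by (auto simp: monoid_algebra_def single_def fun_eq_iff)
      moreover have "k (?g \<oplus>\<^bsub>?F\<^esub> f u \<odot>\<^bsub>?F\<^esub> single R u) = k ?g \<oplus>\<^bsub>M\<^esub> f u \<odot>\<^bsub>M\<^esub> k (single R u)"
        if "k \<in> module_hom R ?F M" for k
        using that g u single[OF u(1)] by (auto simp: module_hom_def)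
      ultimately show "h f = h' f" using insert.IH g supp eq[OF u(1)] assms(2,3) by metis
    qed
  qed
  then show ?thesis using assms(5) by (auto simp: monoid_algebra_def)
qed

lemma module_hom_comp:
  "g \<in> module_hom R M N \<Longrightarrow> h \<in> module_hom R N P \<Longrightarrow> h \<circ> g \<in> module_hom R M P"
  by (auto simp: module_hom_def Pi_iff)

lemma projective_lift:
  fixes M :: "('a, 'm) module" and P :: "('a, 'p) module" and Q :: "('a, 'q) module"
  assumes M: "projective R M" and P: "module R P" and Q: "module R Q"
    and g: "g \<in> module_hom R P Q" "g ` carrier P = carrier Q" and f: "f \<in> module_hom R M Q"
  shows "\<exists>h\<in>module_hom R M P. \<forall>x\<in>carrier M. g (h x) = f x"
proof -
  have mM: "module R M" using M by (simp add: projective_def)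
  then interpret module R M .
  let ?F = "monoid_algebra R M"
  have F: "module R ?F" by (rule monoid_algebra_module) unfold_locales
  define p where "p = linear_extension R M (\<lambda>x. x)"
  have p: "p \<in> module_hom R ?F M" "\<And>x. x \<in> carrier M \<Longrightarrow> p (single R x) = x"
    unfolding p_def by (rule linear_extension[OF mM]; simp)+
  have sing: "single R x \<in> carrier ?F" if "x \<in> carrier M" for x
    using that finite_subset[of "{v. single R x v \<noteq> \<zero>\<^bsub>R\<^esub>}" "{x}"]
    by (auto simp: monoid_algebra_def single_def)
  have psurj: "p ` carrier ?F = carrier M"
  proof
    show "p ` carrier ?F \<subseteq> carrier M" using p(1) by (auto simp: module_hom_def)
    show "carrier M \<subseteq> p ` carrier ?F" using p(2) sing by (metis image_eqI subsetI)
  qed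
  have id: "(\<lambda>x. x) \<in> module_hom R M M" by (simp add: module_hom_def)
  obtain s where s: "s \<in> module_hom R M ?F" "\<And>x. x \<in> carrier M \<Longrightarrow> p (s x) = x"
  proof -
    have "\<exists>h\<in>module_hom R M ?F. \<forall>x\<in>carrier M. p (h x) = x"
      using M[unfolded projective_def, THEN conjunct2, rule_format, OF F mM p(1) id psurj] .
    then show ?thesis using that by blast
  qed
  have "\<forall>x\<in>carrier M. \<exists>y\<in>carrier P. g y = f x"
  proof
    fix x assume "x \<in> carrier M"
    then have "f x \<in> g ` carrier P" using f g(2) by (auto simp: module_hom_def)
    then show "\<exists>y\<in>carrier P. g y = f x" by auto
  qed
  then obtain c where c: "\<And>x. x \<in> carrier M \<Longrightarrow> c x \<in> carrier P \<and> g (c x) = f x" by metis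
  define l where "l = linear_extension R P c"
  have l: "l \<in> module_hom R ?F P" "\<And>x. x \<in> carrier M \<Longrightarrow> l (single R x) = c x"
    unfolding l_def by (rule linear_extension[OF P]; use c in auto)+
  have "(g \<circ> l) z = (f \<circ> p) z" if "z \<in> carrier ?F" for z
    by (rule module_hom_eqI[OF Q module_hom_comp[OF l(1) g(1)] module_hom_comp[OF p(1) f] _ that])
      (simp add: l p c)
  then have "g ((l \<circ> s) x) = f x" if "x \<in> carrier M" for x
  proof -
    have "s x \<in> carrier ?F" using that s(1) by (auto simp: module_hom_def)
    then have "g (l (s x)) = f (p (s x))" using \<open>\<And>z. z \<in> carrier ?F \<Longrightarrow> (g \<circ> l) z = (f \<circ> p) z\<close> by simp
    then show ?thesis using s(2)[OF that] by simp
  qed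
  then show ?thesis using module_hom_comp[OF s(1) l(1)] by blast
qed


section \<open>Tensor products\<close>

abbreviation tensor_free ::
    "('a, 'r) ring_scheme \<Rightarrow> ('a, 'm) module \<Rightarrow> ('a, 'n) module \<Rightarrow> ('a, 'm \<times> 'n \<Rightarrow> 'a) module" where
  "tensor_free R M N \<equiv> monoid_algebra R (M \<times>\<times> N)"

definition tensor_relators ::
    "('a, 'r) ring_scheme \<Rightarrow> ('a, 'm) module \<Rightarrow> ('a, 'n) module \<Rightarrow> ('m \<times> 'n \<Rightarrow> 'a) set" where
  "tensor_relators R M N = (let F = tensor_free R M N; e = (\<lambda>x y. single R (x, y)) in
     {e (x \<oplus>\<^bsub>M\<^esub> x') y \<ominus>\<^bsub>F\<^esub> (e x y \<oplus>\<^bsub>F\<^esub> e x' y) | x x' y.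
        x \<in> carrier M \<and> x' \<in> carrier M \<and> y \<in> carrier N} \<union>
     {e x (y \<oplus>\<^bsub>N\<^esub> y') \<ominus>\<^bsub>F\<^esub> (e x y \<oplus>\<^bsub>F\<^esub> e x y') | x y y'.
        x \<in> carrier M \<and> y \<in> carrier N \<and> y' \<in> carrier N} \<union>
     {e (r \<odot>\<^bsub>M\<^esub> x) y \<ominus>\<^bsub>F\<^esub> r \<odot>\<^bsub>F\<^esub> e x y | r x y.
        r \<in> carrier R \<and> x \<in> carrier M \<and> y \<in> carrier N} \<union>
     {e x (r \<odot>\<^bsub>N\<^esub> y) \<ominus>\<^bsub>F\<^esub> r \<odot>\<^bsub>F\<^esub> e x y | r x y.
        r \<in> carrier R \<and> x \<in> carrier M \<and> y \<in> carrier N})"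

definition tensor_kernel ::
    "('a, 'r) ring_scheme \<Rightarrow> ('a, 'm) module \<Rightarrow> ('a, 'n) module \<Rightarrow> ('m \<times> 'n \<Rightarrow> 'a) set" where
  "tensor_kernel R M N = submodule_span R (tensor_free R M N) (tensor_relators R M N)"

text \<open>For algebras \<open>M\<close>, \<open>N\<close> the convolution on \<open>R[M \<times> N]\<close> sends \<open>(x, y), (x', y')\<close> to
  \<open>(x x', y y')\<close> and the kernel is a two-sided ideal, so the quotient carries the usual product of
  the tensor product of algebras. For plain modules the fields \<open>mult\<close> and \<open>one\<close> are meaningless.\<close>

definition tensor ::
    "('a, 'r) ring_scheme \<Rightarrow> ('a, 'm) module \<Rightarrow> ('a, 'n) module \<Rightarrow>
     ('a, ('m \<times> 'n \<Rightarrow> 'a) set) module" where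
  "tensor R M N = quotient_module (tensor_free R M N) (tensor_kernel R M N)"

definition pure_tensor ::
    "('a, 'r) ring_scheme \<Rightarrow> ('a, 'm) module \<Rightarrow> ('a, 'n) module \<Rightarrow> 'm \<Rightarrow> 'n \<Rightarrow> ('m \<times> 'n \<Rightarrow> 'a) set" where
  "pure_tensor R M N x y = tensor_kernel R M N +>\<^bsub>tensor_free R M N\<^esub> single R (x, y)"


section \<open>Azumaya algebras\<close>

text \<open>Unlike the library locale \<open>algebra\<close>, this does not require commutativity.\<close>

definition R_algebra :: "('a, 'r) ring_scheme \<Rightarrow> ('a, 'b) module \<Rightarrow> bool" where
  "R_algebra R A \<longleftrightarrow> module R A \<and> ring A \<and>
     (\<forall>r\<in>carrier R. \<forall>x\<in>carrier A. \<forall>y\<in>carrier A.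
        (r \<odot>\<^bsub>A\<^esub> x) \<otimes>\<^bsub>A\<^esub> y = r \<odot>\<^bsub>A\<^esub> (x \<otimes>\<^bsub>A\<^esub> y) \<and>
        x \<otimes>\<^bsub>A\<^esub> (r \<odot>\<^bsub>A\<^esub> y) = r \<odot>\<^bsub>A\<^esub> (x \<otimes>\<^bsub>A\<^esub> y))"

definition algebra_isos ::
    "('a, 'r) ring_scheme \<Rightarrow> ('a, 'b) module \<Rightarrow> ('a, 'c) module \<Rightarrow> ('b \<Rightarrow> 'c) set" where
  "algebra_isos R A B = ring_iso A B \<inter> module_hom R A B"

definition algebra_iso :: "('a, 'r) ring_scheme \<Rightarrow> ('a, 'b) module \<Rightarrow> ('a, 'c) module \<Rightarrow> bool" where
  "algebra_iso R A B \<longleftrightarrow> algebra_isos R A B \<noteq> {}"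

definition opposite_algebra :: "('a, 'b) module \<Rightarrow> ('a, 'b) module" where
  "opposite_algebra A = A\<lparr>monoid.mult := (\<lambda>x y. y \<otimes>\<^bsub>A\<^esub> x)\<rparr>"

definition endo_algebra ::
    "('a, 'r) ring_scheme \<Rightarrow> ('a, 'm) module \<Rightarrow> ('a, 'm \<Rightarrow> 'm) module" where
  "endo_algebra R M =
     \<lparr>carrier = module_hom R M M \<inter> extensional (carrier M),
      monoid.mult = compose (carrier M),
      one = (\<lambda>x\<in>carrier M. x),
      zero = (\<lambda>x\<in>carrier M. \<zero>\<^bsub>M\<^esub>),
      add = (\<lambda>f g. \<lambda>x\<in>carrier M. f x \<oplus>\<^bsub>M\<^esub> g x),
      smult = (\<lambda>r f. \<lambda>x\<in>carrier M. r \<odot>\<^bsub>M\<^esub> f x)\<rparr>"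

definition matrix_algebra :: "nat \<Rightarrow> ('a, 'b) module \<Rightarrow> ('a, nat \<times> nat \<Rightarrow> 'b) module" where
  "matrix_algebra n A =
     \<lparr>carrier = {..<n} \<times> {..<n} \<rightarrow>\<^sub>E carrier A,
      monoid.mult = (\<lambda>f g. \<lambda>(i, j)\<in>{..<n} \<times> {..<n}. \<Oplus>\<^bsub>A\<^esub>k\<in>{..<n}. f (i, k) \<otimes>\<^bsub>A\<^esub> g (k, j)),
      one = (\<lambda>(i, j)\<in>{..<n} \<times> {..<n}. if i = j then \<one>\<^bsub>A\<^esub> else \<zero>\<^bsub>A\<^esub>),
      zero = (\<lambda>p\<in>{..<n} \<times> {..<n}. \<zero>\<^bsub>A\<^esub>),
      add = (\<lambda>f g. \<lambda>p\<in>{..<n} \<times> {..<n}. f p \<oplus>\<^bsub>A\<^esub> g p),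
      smult = (\<lambda>r f. \<lambda>p\<in>{..<n} \<times> {..<n}. r \<odot>\<^bsub>A\<^esub> f p)\<rparr>"

text \<open>\<open>A\<close> is faithfully projective and the canonical map from \<open>A\<close> tensored with its opposite to the
  endomorphisms of the module \<open>A\<close>, sending \<open>a \<otimes> b\<close> to \<open>x \<mapsto> a x b\<close>, is an isomorphism of algebras.
  The map is determined by its values on pure tensors, so the quantifier over \<open>\<phi>\<close> just names it.\<close>

definition azumaya :: "('a, 'r) ring_scheme \<Rightarrow> ('a, 'b) module \<Rightarrow> bool" where
  "azumaya R A \<longleftrightarrow> R_algebra R A \<and> faithfully_projective R A \<and>
     (\<exists>\<phi>\<in>algebra_isos R (tensor R A (opposite_algebra A)) (endo_algebra R A).
        \<forall>a\<in>carrier A. \<forall>b\<in>carrier A. \<forall>x\<in>carrier A.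
          \<phi> (pure_tensor R A (opposite_algebra A) a b) x = a \<otimes>\<^bsub>A\<^esub> x \<otimes>\<^bsub>A\<^esub> b)"

end

theory Submission
  imports "Jordan_Normal_Form.Determinant" Defs
begin

text \<open>Both cancellations are Skolem--Noether statements. Two actions of a separable family of operators
  on a finite projective module \<open>V\<close> are intertwined by many endomorphisms of \<open>V\<close>, namely by all averages
  \<open>\<Sum> x\<^sub>i h y\<^sub>i\<close>. Invertibility of an average is the nonvanishing of a determinant, hence a polynomial
  condition on the coefficients of \<open>h\<close>, so over an LG-ring it suffices to find an invertible
  intertwiner modulo each maximal ideal; there, one whose kernel has minimal dimension is invertible.
  For modules one conjugates two systems of generalized matrix units on \<open>V = M\<^sub>1 \<otimes> N \<cong> M\<^sub>2 \<otimes> N\<close>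
  and reads off an isomorphism \<open>M\<^sub>1 \<cong> M\<^sub>2\<close>. For algebras one conjugates two embeddings of \<open>C\<close> into
  \<open>S = A \<otimes> C \<cong> B \<otimes> C\<close> (or of the matrix units into the matrix algebra) among the operators on \<open>S\<close>
  that commute with right multiplications, so that the conjugating operator is left multiplication
  by a unit; it carries the centralizer \<open>A\<close> of one copy to the centralizer \<open>B\<close> of the other.\<close>


section \<open>Polynomial functions and ideals over a commutative ring type\<close>

text \<open>One separability idempotent would not do: its average projects onto the intertwiners but
  may kill a given operator, and the local argument would then find no nonzero \<open>Q G P\<close>
  to add. So averages come in families indexed by \<open>j\<close>. A combination with scalars
  \<open>s j\<close> gives the projection; one with operators \<open>t j\<close> recovers the
  operator, so the averages of a nonzero operator do not all vanish. For an Azumaya algebra the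
  family consists of the preimages, in the algebra tensored with its opposite, of rank-one maps
  built from a dual basis. By the same two combinations, regularity and primeness modulo a maximal
  ideal pass from all endomorphisms of \<open>V\<close> to commutants, which stands in for double
  centralizer theorems and the structure theory of simple algebras. The module \<open>V\<close> need
  not be free or of constant rank. It is treated as the image of an idempotent matrix
  \<open>e\<close>, and the determinant used is that of \<open>H + (1 - e)\<close>, a unit exactly
  when \<open>H\<close> is invertible on \<open>V\<close>. Returning from \<open>V\<close> to the
  modules \<open>M1\<close> and \<open>M2\<close> uses that the trace ideal of a faithfully
  projective module is the whole ring.\<close>

inductive polyfun :: "nat \<Rightarrow> ((nat \<Rightarrow> 'a::comm_ring_1) \<Rightarrow> 'a) \<Rightarrow> bool" for n where
  const: "polyfun n (\<lambda>x. c)"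
| add: "polyfun n f \<Longrightarrow> polyfun n g \<Longrightarrow> polyfun n (\<lambda>x. f x + g x)"
| mult_var: "polyfun n f \<Longrightarrow> i < n \<Longrightarrow> polyfun n (\<lambda>x. f x * x i)"

lemma polyfun_mult_const: "polyfun n f \<Longrightarrow> polyfun n (\<lambda>x. f x * c)"
proof (induction rule: polyfun.induct)
  case (mult_var f i)
  have "(\<lambda>x. f x * x i * c) = (\<lambda>x. f x * c * x i)" by (simp add: ac_simps)
  then show ?case using polyfun.mult_var[OF mult_var.IH mult_var.hyps(2)] by simp
qed (auto simp: distrib_right intro: polyfun.intros)

lemma polyfun_mult: "polyfun n g \<Longrightarrow> polyfun n f \<Longrightarrow> polyfun n (\<lambda>x. f x * g x)"
proof (induction rule: polyfun.induct)
  case (const c) then show ?case by (rule polyfun_mult_const)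
next
  case (mult_var g i)
  have "(\<lambda>x. f x * (g x * x i)) = (\<lambda>x. f x * g x * x i)" by (simp add: ac_simps)
  then show ?case using polyfun.mult_var[OF mult_var.IH[OF mult_var.prems] mult_var.hyps(2)] by simp
qed (auto simp: distrib_left intro: polyfun.intros)

lemma polyfun_sum: "(\<And>a. a \<in> S \<Longrightarrow> polyfun n (f a)) \<Longrightarrow> polyfun n (\<lambda>x. \<Sum>a\<in>S. f a x)"
  by (induction S rule: infinite_finite_induct) (auto intro: polyfun.intros)

lemma polyfun_prod: "(\<And>a. a \<in> S \<Longrightarrow> polyfun n (f a)) \<Longrightarrow> polyfun n (\<lambda>x. \<Prod>a\<in>S. f a x)"
  by (induction S rule: infinite_finite_induct) (auto intro: polyfun.intros polyfun_mult)

lemma polyfun_det: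
  assumes "\<And>i j. i < N \<Longrightarrow> j < N \<Longrightarrow> polyfun n (\<lambda>x. f x i j)"
  shows "polyfun n (\<lambda>x. det (mat N N (\<lambda>(i, j). f x i j)))"
proof -
  have "det (mat N N (\<lambda>(i, j). f x i j)) =
      (\<Sum>p | p permutes {0..<N}. of_int (sign p) * (\<Prod>i = 0..<N. f x i (p i)))" for x
    by (auto simp: det_def'[of _ N] intro!: sum.cong arg_cong2[where f = "(*)"] prod.cong)
  moreover have "polyfun n (\<lambda>x. \<Sum>p | p permutes {0..<N}. of_int (sign p) * (\<Prod>i = 0..<N. f x i (p i)))"
    by (intro polyfun_sum polyfun_mult polyfun_prod polyfun.const assms) (auto simp: permutes_in_image)
  ultimately show ?thesis by simp
qed

text \<open>Properness is added only in \<open>maximal_ideal_set\<close>: the ideal to which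
  \<open>trace_ideal\<close> applies these closure rules turns out to be the whole ring, and that is
  its point.\<close>

locale ideal_set =
  fixes m :: "'a::comm_ring_1 set"
  assumes zero: "0 \<in> m" and add: "a \<in> m \<Longrightarrow> b \<in> m \<Longrightarrow> a + b \<in> m" and mult: "a \<in> m \<Longrightarrow> r * a \<in> m"
begin

lemma mult_right: "a \<in> m \<Longrightarrow> a * r \<in> m" using mult[of a r] by (simp add: mult.commute)

lemma uminus: "a \<in> m \<Longrightarrow> - a \<in> m" using mult[of a "-1"] by simp

lemma diff: "a \<in> m \<Longrightarrow> b \<in> m \<Longrightarrow> a - b \<in> m" using add[of a "- b"] uminus by simp

lemma sum: "(\<And>i. i \<in> S \<Longrightarrow> f i \<in> m) \<Longrightarrow> (\<Sum>i\<in>S. f i) \<in> m"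
  by (induction S rule: infinite_finite_induct) (auto intro: zero add)

lemma prod_diff: "(\<And>i. i \<in> S \<Longrightarrow> f i - g i \<in> m) \<Longrightarrow> (\<Prod>i\<in>S. f i) - (\<Prod>i\<in>S. g i) \<in> m"
proof (induction S rule: infinite_finite_induct)
  case (insert a S)
  have "f a * prod f S - g a * prod g S = (f a - g a) * prod f S + g a * (prod f S - prod g S)"
    by (simp add: algebra_simps)
  then show ?case using insert by (auto intro: add mult mult_right)
qed (auto intro: zero)

lemma det_diff:
  assumes "\<And>i j. i < N \<Longrightarrow> j < N \<Longrightarrow> f i j - g i j \<in> m"
  shows "det (mat N N (\<lambda>(i, j). f i j)) - det (mat N N (\<lambda>(i, j). g i j)) \<in> m"
proof -
  have "det (mat N N (\<lambda>(i, j). h i j)) =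
      (\<Sum>p | p permutes {0..<N}. of_int (sign p) * (\<Prod>i = 0..<N. h i (p i)))" for h :: "nat \<Rightarrow> nat \<Rightarrow> 'a"
    by (auto simp: det_def'[of _ N] intro!: sum.cong arg_cong2[where f = "(*)"] prod.cong)
  then show ?thesis
    by (auto simp: sum_subtractf[symmetric] right_diff_distrib[symmetric] permutes_in_image
        intro!: sum mult prod_diff assms)
qed

end

text \<open>\<open>inverse\<close> says in terms of representatives that the quotient by
  \<open>m\<close> is a field; linear algebra over the residue field is done by congruences modulo
  \<open>m\<close>.\<close>

locale maximal_ideal_set = ideal_set +
  assumes one: "1 \<notin> m" and inverse: "a \<notin> m \<Longrightarrow> \<exists>b. 1 - a * b \<in> m"


section \<open>Finitely supported matrices\<close>

text \<open>Matrices of all sizes form one ring without unit; endomorphism rings are corners \<open>e H e\<close> of it.\<close>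

typedef (overloaded) 'a finmat =
    "{f :: nat \<Rightarrow> nat \<Rightarrow> 'a::zero. \<exists>N. \<forall>i j. N \<le> i \<or> N \<le> j \<longrightarrow> f i j = 0}"
  morphisms entry Finmat by (rule exI[of _ "\<lambda>_ _. 0"]) auto

setup_lifting type_definition_finmat

lemma finmat_eqI: "(\<And>i j. entry A i j = entry B i j) \<Longrightarrow> A = B"
  by (metis entry_inject ext)

definition supp :: "nat \<Rightarrow> 'a::zero finmat \<Rightarrow> bool" where
  "supp N A \<longleftrightarrow> (\<forall>i j. N \<le> i \<or> N \<le> j \<longrightarrow> entry A i j = 0)"

lemma suppD: "supp N A \<Longrightarrow> N \<le> i \<Longrightarrow> entry A i j = 0" "supp N A \<Longrightarrow> N \<le> j \<Longrightarrow> entry A i j = 0"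
  by (auto simp: supp_def)

lemma ex_supp: "\<exists>N. supp N A"
  using entry[of A] by (auto simp: supp_def)

lemma supp_mono: "supp N A \<Longrightarrow> N \<le> N' \<Longrightarrow> supp N' A"
  by (auto simp: supp_def)

lift_definition tab :: "nat \<Rightarrow> (nat \<Rightarrow> nat \<Rightarrow> 'a::zero) \<Rightarrow> 'a finmat"
  is "\<lambda>N f i j. if i < N \<and> j < N then f i j else 0"
  by (metis leD)

lemma entry_tab: "entry (tab N f) i j = (if i < N \<and> j < N then f i j else 0)"
  by transfer simp

lemma supp_tab: "supp N (tab N f)" by (auto simp: supp_def entry_tab)

instantiation finmat :: (comm_ring_1) ring
begin

lift_definition zero_finmat :: "'a finmat" is "\<lambda>_ _. 0" by auto

lift_definition plus_finmat :: "'a finmat \<Rightarrow> 'a finmat \<Rightarrow> 'a finmat" is "\<lambda>f g i j. f i j + g i j"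
proof -
  fix f g :: "nat \<Rightarrow> nat \<Rightarrow> 'a"
  assume "\<exists>N. \<forall>i j. N \<le> i \<or> N \<le> j \<longrightarrow> f i j = 0" "\<exists>N. \<forall>i j. N \<le> i \<or> N \<le> j \<longrightarrow> g i j = 0"
  then obtain M N where "\<forall>i j. M \<le> i \<or> M \<le> j \<longrightarrow> f i j = 0" "\<forall>i j. N \<le> i \<or> N \<le> j \<longrightarrow> g i j = 0" by blast
  then show "\<exists>N. \<forall>i j. N \<le> i \<or> N \<le> j \<longrightarrow> f i j + g i j = 0" by (intro exI[of _ "max M N"]) auto
qed

lift_definition uminus_finmat :: "'a finmat \<Rightarrow> 'a finmat" is "\<lambda>f i j. - f i j" by auto

lift_definition minus_finmat :: "'a finmat \<Rightarrow> 'a finmat \<Rightarrow> 'a finmat" is "\<lambda>f g i j. f i j - g i j"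
proof -
  fix f g :: "nat \<Rightarrow> nat \<Rightarrow> 'a"
  assume "\<exists>N. \<forall>i j. N \<le> i \<or> N \<le> j \<longrightarrow> f i j = 0" "\<exists>N. \<forall>i j. N \<le> i \<or> N \<le> j \<longrightarrow> g i j = 0"
  then obtain M N where "\<forall>i j. M \<le> i \<or> M \<le> j \<longrightarrow> f i j = 0" "\<forall>i j. N \<le> i \<or> N \<le> j \<longrightarrow> g i j = 0" by blast
  then show "\<exists>N. \<forall>i j. N \<le> i \<or> N \<le> j \<longrightarrow> f i j - g i j = 0" by (intro exI[of _ "max M N"]) auto
qed

text \<open>Summing over the nonzero entries of a row of the left factor makes the sum finite
  without fixing a size; by \<open>entry_times\<close> any bound for the left factor can serve as
  the range.\<close>

lift_definition times_finmat :: "'a finmat \<Rightarrow> 'a finmat \<Rightarrow> 'a finmat"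
  is "\<lambda>f g i j. \<Sum>k | f i k \<noteq> 0. f i k * g k j"
proof -
  fix f g :: "nat \<Rightarrow> nat \<Rightarrow> 'a"
  assume "\<exists>N. \<forall>i j. N \<le> i \<or> N \<le> j \<longrightarrow> f i j = 0" "\<exists>N. \<forall>i j. N \<le> i \<or> N \<le> j \<longrightarrow> g i j = 0"
  then obtain M N where "\<forall>i j. M \<le> i \<or> M \<le> j \<longrightarrow> f i j = 0" "\<forall>i j. N \<le> i \<or> N \<le> j \<longrightarrow> g i j = 0" by blast
  then show "\<exists>N. \<forall>i j. N \<le> i \<or> N \<le> j \<longrightarrow> (\<Sum>k | f i k \<noteq> 0. f i k * g k j) = 0"
    by (intro exI[of _ "max M N"]) (auto intro!: sum.neutral)
qed

lemma entry_times: "supp N A \<Longrightarrow> entry (A * B) i j = (\<Sum>k<N. entry A i k * entry B k j)"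
proof -
  assume "supp N A"
  then have "{k. entry A i k \<noteq> 0} \<subseteq> {..<N}" by (metis (mono_tags) linorder_not_less mem_Collect_eq lessThan_iff subsetI suppD(2))
  then have "(\<Sum>k | entry A i k \<noteq> 0. entry A i k * entry B k j) = (\<Sum>k<N. entry A i k * entry B k j)"
    by (intro sum.mono_neutral_left) auto
  then show ?thesis by (simp add: times_finmat.rep_eq)
qed

lemma ex_supp3: "\<exists>N. supp N A \<and> supp N B \<and> supp N C"
proof -
  obtain a b c where "supp a A" "supp b B" "supp c C" using ex_supp by metis
  then have "supp (max a (max b c)) A" "supp (max a (max b c)) B" "supp (max a (max b c)) C"
    by (auto elim: supp_mono)
  then show ?thesis by blast
qed

lemma supp_times: "supp N A \<Longrightarrow> supp N B \<Longrightarrow> supp N (A * B)"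
  by (auto simp: supp_def entry_times[of N A])

instance
proof
  fix A B C :: "'a finmat"
  show "A + B + C = A + (B + C)" by transfer (simp add: add.assoc)
  show "A + B = B + A" by transfer (simp add: add.commute)
  show "0 + A = A" by transfer simp
  show "- A + A = 0" by transfer simp
  show "A - B = A + - B" by transfer simp
  obtain N where N: "supp N A" "supp N B" "supp N C" using ex_supp3 by metis
  have sAB: "supp N (A + B)" using N by (auto simp: supp_def plus_finmat.rep_eq)
  show "A * B * C = A * (B * C)"
  proof (rule finmat_eqI)
    fix i j
    have "entry (A * B * C) i j = (\<Sum>k<N. \<Sum>l<N. entry A i l * entry B l k * entry C k j)"
      using N supp_times[of N A B] by (simp add: entry_times[of N] sum_distrib_right)
    also have "\<dots> = (\<Sum>l<N. \<Sum>k<N. entry A i l * entry B l k * entry C k j)" by (rule sum.swap)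
    also have "\<dots> = entry (A * (B * C)) i j"
      using N by (simp add: entry_times[of N] sum_distrib_left mult.assoc)
    finally show "entry (A * B * C) i j = entry (A * (B * C)) i j" .
  qed
  show "(A + B) * C = A * C + B * C"
    by (rule finmat_eqI)
      (simp add: entry_times[OF N(1)] entry_times[OF N(2)] entry_times[OF sAB] plus_finmat.rep_eq
        distrib_right sum.distrib)
  show "A * (B + C) = A * B + A * C"
    by (rule finmat_eqI)
      (simp add: entry_times[OF N(1)] plus_finmat.rep_eq distrib_left sum.distrib)
qed

end

lemmas entry_simps [simp] = zero_finmat.rep_eq plus_finmat.rep_eq uminus_finmat.rep_eq minus_finmat.rep_eq

lemma entry_sum [simp]: "entry (\<Sum>a\<in>S. f a) i j = (\<Sum>a\<in>S. entry (f a) i j)"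
  by (induction S rule: infinite_finite_induct) auto

lift_definition smul :: "'a::comm_ring_1 \<Rightarrow> 'a finmat \<Rightarrow> 'a finmat" is "\<lambda>c f i j. c * f i j"
  by (metis mult_zero_right)

lemmas entry_smul [simp] = smul.rep_eq

lemma supp_smul: "supp N A \<Longrightarrow> supp N (smul c A)" by (auto simp: supp_def)

lemma supp_add: "supp N A \<Longrightarrow> supp N B \<Longrightarrow> supp N (A + B)" by (auto simp: supp_def)

lemma supp_diff: "supp N A \<Longrightarrow> supp N B \<Longrightarrow> supp N (A - B)" by (auto simp: supp_def)

lemma smul_simps:
  fixes A B :: "'a::comm_ring_1 finmat"
  shows "smul c (A + B) = smul c A + smul c B" "smul (c + d) A = smul c A + smul d A"
    "smul c (A - B) = smul c A - smul c B" "smul c (smul d A) = smul (c * d) A"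
    "smul c A * B = smul c (A * B)" "A * smul c B = smul c (A * B)"
    "smul 0 A = 0" "smul 1 A = A" "smul c 0 = (0 :: 'a finmat)"
proof -
  obtain N where N: "supp N A" using ex_supp by blast
  show "smul c A * B = smul c (A * B)" "A * smul c B = smul c (A * B)"
    by (rule finmat_eqI,
        simp add: entry_times[OF N] entry_times[OF supp_smul[OF N]] sum_distrib_left ac_simps)+
qed (rule finmat_eqI, simp add: algebra_simps)+

lemma smul_sum: "smul c (\<Sum>a\<in>S. f a) = (\<Sum>a\<in>S. smul c (f a))"
  by (rule finmat_eqI) (simp add: sum_distrib_left)

lemma smul_sum_left: "smul (\<Sum>a\<in>S. f a) A = (\<Sum>a\<in>S. smul (f a) A)"
  by (rule finmat_eqI) (simp add: sum_distrib_right)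

section \<open>Matrix units\<close>

definition munit :: "nat \<Rightarrow> nat \<Rightarrow> 'a::comm_ring_1 finmat" where
  "munit a b = tab (Suc (max a b)) (\<lambda>i j. if i = a \<and> j = b then 1 else 0)"

lemma entry_munit: "entry (munit a b) i j = (if i = a \<and> j = b then 1 else 0)"
  by (auto simp: munit_def entry_tab)

lemma entry_times_munit: "entry (A * munit a b) i j = (if j = b then entry A i a else 0)"
proof -
  obtain N where "supp N A" using ex_supp by blast
  then have N: "supp (max N (Suc a)) A" by (rule supp_mono) simp
  show ?thesis by (simp add: entry_times[OF N] entry_munit if_distrib[of "(*) _"] less_max_iff_disj cong: if_cong)
qed

text \<open>Inserting a matrix unit gives a rank-one matrix, a column of \<open>A\<close> times a
  row of \<open>B\<close>. The elimination step of \<open>von_neumann_regular\<close> and the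
  primeness of corners both rest on it.\<close>

lemma entry_munit_sandwich: "entry (A * munit a b * B) i j = entry A i a * entry B b j"
proof -
  obtain N where "supp N (A * munit a b)" using ex_supp by blast
  then have N: "supp (max N (Suc b)) (A * munit a b)" by (rule supp_mono) simp
  have "entry (A * munit a b * B) i j =
      (\<Sum>k<max N (Suc b). if k = b then entry A i a * entry B b j else 0)"
    unfolding entry_times[OF N] by (intro sum.cong) (auto simp: entry_times_munit)
  then show ?thesis by simp
qed

lemma finmat_as_sum:
  assumes "supp N A" shows "A = (\<Sum>p\<in>{..<N} \<times> {..<N}. smul (entry A (fst p) (snd p)) (munit (fst p) (snd p)))"
proof (rule finmat_eqI)
  fix i j
  have "entry (\<Sum>p\<in>{..<N} \<times> {..<N}. smul (entry A (fst p) (snd p)) (munit (fst p) (snd p))) i j =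
      (\<Sum>p\<in>{..<N} \<times> {..<N}. if p = (i, j) then entry A i j else 0)"
    by (auto simp add: entry_munit simp del: sum.delta sum.delta' intro!: sum.cong)
  also have "\<dots> = entry A i j" using suppD[OF assms] by (auto simp: sum.delta not_less)
  finally show "entry A i j =
      entry (\<Sum>p\<in>{..<N} \<times> {..<N}. smul (entry A (fst p) (snd p)) (munit (fst p) (snd p))) i j" by simp
qed

section \<open>Determinant and adjugate of 1 + A\<close>

definition one_finmat :: "nat \<Rightarrow> 'a::comm_ring_1 finmat" where
  "one_finmat N = tab N (\<lambda>i j. if i = j then 1 else 0)"

lemma one_finmat_times: "supp N A \<Longrightarrow> one_finmat N * A = A" "supp N A \<Longrightarrow> A * one_finmat N = A"
proof -
  assume A: "supp N A"
  have 1: "supp N (tab N (\<lambda>i j. if i = j then 1 else 0 :: 'a))" by (rule supp_tab)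
  have *: "(\<Sum>k<N. (if i < N \<and> k < N then if i = k then 1 else 0 else 0) * entry A k j) =
     (\<Sum>k<N. if k = i then entry A i j else 0)" for i j by (intro sum.cong) auto
  show "one_finmat N * A = A"
    by (rule finmat_eqI, unfold one_finmat_def entry_times[OF 1] entry_tab *) (use suppD[OF A] in \<open>auto simp: not_less\<close>)
  have *: "(\<Sum>k<N. entry A i k * (if k < N \<and> j < N then if k = j then 1 else 0 else 0)) =
     (\<Sum>k<N. if k = j then entry A i j else 0)" for i j by (intro sum.cong) auto
  show "A * one_finmat N = A"
    by (rule finmat_eqI, unfold entry_times[OF A] one_finmat_def entry_tab *) (use suppD[OF A] in \<open>auto simp: not_less\<close>)
qed

text \<open>In the absence of a unit, \<open>A\<close> stands for the matrix 1 + A, and products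
  turn into \<open>A + B + A * B\<close>. If \<open>A = H - e\<close> with \<open>H\<close> in the
  corner of an idempotent \<open>e\<close>, then 1 + A is \<open>H\<close> on the image of
  \<open>e\<close> and the identity on its kernel, so \<open>det1\<close> is the determinant of
  \<open>H\<close> as an endomorphism of a projective module.\<close>

definition det1 :: "nat \<Rightarrow> 'a::comm_ring_1 finmat \<Rightarrow> 'a" where
  "det1 N A = det (mat N N (\<lambda>(i, j). (if i = j then 1 else 0) + entry A i j))"

lemma det1_mult:
  assumes "supp N A" "supp N B"
  shows "det1 N A * det1 N B = det1 N (A + B + A * B)"
proof -
  let ?m = "\<lambda>A. mat N N (\<lambda>(i, j). (if i = j then 1 else 0) + entry A i j)"
  have "?m A * ?m B = ?m (A + B + A * B)"
  proof (rule eq_matI)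
    fix i j assume ij: "i < dim_row (?m (A + B + A * B))" "j < dim_col (?m (A + B + A * B))"
    have "(?m A * ?m B) $$ (i, j) =
      (\<Sum>k = 0..<N. ((if i = k then 1 else 0) + entry A i k) * ((if k = j then 1 else 0) + entry B k j))"
      using ij by (auto simp: times_mat_def scalar_prod_def intro!: sum.cong)
    also have "\<dots> = (\<Sum>k = 0..<N. (if k = i then if i = j then 1 else 0 else 0) + (if k = i then entry B i j else 0) +
       (if k = j then entry A i j else 0) + entry A i k * entry B k j)"
      by (intro sum.cong) (auto simp: algebra_simps)
    also have "\<dots> = ?m (A + B + A * B) $$ (i, j)"
      using ij by (simp add: sum.distrib entry_times[OF assms(1)] atLeast0LessThan)
    finally show "(?m A * ?m B) $$ (i, j) = ?m (A + B + A * B) $$ (i, j)" .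
  qed auto
  then show ?thesis unfolding det1_def by (subst det_mult[of _ N, symmetric]) auto
qed

text \<open>\<open>Y\<close> is the adjugate of the \<open>N\<close> by \<open>N\<close> matrix 1 +
  A, and (1 + A) Y has to be written as \<open>Y + A * Y\<close>.\<close>

lemma det1_adjugate:
  fixes A :: "'a::comm_ring_1 finmat"
  assumes A: "supp N A"
  obtains Y where "supp N Y" "Y + A * Y = smul (det1 N A) (one_finmat N)"
    "Y + Y * A = smul (det1 N A) (one_finmat N)"
proof -
  define M where "M = mat N N (\<lambda>(i, j). (if i = j then 1 else 0) + entry A i j)"
  define B where "B = adj_mat M"
  have M: "M \<in> carrier_mat N N" by (simp add: M_def)
  have B: "B \<in> carrier_mat N N" "M * B = det M \<cdot>\<^sub>m 1\<^sub>m N" "B * M = det M \<cdot>\<^sub>m 1\<^sub>m N"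
    using adj_mat[OF M] by (simp_all add: B_def)
  have d: "det1 N A = det M" by (simp add: det1_def M_def)
  have ent: "M $$ (i, j) = (if i = j then 1 else 0) + entry A i j" if "i < N" "j < N" for i j
    using that by (simp add: M_def)
  let ?Y = "tab N (\<lambda>i j. B $$ (i, j))"
  have sY: "supp N ?Y" by (rule supp_tab)
  have 1: "supp N (one_finmat N :: 'a finmat)" by (simp add: one_finmat_def supp_tab)
  have e: "B $$ (i, j) + (\<Sum>k<N. entry A i k * B $$ (k, j)) = (if i = j then det M else 0)"
    "B $$ (i, j) + (\<Sum>k<N. B $$ (i, k) * entry A k j) = (if i = j then det M else 0)"
    if ij: "i < N" "j < N" for i j
  proof -
    have "(M * B) $$ (i, j) = (\<Sum>k = 0..<N. M $$ (i, k) * B $$ (k, j))"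
      "(B * M) $$ (i, j) = (\<Sum>k = 0..<N. B $$ (i, k) * M $$ (k, j))"
      using ij M B(1) by (auto simp: times_mat_def scalar_prod_def intro!: sum.cong)
    moreover have "(\<Sum>k = 0..<N. M $$ (i, k) * B $$ (k, j)) =
        (\<Sum>k = 0..<N. (if k = i then B $$ (i, j) else 0) + entry A i k * B $$ (k, j))"
      using ij by (intro sum.cong) (auto simp: algebra_simps ent)
    moreover have "(\<Sum>k = 0..<N. B $$ (i, k) * M $$ (k, j)) =
        (\<Sum>k = 0..<N. (if k = j then B $$ (i, j) else 0) + B $$ (i, k) * entry A k j)"
      using ij by (intro sum.cong) (auto simp: algebra_simps ent)
    ultimately show "B $$ (i, j) + (\<Sum>k<N. entry A i k * B $$ (k, j)) = (if i = j then det M else 0)"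
      "B $$ (i, j) + (\<Sum>k<N. B $$ (i, k) * entry A k j) = (if i = j then det M else 0)"
      using ij B(2,3) by (auto simp add: sum.distrib atLeast0LessThan split: if_splits)
  qed
  have "?Y + A * ?Y = smul (det1 N A) (one_finmat N)"
  proof (rule finmat_eqI)
    fix i j
    show "entry (?Y + A * ?Y) i j = entry (smul (det1 N A) (one_finmat N)) i j"
    proof (cases "i < N \<and> j < N")
      case True
      then show ?thesis using e(1)[of i j]
        by (simp add: entry_times[OF A] entry_tab one_finmat_def d)
    next
      case False
      then show ?thesis using suppD[OF supp_add[OF sY supp_times[OF A sY]]] suppD[OF supp_smul[OF 1]]
        by (metis linorder_not_less)
    qed
  qed
  moreover have "?Y + ?Y * A = smul (det1 N A) (one_finmat N)"
  proof (rule finmat_eqI)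
    fix i j
    show "entry (?Y + ?Y * A) i j = entry (smul (det1 N A) (one_finmat N)) i j"
    proof (cases "i < N \<and> j < N")
      case True
      then show ?thesis using e(2)[of i j]
        by (simp add: entry_times[OF sY] entry_tab one_finmat_def d)
    next
      case False
      then show ?thesis using suppD[OF supp_add[OF sY supp_times[OF sY A]]] suppD[OF supp_smul[OF 1]]
        by (metis linorder_not_less)
    qed
  qed
  ultimately show ?thesis using that sY by blast
qed

text \<open>Modulo the ideal, 1 + A is the identity matrix.\<close>

lemma (in ideal_set) det1_null:
  assumes "\<And>i j. entry A i j \<in> m" shows "det1 N A - 1 \<in> m"
proof -
  have "det (mat N N (\<lambda>(i, j). if i = j then 1 else 0) :: 'a mat) = 1"
  proof -
    have "mat N N (\<lambda>(i, j). if i = j then 1 else 0) = (1\<^sub>m N :: 'a mat)" by (rule eq_matI) auto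
    then show ?thesis by simp
  qed
  moreover have "det1 N A - det (mat N N (\<lambda>(i, j). if i = j then 1 else 0)) \<in> m"
    unfolding det1_def by (rule det_diff) (use assms in auto)
  ultimately show ?thesis by simp
qed

section \<open>Matrices modulo a maximal ideal\<close>

definition null :: "'a::comm_ring_1 set \<Rightarrow> 'a finmat \<Rightarrow> bool" where
  "null m A \<longleftrightarrow> (\<forall>i j. entry A i j \<in> m)"

context ideal_set
begin

lemma null_zero: "null m 0" by (simp add: null_def zero)

lemma null_add: "null m A \<Longrightarrow> null m B \<Longrightarrow> null m (A + B)" by (simp add: null_def add)

lemma null_diff: "null m A \<Longrightarrow> null m B \<Longrightarrow> null m (A - B)" by (simp add: null_def diff)

lemma null_smul: "null m A \<Longrightarrow> null m (smul c A)" by (simp add: null_def mult)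

lemma null_sum: "(\<And>a. a \<in> S \<Longrightarrow> null m (f a)) \<Longrightarrow> null m (\<Sum>a\<in>S. f a)"
  by (simp add: null_def sum)

lemma null_mult_left: "null m B \<Longrightarrow> null m (A * B)"
proof -
  assume B: "null m B"
  obtain N where "supp N A" using ex_supp by blast
  then show ?thesis using B by (auto simp: null_def entry_times intro!: sum mult)
qed

lemma null_mult_right: "null m A \<Longrightarrow> null m (A * B)"
proof -
  assume A: "null m A"
  obtain N where "supp N A" using ex_supp by blast
  then show ?thesis using A by (auto simp: null_def entry_times intro!: sum mult_right)
qed

end

context maximal_ideal_set
begin

text \<open>Column by column: if \<open>v\<close> inverts the entry \<open>(i, k)\<close> of \<open>D = H - H Y H\<close> modulo \<open>m\<close>, then
  adding \<open>v (1 - Y H) E\<^sub>k\<^sub>i (1 - H Y)\<close> to \<open>Y\<close> replaces \<open>D\<close> by \<open>D - v D E\<^sub>k\<^sub>i D\<close>, which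
  vanishes in column \<open>k\<close> and in all columns in which \<open>D\<close> vanishes.\<close>

lemma von_neumann_regular: "\<exists>Y. null m (H - H * Y * H)"
proof -
  obtain N where N: "supp N H" using ex_supp by blast
  have "\<exists>Y. \<forall>i. \<forall>c<k. entry (H - H * Y * H) i c \<in> m" for k
  proof (induction k)
    case (Suc k)
    then obtain Y where Y: "\<And>i c. c < k \<Longrightarrow> entry (H - H * Y * H) i c \<in> m" by blast
    define D where "D = H - H * Y * H"
    show ?case
    proof (cases "\<forall>i. entry D i k \<in> m")
      case True
      then show ?thesis using Y unfolding D_def by (intro exI[of _ Y]) (auto simp: less_Suc_eq)
    next
      case False
      then obtain i v where i: "1 - entry D i k * v \<in> m" using inverse by blast
      define E where "E = (munit k i :: 'a finmat)"
      define Y' where "Y' = Y + smul v (E - Y * H * E - E * H * Y + Y * H * E * H * Y)"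
      have "H - H * Y' * H = D - smul v (D * E * D)"
        by (simp add: Y'_def D_def algebra_simps smul_simps)
      moreover have "entry (D - smul v (D * E * D)) r c \<in> m" if "c < Suc k" for r c
      proof (cases "c = k")
        case True
        have "entry (D - smul v (D * E * D)) r k = entry D r k * (1 - entry D i k * v)"
          unfolding E_def by (simp add: entry_munit_sandwich) (simp add: algebra_simps)
        then show ?thesis using i mult True by simp
      next
        case False
        then have "entry D r c \<in> m" "entry D i c \<in> m" using Y[of c] that by (auto simp: D_def)
        then show ?thesis unfolding E_def by (auto simp: entry_munit_sandwich intro!: diff mult)
      qed
      ultimately show ?thesis by metis
    qed
  qed simp
  from this[of N] obtain Y where Y: "\<And>i c. c < N \<Longrightarrow> entry (H - H * Y * H) i c \<in> m" by blast
  have "entry (H - H * Y * H) i c = 0" if "N \<le> c" for i c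
  proof -
    obtain K where K: "supp K (H * Y)" using ex_supp by blast
    show ?thesis using that suppD(2)[OF N] by (simp add: entry_times[OF K])
  qed
  then have "entry (H - H * Y * H) i c \<in> m" for i c using Y zero by (cases "c < N") auto
  then show ?thesis unfolding null_def by blast
qed

text \<open>The pivot positions of an echelon basis of the kernel of \<open>H\<close> modulo \<open>m\<close>; their number is
  the dimension of the kernel.\<close>

definition pivots :: "nat \<Rightarrow> 'a finmat \<Rightarrow> nat set" where
  "pivots N H = {i. i < N \<and> (\<exists>V. null m (H * V) \<and> (\<forall>j<i. entry V j 0 \<in> m) \<and> entry V i 0 \<notin> m)}"

text \<open>If no pivot were lost, elimination with the pivots of the smaller kernel would reduce
  every column killed by \<open>H\<close> to zero modulo \<open>m\<close>. Such a column would then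
  lie in the smaller kernel, against \<open>V0\<close>.\<close>

lemma pivots_psubset:
  assumes N: "supp N H'" and ker: "\<And>V. null m (H' * V) \<Longrightarrow> null m (H * V)"
    and V0: "null m (H * V0)" "\<not> null m (H' * V0)"
  shows "pivots N H' \<subset> pivots N H"
proof -
  have sub: "pivots N H' \<subseteq> pivots N H" using ker by (auto simp: pivots_def)
  have False if eq: "pivots N H \<subseteq> pivots N H'"
  proof -
    \<comment> \<open>Induction on the number \<open>k\<close> of leading zeros of column 0, from
      \<open>N\<close> downwards: a pivot of \<open>H\<close> at \<open>k\<close> is also one of
      \<open>H'\<close>, so entry \<open>k\<close> can be cleared by an element of the smaller
      kernel. The factor \<open>munit 0 0\<close> restricts the claim to column 0, the only one that
      \<open>pivots\<close> inspects.\<close>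
    have *: "null m (H' * (V * munit 0 0))"
      if "k \<le> N" "null m (H * V)" "\<forall>j<k. entry V j 0 \<in> m" for k V
      using that
    proof (induction k arbitrary: V rule: inc_induct)
      case base
      then have "entry (H' * V) i 0 \<in> m" for i
        by (auto simp: entry_times[OF N] intro!: sum mult)
      then show ?case by (simp add: null_def entry_times_munit mult.assoc[symmetric] zero)
    next
      case (step k)
      show ?case
      proof (cases "entry V k 0 \<in> m")
        case True
        then show ?thesis using step by (auto simp: less_Suc_eq)
      next
        case False
        then have "k \<in> pivots N H'" using step eq by (auto simp: pivots_def)
        then obtain W where W: "null m (H' * W)" "\<And>j. j < k \<Longrightarrow> entry W j 0 \<in> m" "entry W k 0 \<notin> m"
          by (auto simp: pivots_def)
        obtain b where b: "1 - entry W k 0 * b \<in> m" using inverse[OF W(3)] by blast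
        define V' where "V' = V - smul (b * entry V k 0) W"
        have "null m (H * V')"
          unfolding V'_def using step.prems(1) ker[OF W(1)]
          by (simp add: right_diff_distrib smul_simps null_diff null_smul)
        moreover have "entry V' j 0 \<in> m" if "j < Suc k" for j
        proof (cases "j = k")
          case True
          have "entry V' k 0 = entry V k 0 * (1 - entry W k 0 * b)"
            by (simp add: V'_def algebra_simps)
          then show ?thesis using True b mult by simp
        next
          case False
          then show ?thesis using that step.prems(2) W(2)[of j] by (auto simp: V'_def intro!: diff mult)
        qed
        ultimately have "null m (H' * (V' * munit 0 0))" using step.IH by blast
        moreover have "H' * (V * munit 0 0) =
            H' * (V' * munit 0 0) + smul (b * entry V k 0) (H' * W * munit 0 0)"
          by (simp add: V'_def algebra_simps smul_simps)
        ultimately show ?thesis using W(1) by (simp add: null_add null_smul null_mult_right)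
      qed
    qed
    obtain r c where rc: "entry (H' * V0) r c \<notin> m" using V0(2) by (auto simp: null_def)
    \<comment> \<open>\<open>munit c 0\<close> moves column \<open>c\<close>, where
      \<open>H' * V0\<close> does not vanish, into column 0.\<close>
    have "null m (H * (V0 * munit c 0))"
      using null_mult_right[OF V0(1)] by (simp add: mult.assoc)
    from *[OF le0 this] have "null m (H' * V0 * munit c 0 * munit 0 0)"
      by (simp add: mult.assoc)
    then have "entry (H' * V0 * munit c 0 * munit 0 0) r 0 \<in> m" unfolding null_def by blast
    then show False using rc by (simp add: entry_times_munit)
  qed
  then show ?thesis using sub by blast
qed

lemma finite_pivots: "finite (pivots N H)"
  by (rule finite_subset[of _ "{..<N}"]) (auto simp: pivots_def)

end


section \<open>Orders that are simple modulo maximal ideals\<close>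

text \<open>Von Neumann regularity and primeness of the image of \<open>S\<close> modulo
  \<open>m\<close>, in place of simplicity. Unlike a description as a matrix algebra, these two
  properties pass to commutants by averaging, and they are what the local argument consumes.\<close>

definition simple_mod :: "'a::comm_ring_1 set \<Rightarrow> 'a finmat set \<Rightarrow> bool" where
  "simple_mod m S \<longleftrightarrow> (\<forall>H\<in>S. \<exists>Y\<in>S. null m (H - H * Y * H)) \<and>
     (\<forall>P\<in>S. \<forall>Q\<in>S. \<not> null m P \<longrightarrow> \<not> null m Q \<longrightarrow> (\<exists>G\<in>S. \<not> null m (Q * G * P)))"

text \<open>An algebra with unit \<open>e\<close> that is the linear image of a free module of
  finite rank. The coefficients \<open>c\<close> become the variables of the polynomial to which the
  local-global property is applied.\<close>

definition good_order :: "'a::comm_ring_1 finmat \<Rightarrow> 'a set set \<Rightarrow> 'a finmat set \<Rightarrow> bool" where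
  "good_order e M S \<longleftrightarrow> e \<in> S \<and> (\<forall>H\<in>S. e * H = H \<and> H * e = H) \<and> (\<forall>H\<in>S. \<forall>G\<in>S. H * G \<in> S) \<and>
     (\<exists>n B. S = range (\<lambda>c. \<Sum>k<(n::nat). smul (c k) (B k))) \<and> (\<forall>m\<in>M. simple_mod m S)"

lemma good_orderD:
  assumes "good_order e M S"
  shows "e \<in> S" "H \<in> S \<Longrightarrow> e * H = H" "H \<in> S \<Longrightarrow> H * e = H" "H \<in> S \<Longrightarrow> G \<in> S \<Longrightarrow> H * G \<in> S"
    "m \<in> M \<Longrightarrow> simple_mod m S"
    "H \<in> S \<Longrightarrow> smul a H \<in> S" "H \<in> S \<Longrightarrow> G \<in> S \<Longrightarrow> H + G \<in> S" "(\<And>i. i \<in> J \<Longrightarrow> f i \<in> S) \<Longrightarrow> (\<Sum>i\<in>J. f i) \<in> S"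
    "H \<in> S \<Longrightarrow> G \<in> S \<Longrightarrow> H - G \<in> S"
proof -
  show "e \<in> S" "H \<in> S \<Longrightarrow> e * H = H" "H \<in> S \<Longrightarrow> H * e = H" "H \<in> S \<Longrightarrow> G \<in> S \<Longrightarrow> H * G \<in> S"
    "m \<in> M \<Longrightarrow> simple_mod m S" using assms by (auto simp: good_order_def)
  obtain n :: nat and B where S: "S = range (\<lambda>c. \<Sum>k<n. smul (c k) (B k))"
    using assms by (auto simp: good_order_def)
  have sm: "smul a H \<in> S" if "H \<in> S" for a H
  proof -
    obtain c where "H = (\<Sum>k<n. smul (c k) (B k))" using \<open>H \<in> S\<close> S by blast
    then have "smul a H = (\<Sum>k<n. smul (a * c k) (B k))" by (simp add: smul_sum smul_simps)
    then show ?thesis unfolding S by (intro image_eqI[of _ _ "\<lambda>k. a * c k"]) auto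
  qed
  then show "smul a H \<in> S" if "H \<in> S" using that .
  have ad: "H + G \<in> S" if HG: "H \<in> S" "G \<in> S" for H G
  proof -
    obtain c d where "H = (\<Sum>k<n. smul (c k) (B k))" "G = (\<Sum>k<n. smul (d k) (B k))" using HG S by blast
    then have "H + G = (\<Sum>k<n. smul (c k + d k) (B k))" by (simp add: smul_simps sum.distrib)
    then show ?thesis unfolding S by (intro image_eqI[of _ _ "\<lambda>k. c k + d k"]) auto
  qed
  then show "H + G \<in> S" if "H \<in> S" "G \<in> S" using that .
  have "smul (-1) G = - G" for G :: "'a finmat" by (rule finmat_eqI) simp
  then show "H - G \<in> S" if "H \<in> S" "G \<in> S" using ad[OF that(1) sm[OF that(2), of "-1"]] by simp
  have "0 \<in> S" using sm[OF \<open>e \<in> S\<close>, of 0] by (simp add: smul_simps)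
  then show "(\<And>i. i \<in> J \<Longrightarrow> f i \<in> S) \<Longrightarrow> (\<Sum>i\<in>J. f i) \<in> S"
    by (induction J rule: infinite_finite_induct) (auto intro: ad)
qed

text \<open>A bound for the idempotent bounds its whole corner, so one size \<open>N\<close> serves
  for all determinants.\<close>

lemma supp_corner:
  assumes "supp N e" "e * H = H" "H * e = H" shows "supp N H"
proof -
  obtain L where L: "supp L H" using ex_supp by blast
  have "entry (e * H) i j = 0" if "N \<le> i" for i j
    using suppD(1)[OF assms(1) that] by (simp add: entry_times[OF assms(1)])
  moreover have "entry (H * e) i j = 0" if "N \<le> j" for i j
    using suppD(2)[OF assms(1) that] by (simp add: entry_times[OF L])
  ultimately show ?thesis unfolding supp_def assms(2,3) by blast
qed

text \<open>The corner is the endomorphism ring of the image of \<open>e\<close>, and it is spanned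
  by the sandwiched matrix units. Regularity and primeness come from the full matrices: a middle
  factor \<open>Y\<close> may be replaced by \<open>e * Y * e\<close>, because its neighbours absorb
  \<open>e\<close>.\<close>

lemma good_order_corner:
  assumes e: "e * e = e" and M: "\<And>m. m \<in> M \<Longrightarrow> maximal_ideal_set m"
  shows "good_order e M {H. e * H * e = H}"
  unfolding good_order_def
proof (intro conjI ballI)
  have ee: "e * (e * Y) = e * Y" for Y using e by (simp add: mult.assoc[symmetric])
  have l: "e * H = H" "H * e = H" if "H \<in> {H. e * H * e = H}" for H
  proof -
    have H: "e * H * e = H" using that by simp
    have "e * (e * H * e) = e * H * e" "e * H * e * e = e * H * e" by (simp_all add: mult.assoc ee e)
    then show "e * H = H" "H * e = H" unfolding H .
  qed
  show "e \<in> {H. e * H * e = H}" by (simp add: e)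
  fix H assume H: "H \<in> {H. e * H * e = H}"
  show "e * H = H" "H * e = H" using l[OF H] by blast+
  fix G assume G: "G \<in> {H. e * H * e = H}"
  have "e * (H * G) * e = (e * H) * (G * e)" by (simp add: mult.assoc)
  then show "H * G \<in> {H. e * H * e = H}" using l[OF H] l[OF G] by simp
next
  have ee: "e * (e * Y) = e * Y" for Y using e by (simp add: mult.assoc[symmetric])
  obtain N where N: "supp N e" using ex_supp by blast
  have sm: "e * (\<Sum>k\<in>K. smul (c k) (e * f k * e)) * e = (\<Sum>k\<in>K. smul (c k) (e * f k * e))" for K :: "nat set" and c f
    by (simp add: sum_distrib_left sum_distrib_right smul_simps mult.assoc[symmetric] e)
      (simp add: mult.assoc e)
  obtain h where h: "bij_betw h {..<N*N} ({..<N} \<times> {..<N})"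
  proof -
    have "card ({..<N} \<times> {..<N}) = card {..<N*N}" by simp
    then show ?thesis using that finite_same_card_bij[of "{..<N*N}" "{..<N} \<times> {..<N}"] by auto
  qed
  let ?B = "\<lambda>k. e * munit (fst (h k)) (snd (h k)) * e"
  have "{H. e * H * e = H} = range (\<lambda>c. \<Sum>k<N*N. smul (c k) (?B k))"
  proof (intro subset_antisym subsetI)
    fix H assume "H \<in> {H. e * H * e = H}"
    then have H: "e * H * e = H" by simp
    moreover have "e * (e * H * e) = e * H * e" "e * H * e * e = e * H * e" by (simp_all add: mult.assoc ee e)
    ultimately have "supp N H" using supp_corner[OF N] by metis
    then have "H = (\<Sum>p\<in>{..<N} \<times> {..<N}. smul (entry H (fst p) (snd p)) (munit (fst p) (snd p)))"
      by (rule finmat_as_sum)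
    also have "\<dots> = (\<Sum>k<N*N. smul (entry H (fst (h k)) (snd (h k))) (munit (fst (h k)) (snd (h k))))"
      by (rule sum.reindex_bij_betw[OF h, symmetric])
    finally have H': "H = \<dots>" .
    define c where "c = (\<lambda>k. entry H (fst (h k)) (snd (h k)))"
    have c: "H = (\<Sum>k<N*N. smul (c k) (munit (fst (h k)) (snd (h k))))" unfolding c_def by (rule H')
    have "e * H * e = (\<Sum>k<N*N. smul (c k) (?B k))"
      by (subst c) (simp add: sum_distrib_left sum_distrib_right smul_simps)
    then show "H \<in> range (\<lambda>c. \<Sum>k<N*N. smul (c k) (?B k))" using H by (intro image_eqI[of _ _ c]) auto
  next
    fix H assume "H \<in> range (\<lambda>c. \<Sum>k<N*N. smul (c k) (?B k))"
    then obtain c where "H = (\<Sum>k<N*N. smul (c k) (?B k))" by blast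
    then show "H \<in> {H. e * H * e = H}" using sm[where K = "{..<N*N}" and c = c and f = "\<lambda>k. munit (fst (h k)) (snd (h k))"] by simp
  qed
  then show "\<exists>n B. {H. e * H * e = H} = range (\<lambda>c. \<Sum>k<(n::nat). smul (c k) (B k))"
    by (intro exI[of _ "N*N"] exI[of _ ?B])
next
  fix m assume "m \<in> M"
  then interpret maximal_ideal_set m by (rule M)
  have l: "e * H = H" "H * e = H" if "e * H * e = H" for H
  proof -
    have "e * (e * H * e) = e * H * e" "e * H * e * e = e * H * e"
      using e by (simp_all add: mult.assoc) (simp add: mult.assoc[symmetric] e)
    then show "e * H = H" "H * e = H" unfolding that .
  qed
  have c: "e * (e * Y * e) * e = e * Y * e" for Y
    using e by (simp add: mult.assoc) (simp add: mult.assoc[symmetric] e)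
  show "simple_mod m {H. e * H * e = H}"
    unfolding simple_mod_def
  proof (intro conjI ballI impI)
    fix H assume "H \<in> {H. e * H * e = H}"
    then have H: "H * e = H" "e * H = H" using l by auto
    obtain Y where Y: "null m (H - H * Y * H)" using von_neumann_regular by blast
    have "H * (e * Y * e) * H = H * e * Y * (e * H)" by (simp add: mult.assoc)
    then have "null m (H - H * (e * Y * e) * H)" using Y H by simp
    then show "\<exists>Y\<in>{H. e * H * e = H}. null m (H - H * Y * H)" using c by blast
  next
    fix P Q assume "P \<in> {H. e * H * e = H}" "Q \<in> {H. e * H * e = H}" "\<not> null m P" "\<not> null m Q"
    then obtain a b c' d where P: "e * P = P" "entry P a b \<notin> m" and Q: "Q * e = Q" "entry Q c' d \<notin> m"
      using l by (auto simp: null_def)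
    \<comment> \<open>The unit at \<open>(d, a)\<close> connects a nonzero entry of \<open>Q\<close>
      with a nonzero entry of \<open>P\<close>; modulo \<open>m\<close> both are invertible, so
      their product does not vanish.\<close>
    have "entry (Q * munit d a * P) c' b = entry Q c' d * entry P a b" by (rule entry_munit_sandwich)
    moreover have "entry Q c' d * entry P a b \<notin> m"
    proof
      assume *: "entry Q c' d * entry P a b \<in> m"
      obtain v where v: "1 - entry Q c' d * v \<in> m" using inverse Q(2) by blast
      have "entry P a b = entry P a b * (1 - entry Q c' d * v) + v * (entry Q c' d * entry P a b)"
        by (simp add: algebra_simps)
      then show False using P(2) add[OF mult[OF v] mult[OF *]] by metis
    qed
    moreover have "Q * (e * munit d a * e) * P = Q * e * munit d a * (e * P)" by (simp add: mult.assoc)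
    ultimately have "entry (Q * (e * munit d a * e) * P) c' b \<notin> m" using P Q by simp
    then have "\<not> null m (Q * (e * munit d a * e) * P)" unfolding null_def by blast
    then show "\<exists>G\<in>{H. e * H * e = H}. \<not> null m (Q * G * P)" using c by blast
  qed
qed


section \<open>Averaging over separable families\<close>

text \<open>The families \<open>x, y, t\<close> play the role of elements \<open>\<theta>\<^sub>j = \<Sum>\<^sub>i x\<^sub>j\<^sub>i \<otimes> y\<^sub>j\<^sub>i\<close> of \<open>A \<otimes> A\<^sup>o\<^sup>p\<close>
  with \<open>c \<theta>\<^sub>j = \<theta>\<^sub>j c\<close>, \<open>\<Sum>\<^sub>j t\<^sub>j \<theta>\<^sub>j = 1 \<otimes> 1\<close> and such that \<open>\<Sum>\<^sub>j s\<^sub>j \<theta>\<^sub>j\<close> multiplies out to \<open>1\<close>;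
  they act from the left through \<open>\<rho>'\<close> and from the right through \<open>\<rho>\<close>.\<close>

definition average ::
    "('j \<Rightarrow> 'i set) \<Rightarrow> ('j \<Rightarrow> 'i \<Rightarrow> 't) \<Rightarrow> ('j \<Rightarrow> 'i \<Rightarrow> 't) \<Rightarrow> ('t \<Rightarrow> 'a::comm_ring_1 finmat) \<Rightarrow>
     ('t \<Rightarrow> 'a finmat) \<Rightarrow> 'j \<Rightarrow> 'a finmat \<Rightarrow> 'a finmat" where
  "average I x y \<rho>' \<rho> j h = (\<Sum>i\<in>I j. \<rho>' (x j i) * h * \<rho> (y j i))"

text \<open>The clauses are what the identities for \<theta> yield for operators in the corner, so
  that generalized matrix units and Azumaya algebras can share everything up to the Skolem-Noether
  theorem. The last clause normalizes \<open>\<rho>\<close> alone; intertwiners in both directions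
  therefore call for the condition with the two actions in either order.\<close>

definition separating ::
    "'a::comm_ring_1 finmat \<Rightarrow> 't set \<Rightarrow> 'j set \<Rightarrow> ('j \<Rightarrow> 'i set) \<Rightarrow> ('j \<Rightarrow> 'i \<Rightarrow> 't) \<Rightarrow> ('j \<Rightarrow> 'i \<Rightarrow> 't) \<Rightarrow>
     ('j \<Rightarrow> 't) \<Rightarrow> ('j \<Rightarrow> 'a) \<Rightarrow> ('t \<Rightarrow> 'a finmat) \<Rightarrow> ('t \<Rightarrow> 'a finmat) \<Rightarrow> bool" where
  "separating e K J I x y t s \<rho>' \<rho> \<longleftrightarrow>
     (\<forall>j\<in>J. t j \<in> K \<and> (\<forall>i\<in>I j. x j i \<in> K \<and> y j i \<in> K)) \<and>
     (\<forall>h. e * h * e = h \<longrightarrow> (\<forall>c\<in>K. \<forall>j\<in>J. \<rho>' c * average I x y \<rho>' \<rho> j h = average I x y \<rho>' \<rho> j h * \<rho> c)) \<and>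
     (\<forall>h. e * h * e = h \<longrightarrow> (\<Sum>j\<in>J. \<rho>' (t j) * average I x y \<rho>' \<rho> j h) = h) \<and>
     (\<Sum>j\<in>J. smul (s j) (\<Sum>i\<in>I j. \<rho> (x j i) * \<rho> (y j i))) = e"

text \<open>Under \<open>separating\<close> this is a linear retraction onto the intertwiners, by
  \<open>project_in_W\<close> and \<open>project_W\<close>.\<close>

definition project ::
    "'j set \<Rightarrow> ('j \<Rightarrow> 'i set) \<Rightarrow> ('j \<Rightarrow> 'i \<Rightarrow> 't) \<Rightarrow> ('j \<Rightarrow> 'i \<Rightarrow> 't) \<Rightarrow> ('j \<Rightarrow> 'a) \<Rightarrow>
     ('t \<Rightarrow> 'a::comm_ring_1 finmat) \<Rightarrow> ('t \<Rightarrow> 'a finmat) \<Rightarrow> 'a finmat \<Rightarrow> 'a finmat" where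
  "project J I x y s \<rho>' \<rho> h = (\<Sum>j\<in>J. smul (s j) (average I x y \<rho>' \<rho> j h))"

lemma project_linear:
  "project J I x y s \<rho>' \<rho> (\<Sum>k\<in>A. smul (c k) (B k)) = (\<Sum>k\<in>A. smul (c k) (project J I x y s \<rho>' \<rho> (B k)))"
proof -
  have "average I x y \<rho>' \<rho> j (\<Sum>k\<in>A. smul (c k) (B k)) = (\<Sum>k\<in>A. smul (c k) (average I x y \<rho>' \<rho> j (B k)))" for j
  proof -
    have "average I x y \<rho>' \<rho> j (\<Sum>k\<in>A. smul (c k) (B k)) =
        (\<Sum>i\<in>I j. \<Sum>k\<in>A. smul (c k) (\<rho>' (x j i) * B k * \<rho> (y j i)))"
      by (simp add: average_def sum_distrib_left sum_distrib_right smul_simps)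
    also have "\<dots> = (\<Sum>k\<in>A. \<Sum>i\<in>I j. smul (c k) (\<rho>' (x j i) * B k * \<rho> (y j i)))" by (rule sum.swap)
    finally show ?thesis by (simp add: average_def smul_sum)
  qed
  then have "project J I x y s \<rho>' \<rho> (\<Sum>k\<in>A. smul (c k) (B k)) =
      (\<Sum>j\<in>J. \<Sum>k\<in>A. smul (c k) (smul (s j) (average I x y \<rho>' \<rho> j (B k))))"
    by (simp add: project_def smul_sum smul_simps mult.commute)
  also have "\<dots> = (\<Sum>k\<in>A. \<Sum>j\<in>J. smul (c k) (smul (s j) (average I x y \<rho>' \<rho> j (B k))))" by (rule sum.swap)
  finally show ?thesis by (simp add: project_def smul_sum)
qed

lemma (in ideal_set) null_project: "null m h \<Longrightarrow> null m (project J I x y s \<rho>' \<rho> h)"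
  unfolding project_def average_def by (intro null_sum null_smul null_mult_right null_mult_left)

lemma project_diff:
  "project J I x y s \<rho>' \<rho> (h - h') = project J I x y s \<rho>' \<rho> h - project J I x y s \<rho>' \<rho> h'"
  by (simp add: project_def average_def sum_subtractf smul_simps algebra_simps)

lemma average_between:
  assumes "\<And>i. i \<in> I j \<Longrightarrow> Q * \<rho>' (x j i) = \<tau>' (x j i) * Q" "\<And>i. i \<in> I j \<Longrightarrow> \<rho> (y j i) * P = P * \<tau> (y j i)"
  shows "Q * average I x y \<rho>' \<rho> j h * P = average I x y \<tau>' \<tau> j (Q * h * P)"
proof -
  have "Q * (\<rho>' (x j i) * h * \<rho> (y j i)) * P = \<tau>' (x j i) * (Q * h * P) * \<tau> (y j i)" if "i \<in> I j" for i
  proof -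
    have "Q * (\<rho>' (x j i) * h * \<rho> (y j i)) * P = (Q * \<rho>' (x j i)) * h * (\<rho> (y j i) * P)"
      by (simp add: mult.assoc)
    then show ?thesis unfolding assms[OF that] by (simp add: mult.assoc)
  qed
  then show ?thesis by (simp add: average_def sum_distrib_left sum_distrib_right)
qed

text \<open>Intertwiners on either side can be moved inside the sum, at the price of changing the
  pair of actions. In this way a quasi-inverse found among all operators is replaced by one that
  intertwines.\<close>

lemma project_between:
  assumes "\<And>j i. j \<in> J \<Longrightarrow> i \<in> I j \<Longrightarrow> Q * \<rho>' (x j i) = \<tau>' (x j i) * Q"
    "\<And>j i. j \<in> J \<Longrightarrow> i \<in> I j \<Longrightarrow> \<rho> (y j i) * P = P * \<tau> (y j i)"
  shows "Q * project J I x y s \<rho>' \<rho> h * P = project J I x y s \<tau>' \<tau> (Q * h * P)"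
proof -
  have "Q * project J I x y s \<rho>' \<rho> h * P = (\<Sum>j\<in>J. smul (s j) (Q * average I x y \<rho>' \<rho> j h * P))"
    by (simp add: project_def sum_distrib_left sum_distrib_right smul_simps)
  then show ?thesis using average_between[of I _ Q \<rho>' x \<tau>' \<rho> y P \<tau>] assms by (simp add: project_def)
qed

locale averaging =
  fixes e :: "'a::comm_ring_1 finmat" and M :: "'a set set" and S K J I and x y :: "'j \<Rightarrow> 'i \<Rightarrow> 't"
    and t s \<sigma> \<tau>
  assumes good: "good_order e M S" and max: "\<And>m. m \<in> M \<Longrightarrow> maximal_ideal_set m"
    and sep: "separating e K J I x y t s \<tau> \<sigma>"
    and in_S: "\<And>c. c \<in> K \<Longrightarrow> \<sigma> c \<in> S" "\<And>c. c \<in> K \<Longrightarrow> \<tau> c \<in> S"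
begin

definition "W = {H \<in> S. \<forall>c\<in>K. \<tau> c * H = H * \<sigma> c}"

lemmas goodD = good_orderD[OF good]

lemma corner: "h \<in> S \<Longrightarrow> e * h * e = h" using goodD by simp

lemma xyt: "j \<in> J \<Longrightarrow> i \<in> I j \<Longrightarrow> x j i \<in> K" "j \<in> J \<Longrightarrow> i \<in> I j \<Longrightarrow> y j i \<in> K" "j \<in> J \<Longrightarrow> t j \<in> K"
  using sep by (auto simp: separating_def)

lemma sum_average: "h \<in> S \<Longrightarrow> (\<Sum>j\<in>J. \<tau> (t j) * average I x y \<tau> \<sigma> j h) = h"
  using sep corner unfolding separating_def by blast

lemma average_in_W: "j \<in> J \<Longrightarrow> h \<in> S \<Longrightarrow> average I x y \<tau> \<sigma> j h \<in> W"
proof -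
  assume j: "j \<in> J" and h: "h \<in> S"
  have "average I x y \<tau> \<sigma> j h \<in> S"
    unfolding average_def using in_S xyt j h by (intro goodD) auto
  moreover have "\<forall>c\<in>K. \<tau> c * average I x y \<tau> \<sigma> j h = average I x y \<tau> \<sigma> j h * \<sigma> c"
    using sep corner[OF h] j unfolding separating_def by blast
  ultimately show ?thesis by (simp add: W_def)
qed

lemma W_sub: "W \<subseteq> S" by (auto simp: W_def)

lemma W_closed: "H \<in> W \<Longrightarrow> G \<in> W \<Longrightarrow> H + G \<in> W" "H \<in> W \<Longrightarrow> smul a H \<in> W"
  "(\<And>i. i \<in> A \<Longrightarrow> f i \<in> W) \<Longrightarrow> (\<Sum>i\<in>A. f i) \<in> W"
  by (auto simp: W_def goodD algebra_simps smul_simps sum_distrib_left sum_distrib_right intro!: sum.cong)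

lemma project_in_W: "h \<in> S \<Longrightarrow> project J I x y s \<tau> \<sigma> h \<in> W"
  unfolding project_def by (intro W_closed average_in_W)

text \<open>For an intertwiner \<open>h\<close>, each \<open>\<tau> (x j i)\<close> moves across
  \<open>h\<close> and becomes \<open>\<sigma> (x j i)\<close>; what remains is \<open>h\<close>
  times the expression normalized to \<open>e\<close>.\<close>

lemma project_W: "h \<in> W \<Longrightarrow> project J I x y s \<tau> \<sigma> h = h"
proof -
  assume h: "h \<in> W"
  have "project J I x y s \<tau> \<sigma> h = h * (\<Sum>j\<in>J. smul (s j) (\<Sum>i\<in>I j. \<sigma> (x j i) * \<sigma> (y j i)))"
    using h xyt unfolding W_def project_def average_def
    by (auto simp: sum_distrib_left smul_simps mult.assoc[symmetric] intro!: sum.cong arg_cong[where f = "smul _"])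
  then show ?thesis using sep h goodD(3) by (auto simp: separating_def W_def)
qed

text \<open>Over a general ring the solutions of linear equations, such as those defining
  \<open>W\<close>, need not be finitely generated. Here \<open>W\<close> is the image of
  \<open>S\<close> under a linear retraction and so inherits the parametrization.\<close>

lemma W_param: "\<exists>n B. W = range (\<lambda>c. \<Sum>k<(n::nat). smul (c k) (B k))"
proof -
  obtain n :: nat and B where S: "S = range (\<lambda>c. \<Sum>k<n. smul (c k) (B k))"
    using good by (auto simp: good_order_def)
  let ?p = "project J I x y s \<tau> \<sigma>"
  have "W = ?p ` S" 
  proof (intro subset_antisym subsetI)
    fix H assume "H \<in> W"
    then show "H \<in> ?p ` S" using project_W W_sub by (intro rev_image_eqI[of H]) auto
  qed (use project_in_W in auto)
  also have "\<dots> = range (\<lambda>c. \<Sum>k<n. smul (c k) (?p (B k)))"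
    unfolding S by (simp add: image_image project_linear)
  finally show ?thesis by (intro exI[of _ n] exI[of _ "\<lambda>k. ?p (B k)"])
qed

text \<open>A nonzero product \<open>Q G P\<close> of intertwiners survives averaging of \<open>G\<close>, because the averages
  of \<open>G\<close> generate \<open>G\<close>.\<close>

lemma ex_average_nonnull:
  assumes m: "m \<in> M" and G: "G \<in> S" and nn: "\<not> null m (Q * G * P)" and Q: "\<And>c. c \<in> K \<Longrightarrow> \<tau> c * Q = Q * \<tau> c"
  shows "\<exists>G'\<in>W. \<not> null m (Q * G' * P)"
proof -
  interpret maximal_ideal_set m by (rule max[OF m])
  have "Q * G * P = Q * (\<Sum>j\<in>J. \<tau> (t j) * average I x y \<tau> \<sigma> j G) * P"
    by (simp only: sum_average[OF G])
  moreover have "Q * (\<Sum>j\<in>J. \<tau> (t j) * average I x y \<tau> \<sigma> j G) * P =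
      (\<Sum>j\<in>J. \<tau> (t j) * (Q * average I x y \<tau> \<sigma> j G * P))"
    unfolding sum_distrib_left sum_distrib_right
  proof (rule sum.cong[OF refl])
    fix j assume "j \<in> J"
    then have c: "Q * \<tau> (t j) = \<tau> (t j) * Q" using Q xyt(3) by simp
    have "Q * (\<tau> (t j) * average I x y \<tau> \<sigma> j G) * P = (Q * \<tau> (t j)) * average I x y \<tau> \<sigma> j G * P"
      by (simp only: mult.assoc)
    then show "Q * (\<tau> (t j) * average I x y \<tau> \<sigma> j G) * P = \<tau> (t j) * (Q * average I x y \<tau> \<sigma> j G * P)"
      unfolding c by (simp only: mult.assoc)
  qed
  moreover have "null m (\<Sum>j\<in>J. \<tau> (t j) * (Q * average I x y \<tau> \<sigma> j G * P))"
    if "\<forall>j\<in>J. null m (Q * average I x y \<tau> \<sigma> j G * P)"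
    by (rule null_sum, rule null_mult_left) (use that in blast)
  ultimately have "\<exists>j\<in>J. \<not> null m (Q * average I x y \<tau> \<sigma> j G * P)" using nn by auto
  then show ?thesis using average_in_W G by blast
qed

end

text \<open>With the same action on both sides, intertwiners form a commutant. Applied to the right
  multiplications of an algebra, the result singles out the left multiplications and keeps
  regularity and primeness, with no appeal to a double centralizer theorem.\<close>

lemma good_order_commutant:
  assumes good: "good_order e M S" and max: "\<And>m. m \<in> M \<Longrightarrow> maximal_ideal_set m"
    and sep: "separating e K J I x y t s \<rho> \<rho>" and in_S: "\<And>c. c \<in> K \<Longrightarrow> \<rho> c \<in> S"
  shows "good_order e M {H \<in> S. \<forall>c\<in>K. \<rho> c * H = H * \<rho> c}"
proof -
  interpret averaging e M S K J I x y t s \<rho> \<rho> by (rule averaging.intro) (fact assms)+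
  have "good_order e M W"
    unfolding good_order_def
  proof (intro conjI ballI)
    show "e \<in> W" using goodD in_S by (simp add: W_def)
    fix H assume H: "H \<in> W"
    then show "e * H = H" "H * e = H" using goodD W_sub by auto
    fix G assume "G \<in> W"
    then show "H * G \<in> W" using H goodD by (auto simp: W_def) (metis mult.assoc)
  next
    show "\<exists>n B. W = range (\<lambda>c. \<Sum>k<(n::nat). smul (c k) (B k))" by (rule W_param)
  next
    fix m assume m: "m \<in> M"
    interpret maximal_ideal_set m by (rule max[OF m])
    note sm = goodD(5)[OF m, unfolded simple_mod_def]
    show "simple_mod m W"
      unfolding simple_mod_def
    proof (intro conjI ballI impI)
      fix H assume H: "H \<in> W"
      then obtain Y where Y: "Y \<in> S" "null m (H - H * Y * H)" using sm W_sub by blast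
      \<comment> \<open>The quasi-inverse \<open>Y\<close> need not lie in the commutant, but its
        projection does. Since \<open>H\<close> commutes with the action, the error of the projected
        quasi-inverse is the projection of the old error, hence again zero modulo
        \<open>m\<close>.\<close>
      have "H * project J I x y s \<rho> \<rho> Y * H = project J I x y s \<rho> \<rho> (H * Y * H)"
        using H xyt by (intro project_between) (auto simp: W_def)
      then have "H - H * project J I x y s \<rho> \<rho> Y * H = project J I x y s \<rho> \<rho> (H - H * Y * H)"
        using project_W[OF H] by (simp add: project_diff)
      then show "\<exists>Y\<in>W. null m (H - H * Y * H)" using null_project Y project_in_W by metis
    next
      fix P Q assume PQ: "P \<in> W" "Q \<in> W" "\<not> null m P" "\<not> null m Q"
      then obtain G where "G \<in> S" "\<not> null m (Q * G * P)" using sm W_sub by blast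
      then show "\<exists>G\<in>W. \<not> null m (Q * G * P)"
        using ex_average_nonnull[OF m] PQ by (auto simp: W_def)
    qed
  qed
  then show ?thesis by (simp add: W_def)
qed


section \<open>The local-global Skolem-Noether theorem for matrices\<close>

text \<open>(1 + A)(1 + B) is congruent to 1, so the two determinants multiply to 1 modulo
  \<open>m\<close>; a one-sided inverse is enough.\<close>

lemma det1_circle_unit:
  assumes "maximal_ideal_set m" "supp N A" "supp N B" "null m (A + B + A * B)"
  shows "det1 N A \<notin> m" "det1 N B \<notin> m"
proof -
  interpret maximal_ideal_set m by fact
  have "det1 N A * det1 N B - 1 \<in> m"
    unfolding det1_mult[OF assms(2,3)] by (rule det1_null) (use assms(4) in \<open>auto simp: null_def\<close>)
  then have *: "1 - det1 N A * det1 N B \<in> m" using uminus by fastforce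
  show "det1 N A \<notin> m"
  proof
    assume "det1 N A \<in> m"
    then have "1 - det1 N A * det1 N B + det1 N A * det1 N B \<in> m" by (intro add * mult_right)
    then show False using one by simp
  qed
  show "det1 N B \<notin> m"
  proof
    assume "det1 N B \<in> m"
    then have "1 - det1 N A * det1 N B + det1 N A * det1 N B \<in> m" by (intro add * mult)
    then show False using one by simp
  qed
qed

text \<open>Among the intertwiners choose \<open>H\<close> with the smallest kernel modulo \<open>m\<close>, and an intertwiner
  \<open>Y\<close> in the other direction with \<open>H Y H = H\<close> modulo \<open>m\<close>. If \<open>P = e - Y H\<close> and \<open>Q = e - H Y\<close>
  were both nonzero, then for some intertwiner \<open>G\<close> the sum \<open>H + Q G P\<close> would have a smaller kernel.\<close>

lemma local_intertwiner:
  assumes good: "good_order e M S" and max: "\<And>m. m \<in> M \<Longrightarrow> maximal_ideal_set m"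
    and sep: "separating e K J I x y t s \<tau> \<sigma>" "separating e K J I x y t s \<sigma> \<tau>"
    and in_S: "\<And>c. c \<in> K \<Longrightarrow> \<sigma> c \<in> S" "\<And>c. c \<in> K \<Longrightarrow> \<tau> c \<in> S"
    and N: "supp N e" and m: "m \<in> M"
  shows "\<exists>H\<in>S. (\<forall>c\<in>K. \<tau> c * H = H * \<sigma> c) \<and> det1 N (H - e) \<notin> m"
proof -
  interpret maximal_ideal_set m by (rule max[OF m])
  interpret A: averaging e M S K J I x y t s \<sigma> \<tau> by (rule averaging.intro) (fact assms)+
  interpret B: averaging e M S K J I x y t s \<tau> \<sigma> by (rule averaging.intro) (fact assms)+
  have suppS: "supp N H" if "H \<in> S" for H
    using supp_corner[OF N] A.goodD that by blast
  have "e * e = e" using A.goodD by blast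
  have "0 \<in> A.W" using A.W_closed(3)[of "{}"] by simp
  then obtain H where H: "H \<in> A.W" and min: "\<And>H'. H' \<in> A.W \<Longrightarrow> card (pivots N H) \<le> card (pivots N H')"
    using ex_has_least_nat[of "\<lambda>H. H \<in> A.W" 0 "\<lambda>H. card (pivots N H)"] by blast
  have HS: "H \<in> S" and H\<sigma>: "\<And>c. c \<in> K \<Longrightarrow> \<tau> c * H = H * \<sigma> c" using H by (auto simp: A.W_def)
  note sm = A.goodD(5)[OF m, unfolded simple_mod_def]
  obtain X0 where X0: "X0 \<in> S" "null m (H - H * X0 * H)" using sm HS by blast
  define Y where "Y = project J I x y s \<sigma> \<tau> X0"
  have Y: "Y \<in> B.W" unfolding Y_def by (rule B.project_in_W[OF X0(1)])
  have XS: "Y \<in> S" using Y B.W_sub by blast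
  have "H * Y * H = project J I x y s \<tau> \<sigma> (H * X0 * H)"
    unfolding Y_def using H\<sigma> A.xyt by (intro project_between) auto
  then have "H - H * Y * H = project J I x y s \<tau> \<sigma> (H - H * X0 * H)"
    using A.project_W[OF H] by (simp add: project_diff)
  then have D: "null m (H - H * Y * H)" using null_project X0(2) by simp
  define P where "P = e - Y * H"
  define Q where "Q = e - H * Y"
  have PQS: "P \<in> S" "Q \<in> S" unfolding P_def Q_def using XS HS by (auto intro!: A.goodD)
  have Hee: "e * H = H" "H * e = H" "e * Y = Y" "Y * e = Y" using A.goodD HS XS by auto
  have Q\<tau>: "\<tau> c * Q = Q * \<tau> c" if "c \<in> K" for c
  proof -
    have "\<tau> c * (H * Y) = H * \<sigma> c * Y" using H\<sigma>[OF that] by (simp add: mult.assoc[symmetric])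
    also have "\<dots> = H * Y * \<tau> c" using Y that by (auto simp: B.W_def mult.assoc)
    finally show ?thesis using A.goodD in_S that by (simp add: Q_def algebra_simps)
  qed
  have P\<sigma>: "\<sigma> c * P = P * \<sigma> c" if "c \<in> K" for c
  proof -
    have "\<sigma> c * (Y * H) = Y * (\<tau> c * H)" using Y that by (auto simp: B.W_def mult.assoc[symmetric])
    also have "\<dots> = Y * H * \<sigma> c" using H\<sigma>[OF that] by (simp add: mult.assoc)
    finally show ?thesis using A.goodD in_S that by (simp add: P_def algebra_simps)
  qed
  have "null m P \<or> null m Q"
  proof (rule ccontr)
    assume "\<not> (null m P \<or> null m Q)"
    then have nn: "\<not> null m P" "\<not> null m Q" by auto
    then obtain G0 where "G0 \<in> S" "\<not> null m (Q * G0 * P)" using sm PQS by blast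
    then obtain G where G: "G \<in> A.W" "\<not> null m (Q * G * P)"
      using A.ex_average_nonnull[OF m _ _ Q\<tau>] by blast
    have "Q * G * P \<in> A.W"
      unfolding A.W_def
    proof (intro CollectI conjI ballI)
      show "Q * G * P \<in> S" using PQS G A.W_sub by (intro A.goodD) auto
      fix c assume c: "c \<in> K"
      have "\<tau> c * (Q * G * P) = Q * (\<tau> c * G) * P" using Q\<tau>[OF c] by (simp add: mult.assoc[symmetric])
      also have "\<dots> = Q * G * (\<sigma> c * P)" using G(1) c by (auto simp: A.W_def mult.assoc)
      finally show "\<tau> c * (Q * G * P) = Q * G * P * \<sigma> c" by (simp add: P\<sigma>[OF c] mult.assoc)
    qed
    then have H': "H + Q * G * P \<in> A.W" using A.W_closed H by blast
    have "pivots N (H + Q * G * P) \<subset> pivots N H"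
    proof (rule pivots_psubset)
      show "supp N (H + Q * G * P)" using suppS H' A.W_sub by blast
      \<comment> \<open>Modulo \<open>m\<close>, both \<open>H * Y * Q\<close> and
        \<open>H * P\<close> vanish and \<open>P\<close> is idempotent. Hence the kernel of
        \<open>H + Q * G * P\<close> lies in that of \<open>H\<close>, while \<open>P\<close> itself
        is killed by \<open>H\<close> but sent to \<open>Q * G * P\<close>.\<close>
      have HXQ: "H * Y * Q = (H - H * Y * H) * Y" by (simp add: Q_def algebra_simps Hee)
      have HP: "H * P = H - H * Y * H" by (simp add: P_def algebra_simps Hee)
      have PP: "P * P = P - Y * (H - H * Y * H)"
        by (simp add: P_def algebra_simps Hee \<open>e * e = e\<close>) (simp add: mult.assoc[symmetric] Hee)
      show "null m (H * V)" if V: "null m ((H + Q * G * P) * V)" for V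
      proof -
        have "H * V = (H - H * Y * H) * V + H * Y * ((H + Q * G * P) * V) - (H * Y * Q) * G * P * V"
          by (simp add: algebra_simps)
        moreover have "null m ((H - H * Y * H) * V + H * Y * ((H + Q * G * P) * V) - (H * Y * Q) * G * P * V)"
          unfolding HXQ by (intro null_diff null_add null_mult_right D null_mult_left[OF V])
        ultimately show ?thesis by simp
      qed
      show "null m (H * P)" unfolding HP by (rule D)
      show "\<not> null m ((H + Q * G * P) * P)"
      proof
        assume *: "null m ((H + Q * G * P) * P)"
        have "Q * G * P = (H + Q * G * P) * P - H * P + Q * G * (Y * (H - H * Y * H))"
        proof -
          have "(H + Q * G * P) * P = H * P + Q * G * (P * P)" by (simp add: distrib_right mult.assoc)
          then show ?thesis unfolding PP by (simp add: right_diff_distrib)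
        qed
        moreover have "null m \<dots>" unfolding HP by (intro null_add null_diff * D null_mult_left)
        ultimately show False using G(2) by simp
      qed
    qed
    then have "card (pivots N (H + Q * G * P)) < card (pivots N H)" by (rule psubset_card_mono[OF finite_pivots])
    then show False using min[OF H'] by simp
  qed
  \<comment> \<open>Up to the summand 1 these are the products, in the two orders, of 1 + (H - e)
    and 1 + (Y - e). They are congruent to 1 as soon as \<open>Q\<close>, respectively
    \<open>P\<close>, vanishes.\<close>
  have *: "H - e + (Y - e) + (H - e) * (Y - e) = - Q" "Y - e + (H - e) + (Y - e) * (H - e) = - P"
    by (simp_all add: P_def Q_def algebra_simps Hee \<open>e * e = e\<close>)
  have s: "supp N (H - e)" "supp N (Y - e)" using suppS HS XS N by (auto intro: supp_diff)
  have mm: "maximal_ideal_set m" by (rule max[OF m])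
  have "det1 N (H - e) \<notin> m"
    using \<open>null m P \<or> null m Q\<close>
  proof
    assume "null m Q"
    then have "null m (- Q)" using null_diff[OF null_zero] by fastforce
    then show ?thesis using det1_circle_unit(1)[OF mm s] * by simp
  next
    assume "null m P"
    then have "null m (- P)" using null_diff[OF null_zero] by fastforce
    then show ?thesis using det1_circle_unit(2)[OF mm s(2,1)] * by simp
  qed
  then show ?thesis using HS H\<sigma> by blast
qed

text \<open>The matrices live over a larger ring in which the base ring is the factor cut out by
  \<open>\<epsilon>\<close>. So \<open>lg\<close> promises an inverse of the determinant only after
  multiplication by \<open>\<epsilon>\<close>, and \<open>smul \<epsilon> e = e\<close> makes this
  suffice. The polynomial is \<open>det1 N (H - e)\<close> as a function of the coefficients of the
  intertwiner \<open>H\<close>.\<close>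

theorem skolem_noether_finmat:
  assumes good: "good_order e M S" and max: "\<And>m. m \<in> M \<Longrightarrow> maximal_ideal_set m"
    and sep: "separating e K J I x y t s \<tau> \<sigma>" "separating e K J I x y t s \<sigma> \<tau>"
    and in_S: "\<And>c. c \<in> K \<Longrightarrow> \<sigma> c \<in> S" "\<And>c. c \<in> K \<Longrightarrow> \<tau> c \<in> S"
    and \<epsilon>: "smul \<epsilon> e = e"
    and lg: "\<And>n f. polyfun n f \<Longrightarrow> (\<And>m. m \<in> M \<Longrightarrow> \<exists>x. f x \<notin> m) \<Longrightarrow> \<exists>x u. f x * u * \<epsilon> = \<epsilon>"
  shows "\<exists>H\<in>S. \<exists>G. (\<forall>c\<in>K. \<tau> c * H = H * \<sigma> c) \<and> H * G = e \<and> G * H = e \<and> e * G * e = G"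
proof -
  interpret A: averaging e M S K J I x y t s \<sigma> \<tau> by (rule averaging.intro) (fact assms)+
  obtain n B where W: "A.W = range (\<lambda>c. \<Sum>k<(n::nat). smul (c k) (B k))" using A.W_param by blast
  obtain N where N: "supp N e" using ex_supp by blast
  let ?H = "\<lambda>c. \<Sum>k<n. smul (c k) (B k)"
  let ?f = "\<lambda>c. det1 N (?H c - e)"
  have pf: "polyfun n ?f"
    unfolding det1_def
  proof (rule polyfun_det)
    fix i j
    have "polyfun n (\<lambda>c. (\<Sum>k<n. entry (B k) i j * c k) + ((if i = j then 1 else 0) - entry e i j))"
      by (intro polyfun.add polyfun_sum polyfun.const polyfun.mult_var) auto
    then show "polyfun n (\<lambda>c. (if i = j then 1 else 0) + entry (?H c - e) i j)"
      by (simp add: algebra_simps)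
  qed
  have loc: "\<exists>c. ?f c \<notin> m" if m: "m \<in> M" for m
  proof -
    obtain H where "H \<in> A.W" "det1 N (H - e) \<notin> m"
      using local_intertwiner[OF good max sep in_S N m] by (auto simp: A.W_def)
    moreover obtain c where "H = ?H c" using calculation(1) unfolding W by blast
    ultimately show ?thesis by blast
  qed
  obtain c u where cu: "?f c * u * \<epsilon> = \<epsilon>" using lg[OF pf loc] by blast
  define H where "H = ?H c"
  have H: "H \<in> A.W" using W H_def by blast
  then have HS: "H \<in> S" and H\<sigma>: "\<And>c. c \<in> K \<Longrightarrow> \<tau> c * H = H * \<sigma> c" by (auto simp: A.W_def)
  have Hee: "e * H = H" "H * e = H" "e * e = e" using A.goodD HS by auto
  define d where "d = det1 N (H - e)"
  have cu: "d * u * \<epsilon> = \<epsilon>" using cu by (simp add: d_def H_def)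
  have "supp N (H - e)" using supp_corner[OF N Hee(1,2)] N by (rule supp_diff)
  then obtain Y where Y: "Y + (H - e) * Y = smul d (one_finmat N)"
      "Y + Y * (H - e) = smul d (one_finmat N)"
    unfolding d_def by (rule det1_adjugate)
  have "e * (Y + (H - e) * Y) = H * Y"
    using Hee by (simp add: algebra_simps) (simp add: mult.assoc[symmetric])
  then have HY: "H * Y = smul d e" using Y(1) one_finmat_times[OF N] by (simp add: smul_simps)
  have "(Y + Y * (H - e)) * e = Y * H"
    using Hee by (simp add: algebra_simps)
  then have YH: "Y * H = smul d e" using Y(2) one_finmat_times[OF N] by (simp add: smul_simps)
  \<comment> \<open>The adjugate belongs to the ambient matrix H + (1 - e), so it is cut down to the
    corner before dividing by the determinant with the help of
    \<open>u * \<epsilon>\<close>.\<close>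
  define G where "G = smul (u * \<epsilon>) (e * Y * e)"
  have su: "smul (u * \<epsilon>) (smul d e) = e"
  proof -
    have "u * \<epsilon> * d = \<epsilon>" using cu by (simp add: ac_simps)
    then show ?thesis using \<epsilon> by (simp add: smul_simps)
  qed
  have "H * (e * Y * e) = H * Y * e" using Hee by (simp add: mult.assoc[symmetric])
  then have "H * G = e" unfolding G_def smul_simps HY using su Hee by (simp add: smul_simps)
  moreover have "(e * Y * e) * H = e * (Y * H)" using Hee by (simp add: mult.assoc)
  then have "G * H = e" unfolding G_def smul_simps YH using su Hee by (simp add: smul_simps)
  moreover have "e * G * e = G" using Hee by (simp add: G_def smul_simps mult.assoc) (simp add: mult.assoc[symmetric])
  ultimately show ?thesis using HS H\<sigma> by blast
qed

section \<open>A type-level ring over all commutative rings on a type\<close>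

text \<open>Type-class linear algebra applies to matrices over this product ring, and every carrier-based \<open>R\<close>
  sits in it as the corner cut out by the idempotent supported at \<open>R\<close>. The factor \<open>int\<close> only
  ensures \<open>0 \<noteq> 1\<close>.\<close>

typedef 'a prodring =
    "{p :: int \<times> ('a ring \<Rightarrow> 'a). \<forall>R. if cring R then snd p R \<in> carrier R else snd p R = undefined}"
  by (rule exI[of _ "(0, \<lambda>R. if cring R then \<zero>\<^bsub>R\<^esub> else undefined)"])
    (auto simp: cring.cring_simprules(2))

setup_lifting type_definition_prodring

instantiation prodring :: (type) comm_ring_1
begin

lift_definition zero_prodring :: "'a prodring" is "(0, \<lambda>R. if cring R then \<zero>\<^bsub>R\<^esub> else undefined)"
  by (auto simp: cring.cring_simprules)

lift_definition one_prodring :: "'a prodring" is "(1, \<lambda>R. if cring R then \<one>\<^bsub>R\<^esub> else undefined)"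
  by (auto simp: cring.cring_simprules)

lift_definition plus_prodring :: "'a prodring \<Rightarrow> 'a prodring \<Rightarrow> 'a prodring"
  is "\<lambda>p q. (fst p + fst q, \<lambda>R. if cring R then snd p R \<oplus>\<^bsub>R\<^esub> snd q R else undefined)"
  by (auto simp: cring.cring_simprules)

lift_definition times_prodring :: "'a prodring \<Rightarrow> 'a prodring \<Rightarrow> 'a prodring"
  is "\<lambda>p q. (fst p * fst q, \<lambda>R. if cring R then snd p R \<otimes>\<^bsub>R\<^esub> snd q R else undefined)"
  by (auto simp: cring.cring_simprules)

lift_definition uminus_prodring :: "'a prodring \<Rightarrow> 'a prodring"
  is "\<lambda>p. (- fst p, \<lambda>R. if cring R then \<ominus>\<^bsub>R\<^esub> snd p R else undefined)"
  by (auto simp: cring.cring_simprules)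

lift_definition minus_prodring :: "'a prodring \<Rightarrow> 'a prodring \<Rightarrow> 'a prodring"
  is "\<lambda>p q. (fst p - fst q, \<lambda>R. if cring R then snd p R \<ominus>\<^bsub>R\<^esub> snd q R else undefined)"
  by (auto simp: cring.cring_simprules)

instance
proof
  fix a b c :: "'a prodring"
  show "a * b * c = a * (b * c)" "a * b = b * a" "1 * a = a" "a + b + c = a + (b + c)" "a + b = b + a"
    "0 + a = a" "- a + a = 0" "a - b = a + - b" "(a + b) * c = a * c + b * c"
    by (transfer, auto simp: prod_eq_iff fun_eq_iff cring.cring_simprules algebra_simps split: if_splits)+
  show "(0 :: 'a prodring) \<noteq> 1" by transfer auto
qed

end

text \<open>The product is indexed by records of type \<open>'a ring\<close>; a ring with further
  record fields, such as a module, enters through its truncation.\<close>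

definition ring_core :: "('a, 'r) ring_scheme \<Rightarrow> 'a ring" where
  "ring_core R = \<lparr>carrier = carrier R, monoid.mult = monoid.mult R, one = one R, zero = zero R, add = add R\<rparr>"

lemma ring_core_simps [simp]:
  "carrier (ring_core R) = carrier R" "monoid.mult (ring_core R) = monoid.mult R" "one (ring_core R) = one R"
  "zero (ring_core R) = zero R" "add (ring_core R) = add R"
  by (simp_all add: ring_core_def)

lemma cring_ring_core: "cring R \<Longrightarrow> cring (ring_core R)"
proof -
  assume "cring R"
  then interpret cring R .
  show ?thesis
    by (intro cringI abelian_groupI comm_monoidI)
      (auto simp: a_ac m_ac l_distr r_distr intro: bexI[of _ "\<ominus>\<^bsub>R\<^esub> _"] l_neg)
qed

definition proj :: "('a, 'r) ring_scheme \<Rightarrow> 'a prodring \<Rightarrow> 'a" where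
  "proj R u = snd (Rep_prodring u) (ring_core R)"

text \<open>Extension by zero to the other factors, hence not unital: \<open>emb R \<one>\<close> is
  the idempotent that plays the role of \<open>\<epsilon>\<close> in the Skolem-Noether
  theorem.\<close>

definition emb :: "('a, 'r) ring_scheme \<Rightarrow> 'a \<Rightarrow> 'a prodring" where
  "emb R r = Abs_prodring (0, \<lambda>S. if cring S then if S = ring_core R then r else \<zero>\<^bsub>S\<^esub> else undefined)"

context cring
begin

lemma proj_closed [simp]: "proj R u \<in> carrier R"
  using Rep_prodring[of u] cring_ring_core[OF is_cring] unfolding proj_def
  by (auto dest: spec[of _ "ring_core R"])

lemma proj_hom [simp]: "proj R 0 = \<zero>" "proj R 1 = \<one>" "proj R (u + v) = proj R u \<oplus> proj R v"
  "proj R (u * v) = proj R u \<otimes> proj R v"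
  using cring_ring_core[OF is_cring] unfolding proj_def
  by (simp_all add: zero_prodring.rep_eq one_prodring.rep_eq plus_prodring.rep_eq times_prodring.rep_eq)

lemma proj_uminus [simp]: "proj R (- u) = \<ominus> proj R u"
proof -
  have "proj R (- u) \<oplus> proj R u = \<zero>" using proj_hom(3)[of "- u" u] by simp
  then show ?thesis using minus_equality[of "proj R (- u)" "proj R u"] by simp
qed

lemma proj_minus [simp]: "proj R (u - v) = proj R u \<ominus> proj R v"
  using proj_hom(3)[of u "- v"] by (simp add: a_minus_def)

lemma proj_sum: "proj R (\<Sum>i\<in>A. f i) = (\<Oplus>i\<in>A. proj R (f i))"
  by (induction A rule: infinite_finite_induct) simp_all

lemma Rep_emb: "r \<in> carrier R \<Longrightarrow>
    Rep_prodring (emb R r) = (0, \<lambda>S. if cring S then if S = ring_core R then r else \<zero>\<^bsub>S\<^esub> else undefined)"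
  unfolding emb_def by (subst Abs_prodring_inverse) (auto simp: cring.cring_simprules)

lemma proj_emb [simp]: "r \<in> carrier R \<Longrightarrow> proj R (emb R r) = r"
  using cring_ring_core[OF is_cring] by (simp add: proj_def Rep_emb)

lemma emb_hom: "emb R \<zero> = 0"
  "r \<in> carrier R \<Longrightarrow> s \<in> carrier R \<Longrightarrow> emb R (r \<oplus> s) = emb R r + emb R s"
  "r \<in> carrier R \<Longrightarrow> s \<in> carrier R \<Longrightarrow> emb R (r \<otimes> s) = emb R r * emb R s"
  by (auto simp: Rep_prodring_inject[symmetric] Rep_emb zero_prodring.rep_eq plus_prodring.rep_eq
      times_prodring.rep_eq fun_eq_iff cring.cring_simprules)

lemma emb_proj: "emb R (proj R u) = emb R \<one> * u"
proof -
  have cl: "snd (Rep_prodring u) S \<in> carrier S" if "cring S" for S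
    using Rep_prodring[of u] that by (auto dest: spec[of _ S])
  have "snd (Rep_prodring (emb R (proj R u))) S = snd (Rep_prodring (emb R \<one> * u)) S" for S
  proof (cases "cring S")
    case True
    show ?thesis
    proof (cases "S = ring_core R")
      case True
      then show ?thesis using proj_closed[of u] \<open>cring S\<close>
        by (simp add: Rep_emb times_prodring.rep_eq proj_def)
    next
      case False
      then show ?thesis using cl[OF True] True
        by (simp add: Rep_emb times_prodring.rep_eq cring.cring_simprules)
    qed
  qed (simp add: Rep_emb times_prodring.rep_eq)
  moreover have "fst (Rep_prodring (emb R (proj R u))) = fst (Rep_prodring (emb R \<one> * u))"
    by (simp add: Rep_emb times_prodring.rep_eq)
  ultimately show ?thesis by (simp add: Rep_prodring_inject[symmetric] prod_eq_iff fun_eq_iff)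
qed

lemma emb_mult_proj: "r \<in> carrier R \<Longrightarrow> emb R (r \<otimes> proj R u) = emb R r * u"
proof -
  assume r: "r \<in> carrier R"
  have "emb R (r \<otimes> proj R u) = emb R r * emb R \<one> * u" using r by (simp add: emb_hom(3) emb_proj mult.assoc)
  then show ?thesis using emb_hom(3)[of r \<one>] r by simp
qed

lemma emb_sum: "(\<And>i. i \<in> A \<Longrightarrow> f i \<in> carrier R) \<Longrightarrow> emb R (\<Oplus>i\<in>A. f i) = (\<Sum>i\<in>A. emb R (f i))"
  by (induction A rule: infinite_finite_induct) (simp_all add: emb_hom Pi_iff)

lemma emb_one_mult: "r \<in> carrier R \<Longrightarrow> emb R \<one> * emb R r = emb R r"
  using emb_hom(3)[of \<one> r] by simp

lemma emb_inj: "r \<in> carrier R \<Longrightarrow> s \<in> carrier R \<Longrightarrow> emb R r = emb R s \<Longrightarrow> r = s"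
  using proj_emb by metis

end


section \<open>Evaluation of indexed polynomials\<close>

definition monomial_eval :: "('a, 'r) ring_scheme \<Rightarrow> ('i \<Rightarrow> 'a) \<Rightarrow> 'i multiset \<Rightarrow> 'a" where
  "monomial_eval R x m = (\<Otimes>\<^bsub>R\<^esub>i\<in>set_mset m. x i [^]\<^bsub>R\<^esub> count m i)"

context cring
begin

lemma monomial_eval_closed: "(\<And>i. i \<in># m \<Longrightarrow> x i \<in> carrier R) \<Longrightarrow> monomial_eval R x m \<in> carrier R"
  unfolding monomial_eval_def by (intro finprod_closed) auto

lemma monomial_eval_add_mset:
  assumes "\<And>j. x j \<in> carrier R"
  shows "monomial_eval R x (add_mset i m) = monomial_eval R x m \<otimes> x i"
proof (cases "i \<in># m")
  case True
  then have set: "set_mset m = insert i (set_mset m - {i})" by auto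
  have "monomial_eval R x (add_mset i m) = (\<Otimes>j\<in>insert i (set_mset m - {i}). x j [^] count (add_mset i m) j)"
    unfolding monomial_eval_def using True by (simp add: insert_absorb)
  also have "\<dots> = x i [^] count (add_mset i m) i \<otimes> (\<Otimes>j\<in>set_mset m - {i}. x j [^] count (add_mset i m) j)"
    using assms by (intro finprod_insert) auto
  also have "(\<Otimes>j\<in>set_mset m - {i}. x j [^] count (add_mset i m) j) = (\<Otimes>j\<in>set_mset m - {i}. x j [^] count m j)"
    using assms by (intro finprod_cong') auto
  finally have 1: "monomial_eval R x (add_mset i m) =
      x i [^] count m i \<otimes> x i \<otimes> (\<Otimes>j\<in>set_mset m - {i}. x j [^] count m j)" using assms by simp
  have "monomial_eval R x m = (\<Otimes>j\<in>insert i (set_mset m - {i}). x j [^] count m j)"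
    unfolding monomial_eval_def using set by simp
  also have "\<dots> = x i [^] count m i \<otimes> (\<Otimes>j\<in>set_mset m - {i}. x j [^] count m j)"
    using assms by (intro finprod_insert) auto
  finally show ?thesis unfolding 1 using assms by (simp add: m_ac)
next
  case False
  then have "monomial_eval R x (add_mset i m) = x i [^] count (add_mset i m) i \<otimes> (\<Otimes>j\<in>set_mset m. x j [^] count (add_mset i m) j)"
    unfolding monomial_eval_def set_mset_add_mset_insert using assms by (intro finprod_insert) auto
  also have "(\<Otimes>j\<in>set_mset m. x j [^] count (add_mset i m) j) = monomial_eval R x m"
    unfolding monomial_eval_def using assms False by (intro finprod_cong') auto
  moreover have "count m i = 0" using False by (simp add: not_in_iff)
  ultimately show ?thesis using assms monomial_eval_closed[of m x] by (simp add: m_comm)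
qed

lemma poly_eval_alt: "poly_eval R P x = (\<Oplus>m\<in>{m. P m \<noteq> \<zero>}. P m \<otimes> monomial_eval R x m)"
  by (simp add: poly_eval_def monomial_eval_def)

lemma poly_eval_superset:
  assumes "finite S" "{m. P m \<noteq> \<zero>} \<subseteq> S" "\<And>m. P m \<in> carrier R" "\<And>j. x j \<in> carrier R"
  shows "poly_eval R P x = (\<Oplus>m\<in>S. P m \<otimes> monomial_eval R x m)"
  unfolding poly_eval_alt
  by (rule add.finprod_mono_neutral_cong_left) (use assms in \<open>auto simp: monomial_eval_closed\<close>)

text \<open>Finiteness of the support matters because \<open>poly_eval\<close> is a
  \<open>finsum\<close> over it, which is zero by default on an infinite index set.\<close>

lemma indexed_pset_props:
  assumes "P \<in> indexed_pset I (carrier R)"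
  shows "finite {m. P m \<noteq> \<zero>}" "P m \<in> carrier R" "P m \<noteq> \<zero> \<Longrightarrow> set_mset m \<subseteq> I"
proof -
  have "finite {m. P m \<noteq> \<zero>} \<and> (\<forall>m. P m \<in> carrier R) \<and> (\<forall>m. P m \<noteq> \<zero> \<longrightarrow> set_mset m \<subseteq> I)"
    using assms
  proof induction
    case (indexed_const k)
    have "{m. indexed_const k m \<noteq> \<zero>} \<subseteq> {{#}}" by (auto simp: indexed_const_def)
    then show ?case using indexed_const by (auto simp: indexed_const_def intro: finite_subset)
  next
    case (indexed_padd P Q)
    have sub: "{m. indexed_padd P Q m \<noteq> \<zero>} \<subseteq> {m. P m \<noteq> \<zero>} \<union> {m. Q m \<noteq> \<zero>}"
      by (auto simp: indexed_padd_def)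
    have "finite {m. indexed_padd P Q m \<noteq> \<zero>}" by (rule finite_subset[OF sub]) (use indexed_padd in auto)
    moreover have "set_mset m \<subseteq> I" if "indexed_padd P Q m \<noteq> \<zero>" for m
      using that sub indexed_padd.IH by blast
    ultimately show ?case using indexed_padd.IH by (auto simp: indexed_padd_def)
  next
    case (indexed_pmult P i)
    have sub: "{m. indexed_pmult P i m \<noteq> \<zero>} \<subseteq> add_mset i ` {m. P m \<noteq> \<zero>}"
    proof
      fix m assume "m \<in> {m. indexed_pmult P i m \<noteq> \<zero>}"
      then have "i \<in># m" "P (m - {#i#}) \<noteq> \<zero>" by (auto simp: indexed_pmult_def split: if_splits)
      then show "m \<in> add_mset i ` {m. P m \<noteq> \<zero>}" by (intro image_eqI[of _ _ "m - {#i#}"]) auto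
    qed
    have "finite {m. indexed_pmult P i m \<noteq> \<zero>}" by (rule finite_subset[OF sub]) (use indexed_pmult in auto)
    moreover have "set_mset m \<subseteq> I" if "indexed_pmult P i m \<noteq> \<zero>" for m
    proof -
      have "m \<in> add_mset i ` {m. P m \<noteq> \<zero>}" by (rule subsetD[OF sub]) (use that in simp)
      then obtain m' where "m = add_mset i m'" "P m' \<noteq> \<zero>" by auto
      then show ?thesis using indexed_pmult by auto
    qed
    ultimately show ?case using indexed_pmult.IH by (auto simp: indexed_pmult_def)
  qed
  then show "finite {m. P m \<noteq> \<zero>}" "P m \<in> carrier R" "P m \<noteq> \<zero> \<Longrightarrow> set_mset m \<subseteq> I" by auto
qed

lemma poly_eval_const: "k \<in> carrier R \<Longrightarrow> (\<And>j. x j \<in> carrier R) \<Longrightarrow> poly_eval R (indexed_const k) x = k"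
proof -
  assume k: "k \<in> carrier R" and x: "\<And>j. x j \<in> carrier R"
  have "poly_eval R (indexed_const k) x = (\<Oplus>m\<in>{{#}}. indexed_const k m \<otimes> monomial_eval R x m)"
    using k x by (intro poly_eval_superset) (auto simp: indexed_const_def)
  then show ?thesis using k by (simp add: indexed_const_def monomial_eval_def)
qed

lemma poly_eval_padd:
  assumes "P \<in> indexed_pset I (carrier R)" "Q \<in> indexed_pset I (carrier R)" "\<And>j. x j \<in> carrier R"
  shows "poly_eval R (indexed_padd P Q) x = poly_eval R P x \<oplus> poly_eval R Q x"
proof -
  let ?S = "{m. P m \<noteq> \<zero>} \<union> {m. Q m \<noteq> \<zero>}"
  note P = indexed_pset_props[OF assms(1)] and Q = indexed_pset_props[OF assms(2)]
  have "poly_eval R (indexed_padd P Q) x = (\<Oplus>m\<in>?S. indexed_padd P Q m \<otimes> monomial_eval R x m)"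
    using P Q assms(3) by (intro poly_eval_superset) (auto simp: indexed_padd_def)
  also have "\<dots> = (\<Oplus>m\<in>?S. P m \<otimes> monomial_eval R x m \<oplus> Q m \<otimes> monomial_eval R x m)"
    using P Q assms(3) by (intro finsum_cong') (auto simp: indexed_padd_def l_distr monomial_eval_closed)
  also have "\<dots> = (\<Oplus>m\<in>?S. P m \<otimes> monomial_eval R x m) \<oplus> (\<Oplus>m\<in>?S. Q m \<otimes> monomial_eval R x m)"
    using P Q assms(3) by (intro finsum_addf) (auto simp: monomial_eval_closed)
  also have "(\<Oplus>m\<in>?S. P m \<otimes> monomial_eval R x m) = poly_eval R P x"
    using P Q assms(3) by (intro poly_eval_superset[symmetric]) auto
  also have "(\<Oplus>m\<in>?S. Q m \<otimes> monomial_eval R x m) = poly_eval R Q x"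
    using P Q assms(3) by (intro poly_eval_superset[symmetric]) auto
  finally show ?thesis .
qed

lemma poly_eval_pmult:
  assumes "P \<in> indexed_pset I (carrier R)" "\<And>j. x j \<in> carrier R"
  shows "poly_eval R (indexed_pmult P i) x = poly_eval R P x \<otimes> x i"
proof -
  let ?S = "{m. P m \<noteq> \<zero>}"
  note P = indexed_pset_props[OF assms(1)]
  have "poly_eval R (indexed_pmult P i) x = (\<Oplus>m\<in>add_mset i ` ?S. indexed_pmult P i m \<otimes> monomial_eval R x m)"
  proof (rule poly_eval_superset)
    show "{m. indexed_pmult P i m \<noteq> \<zero>} \<subseteq> add_mset i ` ?S"
    proof
      fix m assume "m \<in> {m. indexed_pmult P i m \<noteq> \<zero>}"
      then have "i \<in># m" "P (m - {#i#}) \<noteq> \<zero>" by (auto simp: indexed_pmult_def split: if_splits)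
      then show "m \<in> add_mset i ` ?S" by (intro image_eqI[of _ _ "m - {#i#}"]) auto
    qed
  qed (use P assms(2) in \<open>auto simp: indexed_pmult_def\<close>)
  also have "\<dots> = (\<Oplus>m\<in>?S. indexed_pmult P i (add_mset i m) \<otimes> monomial_eval R x (add_mset i m))"
    using P assms(2) by (intro add.finprod_reindex) (auto simp: indexed_pmult_def monomial_eval_closed inj_on_def)
  also have "\<dots> = (\<Oplus>m\<in>?S. P m \<otimes> monomial_eval R x m \<otimes> x i)"
    using P assms(2)
    by (intro finsum_cong') (auto simp: indexed_pmult_def monomial_eval_add_mset monomial_eval_closed m_assoc)
  also have "\<dots> = poly_eval R P x \<otimes> x i"
    unfolding poly_eval_alt using P assms(2) by (intro finsum_ldistr[symmetric]) (auto simp: monomial_eval_closed)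
  finally show ?thesis .
qed

lemma poly_eval_cong:
  assumes "P \<in> indexed_pset I (carrier R)" "\<And>i. i \<in> I \<Longrightarrow> x i = y i" "\<And>j. y j \<in> carrier R"
  shows "poly_eval R P x = poly_eval R P y"
proof -
  have "monomial_eval R x m = monomial_eval R y m" if "set_mset m \<subseteq> I" for m
    unfolding monomial_eval_def using that assms by (intro finprod_cong') auto
  then show ?thesis
    unfolding poly_eval_alt using indexed_pset_props[OF assms(1)] assms(3)
    by (intro finsum_cong') (auto simp: monomial_eval_closed)
qed

text \<open>The three clauses of \<open>polyfun\<close> mirror those of \<open>indexed_pset\<close>:
  constants, sums, multiplication by one variable. Rule induction thus turns a type-level polynomial
  function into an indexed polynomial over the carrier.\<close>

lemma polyfun_poly_eval:
  assumes "polyfun n f"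
  shows "\<exists>F\<in>indexed_pset {..<n} (carrier R). \<forall>x. proj R (f x) = poly_eval R F (\<lambda>i. proj R (x i))"
  using assms
proof induction
  case (const c)
  show ?case
    by (rule bexI[of _ "indexed_const (proj R c)"]) (auto simp: poly_eval_const intro: indexed_pset.intros)
next
  case (add f g)
  then obtain F G where "F \<in> indexed_pset {..<n} (carrier R)" "G \<in> indexed_pset {..<n} (carrier R)"
    "\<forall>x. proj R (f x) = poly_eval R F (\<lambda>i. proj R (x i))" "\<forall>x. proj R (g x) = poly_eval R G (\<lambda>i. proj R (x i))"
    by blast
  then show ?case
    by (intro bexI[of _ "indexed_padd F G"]) (auto simp: poly_eval_padd intro: indexed_pset.intros)
next
  case (mult_var f i)
  then obtain F where "F \<in> indexed_pset {..<n} (carrier R)"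
    "\<forall>x. proj R (f x) = poly_eval R F (\<lambda>i. proj R (x i))" by blast
  then show ?case using mult_var(2)
    by (intro bexI[of _ "indexed_pmult F i"]) (auto simp: poly_eval_pmult intro: indexed_pset.intros)
qed

end

lemma poly_eval_hom:
  fixes x :: "'i \<Rightarrow> 'a"
  assumes R: "cring R" and S: "cring S" and h: "h \<in> ring_hom R S"
    and P: "P \<in> ring.indexed_pset R I (carrier R)" and x: "\<And>j. x j \<in> carrier R"
  shows "poly_eval S (\<lambda>m. h (P m)) (\<lambda>i. h (x i)) = h (poly_eval R P x)"
proof -
  interpret R: cring R by fact
  interpret S: cring S by fact
  interpret h: ring_hom_cring R S h by (simp add: ring_hom_cring_def ring_hom_cring_axioms_def R S h)
  note P = R.indexed_pset_props[OF P]
  have pow: "h (x i [^]\<^bsub>R\<^esub> (k::nat)) = h (x i) [^]\<^bsub>S\<^esub> k" for i k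
    using x by (induction k) auto
  have mono: "h (monomial_eval R x m) = monomial_eval S (\<lambda>i. h (x i)) m" for m
  proof -
    have "h (\<Otimes>\<^bsub>R\<^esub>i\<in>A. x i [^]\<^bsub>R\<^esub> count m i) = (\<Otimes>\<^bsub>S\<^esub>i\<in>A. h (x i) [^]\<^bsub>S\<^esub> count m i)" for A
      by (induction A rule: infinite_finite_induct) (use x in \<open>auto simp: pow\<close>)
    then show ?thesis by (simp add: monomial_eval_def)
  qed
  have hsum: "h (\<Oplus>\<^bsub>R\<^esub>m\<in>A. f m) = (\<Oplus>\<^bsub>S\<^esub>m\<in>A. h (f m))" if "\<And>m. f m \<in> carrier R" for A and f :: "'i multiset \<Rightarrow> 'a"
    by (induction A rule: infinite_finite_induct) (use that in auto)
  \<comment> \<open>Coefficients may die under \<open>h\<close>, so the sum is taken over the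
    support of \<open>P\<close> and not over that of its image.\<close>
  have "poly_eval S (\<lambda>m. h (P m)) (\<lambda>i. h (x i)) =
      (\<Oplus>\<^bsub>S\<^esub>m\<in>{m. P m \<noteq> \<zero>\<^bsub>R\<^esub>}. h (P m) \<otimes>\<^bsub>S\<^esub> monomial_eval S (\<lambda>i. h (x i)) m)"
    using P x by (intro S.poly_eval_superset) auto
  also have "\<dots> = (\<Oplus>\<^bsub>S\<^esub>m\<in>{m. P m \<noteq> \<zero>\<^bsub>R\<^esub>}. h (P m \<otimes>\<^bsub>R\<^esub> monomial_eval R x m))"
    using P x by (intro S.finsum_cong') (auto simp: mono[symmetric] R.monomial_eval_closed)
  also have "\<dots> = h (poly_eval R P x)"
    unfolding R.poly_eval_alt using P x by (subst hsum) (auto simp: R.monomial_eval_closed)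
  finally show ?thesis .
qed

text \<open>Preimages of the maximal ideals of the one factor \<open>R\<close>, the ideals about
  which the local-global property speaks.\<close>

definition proj_maximals :: "('a, 'r) ring_scheme \<Rightarrow> 'a prodring set set" where
  "proj_maximals R = {{u. proj R u \<in> I} | I. maximalideal I R}"

lemma (in cring) maximal_ideal_set_proj:
  assumes "maximalideal I R" shows "maximal_ideal_set {u. proj R u \<in> I}"
proof -
  interpret I: maximalideal I R by fact
  show ?thesis
  proof
    fix a assume "a \<notin> {u. proj R u \<in> I}"
    then have a: "proj R a \<notin> I" by simp
    interpret Q: field "R Quot I" by (rule I.quotient_is_field[OF is_cring])
    have "I +> proj R a \<in> carrier (R Quot I)" by (auto simp: FactRing_def A_RCOSETS_def')
    moreover have "I +> proj R a \<noteq> \<zero>\<^bsub>R Quot I\<^esub>"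
      using a I.a_rcos_self[of "proj R a"] by (auto simp: FactRing_def)
    ultimately have "I +> proj R a \<in> Units (R Quot I)" by (simp add: Q.field_Units)
    then obtain B where B: "B \<in> carrier (R Quot I)" "(I +> proj R a) \<otimes>\<^bsub>R Quot I\<^esub> B = \<one>\<^bsub>R Quot I\<^esub>"
      using Q.Units_r_inv Q.Units_inv_closed by blast
    obtain b where b: "b \<in> carrier R" "B = I +> b" using B(1) by (auto simp: FactRing_def A_RCOSETS_def')
    have "I +> (proj R a \<otimes> b) = I +> \<one>"
      using B(2) b I.rcoset_mult_add[of "proj R a" b] by (simp add: FactRing_def)
    then have "\<one> \<ominus> proj R a \<otimes> b \<in> I"
      using b I.a_rcos_module_minus[OF ring_axioms, of "proj R a \<otimes> b" \<one>] I.a_rcos_self[of \<one>] by auto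
    then show "\<exists>b. 1 - a * b \<in> {u. proj R u \<in> I}" using b by (intro exI[of _ "emb R b"]) simp
  next
    show "1 \<notin> {u. proj R u \<in> I}" using I.one_imp_carrier I.I_notcarr by auto
  qed (simp_all add: I.I_l_closed)
qed

text \<open>The translation of the local-global property to the type-level ring, in the form
  demanded by \<open>skolem_noether_finmat\<close>: a unit value in \<open>R\<close> means a value
  invertible up to the idempotent \<open>emb R \<one>\<close>.\<close>

lemma LG_ring_polyfun:
  assumes LG: "LG_ring R" and f: "polyfun n f" and loc: "\<And>m. m \<in> proj_maximals R \<Longrightarrow> \<exists>x. f x \<notin> m"
  shows "\<exists>x u. f x * u * emb R \<one>\<^bsub>R\<^esub> = emb R \<one>\<^bsub>R\<^esub>"
proof -
  interpret cring R using LG by (simp add: LG_ring_def)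
  obtain F where F: "F \<in> indexed_pset {..<n} (carrier R)"
      and fF: "\<And>x. proj R (f x) = poly_eval R F (\<lambda>i. proj R (x i))"
    using polyfun_poly_eval[OF f] by blast
  have "\<exists>x\<in>{..<n} \<rightarrow> carrier (R Quot I). poly_eval (R Quot I) (\<lambda>m. I +>\<^bsub>R\<^esub> F m) x \<noteq> \<zero>\<^bsub>R Quot I\<^esub>"
    if I: "maximalideal I R" for I
  proof -
    interpret I: maximalideal I R by fact
    obtain x where x: "proj R (f x) \<notin> I" using loc I unfolding proj_maximals_def by blast
    have h: "(+>\<^bsub>R\<^esub>) I \<in> ring_hom R (R Quot I)" by (rule I.rcos_ring_hom)
    have "cring (R Quot I)" by (rule I.quotient_is_cring[OF is_cring])
    then have "poly_eval (R Quot I) (\<lambda>m. I +>\<^bsub>R\<^esub> F m) (\<lambda>i. I +>\<^bsub>R\<^esub> proj R (x i)) = I +>\<^bsub>R\<^esub> proj R (f x)"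
      unfolding fF by (intro poly_eval_hom[OF is_cring _ h F]) auto
    moreover have "I +>\<^bsub>R\<^esub> proj R (f x) \<noteq> \<zero>\<^bsub>R Quot I\<^esub>"
      using x I.a_rcos_self[of "proj R (f x)"] by (auto simp: FactRing_def)
    moreover have "(\<lambda>i. I +>\<^bsub>R\<^esub> proj R (x i)) \<in> {..<n} \<rightarrow> carrier (R Quot I)"
      using proj_closed by (fastforce simp: FactRing_def A_RCOSETS_def')
    ultimately show ?thesis by metis
  qed
  then obtain r where r: "r \<in> {..<n} \<rightarrow> carrier R" "poly_eval R F r \<in> Units R"
    using LG F unfolding LG_ring_def by blast
  \<comment> \<open>The values beyond \<open>n\<close> are padding; \<open>F\<close> involves only
    the variables below \<open>n\<close>.\<close>
  define x where "x = (\<lambda>i. if i < n then emb R (r i) else 0)"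
  have "poly_eval R F r = poly_eval R F (\<lambda>i. proj R (x i))"
    by (rule poly_eval_cong[OF F]) (use r(1) in \<open>auto simp: x_def Pi_iff\<close>)
  then have U: "proj R (f x) \<in> Units R" using r fF by simp
  then have "emb R (proj R (f x)) * emb R (inv\<^bsub>R\<^esub> (proj R (f x))) = emb R \<one>\<^bsub>R\<^esub>"
    by (simp add: emb_hom(3)[symmetric])
  then have "emb R \<one>\<^bsub>R\<^esub> * f x * emb R (inv\<^bsub>R\<^esub> (proj R (f x))) = emb R \<one>\<^bsub>R\<^esub>"
    unfolding emb_proj .
  then show ?thesis by (metis mult.assoc mult.commute)
qed

section \<open>Homomorphisms of modules\<close>

lemma module_homD:
  assumes "h \<in> module_hom R M N"
  shows "x \<in> carrier M \<Longrightarrow> h x \<in> carrier N"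
    "x \<in> carrier M \<Longrightarrow> y \<in> carrier M \<Longrightarrow> h (x \<oplus>\<^bsub>M\<^esub> y) = h x \<oplus>\<^bsub>N\<^esub> h y"
    "r \<in> carrier R \<Longrightarrow> x \<in> carrier M \<Longrightarrow> h (r \<odot>\<^bsub>M\<^esub> x) = r \<odot>\<^bsub>N\<^esub> h x"
  using assms by (auto simp: module_hom_def)

lemma module_homI:
  assumes "\<And>x. x \<in> carrier M \<Longrightarrow> h x \<in> carrier N"
    "\<And>x y. x \<in> carrier M \<Longrightarrow> y \<in> carrier M \<Longrightarrow> h (x \<oplus>\<^bsub>M\<^esub> y) = h x \<oplus>\<^bsub>N\<^esub> h y"
    "\<And>r x. r \<in> carrier R \<Longrightarrow> x \<in> carrier M \<Longrightarrow> h (r \<odot>\<^bsub>M\<^esub> x) = r \<odot>\<^bsub>N\<^esub> h x"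
  shows "h \<in> module_hom R M N"
  using assms by (auto simp: module_hom_def)

lemma module_hom_zero:
  assumes "module R M" "module R N" "h \<in> module_hom R M N"
  shows "h \<zero>\<^bsub>M\<^esub> = \<zero>\<^bsub>N\<^esub>"
proof -
  interpret M: module R M by fact
  interpret N: module R N by fact
  have "h (\<zero>\<^bsub>R\<^esub> \<odot>\<^bsub>M\<^esub> \<zero>\<^bsub>M\<^esub>) = \<zero>\<^bsub>R\<^esub> \<odot>\<^bsub>N\<^esub> h \<zero>\<^bsub>M\<^esub>"
    using module_homD(3)[OF assms(3)] by blast
  then show ?thesis using module_homD(1)[OF assms(3)] by simp
qed

lemma module_hom_sum:
  assumes "module R M" "module R N" "h \<in> module_hom R M N" "\<And>i. i \<in> A \<Longrightarrow> f i \<in> carrier M"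
  shows "h (\<Oplus>\<^bsub>M\<^esub>i\<in>A. f i) = (\<Oplus>\<^bsub>N\<^esub>i\<in>A. h (f i))"
proof -
  interpret M: module R M by fact
  interpret N: module R N by fact
  show ?thesis using assms(4)
  proof (induction A rule: infinite_finite_induct)
    case (insert a A)
    have "h (f a) \<in> carrier N" "\<And>i. i \<in> A \<Longrightarrow> h (f i) \<in> carrier N"
      using insert.prems module_homD(1)[OF assms(3)] by auto
    then show ?case using insert by (simp add: module_homD(2)[OF assms(3)] Pi_iff)
  qed (simp_all add: module_hom_zero[OF assms(1-3)])
qed

lemma module_hom_lincomb:
  assumes "module R M" "module R N" "h \<in> module_hom R M N" "\<And>i. i \<in> A \<Longrightarrow> f i \<in> carrier M"
    "\<And>i. i \<in> A \<Longrightarrow> c i \<in> carrier R"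
  shows "h (\<Oplus>\<^bsub>M\<^esub>i\<in>A. c i \<odot>\<^bsub>M\<^esub> f i) = (\<Oplus>\<^bsub>N\<^esub>i\<in>A. c i \<odot>\<^bsub>N\<^esub> h (f i))"
proof -
  interpret M: module R M by fact
  interpret N: module R N by fact
  show ?thesis
    using assms(4,5) module_homD(1,3)[OF assms(3)]
    by (subst module_hom_sum[OF assms(1-3)]) (auto intro!: N.finsum_cong')
qed

lemma module_hom_compose:
  "g \<in> module_hom R M N \<Longrightarrow> h \<in> module_hom R N P \<Longrightarrow> (\<lambda>x. h (g x)) \<in> module_hom R M P"
  by (auto simp: module_hom_def Pi_iff)

lemma module_hom_id: "(\<lambda>x. x) \<in> module_hom R M M"
  by (auto simp: module_hom_def)

lemma module_hom_smult:
  assumes "module R N" "h \<in> module_hom R M N" "r \<in> carrier R"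
  shows "(\<lambda>x. r \<odot>\<^bsub>N\<^esub> h x) \<in> module_hom R M N"
proof -
  interpret N: module R N by fact
  show ?thesis using assms(2,3)
    by (auto simp: module_hom_def Pi_iff N.smult_r_distr N.smult_assoc1[symmetric] N.R.m_comm)
qed

lemma module_hom_zero_map:
  assumes "module R N" shows "(\<lambda>x. \<zero>\<^bsub>N\<^esub>) \<in> module_hom R M N"
proof -
  interpret N: module R N by fact
  show ?thesis by (auto simp: module_hom_def)
qed

lemma module_hom_finsum:
  assumes "module R N" "\<And>i. i \<in> A \<Longrightarrow> h i \<in> module_hom R M N"
  shows "(\<lambda>x. \<Oplus>\<^bsub>N\<^esub>i\<in>A. h i x) \<in> module_hom R M N"
proof -
  interpret N: module R N by fact
  show ?thesis
  proof (rule module_homI)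
    show "(\<Oplus>\<^bsub>N\<^esub>i\<in>A. h i x) \<in> carrier N" if "x \<in> carrier M" for x
      using module_homD(1)[OF assms(2)] that by (intro N.finsum_closed) auto
    show "(\<Oplus>\<^bsub>N\<^esub>i\<in>A. h i (x \<oplus>\<^bsub>M\<^esub> y)) = (\<Oplus>\<^bsub>N\<^esub>i\<in>A. h i x) \<oplus>\<^bsub>N\<^esub> (\<Oplus>\<^bsub>N\<^esub>i\<in>A. h i y)"
      if "x \<in> carrier M" "y \<in> carrier M" for x y
    proof -
      have "(\<Oplus>\<^bsub>N\<^esub>i\<in>A. h i (x \<oplus>\<^bsub>M\<^esub> y)) = (\<Oplus>\<^bsub>N\<^esub>i\<in>A. h i x \<oplus>\<^bsub>N\<^esub> h i y)"
        using module_homD(1,2)[OF assms(2)] that by (intro N.finsum_cong') auto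
      also have "\<dots> = (\<Oplus>\<^bsub>N\<^esub>i\<in>A. h i x) \<oplus>\<^bsub>N\<^esub> (\<Oplus>\<^bsub>N\<^esub>i\<in>A. h i y)"
        using module_homD(1)[OF assms(2)] that by (intro N.finsum_addf) auto
      finally show ?thesis .
    qed
    show "(\<Oplus>\<^bsub>N\<^esub>i\<in>A. h i (r \<odot>\<^bsub>M\<^esub> x)) = r \<odot>\<^bsub>N\<^esub> (\<Oplus>\<^bsub>N\<^esub>i\<in>A. h i x)"
      if r: "r \<in> carrier R" and x: "x \<in> carrier M" for r x
    proof (cases "finite A")
      case True
      then show ?thesis using module_homD(1,3)[OF assms(2)] r x
        by (subst N.finsum_smult_ldistr) (auto intro!: N.finsum_cong')
    qed (use r in simp)
  qed
qed

lemma module_hom_inverse: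
  assumes M: "module R M" and h: "h \<in> module_hom R M N" and bij: "bij_betw h (carrier M) (carrier N)"
  shows "inv_into (carrier M) h \<in> module_hom R N M"
proof -
  interpret M: module R M by fact
  have inv: "inv_into (carrier M) h y \<in> carrier M" "h (inv_into (carrier M) h y) = y" if "y \<in> carrier N" for y
    using that bij by (auto simp: bij_betw_def inv_into_into f_inv_into_f)
  have eq: "inv_into (carrier M) h y = x" if "x \<in> carrier M" "h x = y" for x y
    using that bij by (auto simp: bij_betw_def)
  show ?thesis
    by (rule module_homI) (auto intro!: eq simp: inv module_homD[OF h])
qed

definition reg_module :: "('a, 'r) ring_scheme \<Rightarrow> ('a, 'a) module" where
  "reg_module R = \<lparr>carrier = carrier R, monoid.mult = monoid.mult R, one = one R, zero = zero R, add = add R,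
     module.smult = monoid.mult R\<rparr>"

lemma reg_module_simps [simp]:
  "carrier (reg_module R) = carrier R" "zero (reg_module R) = zero R" "add (reg_module R) = add R"
  "module.smult (reg_module R) = monoid.mult R" "monoid.mult (reg_module R) = monoid.mult R" "one (reg_module R) = one R"
  by (simp_all add: reg_module_def)

lemma (in cring) reg_module: "module R (reg_module R)"
  by (intro moduleI abelian_groupI is_cring)
    (auto simp: a_ac l_distr r_distr m_assoc intro: bexI[of _ "\<ominus> _"] l_neg)

lemma (in cring) finsum_reg_module: "finsum (reg_module R) f A = finsum R f A"
  by (simp add: finsum_def finprod_def)


section \<open>Dual bases\<close>

text \<open>A dual basis. It makes \<open>M\<close> a direct summand of the free module R^q, the
  image of the idempotent matrix with entries \<open>l i (n j)\<close>.\<close>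

locale coordinates = module R M for R (structure) and M :: "('a, 'm) module" (structure) +
  fixes q :: nat and n :: "nat \<Rightarrow> 'm" and l :: "nat \<Rightarrow> 'm \<Rightarrow> 'a"
  assumes n_closed: "i < q \<Longrightarrow> n i \<in> carrier M"
    and l_hom: "i < q \<Longrightarrow> l i \<in> module_hom R M (reg_module R)"
    and expand: "v \<in> carrier M \<Longrightarrow> (\<Oplus>\<^bsub>M\<^esub>i\<in>{..<q}. l i v \<odot>\<^bsub>M\<^esub> n i) = v"

text \<open>Projectivity splits the surjection from the free module on a finite generating set; the
  coefficients of the splitting are the functionals.\<close>

lemma module_coordinates:
  fixes M :: "('a, 'm) module"
  assumes "finite_projective R M" obtains q n l where "coordinates R M q n l"
proof -
  have pM: "projective R M" and "finitely_generated R M" using assms by (auto simp: finite_projective_def)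
  then obtain S where S: "finite S" "S \<subseteq> carrier M" "submodule_span R M S = carrier M"
    by (auto simp: finitely_generated_def)
  have M: "module R M" using pM by (simp add: projective_def)
  interpret M: module R M by fact
  \<comment> \<open>Only the carrier of \<open>G\<close> enters the module structure of
    \<open>monoid_algebra\<close>, so the operations can be left undefined.\<close>
  define G :: "'m monoid" where "G = \<lparr>carrier = S, monoid.mult = undefined, one = undefined\<rparr>"
  let ?F = "monoid_algebra R G"
  have F: "module R ?F" by (rule monoid_algebra_module) unfold_locales
  define g where "g = linear_extension R M (\<lambda>x. x)"
  have g: "g \<in> module_hom R ?F M" "\<And>u. u \<in> S \<Longrightarrow> g (single R u) = u"
    unfolding g_def using linear_extension[OF M, of "\<lambda>x. x" G] S(2) by (auto simp: G_def)
  interpret F: module R ?F by fact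
  have single: "single R u \<in> carrier ?F" if "u \<in> S" for u
    using that finite_subset[of "{v. single R u v \<noteq> \<zero>\<^bsub>R\<^esub>}" "{u}"]
    by (auto simp: monoid_algebra_def single_def G_def)
  have "submodule (g ` carrier ?F) R M"
  proof (rule M.submoduleI)
    show "g ` carrier ?F \<subseteq> carrier M" using module_homD(1)[OF g(1)] by auto
    show "\<zero>\<^bsub>M\<^esub> \<in> g ` carrier ?F" using module_hom_zero[OF F M g(1)] by (metis F.zero_closed image_eqI)
    fix a assume "a \<in> g ` carrier ?F"
    then obtain b where b: "b \<in> carrier ?F" "a = g b" by auto
    then have "\<ominus>\<^bsub>M\<^esub> a = g ((\<ominus>\<^bsub>R\<^esub> \<one>\<^bsub>R\<^esub>) \<odot>\<^bsub>?F\<^esub> b)"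
      by (simp add: module_homD[OF g(1)] M.smult_l_minus)
    then show "\<ominus>\<^bsub>M\<^esub> a \<in> g ` carrier ?F" using b(1) by (simp only:) (intro imageI, simp)
    fix r assume r: "r \<in> carrier R"
    show "r \<odot>\<^bsub>M\<^esub> a \<in> g ` carrier ?F"
      using b r by (intro image_eqI[of _ _ "r \<odot>\<^bsub>?F\<^esub> b"]) (auto simp: module_homD[OF g(1)])
  next
    fix a b assume "a \<in> g ` carrier ?F" "b \<in> g ` carrier ?F"
    then obtain a' b' where "a' \<in> carrier ?F" "b' \<in> carrier ?F" "a = g a'" "b = g b'" by auto
    then show "a \<oplus>\<^bsub>M\<^esub> b \<in> g ` carrier ?F"
      by (intro image_eqI[of _ _ "a' \<oplus>\<^bsub>?F\<^esub> b'"]) (auto simp: module_homD[OF g(1)])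
  qed
  moreover have "S \<subseteq> g ` carrier ?F" using g(2) single by (metis image_eqI subsetI)
  ultimately have "carrier M \<subseteq> g ` carrier ?F" using S(3) unfolding submodule_span_def by blast
  then have surj: "g ` carrier ?F = carrier M" using module_homD(1)[OF g(1)] by auto
  obtain h where h: "h \<in> module_hom R M ?F" "\<And>v. v \<in> carrier M \<Longrightarrow> g (h v) = v"
    using projective_lift[OF pM F M g(1) surj module_hom_id] by blast
  obtain n where n: "bij_betw n {..<card S} S" using ex_bij_betw_nat_finite[OF S(1)] by (auto simp: atLeast0LessThan)
  have "coordinates R M (card S) n (\<lambda>i v. h v (n i))"
  proof (unfold_locales)
    fix i assume "i < card S"
    then have i: "n i \<in> S" using n by (auto simp: bij_betw_def)
    then show "n i \<in> carrier M" using S by blast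
    show "(\<lambda>v. h v (n i)) \<in> module_hom R M (reg_module R)"
      using h(1) by (auto simp: module_hom_def monoid_algebra_def)
  next
    fix v assume v: "v \<in> carrier M"
    then have hv: "h v \<in> carrier ?F" using module_homD(1)[OF h(1)] by blast
    have "v = g (h v)" using h(2) v by simp
    also have "\<dots> = (\<Oplus>\<^bsub>M\<^esub>u\<in>{u. h v u \<noteq> \<zero>\<^bsub>R\<^esub>}. h v u \<odot>\<^bsub>M\<^esub> u)"
      by (simp add: g_def linear_extension_def)
    also have "\<dots> = (\<Oplus>\<^bsub>M\<^esub>u\<in>S. h v u \<odot>\<^bsub>M\<^esub> u)"
      using hv S by (intro M.add.finprod_mono_neutral_cong_left) (auto simp: monoid_algebra_def G_def subset_iff)
    also have "\<dots> = (\<Oplus>\<^bsub>M\<^esub>u\<in>n ` {..<card S}. h v u \<odot>\<^bsub>M\<^esub> u)" using n by (simp add: bij_betw_def)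
    also have "\<dots> = (\<Oplus>\<^bsub>M\<^esub>i\<in>{..<card S}. h v (n i) \<odot>\<^bsub>M\<^esub> n i)"
      using n S hv by (intro M.add.finprod_reindex) (auto simp: bij_betw_def monoid_algebra_def)
    finally show "(\<Oplus>\<^bsub>M\<^esub>i\<in>{..<card S}. h v (n i) \<odot>\<^bsub>M\<^esub> n i) = v" by simp
  qed
  then show ?thesis using that by blast
qed

context coordinates
begin

lemma mod: "module R M" by unfold_locales

lemma l_closed: "i < q \<Longrightarrow> v \<in> carrier M \<Longrightarrow> l i v \<in> carrier R"
  using module_homD(1)[OF l_hom] by simp

lemma l_lincomb:
  assumes "i < q" "\<And>j. j \<in> A \<Longrightarrow> c j \<in> carrier R" "\<And>j. j \<in> A \<Longrightarrow> v j \<in> carrier M"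
  shows "l i (\<Oplus>\<^bsub>M\<^esub>j\<in>A. c j \<odot>\<^bsub>M\<^esub> v j) = (\<Oplus>\<^bsub>R\<^esub>j\<in>A. c j \<otimes>\<^bsub>R\<^esub> l i (v j))"
  using module_hom_lincomb[OF mod reg_module l_hom, of i A v c] assms
  by (simp add: finsum_reg_module)

text \<open>The matrix on R^q of the composite R^q to \<open>M\<close> to \<open>M\<close> to R^q,
  where the outer maps are given by the \<open>n j\<close> and by the \<open>l i\<close>. For the
  identity it is the idempotent whose image is \<open>M\<close>; in general it is \<open>h\<close>
  extended by zero on a complement.\<close>

definition mat_of :: "('m \<Rightarrow> 'm) \<Rightarrow> 'a prodring finmat" where
  "mat_of h = tab q (\<lambda>i j. emb R (l i (h (n j))))"

definition unit_mat :: "'a prodring finmat" where "unit_mat = mat_of (\<lambda>v. v)"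

lemma supp_mat_of: "supp q (mat_of h)" by (simp add: mat_of_def supp_tab)

lemma mat_of_cong: "(\<And>v. v \<in> carrier M \<Longrightarrow> h v = g v) \<Longrightarrow> mat_of h = mat_of g"
  by (rule finmat_eqI) (simp add: mat_of_def entry_tab n_closed)

lemma mat_of_compose:
  assumes h: "h \<in> module_hom R M M" and g: "g \<in> module_hom R M M"
  shows "mat_of h * mat_of g = mat_of (\<lambda>v. h (g v))"
proof (rule finmat_eqI)
  fix i j
  show "entry (mat_of h * mat_of g) i j = entry (mat_of (\<lambda>v. h (g v))) i j"
  proof (cases "i < q \<and> j < q")
    case True
    have gn: "g (n j) \<in> carrier M" and hn: "\<And>k. k < q \<Longrightarrow> h (n k) \<in> carrier M"
      using True module_homD(1)[OF g] module_homD(1)[OF h] n_closed by auto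
    have "h (g (n j)) = h (\<Oplus>\<^bsub>M\<^esub>k\<in>{..<q}. l k (g (n j)) \<odot>\<^bsub>M\<^esub> n k)" using expand[OF gn] by simp
    also have "\<dots> = (\<Oplus>\<^bsub>M\<^esub>k\<in>{..<q}. l k (g (n j)) \<odot>\<^bsub>M\<^esub> h (n k))"
      using gn n_closed l_closed by (intro module_hom_lincomb[OF mod mod h]) auto
    moreover have "l i (\<Oplus>\<^bsub>M\<^esub>k\<in>{..<q}. l k (g (n j)) \<odot>\<^bsub>M\<^esub> h (n k)) =
        (\<Oplus>\<^bsub>R\<^esub>k\<in>{..<q}. l k (g (n j)) \<otimes>\<^bsub>R\<^esub> l i (h (n k)))"
      using gn hn True l_closed by (intro l_lincomb) auto
    ultimately have "l i (h (g (n j))) = (\<Oplus>\<^bsub>R\<^esub>k\<in>{..<q}. l k (g (n j)) \<otimes>\<^bsub>R\<^esub> l i (h (n k)))"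
      by simp
    then have "emb R (l i (h (g (n j)))) = (\<Sum>k<q. emb R (l k (g (n j)) \<otimes>\<^bsub>R\<^esub> l i (h (n k))))"
      using gn hn True l_closed by (simp only:) (intro emb_sum, auto)
    also have "\<dots> = (\<Sum>k<q. emb R (l i (h (n k))) * emb R (l k (g (n j))))"
      using gn hn True l_closed by (intro sum.cong) (auto simp: emb_hom)
    finally show ?thesis using True by (simp add: entry_times[OF supp_mat_of]) (simp add: mat_of_def entry_tab)
  next
    case False
    then show ?thesis
      using suppD[OF supp_mat_of] suppD[OF supp_times[OF supp_mat_of supp_mat_of]] by (metis not_less)
  qed
qed

lemma mat_of_add:
  assumes "h \<in> module_hom R M M" "g \<in> module_hom R M M"
  shows "mat_of (\<lambda>v. h v \<oplus>\<^bsub>M\<^esub> g v) = mat_of h + mat_of g"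
  by (rule finmat_eqI)
    (auto simp: mat_of_def entry_tab n_closed module_homD[OF assms(1)] module_homD[OF assms(2)]
      module_homD(2)[OF l_hom] l_closed emb_hom)

lemma mat_of_smult:
  assumes "h \<in> module_hom R M M" "r \<in> carrier R"
  shows "mat_of (\<lambda>v. r \<odot>\<^bsub>M\<^esub> h v) = smul (emb R r) (mat_of h)"
  by (rule finmat_eqI)
    (use assms(2) in \<open>auto simp: mat_of_def entry_tab n_closed module_homD[OF assms(1)] module_homD(3)[OF l_hom]
      l_closed emb_hom\<close>)

lemma mat_of_zero: "mat_of (\<lambda>v. \<zero>\<^bsub>M\<^esub>) = 0"
  by (rule finmat_eqI)
    (auto simp: mat_of_def entry_tab module_hom_zero[OF mod reg_module l_hom] emb_hom)

lemma mat_of_finsum: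
  assumes "\<And>i. i \<in> A \<Longrightarrow> h i \<in> module_hom R M M"
  shows "mat_of (\<lambda>v. \<Oplus>\<^bsub>M\<^esub>i\<in>A. h i v) = (\<Sum>i\<in>A. mat_of (h i))"
  using assms
proof (induction A rule: infinite_finite_induct)
  case (insert a A)
  have 1: "mat_of (\<lambda>v. \<Oplus>\<^bsub>M\<^esub>i\<in>insert a A. h i v) = mat_of (\<lambda>v. h a v \<oplus>\<^bsub>M\<^esub> (\<Oplus>\<^bsub>M\<^esub>i\<in>A. h i v))"
    using insert module_homD(1) by (intro mat_of_cong) (fastforce intro!: M.finsum_insert)
  have 2: "mat_of (\<lambda>v. h a v \<oplus>\<^bsub>M\<^esub> (\<Oplus>\<^bsub>M\<^esub>i\<in>A. h i v)) = mat_of (h a) + mat_of (\<lambda>v. \<Oplus>\<^bsub>M\<^esub>i\<in>A. h i v)"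
    using insert.prems by (intro mat_of_add module_hom_finsum[OF mod]) auto
  have 3: "mat_of (\<lambda>v. \<Oplus>\<^bsub>M\<^esub>i\<in>A. h i v) = (\<Sum>i\<in>A. mat_of (h i))"
    using insert.prems by (intro insert.IH) auto
  show ?case unfolding 1 2 3 sum.insert[OF insert.hyps] by (rule refl)
next
  case (infinite A)
  have "(\<Oplus>\<^bsub>M\<^esub>i\<in>A. h i v) = \<zero>\<^bsub>M\<^esub>" for v using infinite(1) by (rule M.finsum_infinite)
  then show ?case using infinite(1) by (simp only: mat_of_zero sum.infinite not_False_eq_True)
next
  case empty
  show ?case by (simp only: M.finsum_empty mat_of_zero sum.empty)
qed

lemma mat_of_inject:
  assumes "h \<in> module_hom R M M" "g \<in> module_hom R M M" "mat_of h = mat_of g" "v \<in> carrier M"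
  shows "h v = g v"
proof -
  have "h (n j) = g (n j)" if "j < q" for j
  proof -
    have c: "h (n j) \<in> carrier M" "g (n j) \<in> carrier M" 
      using that n_closed module_homD(1)[OF assms(1)] module_homD(1)[OF assms(2)] by auto
    have "l i (h (n j)) = l i (g (n j))" if "i < q" for i
    proof -
      have "entry (mat_of h) i j = entry (mat_of g) i j" using assms(3) by simp
      then show ?thesis using that \<open>j < q\<close> c l_closed by (auto simp: mat_of_def entry_tab intro: emb_inj)
    qed
    then have "(\<Oplus>\<^bsub>M\<^esub>i\<in>{..<q}. l i (h (n j)) \<odot>\<^bsub>M\<^esub> n i) = (\<Oplus>\<^bsub>M\<^esub>i\<in>{..<q}. l i (g (n j)) \<odot>\<^bsub>M\<^esub> n i)"
      using c l_closed n_closed by (intro M.finsum_cong') auto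
    then show ?thesis using expand c by simp
  qed
  moreover have "f v = (\<Oplus>\<^bsub>M\<^esub>j\<in>{..<q}. l j v \<odot>\<^bsub>M\<^esub> f (n j))" if f: "f \<in> module_hom R M M" for f
  proof -
    have "f v = f (\<Oplus>\<^bsub>M\<^esub>k\<in>{..<q}. l k v \<odot>\<^bsub>M\<^esub> n k)" using expand[OF assms(4)] by simp
    then show ?thesis
      using assms(4) n_closed l_closed module_hom_lincomb[OF mod mod f, of "{..<q}" n "\<lambda>k. l k v"] by auto
  qed
  moreover have "(\<Oplus>\<^bsub>M\<^esub>j\<in>{..<q}. l j v \<odot>\<^bsub>M\<^esub> h (n j)) = (\<Oplus>\<^bsub>M\<^esub>j\<in>{..<q}. l j v \<odot>\<^bsub>M\<^esub> g (n j))"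
    using calculation(1) assms(4) l_closed n_closed module_homD(1)[OF assms(2)] by (intro M.finsum_cong') auto
  ultimately show ?thesis using assms(1,2) by simp
qed

lemma unit_mat_idem: "unit_mat * unit_mat = unit_mat"
  unfolding unit_mat_def using mat_of_compose[OF module_hom_id module_hom_id] .

lemma mat_of_corner: "h \<in> module_hom R M M \<Longrightarrow> unit_mat * mat_of h = mat_of h"
  "h \<in> module_hom R M M \<Longrightarrow> mat_of h * unit_mat = mat_of h"
  unfolding unit_mat_def using mat_of_compose module_hom_id by fastforce+

lemma smul_one_mat_of: "h \<in> module_hom R M M \<Longrightarrow> smul (emb R \<one>) (mat_of h) = mat_of h"
  using mat_of_smult[of h \<one>] mat_of_cong[of "\<lambda>v. \<one> \<odot>\<^bsub>M\<^esub> h v" h] module_homD(1) by fastforce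

lemma smul_one_unit_mat: "smul (emb R \<one>) unit_mat = unit_mat"
  unfolding unit_mat_def by (rule smul_one_mat_of[OF module_hom_id])

text \<open>Compressing an operator \<open>H\<close> of R^q to the summand \<open>M\<close> gives an
  endomorphism whose matrix is \<open>unit_mat * H * unit_mat\<close>; on the corner nothing is
  lost.\<close>

lemma mat_of_surj:
  assumes "unit_mat * H * unit_mat = H"
  obtains h where "h \<in> module_hom R M M" "mat_of h = H"
proof -
  define h where "h = (\<lambda>v. \<Oplus>\<^bsub>M\<^esub>i\<in>{..<q}. (\<Oplus>\<^bsub>R\<^esub>j\<in>{..<q}. proj R (entry H i j) \<otimes> l j v) \<odot>\<^bsub>M\<^esub> n i)"
  have lr: "(\<lambda>v. \<Oplus>\<^bsub>R\<^esub>j\<in>{..<q}. proj R (entry H i j) \<otimes> l j v) \<in> module_hom R M (reg_module R)" for i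
  proof -
    have "(\<lambda>v. \<Oplus>\<^bsub>reg_module R\<^esub>j\<in>{..<q}. proj R (entry H i j) \<odot>\<^bsub>reg_module R\<^esub> l j v) \<in> module_hom R M (reg_module R)"
      by (intro module_hom_finsum[OF reg_module] module_hom_smult[OF reg_module] l_hom) auto
    then show ?thesis by (simp add: finsum_reg_module)
  qed
  have h: "h \<in> module_hom R M M"
    unfolding h_def
  proof (rule module_hom_finsum[OF mod])
    fix i assume "i \<in> {..<q}"
    then have i: "n i \<in> carrier M" using n_closed by simp
    show "(\<lambda>v. (\<Oplus>\<^bsub>R\<^esub>j\<in>{..<q}. proj R (entry H i j) \<otimes> l j v) \<odot>\<^bsub>M\<^esub> n i) \<in> module_hom R M M"
      using module_homD[OF lr[of i]] i
      by (intro module_homI) (simp_all add: smult_l_distr smult_assoc1)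
  qed
  have sH: "supp q H"
  proof (rule supp_corner[of q unit_mat])
    show "supp q unit_mat" by (simp add: unit_mat_def supp_mat_of)
    show "unit_mat * H = H" "H * unit_mat = H"
      using assms unit_mat_idem by (metis mult.assoc)+
  qed
  have "mat_of h = unit_mat * H * unit_mat"
  proof (rule finmat_eqI)
    fix i j
    show "entry (mat_of h) i j = entry (unit_mat * H * unit_mat) i j"
    proof (cases "i < q \<and> j < q")
      case True
      have "l i (h (n j)) = (\<Oplus>\<^bsub>R\<^esub>k\<in>{..<q}. (\<Oplus>\<^bsub>R\<^esub>m\<in>{..<q}. proj R (entry H k m) \<otimes> l m (n j)) \<otimes> l i (n k))"
        unfolding h_def using True n_closed l_closed by (intro l_lincomb R.finsum_closed) auto
      also have "\<dots> = (\<Oplus>\<^bsub>R\<^esub>k\<in>{..<q}. l i (n k) \<otimes> (\<Oplus>\<^bsub>R\<^esub>m\<in>{..<q}. l m (n j) \<otimes> proj R (entry H k m)))"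
      proof -
        have "(\<Oplus>\<^bsub>R\<^esub>m\<in>{..<q}. proj R (entry H k m) \<otimes> l m (n j)) = (\<Oplus>\<^bsub>R\<^esub>m\<in>{..<q}. l m (n j) \<otimes> proj R (entry H k m))" for k
          using True n_closed l_closed by (intro R.finsum_cong') (auto simp: R.m_comm)
        moreover have "(\<Oplus>\<^bsub>R\<^esub>m\<in>{..<q}. l m (n j) \<otimes> proj R (entry H k m)) \<in> carrier R" for k
          using True n_closed l_closed by (intro R.finsum_closed) auto
        ultimately show ?thesis
          using True n_closed l_closed by (intro R.finsum_cong') (auto simp: R.m_comm)
      qed
      finally have "emb R (l i (h (n j))) =
          emb R (\<Oplus>\<^bsub>R\<^esub>k\<in>{..<q}. l i (n k) \<otimes> (\<Oplus>\<^bsub>R\<^esub>m\<in>{..<q}. l m (n j) \<otimes> proj R (entry H k m)))" by simp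
      also have "\<dots> = (\<Sum>k<q. emb R (l i (n k)) * (\<Sum>m<q. emb R (l m (n j)) * entry H k m))"
      proof -
        have "emb R (\<Oplus>\<^bsub>R\<^esub>m\<in>{..<q}. l m (n j) \<otimes> proj R (entry H k m)) = (\<Sum>m<q. emb R (l m (n j)) * entry H k m)" for k
          using True n_closed l_closed by (subst emb_sum) (auto simp: emb_mult_proj)
        moreover have "(\<Oplus>\<^bsub>R\<^esub>m\<in>{..<q}. l m (n j) \<otimes> proj R (entry H k m)) \<in> carrier R" for k
          using True n_closed l_closed by (intro R.finsum_closed) auto
        ultimately show ?thesis
          using True n_closed l_closed by (subst emb_sum) (auto simp: emb_hom)
      qed
      also have "\<dots> = (\<Sum>k<q. \<Sum>m<q. emb R (l i (n k)) * entry H k m * emb R (l m (n j)))"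
        by (simp add: sum_distrib_left ac_simps)
      also have "\<dots> = (\<Sum>m<q. \<Sum>k<q. emb R (l i (n k)) * entry H k m * emb R (l m (n j)))" by (rule sum.swap)
      also have "\<dots> = entry (unit_mat * H * unit_mat) i j"
        using True sH supp_mat_of
        by (simp add: entry_times[of q] supp_times unit_mat_def sum_distrib_right) (simp add: mat_of_def entry_tab)
      finally show ?thesis using True by (simp add: mat_of_def entry_tab)
    next
      case False
      have "supp q (unit_mat * H * unit_mat)" using assms sH by simp
      then show ?thesis using False suppD supp_mat_of by (metis not_less)
    qed
  qed
  then show ?thesis using that h assms by metis
qed

lemma good_order_unit_mat: "good_order unit_mat (proj_maximals R) {H. unit_mat * H * unit_mat = H}"
  by (rule good_order_corner[OF unit_mat_idem]) (auto simp: proj_maximals_def maximal_ideal_set_proj)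

end

lemma (in cring) proj_maximalsD: "m \<in> proj_maximals R \<Longrightarrow> maximal_ideal_set m"
  by (auto simp: proj_maximals_def maximal_ideal_set_proj)

section \<open>Systems of generalized matrix units\<close>

text \<open>For a dual basis \<open>n\<^sub>i, \<lambda>\<^sub>i\<close> of \<open>N\<close> the endomorphisms \<open>n\<^sub>i \<lambda>\<^sub>j\<close> of \<open>N\<close> multiply in this way, with
  \<open>P j k = \<lambda>\<^sub>j(n\<^sub>k)\<close>.\<close>

definition unit_system ::
    "nat \<Rightarrow> (nat \<Rightarrow> nat \<Rightarrow> 'a::comm_ring_1) \<Rightarrow> 'a finmat \<Rightarrow> (nat \<times> nat \<Rightarrow> 'a finmat) \<Rightarrow> bool" where
  "unit_system q P e \<rho> \<longleftrightarrow>
     (\<forall>i<q. \<forall>j<q. e * \<rho> (i, j) = \<rho> (i, j) \<and> \<rho> (i, j) * e = \<rho> (i, j) \<and>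
        (\<forall>k<q. \<forall>m<q. \<rho> (i, j) * \<rho> (k, m) = smul (P j k) (\<rho> (i, m)))) \<and> (\<Sum>i<q. \<rho> (i, i)) = e"

lemma unit_systemD:
  assumes "unit_system q P e \<rho>"
  shows "i < q \<Longrightarrow> j < q \<Longrightarrow> k < q \<Longrightarrow> m < q \<Longrightarrow> \<rho> (i, j) * \<rho> (k, m) = smul (P j k) (\<rho> (i, m))"
    "(\<Sum>i<q. \<rho> (i, i)) = e"
    "b < q \<Longrightarrow> m < q \<Longrightarrow> (\<Sum>i<q. smul (P m i) (\<rho> (b, i))) = \<rho> (b, m)"
    "a < q \<Longrightarrow> k < q \<Longrightarrow> (\<Sum>i<q. smul (P i k) (\<rho> (i, a))) = \<rho> (k, a)"
proof -
  show 1: "i < q \<Longrightarrow> j < q \<Longrightarrow> k < q \<Longrightarrow> m < q \<Longrightarrow> \<rho> (i, j) * \<rho> (k, m) = smul (P j k) (\<rho> (i, m))" for i j k m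
    using assms by (simp add: unit_system_def)
  show 2: "(\<Sum>i<q. \<rho> (i, i)) = e" using assms by (simp add: unit_system_def)
  show "(\<Sum>i<q. smul (P m i) (\<rho> (b, i))) = \<rho> (b, m)" if "b < q" "m < q"
  proof -
    have "(\<Sum>i<q. smul (P m i) (\<rho> (b, i))) = (\<Sum>i<q. \<rho> (b, m) * \<rho> (i, i))"
      using that 1 by (intro sum.cong) auto
    also have "\<dots> = \<rho> (b, m) * e" by (simp add: sum_distrib_left[symmetric] 2)
    finally show ?thesis using assms that by (simp add: unit_system_def)
  qed
  show "(\<Sum>i<q. smul (P i k) (\<rho> (i, a))) = \<rho> (k, a)" if "a < q" "k < q"
  proof -
    have "(\<Sum>i<q. smul (P i k) (\<rho> (i, a))) = (\<Sum>i<q. \<rho> (i, i) * \<rho> (k, a))"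
      using that 1 by (intro sum.cong) auto
    also have "\<dots> = e * \<rho> (k, a)" by (simp add: sum_distrib_right[symmetric] 2)
    finally show ?thesis using assms that by (simp add: unit_system_def)
  qed
qed

text \<open>The family is \<theta>(a,b) = \<Sum> E(i,a) \<otimes> E(b,i), summed over
  \<open>i\<close>. Multiplying it by E(k,m) from the outer left or from the outer right gives
  E(k,a) \<otimes> E(b,m) both times, because the entries of \<open>P\<close> reproduce the units.
  With \<open>t\<close> the unit at (a,b) this is E(a,a) \<otimes> E(b,b), and these sum to the
  identity. The products E(i,a) E(b,i) sum to \<open>P a b\<close> times the identity, so the
  weights \<open>s\<close> have to satisfy \<Sum> s P = 1.\<close>

lemma separating_unit_system:
  fixes s :: "nat \<times> nat \<Rightarrow> 'a::comm_ring_1"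
  assumes \<rho>': "unit_system q P e \<rho>'" and \<rho>: "unit_system q P e \<rho>"
    and s: "smul (\<Sum>p\<in>{..<q} \<times> {..<q}. s p * P (fst p) (snd p)) e = e"
  shows "separating e ({..<q} \<times> {..<q}) ({..<q} \<times> {..<q}) (\<lambda>_. {..<q}) (\<lambda>p i. (i, fst p)) (\<lambda>p i. (snd p, i))
    (\<lambda>p. p) s \<rho>' \<rho>"
proof -
  let ?K = "{..<q} \<times> {..<q}"
  let ?av = "average (\<lambda>_. {..<q}) (\<lambda>p i. (i, fst p)) (\<lambda>p i. (snd p, i)) \<rho>' \<rho>"
  note r' = unit_systemD[OF \<rho>'] and r = unit_systemD[OF \<rho>]
  have left: "\<rho>' (k, m) * ?av (a, b) h = \<rho>' (k, a) * h * \<rho> (b, m)"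
    if "k < q" "m < q" "a < q" "b < q" for k m a b h
  proof -
    have "\<rho>' (k, m) * ?av (a, b) h = (\<Sum>i<q. \<rho>' (k, m) * \<rho>' (i, a) * h * \<rho> (b, i))"
      by (simp add: average_def sum_distrib_left mult.assoc)
    also have "\<dots> = (\<Sum>i<q. \<rho>' (k, a) * h * smul (P m i) (\<rho> (b, i)))"
      using that r'(1) by (intro sum.cong) (auto simp: smul_simps)
    also have "\<dots> = \<rho>' (k, a) * h * \<rho> (b, m)" using that r(3) by (simp add: sum_distrib_left[symmetric])
    finally show ?thesis .
  qed
  have right: "?av (a, b) h * \<rho> (k, m) = \<rho>' (k, a) * h * \<rho> (b, m)"
    if "k < q" "m < q" "a < q" "b < q" for k m a b h
  proof -
    have "?av (a, b) h * \<rho> (k, m) = (\<Sum>i<q. \<rho>' (i, a) * h * (\<rho> (b, i) * \<rho> (k, m)))"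
      by (simp add: average_def sum_distrib_right mult.assoc)
    also have "\<dots> = (\<Sum>i<q. smul (P i k) (\<rho>' (i, a)) * (h * \<rho> (b, m)))"
      using that r(1) by (intro sum.cong) (auto simp: smul_simps mult.assoc)
    also have "\<dots> = \<rho>' (k, a) * h * \<rho> (b, m)"
      using that r'(4) by (simp add: sum_distrib_right[symmetric] mult.assoc)
    finally show ?thesis .
  qed
  have "(\<Sum>p\<in>?K. \<rho>' p * ?av p h) = h" if h: "e * h * e = h" for h
  proof -
    have "(\<Sum>p\<in>?K. \<rho>' p * ?av p h) = (\<Sum>p\<in>?K. \<rho>' (fst p, fst p) * h * \<rho> (snd p, snd p))"
      using left by (intro sum.cong) auto
    also have "\<dots> = (\<Sum>a<q. \<Sum>b<q. \<rho>' (a, a) * h * \<rho> (b, b))"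
      by (simp add: sum.cartesian_product case_prod_unfold)
    also have "\<dots> = e * h * e" by (simp add: sum_distrib_left[symmetric] sum_distrib_right[symmetric] r(2) r'(2))
    finally show ?thesis using h by simp
  qed
  moreover have "(\<Sum>p\<in>?K. smul (s p) (\<Sum>i<q. \<rho> (i, fst p) * \<rho> (snd p, i))) = e"
  proof -
    have "(\<Sum>p\<in>?K. smul (s p) (\<Sum>i<q. \<rho> (i, fst p) * \<rho> (snd p, i))) = (\<Sum>p\<in>?K. smul (s p * P (fst p) (snd p)) e)"
    proof (rule sum.cong[OF refl])
      fix p assume p: "p \<in> ?K"
      then have "(\<Sum>i<q. \<rho> (i, fst p) * \<rho> (snd p, i)) = (\<Sum>i<q. smul (P (fst p) (snd p)) (\<rho> (i, i)))"
        using r(1) by (intro sum.cong) auto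
      then show "smul (s p) (\<Sum>i<q. \<rho> (i, fst p) * \<rho> (snd p, i)) = smul (s p * P (fst p) (snd p)) e"
        by (simp add: smul_sum[symmetric] r(2) smul_simps)
    qed
    then show ?thesis using s by (simp add: smul_sum_left)
  qed
  moreover have "\<forall>h. \<forall>c\<in>?K. \<forall>j\<in>?K. \<rho>' c * ?av j h = ?av j h * \<rho> c"
    using left right by auto
  ultimately show ?thesis
    unfolding separating_def by (intro conjI; (blast | force)?)
qed


section \<open>Intertwining automorphisms over LG-rings\<close>

text \<open>The Skolem-Noether theorem read through \<open>mat_of\<close>, which identifies the
  endomorphisms of \<open>M\<close> with the corner of \<open>unit_mat\<close>.\<close>

lemma (in coordinates) intertwining_automorphism:
  assumes LG: "LG_ring R" and good: "good_order unit_mat (proj_maximals R) S"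
    and sep: "separating unit_mat K J I x y t s (\<lambda>c. mat_of (\<tau> c)) (\<lambda>c. mat_of (\<sigma> c))"
      "separating unit_mat K J I x y t s (\<lambda>c. mat_of (\<sigma> c)) (\<lambda>c. mat_of (\<tau> c))"
    and in_S: "\<And>c. c \<in> K \<Longrightarrow> mat_of (\<sigma> c) \<in> S" "\<And>c. c \<in> K \<Longrightarrow> mat_of (\<tau> c) \<in> S"
    and hom: "\<And>c. c \<in> K \<Longrightarrow> \<sigma> c \<in> module_hom R M M" "\<And>c. c \<in> K \<Longrightarrow> \<tau> c \<in> module_hom R M M"
  shows "\<exists>h\<in>module_hom R M M. \<exists>g\<in>module_hom R M M. mat_of h \<in> S \<and>
    (\<forall>v\<in>carrier M. g (h v) = v \<and> h (g v) = v) \<and> (\<forall>c\<in>K. \<forall>v\<in>carrier M. \<tau> c (h v) = h (\<sigma> c v))"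
proof -
  have "\<exists>H\<in>S. \<exists>G. (\<forall>c\<in>K. mat_of (\<tau> c) * H = H * mat_of (\<sigma> c)) \<and> H * G = unit_mat \<and> G * H = unit_mat \<and>
      unit_mat * G * unit_mat = G"
    by (rule skolem_noether_finmat[OF good proj_maximalsD sep in_S smul_one_unit_mat LG_ring_polyfun[OF LG]])
  then obtain H G where H: "H \<in> S" "\<And>c. c \<in> K \<Longrightarrow> mat_of (\<tau> c) * H = H * mat_of (\<sigma> c)"
    and G: "H * G = unit_mat" "G * H = unit_mat" "unit_mat * G * unit_mat = G" by blast
  obtain h where h: "h \<in> module_hom R M M" "mat_of h = H"
    using mat_of_surj[of H] good_orderD(2,3)[OF good H(1)] by auto
  obtain g where g: "g \<in> module_hom R M M" "mat_of g = G" using mat_of_surj[OF G(3)] by blast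
  show ?thesis
  proof (rule bexI[OF _ h(1)], rule bexI[OF _ g(1)], intro conjI ballI)
    show "mat_of h \<in> S" using H h by simp
    have "mat_of (\<lambda>v. g (h v)) = mat_of (\<lambda>v. v)"
      using mat_of_compose[OF g(1) h(1)] G h g by (simp add: unit_mat_def)
    then show "g (h v) = v" if "v \<in> carrier M" for v
      using mat_of_inject[OF module_hom_compose[OF h(1) g(1)] module_hom_id] that by blast
    have "mat_of (\<lambda>v. h (g v)) = mat_of (\<lambda>v. v)"
      using mat_of_compose[OF h(1) g(1)] G h g by (simp add: unit_mat_def)
    then show "h (g v) = v" if "v \<in> carrier M" for v
      using mat_of_inject[OF module_hom_compose[OF g(1) h(1)] module_hom_id] that by blast
    fix c v assume c: "c \<in> K" and v: "v \<in> carrier M"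
    have "mat_of (\<lambda>v. \<tau> c (h v)) = mat_of (\<lambda>v. h (\<sigma> c v))"
      using mat_of_compose[OF hom(2)[OF c] h(1)] mat_of_compose[OF h(1) hom(1)[OF c]] H(2)[OF c] h(2) by simp
    then show "\<tau> c (h v) = h (\<sigma> c v)"
      by (rule mat_of_inject[OF module_hom_compose[OF h(1) hom(2)[OF c]] module_hom_compose[OF hom(1)[OF c] h(1)] _ v])
  qed
qed

section \<open>Double sums, finite dual bases, and presentations by generalized matrix units\<close>

lemma (in abelian_monoid) finsum_cartesian:
  assumes "finite A" "finite B" "\<And>a b. a \<in> A \<Longrightarrow> b \<in> B \<Longrightarrow> f a b \<in> carrier G"
  shows "(\<Oplus>p\<in>A \<times> B. f (fst p) (snd p)) = (\<Oplus>a\<in>A. \<Oplus>b\<in>B. f a b)"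
  using assms(1,3)
proof (induction A rule: finite_induct)
  case (insert a A)
  have "insert a A \<times> B = ({a} \<times> B) \<union> (A \<times> B)" by auto
  then have "(\<Oplus>p\<in>insert a A \<times> B. f (fst p) (snd p)) =
      (\<Oplus>p\<in>{a} \<times> B. f (fst p) (snd p)) \<oplus> (\<Oplus>p\<in>A \<times> B. f (fst p) (snd p))"
    using insert assms(2) by (simp only:) (rule add.finprod_Un_disjoint; auto)
  also have "{a} \<times> B = Pair a ` B" by auto
  also have "(\<Oplus>p\<in>Pair a ` B. f (fst p) (snd p)) = (\<Oplus>b\<in>B. f a b)"
    using insert.prems by (subst add.finprod_reindex) (auto simp: inj_on_def)
  also have "(\<Oplus>p\<in>A \<times> B. f (fst p) (snd p)) = (\<Oplus>a\<in>A. \<Oplus>b\<in>B. f a b)"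
    using insert by auto
  also have "(\<Oplus>b\<in>B. f a b) \<oplus> (\<Oplus>a\<in>A. \<Oplus>b\<in>B. f a b) = (\<Oplus>a\<in>insert a A. \<Oplus>b\<in>B. f a b)"
    using insert by (subst finsum_insert) (auto intro!: finsum_closed)
  finally show ?case .
qed simp

lemma (in abelian_monoid) finsum_swap:
  assumes "finite A" "finite B" "\<And>a b. a \<in> A \<Longrightarrow> b \<in> B \<Longrightarrow> f a b \<in> carrier G"
  shows "(\<Oplus>a\<in>A. \<Oplus>b\<in>B. f a b) = (\<Oplus>b\<in>B. \<Oplus>a\<in>A. f a b)"
proof -
  have "(\<Oplus>b\<in>B. \<Oplus>a\<in>A. f a b) = (\<Oplus>p\<in>B \<times> A. f (snd p) (fst p))"
    using finsum_cartesian[of B A "\<lambda>b a. f a b"] assms by simp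
  also have "B \<times> A = prod.swap ` (A \<times> B)" by auto
  also have "(\<Oplus>p\<in>prod.swap ` (A \<times> B). f (snd p) (fst p)) = (\<Oplus>p\<in>A \<times> B. f (fst p) (snd p))"
    using assms by (subst add.finprod_reindex) (auto simp: inj_on_def)
  finally show ?thesis using finsum_cartesian[of A B f] assms by simp
qed

lemma coordinates_of_finite:
  assumes M: "module R M" and A: "finite A"
    and n: "\<And>a. a \<in> A \<Longrightarrow> n a \<in> carrier M" and l: "\<And>a. a \<in> A \<Longrightarrow> l a \<in> module_hom R M (reg_module R)"
    and expand: "\<And>v. v \<in> carrier M \<Longrightarrow> (\<Oplus>\<^bsub>M\<^esub>a\<in>A. l a v \<odot>\<^bsub>M\<^esub> n a) = v"
  obtains q n l where "coordinates R M q n l"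
proof -
  interpret M: module R M by fact
  obtain f where f: "bij_betw f {..<card A} A" using ex_bij_betw_nat_finite[OF A] by (auto simp: atLeast0LessThan)
  then have fA: "f i \<in> A" if "i < card A" for i using that by (auto simp: bij_betw_def)
  have "coordinates R M (card A) (\<lambda>i. n (f i)) (\<lambda>i. l (f i))"
  proof (unfold_locales)
    fix v assume v: "v \<in> carrier M"
    have lc: "l a v \<in> carrier R" if "a \<in> A" for a using module_homD(1)[OF l[OF that] v] by simp
    have "(\<Oplus>\<^bsub>M\<^esub>i\<in>{..<card A}. l (f i) v \<odot>\<^bsub>M\<^esub> n (f i)) = (\<Oplus>\<^bsub>M\<^esub>a\<in>f ` {..<card A}. l a v \<odot>\<^bsub>M\<^esub> n a)"
      using f lc n fA by (intro M.add.finprod_reindex[symmetric]) (auto simp: bij_betw_def)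
    also have "f ` {..<card A} = A" using f by (simp add: bij_betw_def)
    finally show "(\<Oplus>\<^bsub>M\<^esub>i\<in>{..<card A}. l (f i) v \<odot>\<^bsub>M\<^esub> n (f i)) = v" using expand[OF v] by simp
  qed (use n l fA in auto)
  then show ?thesis using that by blast
qed

text \<open>\<open>V\<close> is presented by generalized matrix units over \<open>M\<close>, as \<open>M \<otimes> N\<close> is by \<open>\<iota>\<^sub>i(m) = m \<otimes> n\<^sub>i\<close> and
  \<open>\<pi>\<^sub>i(m \<otimes> n) = \<lambda>\<^sub>i(n) m\<close>.\<close>

definition presented ::
    "('a, 'r) ring_scheme \<Rightarrow> nat \<Rightarrow> (nat \<Rightarrow> nat \<Rightarrow> 'a) \<Rightarrow> ('a, 'm) module \<Rightarrow> ('a, 'v) module \<Rightarrow>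
     (nat \<Rightarrow> 'm \<Rightarrow> 'v) \<Rightarrow> (nat \<Rightarrow> 'v \<Rightarrow> 'm) \<Rightarrow> bool" where
  "presented R q p M V \<iota> \<pi> \<longleftrightarrow>
     (\<forall>i<q. \<iota> i \<in> module_hom R M V \<and> \<pi> i \<in> module_hom R V M) \<and>
     (\<forall>i<q. \<forall>j<q. \<forall>m\<in>carrier M. \<pi> i (\<iota> j m) = p i j \<odot>\<^bsub>M\<^esub> m) \<and>
     (\<forall>v\<in>carrier V. (\<Oplus>\<^bsub>V\<^esub>i\<in>{..<q}. \<iota> i (\<pi> i v)) = v)"

text \<open>The vectors \<open>\<iota> i (n j)\<close> and the functionals obtained by composing
  \<open>l j\<close> with \<open>\<pi> i\<close> form a dual basis of \<open>V\<close>. So finite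
  projectivity of tensor products, direct powers and matrix algebras never has to be established
  separately.\<close>

lemma presented_coordinates:
  assumes M: "finite_projective R M" and V: "module R V" and pr: "presented R q p M V \<iota> \<pi>"
  obtains q n l where "coordinates R V q n l"
proof -
  obtain k n l where "coordinates R M k n l" using module_coordinates[OF M] .
  then interpret M: coordinates R M k n l .
  interpret V: module R V by fact
  have io: "\<iota> i \<in> module_hom R M V" "\<pi> i \<in> module_hom R V M" if "i < q" for i
    using pr that by (auto simp: presented_def)
  show thesis
  proof (rule coordinates_of_finite[OF V, of "{..<q} \<times> {..<k}" "\<lambda>a. \<iota> (fst a) (n (snd a))" "\<lambda>a v. l (snd a) (\<pi> (fst a) v)"])
    fix a assume a: "a \<in> {..<q} \<times> {..<k}"
    then show "\<iota> (fst a) (n (snd a)) \<in> carrier V" using module_homD(1)[OF io(1)] M.n_closed by auto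
    show "(\<lambda>v. l (snd a) (\<pi> (fst a) v)) \<in> module_hom R V (reg_module R)"
      by (rule module_hom_compose[OF io(2) M.l_hom]) (use a in auto)
  next
    fix v assume v: "v \<in> carrier V"
    have pv: "\<pi> i v \<in> carrier M" if "i < q" for i using module_homD(1)[OF io(2)[OF that] v] .
    have "(\<Oplus>\<^bsub>V\<^esub>a\<in>{..<q} \<times> {..<k}. l (snd a) (\<pi> (fst a) v) \<odot>\<^bsub>V\<^esub> \<iota> (fst a) (n (snd a))) =
        (\<Oplus>\<^bsub>V\<^esub>i\<in>{..<q}. \<Oplus>\<^bsub>V\<^esub>j\<in>{..<k}. l j (\<pi> i v) \<odot>\<^bsub>V\<^esub> \<iota> i (n j))"
      using M.l_closed pv module_homD(1)[OF io(1)] M.n_closed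
      by (intro V.finsum_cartesian[where f = "\<lambda>i j. l j (\<pi> i v) \<odot>\<^bsub>V\<^esub> \<iota> i (n j)"]) auto
    also have "\<dots> = (\<Oplus>\<^bsub>V\<^esub>i\<in>{..<q}. \<iota> i (\<pi> i v))"
    proof (rule V.finsum_cong')
      fix i assume "i \<in> {..<q}"
      then have i: "i < q" by simp
      have "\<iota> i (\<pi> i v) = \<iota> i (\<Oplus>\<^bsub>M\<^esub>j\<in>{..<k}. l j (\<pi> i v) \<odot>\<^bsub>M\<^esub> n j)" using M.expand[OF pv[OF i]] by simp
      also have "\<dots> = (\<Oplus>\<^bsub>V\<^esub>j\<in>{..<k}. l j (\<pi> i v) \<odot>\<^bsub>V\<^esub> \<iota> i (n j))"
        using M.n_closed M.l_closed pv[OF i] by (intro module_hom_lincomb[OF M.mod V io(1)[OF i]]) auto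
      finally show "(\<Oplus>\<^bsub>V\<^esub>j\<in>{..<k}. l j (\<pi> i v) \<odot>\<^bsub>V\<^esub> \<iota> i (n j)) = \<iota> i (\<pi> i v)" by simp
    qed (use module_homD(1)[OF io(1)] pv in auto)
    finally show "(\<Oplus>\<^bsub>V\<^esub>a\<in>{..<q} \<times> {..<k}. l (snd a) (\<pi> (fst a) v) \<odot>\<^bsub>V\<^esub> \<iota> (fst a) (n (snd a))) = v"
      using pr v by (simp add: presented_def)
  qed (use that in auto)
qed

lemma (in coordinates) unit_system_presented:
  assumes N: "module R N" and pr: "presented R k p N M \<iota> \<pi>" and p: "\<And>i j. i < k \<Longrightarrow> j < k \<Longrightarrow> p i j \<in> carrier R"
  shows "unit_system k (\<lambda>i j. emb R (p i j)) unit_mat (\<lambda>c. mat_of (\<lambda>v. \<iota> (fst c) (\<pi> (snd c) v)))"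
proof -
  have io: "\<iota> i \<in> module_hom R N M" "\<pi> i \<in> module_hom R M N" if "i < k" for i
    using pr that by (auto simp: presented_def)
  have \<rho>: "(\<lambda>v. \<iota> i (\<pi> j v)) \<in> module_hom R M M" if "i < k" "j < k" for i j
    by (rule module_hom_compose[OF io(2)[OF that(2)] io(1)[OF that(1)]])
  have "mat_of (\<lambda>v. \<iota> i (\<pi> j v)) * mat_of (\<lambda>v. \<iota> a (\<pi> b v)) = smul (emb R (p j a)) (mat_of (\<lambda>v. \<iota> i (\<pi> b v)))"
    if ij: "i < k" "j < k" "a < k" "b < k" for i j a b
  proof -
    have "mat_of (\<lambda>v. \<iota> i (\<pi> j v)) * mat_of (\<lambda>v. \<iota> a (\<pi> b v)) = mat_of (\<lambda>v. \<iota> i (\<pi> j (\<iota> a (\<pi> b v))))"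
      using \<rho> ij by (intro mat_of_compose) auto
    also have "\<dots> = mat_of (\<lambda>v. p j a \<odot>\<^bsub>M\<^esub> \<iota> i (\<pi> b v))"
    proof (rule mat_of_cong)
      fix v assume v: "v \<in> carrier M"
      then have "\<pi> b v \<in> carrier N" using module_homD(1)[OF io(2)] ij by blast
      then show "\<iota> i (\<pi> j (\<iota> a (\<pi> b v))) = p j a \<odot>\<^bsub>M\<^esub> \<iota> i (\<pi> b v)"
        using pr ij p module_homD(3)[OF io(1)[OF ij(1)]] by (simp add: presented_def)
    qed
    also have "\<dots> = smul (emb R (p j a)) (mat_of (\<lambda>v. \<iota> i (\<pi> b v)))"
      using \<rho> ij p by (intro mat_of_smult) auto
    finally show ?thesis .
  qed
  moreover have "(\<Sum>i<k. mat_of (\<lambda>v. \<iota> i (\<pi> i v))) = unit_mat"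
  proof -
    have "mat_of (\<lambda>v. \<Oplus>\<^bsub>M\<^esub>i\<in>{..<k}. \<iota> i (\<pi> i v)) = (\<Sum>i<k. mat_of (\<lambda>v. \<iota> i (\<pi> i v)))"
      by (rule mat_of_finsum) (use \<rho> in auto)
    moreover have "mat_of (\<lambda>v. \<Oplus>\<^bsub>M\<^esub>i\<in>{..<k}. \<iota> i (\<pi> i v)) = unit_mat"
      unfolding unit_mat_def by (rule mat_of_cong) (use pr in \<open>auto simp: presented_def\<close>)
    ultimately show ?thesis by simp
  qed
  ultimately show ?thesis using mat_of_corner[OF \<rho>] by (simp add: unit_system_def)
qed

lemma (in module) finsum_smult_rdistr:
  assumes "finite A" "\<And>i. i \<in> A \<Longrightarrow> c i \<in> carrier R" "x \<in> carrier M"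
  shows "(\<Oplus>\<^bsub>M\<^esub>i\<in>A. c i \<odot>\<^bsub>M\<^esub> x) = (\<Oplus>\<^bsub>R\<^esub>i\<in>A. c i) \<odot>\<^bsub>M\<^esub> x"
  using assms(1,2)
proof (induction A rule: finite_induct)
  case (insert a A)
  then show ?case using assms(3) by (simp add: Pi_iff smult_l_distr)
qed (use assms(3) in simp)

text \<open>Between the two maps stands \<iota>' \<pi>' h, which equals h \<iota> \<pi>; then
  \<open>g\<close> cancels \<open>h\<close>, and only \<pi> \<iota> \<pi> \<iota> remains, a product
  of two scalars \<open>p\<close>. Summed with the weights each factor gives 1. The statement has
  the shape of a one-sided inverse so that it can be used again with the two modules
  exchanged.\<close>

lemma presented_descent:
  fixes V :: "('a, 'v) module"
  assumes M1: "module R M1" and M2: "module R M2" and V: "module R V"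
    and pr1: "presented R q p M1 V \<iota> \<pi>" and pr2: "presented R q p M2 V \<iota>' \<pi>'"
    and p: "\<And>i j. i < q \<Longrightarrow> j < q \<Longrightarrow> p i j \<in> carrier R" and s: "\<And>c. s c \<in> carrier R"
    and sp: "(\<Oplus>\<^bsub>R\<^esub>c\<in>{..<q} \<times> {..<q}. s c \<otimes>\<^bsub>R\<^esub> p (fst c) (snd c)) = \<one>\<^bsub>R\<^esub>"
    and h: "h \<in> module_hom R V V" and g: "g \<in> module_hom R V V" and gh: "\<And>v. v \<in> carrier V \<Longrightarrow> g (h v) = v"
    and comm: "\<And>i j v. i < q \<Longrightarrow> j < q \<Longrightarrow> v \<in> carrier V \<Longrightarrow> \<iota>' i (\<pi>' j (h v)) = h (\<iota> i (\<pi> j v))"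
    and m: "m \<in> carrier M1"
  shows "(\<Oplus>\<^bsub>M1\<^esub>d\<in>{..<q} \<times> {..<q}. s d \<odot>\<^bsub>M1\<^esub> \<pi> (fst d) (g (\<iota>' (snd d)
      (\<Oplus>\<^bsub>M2\<^esub>c\<in>{..<q} \<times> {..<q}. s c \<odot>\<^bsub>M2\<^esub> \<pi>' (fst c) (h (\<iota> (snd c) m)))))) = m"
proof -
  interpret M1: module R M1 by fact
  interpret M2: module R M2 by fact
  interpret V: module R V by fact
  let ?K = "{..<q} \<times> {..<q}"
  have io: "\<iota> i \<in> module_hom R M1 V" "\<pi> i \<in> module_hom R V M1"
    "\<iota>' i \<in> module_hom R M2 V" "\<pi>' i \<in> module_hom R V M2" if "i < q" for i
    using pr1 pr2 that by (auto simp: presented_def)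
  note cl = module_homD(1)[OF io(1)] module_homD(1)[OF io(2)] module_homD(1)[OF io(3)] module_homD(1)[OF io(4)]
    module_homD(1)[OF h] module_homD(1)[OF g]
  have \<pi>\<iota>: "\<pi> i (\<iota> j x) = p i j \<odot>\<^bsub>M1\<^esub> x" if "i < q" "j < q" "x \<in> carrier M1" for i j x
    using pr1 that by (auto simp: presented_def)
  let ?f = "\<Oplus>\<^bsub>M2\<^esub>c\<in>?K. s c \<odot>\<^bsub>M2\<^esub> \<pi>' (fst c) (h (\<iota> (snd c) m))"
  have inner: "\<pi> (fst d) (g (\<iota>' (snd d) ?f)) = p (fst d) (snd d) \<odot>\<^bsub>M1\<^esub> m" if d: "d \<in> ?K" for d
  proof -
    have d': "fst d < q" "snd d < q" using d by auto
    have k: "(\<lambda>x. \<pi> (fst d) (g (\<iota>' (snd d) x))) \<in> module_hom R M2 M1"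
      by (rule module_hom_compose[OF module_hom_compose[OF io(3)[OF d'(2)] g] io(2)[OF d'(1)]])
    have "\<pi> (fst d) (g (\<iota>' (snd d) ?f)) =
        (\<Oplus>\<^bsub>M1\<^esub>c\<in>?K. s c \<odot>\<^bsub>M1\<^esub> \<pi> (fst d) (g (\<iota>' (snd d) (\<pi>' (fst c) (h (\<iota> (snd c) m))))))"
      using cl s m by (intro module_hom_lincomb[OF M2 M1 k]) auto
    also have "\<dots> = (\<Oplus>\<^bsub>M1\<^esub>c\<in>?K. (s c \<otimes>\<^bsub>R\<^esub> p (fst c) (snd c)) \<odot>\<^bsub>M1\<^esub> (p (fst d) (snd d) \<odot>\<^bsub>M1\<^esub> m))"
    proof (rule M1.finsum_cong'[OF refl])
      show "(\<lambda>c. (s c \<otimes>\<^bsub>R\<^esub> p (fst c) (snd c)) \<odot>\<^bsub>M1\<^esub> (p (fst d) (snd d) \<odot>\<^bsub>M1\<^esub> m)) \<in> ?K \<rightarrow> carrier M1"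
        using s p d' m by auto
      fix c assume "c \<in> ?K"
      then have c': "fst c < q" "snd c < q" by auto
      have im: "\<iota> (snd c) m \<in> carrier V" using cl c' m by auto
      have "g (\<iota>' (snd d) (\<pi>' (fst c) (h (\<iota> (snd c) m)))) = \<iota> (snd d) (\<pi> (fst c) (\<iota> (snd c) m))"
        using comm[OF d'(2) c'(1) im] gh cl c' d' im by simp
      then have "\<pi> (fst d) (g (\<iota>' (snd d) (\<pi>' (fst c) (h (\<iota> (snd c) m))))) =
          p (fst d) (snd d) \<odot>\<^bsub>M1\<^esub> (p (fst c) (snd c) \<odot>\<^bsub>M1\<^esub> m)"
        using \<pi>\<iota> c' d' m p by simp
      also have "\<dots> = p (fst c) (snd c) \<odot>\<^bsub>M1\<^esub> (p (fst d) (snd d) \<odot>\<^bsub>M1\<^esub> m)"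
        using p c' d' m by (simp add: M1.smult_assoc1[symmetric] M1.R.m_comm)
      finally show "s c \<odot>\<^bsub>M1\<^esub> \<pi> (fst d) (g (\<iota>' (snd d) (\<pi>' (fst c) (h (\<iota> (snd c) m))))) =
          (s c \<otimes>\<^bsub>R\<^esub> p (fst c) (snd c)) \<odot>\<^bsub>M1\<^esub> (p (fst d) (snd d) \<odot>\<^bsub>M1\<^esub> m)"
        using s p c' d' m by (simp add: M1.smult_assoc1)
    qed
    also have "\<dots> = p (fst d) (snd d) \<odot>\<^bsub>M1\<^esub> m"
      using s p d' m sp by (subst M1.finsum_smult_rdistr) auto
    finally show ?thesis .
  qed
  have "(\<Oplus>\<^bsub>M1\<^esub>d\<in>?K. s d \<odot>\<^bsub>M1\<^esub> \<pi> (fst d) (g (\<iota>' (snd d) ?f))) =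
      (\<Oplus>\<^bsub>M1\<^esub>d\<in>?K. (s d \<otimes>\<^bsub>R\<^esub> p (fst d) (snd d)) \<odot>\<^bsub>M1\<^esub> m)"
    using inner s p m by (intro M1.finsum_cong') (auto simp: M1.smult_assoc1)
  also have "\<dots> = m" using s p m sp by (subst M1.finsum_smult_rdistr) auto
  finally show ?thesis .
qed

lemma presented_transport:
  assumes V: "module R V" and V': "module R V'" and h: "h \<in> module_hom R V V'"
    and bij: "bij_betw h (carrier V) (carrier V')" and pr: "presented R q p M V' \<iota> \<pi>"
  shows "presented R q p M V (\<lambda>i x. inv_into (carrier V) h (\<iota> i x)) (\<lambda>i v. \<pi> i (h v))"
proof -
  interpret V: module R V by fact
  let ?g = "inv_into (carrier V) h"
  have g: "?g \<in> module_hom R V' V" by (rule module_hom_inverse[OF V h bij])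
  have hg: "h (?g y) = y" if "y \<in> carrier V'" for y using that bij by (auto simp: bij_betw_def f_inv_into_f)
  have gh: "?g (h x) = x" if "x \<in> carrier V" for x using that bij by (auto simp: bij_betw_def)
  have io: "\<iota> i \<in> module_hom R M V'" "\<pi> i \<in> module_hom R V' M" if "i < q" for i
    using pr that by (auto simp: presented_def)
  have "(\<Oplus>\<^bsub>V\<^esub>i\<in>{..<q}. ?g (\<iota> i (\<pi> i (h v)))) = v" if v: "v \<in> carrier V" for v
  proof -
    have hv: "h v \<in> carrier V'" using module_homD(1)[OF h v] .
    have "(\<Oplus>\<^bsub>V\<^esub>i\<in>{..<q}. ?g (\<iota> i (\<pi> i (h v)))) = ?g (\<Oplus>\<^bsub>V'\<^esub>i\<in>{..<q}. \<iota> i (\<pi> i (h v)))"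
      by (rule module_hom_sum[OF V' V g, symmetric])
        (use hv in \<open>auto intro!: module_homD(1)[OF io(1)] module_homD(1)[OF io(2)]\<close>)
    then show ?thesis using pr hv gh v by (simp add: presented_def)
  qed
  moreover have "\<pi> i (h (?g (\<iota> j m))) = p i j \<odot>\<^bsub>M\<^esub> m" if "i < q" "j < q" "m \<in> carrier M" for i j m
    using pr that hg module_homD(1)[OF io(1)] by (simp add: presented_def)
  moreover have "(\<lambda>x. ?g (\<iota> i x)) \<in> module_hom R M V" if "i < q" for i
    by (rule module_hom_compose[OF io(1)[OF that] g])
  moreover have "(\<lambda>v. \<pi> i (h v)) \<in> module_hom R V M" if "i < q" for i
    by (rule module_hom_compose[OF h io(2)[OF that]])
  ultimately show ?thesis by (auto simp: presented_def)
qed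

text \<open>The second presentation is transported to \<open>V1\<close>, where both systems of
  matrix units act and obey the same relations \<open>p\<close>. Once they are conjugate,
  \<open>presented_descent\<close> in both directions gives the isomorphism. Tensor products and
  direct powers are the two instances.\<close>

theorem presented_cancel:
  fixes V1 :: "('a, 'v) module" and V2 :: "('a, 'w) module"
  assumes LG: "LG_ring R" and fp1: "finite_projective R M1" and M2: "module R M2"
    and V: "module R V1" "module R V2"
    and pr: "presented R q p M1 V1 \<iota> \<pi>" "presented R q p M2 V2 \<iota>' \<pi>'"
    and p: "\<And>i j. i < q \<Longrightarrow> j < q \<Longrightarrow> p i j \<in> carrier R" and s: "\<And>c. s c \<in> carrier R"
    and sp: "(\<Oplus>\<^bsub>R\<^esub>c\<in>{..<q} \<times> {..<q}. s c \<otimes>\<^bsub>R\<^esub> p (fst c) (snd c)) = \<one>\<^bsub>R\<^esub>"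
    and iso: "module_iso R V1 V2"
  shows "module_iso R M1 M2"
proof -
  let ?K = "{..<q} \<times> {..<q}"
  obtain h0 where h0: "h0 \<in> module_hom R V1 V2" "bij_betw h0 (carrier V1) (carrier V2)"
    using iso by (auto simp: module_iso_def)
  define \<iota>2 where "\<iota>2 = (\<lambda>i x. inv_into (carrier V1) h0 (\<iota>' i x))"
  define \<pi>2 where "\<pi>2 = (\<lambda>i v. \<pi>' i (h0 v))"
  have pr2: "presented R q p M2 V1 \<iota>2 \<pi>2"
    unfolding \<iota>2_def \<pi>2_def by (rule presented_transport[OF V h0 pr(2)])
  obtain k n l where "coordinates R V1 k n l" by (rule presented_coordinates[OF fp1 V(1) pr(1)])
  then interpret C: coordinates R V1 k n l .
  have M1: "module R M1" using fp1 by (simp add: finite_projective_def projective_def)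
  have io: "\<iota> i \<in> module_hom R M1 V1" "\<pi> i \<in> module_hom R V1 M1"
    "\<iota>2 i \<in> module_hom R M2 V1" "\<pi>2 i \<in> module_hom R V1 M2" if "i < q" for i
    using pr(1) pr2 that by (auto simp: presented_def)
  define \<sigma> where "\<sigma> = (\<lambda>c v. \<iota> (fst c) (\<pi> (snd c) v))"
  define \<tau> where "\<tau> = (\<lambda>c v. \<iota>2 (fst c) (\<pi>2 (snd c) v))"
  have hom: "\<sigma> c \<in> module_hom R V1 V1" "\<tau> c \<in> module_hom R V1 V1" if "c \<in> ?K" for c
    unfolding \<sigma>_def \<tau>_def using that
    by (auto intro!: module_hom_compose[OF io(2) io(1)] module_hom_compose[OF io(4) io(3)])
  have us: "unit_system q (\<lambda>i j. emb R (p i j)) C.unit_mat (\<lambda>c. C.mat_of (\<sigma> c))"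
      "unit_system q (\<lambda>i j. emb R (p i j)) C.unit_mat (\<lambda>c. C.mat_of (\<tau> c))"
    unfolding \<sigma>_def \<tau>_def
    using C.unit_system_presented[OF M1 pr(1)] C.unit_system_presented[OF M2 pr2] p by auto
  have "(\<Sum>c\<in>?K. emb R (s c) * emb R (p (fst c) (snd c))) = emb R \<one>\<^bsub>R\<^esub>"
    unfolding sp[symmetric] using s p by (subst C.emb_sum) (auto simp: C.emb_hom intro!: sum.cong)
  then have e: "smul (\<Sum>c\<in>?K. emb R (s c) * emb R (p (fst c) (snd c))) C.unit_mat = C.unit_mat"
    using C.smul_one_unit_mat by simp
  have corner: "C.mat_of f \<in> {H. C.unit_mat * H * C.unit_mat = H}" if "f \<in> module_hom R V1 V1" for f
    using C.mat_of_corner[OF that] by simp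
  have "\<exists>h\<in>module_hom R V1 V1. \<exists>g\<in>module_hom R V1 V1. C.mat_of h \<in> {H. C.unit_mat * H * C.unit_mat = H} \<and>
      (\<forall>v\<in>carrier V1. g (h v) = v \<and> h (g v) = v) \<and> (\<forall>c\<in>?K. \<forall>v\<in>carrier V1. \<tau> c (h v) = h (\<sigma> c v))"
    by (rule C.intertwining_automorphism[OF LG C.good_order_unit_mat separating_unit_system[OF us(2,1) e]
        separating_unit_system[OF us e] corner[OF hom(1)] corner[OF hom(2)] hom])
  then obtain h g where h: "h \<in> module_hom R V1 V1" and g: "g \<in> module_hom R V1 V1"
      and gh: "\<And>v. v \<in> carrier V1 \<Longrightarrow> g (h v) = v" and hg: "\<And>v. v \<in> carrier V1 \<Longrightarrow> h (g v) = v"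
      and comm: "\<And>c v. c \<in> ?K \<Longrightarrow> v \<in> carrier V1 \<Longrightarrow> \<tau> c (h v) = h (\<sigma> c v)"
    by blast
  let ?f = "\<lambda>m. \<Oplus>\<^bsub>M2\<^esub>c\<in>?K. s c \<odot>\<^bsub>M2\<^esub> \<pi>2 (fst c) (h (\<iota> (snd c) m))"
  let ?g = "\<lambda>m. \<Oplus>\<^bsub>M1\<^esub>d\<in>?K. s d \<odot>\<^bsub>M1\<^esub> \<pi> (fst d) (g (\<iota>2 (snd d) m))"
  have f: "?f \<in> module_hom R M1 M2"
    using s by (intro module_hom_finsum[OF M2] module_hom_smult[OF M2]
        module_hom_compose[OF module_hom_compose[OF io(1) h] io(4)]) auto
  have g': "?g \<in> module_hom R M2 M1"
    using s by (intro module_hom_finsum[OF M1] module_hom_smult[OF M1]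
        module_hom_compose[OF module_hom_compose[OF io(3) g] io(2)]) auto
  have gf: "?g (?f m) = m" if "m \<in> carrier M1" for m
    by (rule presented_descent[OF M1 M2 V(1) pr(1) pr2 p s sp h g gh _ that])
      (use comm in \<open>auto simp: \<sigma>_def \<tau>_def\<close>)
  have comm': "\<iota> i (\<pi> j (g v)) = g (\<iota>2 i (\<pi>2 j v))" if "i < q" "j < q" and v: "v \<in> carrier V1" for i j v
  proof -
    have gv: "g v \<in> carrier V1" using module_homD(1)[OF g v] .
    have "g (\<iota>2 i (\<pi>2 j (h (g v)))) = g (h (\<iota> i (\<pi> j (g v))))"
      using comm[of "(i, j)" "g v"] that gv by (simp add: \<sigma>_def \<tau>_def)
    moreover have "\<iota> i (\<pi> j (g v)) \<in> carrier V1"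
      using module_homD(1)[OF hom(1)[of "(i, j)"] gv] that by (simp add: \<sigma>_def)
    ultimately show ?thesis using gh hg v by simp
  qed
  have fg: "?f (?g m) = m" if "m \<in> carrier M2" for m
    by (rule presented_descent[OF M2 M1 V(1) pr2 pr(1) p s sp g h hg _ that]) (use comm' in auto)
  have "bij_betw ?f (carrier M1) (carrier M2)"
    by (rule bij_betw_byWitness[where f' = ?g])
      (use gf fg module_homD(1)[OF f] module_homD(1)[OF g'] in auto)
  then show ?thesis using f unfolding module_iso_def by blast
qed

text \<open>The matrix \<open>E = (\<lambda>\<^sub>i(n\<^sub>j))\<close> fixes the row of the \<open>n\<^sub>j\<close>, so \<open>det (1 - E)\<close> annihilates the module,
  while it is \<open>1\<close> modulo the ideal generated by the entries of \<open>E\<close>.\<close>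

lemma (in coordinates) trace_ideal:
  assumes faithful: "faithful R M"
  obtains s where "\<And>c. s c \<in> carrier R"
    "(\<Oplus>c\<in>{..<q} \<times> {..<q}. s c \<otimes> l (fst c) (n (snd c))) = \<one>"
proof -
  let ?K = "{..<q} \<times> {..<q}"
  \<comment> \<open>The preimage under \<open>proj\<close> of the trace ideal of \<open>M\<close>,
    which is generated by the \<open>l i (n j)\<close>.\<close>
  define m where "m = {u. \<exists>s. (\<forall>c. s c \<in> carrier R) \<and> proj R u = (\<Oplus>c\<in>?K. s c \<otimes> l (fst c) (n (snd c)))}"
  have lc: "l (fst c) (n (snd c)) \<in> carrier R" if "c \<in> ?K" for c using that l_closed n_closed by auto
  interpret m: ideal_set m
  proof
    show "0 \<in> m"
      unfolding m_def using lc by (auto intro!: exI[of _ "\<lambda>_. \<zero>"] R.add.finprod_one_eqI[symmetric])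
    fix a b assume "a \<in> m"
    then obtain s where s: "\<And>c. s c \<in> carrier R" "proj R a = (\<Oplus>c\<in>?K. s c \<otimes> l (fst c) (n (snd c)))"
      by (auto simp: m_def)
    have "proj R (r * a) = (\<Oplus>c\<in>?K. proj R r \<otimes> s c \<otimes> l (fst c) (n (snd c)))" for r
    proof -
      have "proj R (r * a) = (\<Oplus>c\<in>?K. proj R r \<otimes> (s c \<otimes> l (fst c) (n (snd c))))"
        using s lc by (simp add: R.finsum_rdistr Pi_iff)
      also have "\<dots> = (\<Oplus>c\<in>?K. proj R r \<otimes> s c \<otimes> l (fst c) (n (snd c)))"
        using s lc by (intro R.finsum_cong') (auto simp: R.m_assoc)
      finally show ?thesis .
    qed
    then show "r * a \<in> m" for r
      unfolding m_def using s(1) by (intro CollectI exI[of _ "\<lambda>c. proj R r \<otimes> s c"]) auto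
    assume "b \<in> m"
    then obtain t where t: "\<And>c. t c \<in> carrier R" "proj R b = (\<Oplus>c\<in>?K. t c \<otimes> l (fst c) (n (snd c)))"
      by (auto simp: m_def)
    have "proj R (a + b) = (\<Oplus>c\<in>?K. s c \<otimes> l (fst c) (n (snd c)) \<oplus> t c \<otimes> l (fst c) (n (snd c)))"
      using s t lc by (simp add: R.finsum_addf Pi_iff)
    also have "\<dots> = (\<Oplus>c\<in>?K. (s c \<oplus> t c) \<otimes> l (fst c) (n (snd c)))"
      using s t lc by (intro R.finsum_cong') (auto simp: R.l_distr)
    finally show "a + b \<in> m"
      unfolding m_def using s(1) t(1) by (intro CollectI exI[of _ "\<lambda>c. s c \<oplus> t c"]) auto
  qed
  have ent: "entry (- unit_mat) i j \<in> m" for i j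
  proof (cases "i < q \<and> j < q")
    case True
    have "(\<Oplus>c\<in>?K. (if c = (i, j) then \<one> else \<zero>) \<otimes> l (fst c) (n (snd c))) =
        (\<Oplus>c\<in>?K. if c = (i, j) then l i (n j) else \<zero>)"
      using lc True n_closed l_closed by (intro R.finsum_cong') auto
    also have "\<dots> = l i (n j)"
      using True n_closed l_closed
      by (subst R.add.finprod_singleton_swap) auto
    finally have "entry unit_mat i j \<in> m"
      unfolding m_def using True n_closed l_closed
      by (intro CollectI exI[of _ "\<lambda>c. if c = (i, j) then \<one> else \<zero>"]) (auto simp: unit_mat_def mat_of_def entry_tab)
    then show ?thesis using m.uminus by simp
  next
    case False
    then have "entry (- unit_mat) i j = 0"
      by (auto simp: unit_mat_def mat_of_def entry_tab)
    then show ?thesis using m.zero by simp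
  qed
  have su: "supp q unit_mat" by (simp add: unit_mat_def supp_mat_of)
  have "supp q (- unit_mat)" using su by (auto simp: supp_def)
  then obtain Y where Y: "supp q Y" "Y + (- unit_mat) * Y = smul (det1 q (- unit_mat)) (one_finmat q)"
    using det1_adjugate by metis
  define d where "d = det1 q (- unit_mat)"
  have ann: "proj R d \<odot>\<^bsub>M\<^esub> n j = \<zero>\<^bsub>M\<^esub>" if j: "j < q" for j
  proof -
    \<comment> \<open>Entry \<open>j\<close> of the row vector of the \<open>n i\<close> times
      \<open>Z\<close>. The row is fixed by \<open>unit_mat\<close>, so multiplying it by (1 -
      \<open>unit_mat\<close>) Y gives zero, while by the adjugate identity the same product is
      \<open>d\<close> times the row.\<close>
    let ?row = "\<lambda>Z :: 'a prodring finmat. \<Oplus>\<^bsub>M\<^esub>i\<in>{..<q}. proj R (entry Z i j) \<odot>\<^bsub>M\<^esub> n i"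
    have "?row (smul d (one_finmat q)) = (\<Oplus>\<^bsub>M\<^esub>i\<in>{..<q}. if i = j then proj R d \<odot>\<^bsub>M\<^esub> n j else \<zero>\<^bsub>M\<^esub>)"
      using j n_closed by (intro M.finsum_cong') (auto simp: one_finmat_def entry_tab)
    also have "\<dots> = proj R d \<odot>\<^bsub>M\<^esub> n j"
      using j n_closed M.add.finprod_singleton_swap[of j "{..<q}" "\<lambda>_. proj R d \<odot>\<^bsub>M\<^esub> n j"] by simp
    finally have 1: "?row (smul d (one_finmat q)) = proj R d \<odot>\<^bsub>M\<^esub> n j" .
    have "?row (unit_mat * Y) =
        (\<Oplus>\<^bsub>M\<^esub>i\<in>{..<q}. \<Oplus>\<^bsub>M\<^esub>k\<in>{..<q}. (l i (n k) \<otimes> proj R (entry Y k j)) \<odot>\<^bsub>M\<^esub> n i)"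
    proof (rule M.finsum_cong')
      fix i assume i: "i \<in> {..<q}"
      have "proj R (entry (unit_mat * Y) i j) = (\<Oplus>k\<in>{..<q}. l i (n k) \<otimes> proj R (entry Y k j))"
        unfolding entry_times[OF su] proj_sum using i n_closed l_closed
        by (intro R.finsum_cong') (auto simp: unit_mat_def mat_of_def entry_tab)
      then show "proj R (entry (unit_mat * Y) i j) \<odot>\<^bsub>M\<^esub> n i =
          (\<Oplus>\<^bsub>M\<^esub>k\<in>{..<q}. (l i (n k) \<otimes> proj R (entry Y k j)) \<odot>\<^bsub>M\<^esub> n i)"
        using i n_closed l_closed by (simp only:) (intro finsum_smult_rdistr[symmetric], auto)
    qed (use n_closed l_closed in \<open>auto intro!: M.finsum_closed\<close>)
    also have "\<dots> = (\<Oplus>\<^bsub>M\<^esub>k\<in>{..<q}. \<Oplus>\<^bsub>M\<^esub>i\<in>{..<q}. (l i (n k) \<otimes> proj R (entry Y k j)) \<odot>\<^bsub>M\<^esub> n i)"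
      using n_closed l_closed by (intro M.finsum_swap) auto
    also have "\<dots> = ?row Y"
    proof (rule M.finsum_cong')
      fix k assume k: "k \<in> {..<q}"
      have "(\<Oplus>\<^bsub>M\<^esub>i\<in>{..<q}. (l i (n k) \<otimes> proj R (entry Y k j)) \<odot>\<^bsub>M\<^esub> n i) =
          (\<Oplus>\<^bsub>M\<^esub>i\<in>{..<q}. proj R (entry Y k j) \<odot>\<^bsub>M\<^esub> (l i (n k) \<odot>\<^bsub>M\<^esub> n i))"
        using k n_closed l_closed by (intro M.finsum_cong') (auto simp: smult_assoc1[symmetric] R.m_comm)
      also have "\<dots> = proj R (entry Y k j) \<odot>\<^bsub>M\<^esub> (\<Oplus>\<^bsub>M\<^esub>i\<in>{..<q}. l i (n k) \<odot>\<^bsub>M\<^esub> n i)"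
        using k n_closed l_closed by (intro finsum_smult_ldistr[symmetric]) auto
      finally show "(\<Oplus>\<^bsub>M\<^esub>i\<in>{..<q}. (l i (n k) \<otimes> proj R (entry Y k j)) \<odot>\<^bsub>M\<^esub> n i) = proj R (entry Y k j) \<odot>\<^bsub>M\<^esub> n k"
        using k n_closed expand by simp
    qed (use n_closed in auto)
    finally have 2: "?row (unit_mat * Y) = ?row Y" .
    have add: "?row (A + B) = ?row A \<oplus>\<^bsub>M\<^esub> ?row B" for A B
    proof -
      have "?row (A + B) = (\<Oplus>\<^bsub>M\<^esub>i\<in>{..<q}. proj R (entry A i j) \<odot>\<^bsub>M\<^esub> n i \<oplus>\<^bsub>M\<^esub> proj R (entry B i j) \<odot>\<^bsub>M\<^esub> n i)"
        using n_closed by (intro M.finsum_cong') (auto simp: smult_l_distr)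
      also have "\<dots> = ?row A \<oplus>\<^bsub>M\<^esub> ?row B" using n_closed by (intro M.finsum_addf) auto
      finally show ?thesis .
    qed
    have "?row (smul d (one_finmat q)) \<oplus>\<^bsub>M\<^esub> ?row (unit_mat * Y) = ?row (smul d (one_finmat q) + unit_mat * Y)"
      by (rule add[symmetric])
    also have "smul d (one_finmat q) + unit_mat * Y = Y" using Y(2) by (simp add: d_def algebra_simps)
    finally show ?thesis
      unfolding 1 2 using n_closed j by (simp add: M.add.r_cancel_one M.finsum_closed Pi_iff)
  qed
  have "proj R d \<odot>\<^bsub>M\<^esub> v = \<zero>\<^bsub>M\<^esub>" if v: "v \<in> carrier M" for v
  proof -
    have "proj R d \<odot>\<^bsub>M\<^esub> v = proj R d \<odot>\<^bsub>M\<^esub> (\<Oplus>\<^bsub>M\<^esub>i\<in>{..<q}. l i v \<odot>\<^bsub>M\<^esub> n i)" using expand[OF v] by simp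
    also have "\<dots> = (\<Oplus>\<^bsub>M\<^esub>i\<in>{..<q}. proj R d \<odot>\<^bsub>M\<^esub> (l i v \<odot>\<^bsub>M\<^esub> n i))"
      using n_closed l_closed v by (intro finsum_smult_ldistr) auto
    also have "\<dots> = (\<Oplus>\<^bsub>M\<^esub>i\<in>{..<q}. l i v \<odot>\<^bsub>M\<^esub> (proj R d \<odot>\<^bsub>M\<^esub> n i))"
      using n_closed l_closed v by (intro M.finsum_cong') (auto simp: smult_assoc1[symmetric] R.m_comm)
    also have "\<dots> = \<zero>\<^bsub>M\<^esub>" using ann l_closed v by (intro M.add.finprod_one_eqI) auto
    finally show ?thesis .
  qed
  then have d0: "proj R d = \<zero>" using faithful by (auto simp: faithful_def)
  have "d - 1 \<in> m" unfolding d_def by (rule m.det1_null[OF ent])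
  then have "- (d - 1) \<in> m" by (rule m.uminus)
  then obtain s where s: "\<And>c. s c \<in> carrier R" "proj R (- (d - 1)) = (\<Oplus>c\<in>?K. s c \<otimes> l (fst c) (n (snd c)))"
    by (auto simp: m_def)
  have "proj R (- (d - 1)) = \<one>" using d0 by (simp add: a_minus_def R.minus_minus)
  then show thesis using that s by metis
qed


section \<open>Direct powers\<close>

lemma direct_power_simps [simp]:
  "carrier (direct_power n M) = {..<n} \<rightarrow>\<^sub>E carrier M" "zero (direct_power n M) = (\<lambda>i\<in>{..<n}. \<zero>\<^bsub>M\<^esub>)"
  "x \<oplus>\<^bsub>direct_power n M\<^esub> y = (\<lambda>i\<in>{..<n}. x i \<oplus>\<^bsub>M\<^esub> y i)" "r \<odot>\<^bsub>direct_power n M\<^esub> x = (\<lambda>i\<in>{..<n}. r \<odot>\<^bsub>M\<^esub> x i)"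
  by (simp_all add: direct_power_def)

lemma direct_power_module:
  assumes "module R M" shows "module R (direct_power n M)"
proof -
  interpret module R M by fact
  have ex: "\<exists>y\<in>{..<n} \<rightarrow>\<^sub>E carrier M. (\<lambda>i\<in>{..<n}. y i \<oplus>\<^bsub>M\<^esub> x i) = (\<lambda>i\<in>{..<n}. \<zero>\<^bsub>M\<^esub>)"
    if "x \<in> {..<n} \<rightarrow>\<^sub>E carrier M" for x
    using that by (intro bexI[of _ "\<lambda>i\<in>{..<n}. \<ominus>\<^bsub>M\<^esub> x i"]) (auto simp: fun_eq_iff PiE_iff M.l_neg)
  have res: "(\<lambda>i\<in>{..<n}. x i) = x" if "x \<in> {..<n} \<rightarrow>\<^sub>E carrier M" for x
    using that by (auto simp: fun_eq_iff PiE_iff extensional_def)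
  show ?thesis
    by (intro moduleI abelian_groupI R.is_cring)
      (use ex res in \<open>auto simp: PiE_iff fun_eq_iff M.a_ac smult_l_distr smult_r_distr smult_assoc1 extensional_def\<close>)
qed

text \<open>The case of ordinary matrix units, with the identity matrix as \<open>p\<close>:
  inclusions and projections of a direct sum.\<close>

lemma direct_power_presented:
  assumes M: "module R M"
  shows "presented R n (\<lambda>i j. if i = j then \<one>\<^bsub>R\<^esub> else \<zero>\<^bsub>R\<^esub>) M (direct_power n M)
    (\<lambda>i m. \<lambda>j\<in>{..<n}. if j = i then m else \<zero>\<^bsub>M\<^esub>) (\<lambda>i x. x i)"
proof -
  interpret module R M by fact
  let ?V = "direct_power n M"
  let ?\<iota> = "\<lambda>i m. \<lambda>j\<in>{..<n}. if j = i then m else \<zero>\<^bsub>M\<^esub>"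
  have V: "module R ?V" by (rule direct_power_module[OF M])
  interpret V: module R ?V by fact
  have \<pi>: "(\<lambda>x. x i) \<in> module_hom R ?V M" if "i < n" for i
    using that by (auto simp: module_hom_def PiE_iff)
  have \<iota>: "?\<iota> i \<in> module_hom R M ?V" for i
    by (rule module_homI) (auto simp: fun_eq_iff)
  have "(\<Oplus>\<^bsub>?V\<^esub>i\<in>{..<n}. ?\<iota> i (v i)) = v" if v: "v \<in> carrier ?V" for v
  proof
    fix j
    have vM: "\<And>i. i < n \<Longrightarrow> v i \<in> carrier M" and vx: "\<And>i. \<not> i < n \<Longrightarrow> v i = undefined"
      using v by (simp_all add: PiE_iff extensional_def)
    have c: "(\<Oplus>\<^bsub>?V\<^esub>i\<in>{..<n}. ?\<iota> i (v i)) \<in> carrier ?V"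
      by (intro V.finsum_closed Pi_I module_homD(1)[OF \<iota>]) (use v in \<open>simp add: PiE_iff\<close>)
    show "(\<Oplus>\<^bsub>?V\<^esub>i\<in>{..<n}. ?\<iota> i (v i)) j = v j"
    proof (cases "j < n")
      case True
      have "(\<Oplus>\<^bsub>?V\<^esub>i\<in>{..<n}. ?\<iota> i (v i)) j = (\<Oplus>\<^bsub>M\<^esub>i\<in>{..<n}. ?\<iota> i (v i) j)"
        by (rule module_hom_sum[OF V M \<pi>[OF True]], rule module_homD(1)[OF \<iota>]) (use v in \<open>simp add: PiE_iff\<close>)
      also have "\<dots> = (\<Oplus>\<^bsub>M\<^esub>i\<in>{..<n}. if j = i then v i else \<zero>\<^bsub>M\<^esub>)"
        using True vM by (intro M.finsum_cong') auto
      also have "\<dots> = v j" using True vM by (subst M.add.finprod_singleton) auto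
      finally show ?thesis .
    next
      case False
      then show ?thesis using c vx by (simp add: PiE_iff extensional_def)
    qed
  qed
  then show ?thesis using \<pi> \<iota> by (auto simp: presented_def)
qed

lemma direct_power_cancel:
  assumes LG: "LG_ring R" and fp: "finite_projective R M1" "finite_projective R M2" and n: "n > 0"
    and iso: "module_iso R (direct_power n M1) (direct_power n M2)"
  shows "module_iso R M1 M2"
proof -
  interpret cring R using LG by (simp add: LG_ring_def)
  have M: "module R M1" "module R M2" using fp by (auto simp: finite_projective_def projective_def)
  let ?p = "\<lambda>i j. if i = j then \<one>\<^bsub>R\<^esub> else \<zero>\<^bsub>R\<^esub>"
  \<comment> \<open>One diagonal unit already has trace 1; position (0, 0) exists because
    \<open>n\<close> is positive.\<close>
  let ?s = "\<lambda>c. if c = (0::nat, 0::nat) then \<one>\<^bsub>R\<^esub> else \<zero>\<^bsub>R\<^esub>"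
  have "(\<Oplus>\<^bsub>R\<^esub>c\<in>{..<n} \<times> {..<n}. ?s c \<otimes>\<^bsub>R\<^esub> ?p (fst c) (snd c)) =
      (\<Oplus>\<^bsub>R\<^esub>c\<in>{..<n} \<times> {..<n}. if (0, 0) = c then \<one>\<^bsub>R\<^esub> else \<zero>\<^bsub>R\<^esub>)"
    by (intro finsum_cong') auto
  also have "\<dots> = \<one>\<^bsub>R\<^esub>" using n add.finprod_singleton[of "(0, 0)" "{..<n} \<times> {..<n}" "\<lambda>_. \<one>\<^bsub>R\<^esub>"] by auto
  finally have sp: "(\<Oplus>\<^bsub>R\<^esub>c\<in>{..<n} \<times> {..<n}. ?s c \<otimes>\<^bsub>R\<^esub> ?p (fst c) (snd c)) = \<one>\<^bsub>R\<^esub>" .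
  show ?thesis
    by (rule presented_cancel[OF LG fp(1) M(2) direct_power_module[OF M(1)] direct_power_module[OF M(2)]
        direct_power_presented[OF M(1)] direct_power_presented[OF M(2)] _ _ sp iso]) auto
qed

section \<open>Quotient modules\<close>

locale quotient_of_module = module R F for R (structure) and F :: "('a, 'f) module" (structure) +
  fixes K :: "'f set"
  assumes K: "submodule K R F"
begin

definition cls :: "'f \<Rightarrow> 'f set" where "cls x = K +>\<^bsub>F\<^esub> x"

lemmas KE = submoduleE[OF K]

lemma K_zero: "\<zero>\<^bsub>F\<^esub> \<in> K"
  using subgroup.one_closed[OF submodule.axioms(1)[OF K]] by simp

lemma abelian_subgroup_K: "abelian_subgroup K F"
  by (rule abelian_subgroupI3[OF additive_subgroupI[OF submodule.axioms(1)[OF K]] M.abelian_group_axioms])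

lemma mem_cls: "z \<in> cls x \<longleftrightarrow> (\<exists>k\<in>K. z = k \<oplus>\<^bsub>F\<^esub> x)"
  by (auto simp: cls_def a_r_coset_def')

lemma cls_self: "x \<in> carrier F \<Longrightarrow> x \<in> cls x"
  using K_zero by (auto simp: mem_cls intro!: bexI[of _ "\<zero>\<^bsub>F\<^esub>"])

lemma cls_eq: "x \<in> carrier F \<Longrightarrow> k \<in> K \<Longrightarrow> cls (k \<oplus>\<^bsub>F\<^esub> x) = cls x"
  using M.a_repr_independence[of "k \<oplus>\<^bsub>F\<^esub> x" K x] submodule.axioms(1)[OF K]
  by (metis cls_def mem_cls)

lemma cls_eq_iff: "x \<in> carrier F \<Longrightarrow> y \<in> carrier F \<Longrightarrow> cls x = cls y \<longleftrightarrow> x \<ominus>\<^bsub>F\<^esub> y \<in> K"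
proof
  assume x: "x \<in> carrier F" and y: "y \<in> carrier F" and eq: "cls x = cls y"
  then obtain k where k: "k \<in> K" "x = k \<oplus>\<^bsub>F\<^esub> y" using cls_self[OF x] by (auto simp: mem_cls)
  then show "x \<ominus>\<^bsub>F\<^esub> y \<in> K"
    using y KE(1) by (metis M.add.inv_solve_right M.minus_eq subsetD x)
next
  assume x: "x \<in> carrier F" and y: "y \<in> carrier F" and k: "x \<ominus>\<^bsub>F\<^esub> y \<in> K"
  have "x = (x \<ominus>\<^bsub>F\<^esub> y) \<oplus>\<^bsub>F\<^esub> y" using x y by (simp add: M.minus_eq M.a_assoc M.l_neg)
  then show "cls x = cls y" using cls_eq[OF y k] by simp
qed

lemma carrier_quotient: "carrier (quotient_module F K) = cls ` carrier F"
  by (auto simp: quotient_module_def FactRing_def A_RCOSETS_def' cls_def)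

lemma zero_quotient: "\<zero>\<^bsub>quotient_module F K\<^esub> = cls \<zero>\<^bsub>F\<^esub>"
  using KE(1) M.a_coset_add_zero[of K] by (simp add: quotient_module_def FactRing_def cls_def)

lemma add_quotient: "x \<in> carrier F \<Longrightarrow> y \<in> carrier F \<Longrightarrow> cls x \<oplus>\<^bsub>quotient_module F K\<^esub> cls y = cls (x \<oplus>\<^bsub>F\<^esub> y)"
  using abelian_subgroup.a_rcos_sum[OF abelian_subgroup_K]
  by (simp add: quotient_module_def FactRing_def cls_def)

text \<open>The definition takes a union of cosets over all representatives \<open>z\<close>;
  closure of \<open>K\<close> under scalars makes all these cosets equal.\<close>

lemma smult_quotient: "r \<in> carrier R \<Longrightarrow> x \<in> carrier F \<Longrightarrow> r \<odot>\<^bsub>quotient_module F K\<^esub> cls x = cls (r \<odot>\<^bsub>F\<^esub> x)"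
proof -
  assume r: "r \<in> carrier R" and x: "x \<in> carrier F"
  have "cls (r \<odot>\<^bsub>F\<^esub> z) = cls (r \<odot>\<^bsub>F\<^esub> x)" if z: "z \<in> cls x" for z
  proof -
    obtain k where k: "k \<in> K" "z = k \<oplus>\<^bsub>F\<^esub> x" using z by (auto simp: mem_cls)
    then have "k \<in> carrier F" using KE(1) by auto
    then show ?thesis using k r x KE(4) by (simp add: smult_r_distr cls_eq)
  qed
  moreover have "r \<odot>\<^bsub>quotient_module F K\<^esub> cls x = (\<Union>z\<in>cls x. cls (r \<odot>\<^bsub>F\<^esub> z))"
    by (simp add: quotient_module_def cls_def)
  ultimately show ?thesis using cls_self[OF x] by blast
qed

lemma quotient_is_module: "module R (quotient_module F K)"
proof (intro moduleI abelian_groupI R.is_cring)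
  fix x assume "x \<in> carrier (quotient_module F K)"
  then obtain a where a: "a \<in> carrier F" "x = cls a" by (auto simp: carrier_quotient)
  have "cls (\<ominus>\<^bsub>F\<^esub> a) \<oplus>\<^bsub>quotient_module F K\<^esub> x = \<zero>\<^bsub>quotient_module F K\<^esub>"
    using a by (simp add: add_quotient zero_quotient M.l_neg)
  then show "\<exists>y\<in>carrier (quotient_module F K). y \<oplus>\<^bsub>quotient_module F K\<^esub> x = \<zero>\<^bsub>quotient_module F K\<^esub>"
    using a by (auto simp: carrier_quotient)
qed (auto simp: carrier_quotient zero_quotient add_quotient smult_quotient M.a_ac smult_l_distr smult_r_distr
    smult_assoc1)

lemma cls_hom: "cls \<in> module_hom R F (quotient_module F K)"
  by (rule module_homI) (auto simp: carrier_quotient add_quotient smult_quotient)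

lemma cls_zero_iff: "x \<in> carrier F \<Longrightarrow> cls x = \<zero>\<^bsub>quotient_module F K\<^esub> \<longleftrightarrow> x \<in> K"
proof -
  assume x: "x \<in> carrier F"
  have z: "\<ominus>\<^bsub>F\<^esub> \<zero>\<^bsub>F\<^esub> = \<zero>\<^bsub>F\<^esub>" by (rule M.minus_equality) auto
  have "x \<ominus>\<^bsub>F\<^esub> \<zero>\<^bsub>F\<^esub> = x" unfolding M.minus_eq z using x by (rule M.r_zero)
  then show ?thesis using cls_eq_iff[OF x M.zero_closed] by (simp only: zero_quotient)
qed

lemma quotient_lift:
  assumes V: "module R V" and f: "f \<in> module_hom R F V" and fK: "\<And>k. k \<in> K \<Longrightarrow> f k = \<zero>\<^bsub>V\<^esub>"
  obtains g where "g \<in> module_hom R (quotient_module F K) V" "\<And>x. x \<in> carrier F \<Longrightarrow> g (cls x) = f x"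
proof -
  interpret V: module R V by fact
  define g where "g = (\<lambda>Z. f (SOME x. x \<in> carrier F \<and> Z = cls x))"
  have g: "g (cls x) = f x" if x: "x \<in> carrier F" for x
  proof -
    define y where "y = (SOME y. y \<in> carrier F \<and> cls x = cls y)"
    have y: "y \<in> carrier F \<and> cls x = cls y" unfolding y_def by (rule someI[of _ x]) (use x in simp)
    then have "y \<in> cls x" using cls_self by metis
    then obtain k where k: "k \<in> K" "y = k \<oplus>\<^bsub>F\<^esub> x" by (auto simp: mem_cls)
    then have "k \<in> carrier F" using KE(1) by auto
    then have "f y = f x" using k x fK module_homD(1,2)[OF f] by simp
    then show ?thesis by (simp add: g_def y_def)
  qed
  have "g \<in> module_hom R (quotient_module F K) V"
    by (rule module_homI) (auto simp: carrier_quotient add_quotient smult_quotient g module_homD[OF f])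
  then show ?thesis using that g by blast
qed

end

lemma submodule_submodule_span:
  assumes "module R M" "S \<subseteq> carrier M"
  shows "submodule (submodule_span R M S) R M" "S \<subseteq> submodule_span R M S"
proof -
  interpret module R M by fact
  have sub: "H \<subseteq> carrier M \<and> \<zero>\<^bsub>M\<^esub> \<in> H" if "submodule H R M" for H
    using submoduleE(1)[OF that] subgroup.one_closed[OF submodule.axioms(1)[OF that]] by simp
  show "submodule (submodule_span R M S) R M"
    unfolding submodule_span_def
  proof (rule submoduleI)
    show "\<Inter> {K. submodule K R M \<and> S \<subseteq> K} \<subseteq> carrier M" using carrier_is_submodule assms(2) by blast
    show "\<zero>\<^bsub>M\<^esub> \<in> \<Inter> {K. submodule K R M \<and> S \<subseteq> K}" using sub by blast
    show "\<ominus>\<^bsub>M\<^esub> a \<in> \<Inter> {K. submodule K R M \<and> S \<subseteq> K}" if "a \<in> \<Inter> {K. submodule K R M \<and> S \<subseteq> K}" for a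
      using that submoduleE(3) by simp
    show "a \<oplus>\<^bsub>M\<^esub> b \<in> \<Inter> {K. submodule K R M \<and> S \<subseteq> K}"
      if "a \<in> \<Inter> {K. submodule K R M \<and> S \<subseteq> K}" "b \<in> \<Inter> {K. submodule K R M \<and> S \<subseteq> K}" for a b
      using that submoduleE(5) by simp
    show "r \<odot>\<^bsub>M\<^esub> a \<in> \<Inter> {K. submodule K R M \<and> S \<subseteq> K}"
      if "r \<in> carrier R" "a \<in> \<Inter> {K. submodule K R M \<and> S \<subseteq> K}" for r a
      using that submoduleE(4) by simp
  qed
  show "S \<subseteq> submodule_span R M S" by (auto simp: submodule_span_def)
qed

lemma submodule_kernel:
  assumes M: "module R M" and N: "module R N" and h: "h \<in> module_hom R M N"
  shows "submodule {x \<in> carrier M. h x = \<zero>\<^bsub>N\<^esub>} R M"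
proof -
  interpret M: module R M by fact
  interpret N: module R N by fact
  have neg: "h (\<ominus>\<^bsub>M\<^esub> x) = \<ominus>\<^bsub>N\<^esub> h x" if x: "x \<in> carrier M" for x
  proof -
    have "h (\<ominus>\<^bsub>M\<^esub> x) \<oplus>\<^bsub>N\<^esub> h x = \<zero>\<^bsub>N\<^esub>"
      using x module_homD(2)[OF h, of "\<ominus>\<^bsub>M\<^esub> x" x] module_hom_zero[OF M N h] by (simp add: M.M.l_neg)
    then show ?thesis using x module_homD(1)[OF h] by (simp add: N.M.minus_equality)
  qed
  show ?thesis
    by (rule M.submoduleI) (auto simp: module_hom_zero[OF M N h] neg module_homD[OF h])
qed


section \<open>Tensor products of modules\<close>

lemma single_closed:
  assumes "cring R" "u \<in> carrier G" shows "single R u \<in> carrier (monoid_algebra R G)"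
proof -
  interpret cring R by fact
  show ?thesis using assms(2) finite_subset[of "{v. single R u v \<noteq> \<zero>\<^bsub>R\<^esub>}" "{u}"]
    by (auto simp: monoid_algebra_def single_def)
qed

definition bilinear_map ::
    "('a, 'r) ring_scheme \<Rightarrow> ('a, 'm) module \<Rightarrow> ('a, 'n) module \<Rightarrow> ('a, 'x) module \<Rightarrow> ('m \<Rightarrow> 'n \<Rightarrow> 'x) \<Rightarrow> bool" where
  "bilinear_map R M N V b \<longleftrightarrow> (\<forall>y\<in>carrier N. (\<lambda>x. b x y) \<in> module_hom R M V) \<and>
     (\<forall>x\<in>carrier M. b x \<in> module_hom R N V)"

lemma bilinear_mapD:
  assumes "bilinear_map R M N V b"
  shows "y \<in> carrier N \<Longrightarrow> (\<lambda>x. b x y) \<in> module_hom R M V" "x \<in> carrier M \<Longrightarrow> b x \<in> module_hom R N V"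
    "x \<in> carrier M \<Longrightarrow> y \<in> carrier N \<Longrightarrow> b x y \<in> carrier V"
proof -
  show 1: "y \<in> carrier N \<Longrightarrow> (\<lambda>x. b x y) \<in> module_hom R M V" "x \<in> carrier M \<Longrightarrow> b x \<in> module_hom R N V"
    using assms by (auto simp: bilinear_map_def)
  show "x \<in> carrier M \<Longrightarrow> y \<in> carrier N \<Longrightarrow> b x y \<in> carrier V" using module_homD(1)[OF 1(2)] by blast
qed

locale tensor_modules = M: module R M + N: module R N
  for R :: "('a, 'r) ring_scheme" (structure) and M :: "('a, 'm) module" and N :: "('a, 'n) module"
begin

abbreviation "F \<equiv> tensor_free R M N"
abbreviation "T \<equiv> tensor R M N"
abbreviation "e x y \<equiv> single R (x, y)"
abbreviation "pure \<equiv> pure_tensor R M N"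

lemma mods: "module R M" "module R N" "cring R" by unfold_locales

lemma F_module: "module R F" by (rule monoid_algebra_module[OF mods(3)])

sublocale F: module R F by (rule F_module)

lemma e_closed: "x \<in> carrier M \<Longrightarrow> y \<in> carrier N \<Longrightarrow> e x y \<in> carrier F"
  by (rule single_closed[OF mods(3)]) simp

lemma relators_closed: "tensor_relators R M N \<subseteq> carrier F"
  unfolding tensor_relators_def Let_def
  by (auto intro!: F.M.minus_closed F.M.a_closed F.smult_closed e_closed)

lemma kernel_submodule: "submodule (tensor_kernel R M N) R F"
  unfolding tensor_kernel_def by (rule submodule_submodule_span(1)[OF F_module relators_closed])

sublocale Q: quotient_of_module R F "tensor_kernel R M N"
  by (intro quotient_of_module.intro F_module quotient_of_module_axioms.intro kernel_submodule)

lemma T_alt: "T = quotient_module F (tensor_kernel R M N)" by (simp add: tensor_def)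

lemma T_module: "module R T" unfolding T_alt by (rule Q.quotient_is_module)

sublocale T: module R T by (rule T_module)

lemma pure_alt: "pure x y = Q.cls (e x y)" by (simp add: pure_tensor_def Q.cls_def)

lemma cls_hom: "Q.cls \<in> module_hom R F T" unfolding T_alt by (rule Q.cls_hom)

lemma pure_closed: "x \<in> carrier M \<Longrightarrow> y \<in> carrier N \<Longrightarrow> pure x y \<in> carrier T"
  unfolding pure_alt by (rule module_homD(1)[OF cls_hom e_closed])

lemma relator_zero: "k \<in> tensor_relators R M N \<Longrightarrow> Q.cls k = \<zero>\<^bsub>T\<^esub>"
  using Q.cls_zero_iff submodule_submodule_span(2)[OF F_module relators_closed] relators_closed
  by (auto simp: T_alt tensor_kernel_def)

lemma cls_diff: "a \<in> carrier F \<Longrightarrow> b \<in> carrier F \<Longrightarrow> Q.cls (a \<ominus>\<^bsub>F\<^esub> b) = \<zero>\<^bsub>T\<^esub> \<Longrightarrow> Q.cls a = Q.cls b"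
  using Q.cls_zero_iff[of "a \<ominus>\<^bsub>F\<^esub> b"] Q.cls_eq_iff by (simp add: T_alt)

lemma relator_cls:
  "a \<in> carrier F \<Longrightarrow> b \<in> carrier F \<Longrightarrow> a \<ominus>\<^bsub>F\<^esub> b \<in> tensor_relators R M N \<Longrightarrow> Q.cls a = Q.cls b"
  by (rule cls_diff[OF _ _ relator_zero])

lemma pure_bilinear: "bilinear_map R M N T pure"
  unfolding bilinear_map_def
proof (intro conjI ballI module_homI pure_closed; assumption?)
  fix y x x' assume "y \<in> carrier N" "x \<in> carrier M" "x' \<in> carrier M"
  then show "pure (x \<oplus>\<^bsub>M\<^esub> x') y = pure x y \<oplus>\<^bsub>T\<^esub> pure x' y"
    unfolding pure_alt using e_closed
    by (subst module_homD(2)[OF cls_hom, symmetric], simp, simp, intro relator_cls)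
      (auto intro!: e_closed, unfold tensor_relators_def Let_def, blast)
next
  fix y x r assume "y \<in> carrier N" "x \<in> carrier M" "r \<in> carrier R"
  then show "pure (r \<odot>\<^bsub>M\<^esub> x) y = r \<odot>\<^bsub>T\<^esub> pure x y"
    unfolding pure_alt using e_closed
    by (subst module_homD(3)[OF cls_hom, symmetric], simp, simp, intro relator_cls)
      (auto intro!: e_closed, unfold tensor_relators_def Let_def, blast)
next
  fix x y y' assume "x \<in> carrier M" "y \<in> carrier N" "y' \<in> carrier N"
  then show "pure x (y \<oplus>\<^bsub>N\<^esub> y') = pure x y \<oplus>\<^bsub>T\<^esub> pure x y'"
    unfolding pure_alt using e_closed
    by (subst module_homD(2)[OF cls_hom, symmetric], simp, simp, intro relator_cls)
      (auto intro!: e_closed, unfold tensor_relators_def Let_def, blast)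
next
  fix x y r assume "x \<in> carrier M" "y \<in> carrier N" "r \<in> carrier R"
  then show "pure x (r \<odot>\<^bsub>N\<^esub> y) = r \<odot>\<^bsub>T\<^esub> pure x y"
    unfolding pure_alt using e_closed
    by (subst module_homD(3)[OF cls_hom, symmetric], simp, simp, intro relator_cls)
      (auto intro!: e_closed, unfold tensor_relators_def Let_def, blast)
qed

lemmas pure_homs = bilinear_mapD[OF pure_bilinear]

text \<open>The kernel of \<open>h\<close> is a submodule, and bilinearity puts the relators into
  it; the tensor kernel is the smallest such submodule. Stating this for a map \<open>h\<close> on
  the free module rather than for a lifted bilinear map lets it serve again for products in
  \<open>kernel_ideal\<close>.\<close>

lemma vanish_on_kernel:
  assumes V: "module R V" and h: "h \<in> module_hom R F V" and b: "bilinear_map R M N V (\<lambda>x y. h (e x y))"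
    and k: "k \<in> tensor_kernel R M N"
  shows "h k = \<zero>\<^bsub>V\<^esub>"
proof -
  interpret V: module R V by fact
  have ker: "submodule {x \<in> carrier F. h x = \<zero>\<^bsub>V\<^esub>} R F" by (rule submodule_kernel[OF F_module V h])
  have diff: "a \<ominus>\<^bsub>F\<^esub> b \<in> {x \<in> carrier F. h x = \<zero>\<^bsub>V\<^esub>}" if "a \<in> carrier F" "b \<in> carrier F" "h a = h b" for a b
  proof -
    have "h a = h ((a \<ominus>\<^bsub>F\<^esub> b) \<oplus>\<^bsub>F\<^esub> b)" using that by (simp add: F.M.minus_eq F.M.a_assoc F.M.l_neg)
    also have "\<dots> = h (a \<ominus>\<^bsub>F\<^esub> b) \<oplus>\<^bsub>V\<^esub> h b" using that by (intro module_homD(2)[OF h]) auto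
    finally have "h (a \<ominus>\<^bsub>F\<^esub> b) \<oplus>\<^bsub>V\<^esub> h b = \<zero>\<^bsub>V\<^esub> \<oplus>\<^bsub>V\<^esub> h b" using that module_homD(1)[OF h] by simp
    then show ?thesis using that module_homD(1)[OF h]
      by (metis (mono_tags, lifting) F.M.minus_closed V.M.add.r_cancel V.M.zero_closed mem_Collect_eq)
  qed
  note hb = module_homD(2,3)[OF bilinear_mapD(1)[OF b]] module_homD(2,3)[OF bilinear_mapD(2)[OF b]]
  have "tensor_relators R M N \<subseteq> {x \<in> carrier F. h x = \<zero>\<^bsub>V\<^esub>}"
    unfolding tensor_relators_def Let_def
    by (rule subsetI, elim UnE CollectE exE conjE; hypsubst; rule diff)
      (auto simp: e_closed module_homD[OF h] hb)
  then have "tensor_kernel R M N \<subseteq> {x \<in> carrier F. h x = \<zero>\<^bsub>V\<^esub>}"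
    unfolding tensor_kernel_def submodule_span_def using ker by blast
  then show ?thesis using k by blast
qed

lemma tensor_lift:
  assumes V: "module R V" and b: "bilinear_map R M N V b"
  obtains g where "g \<in> module_hom R T V" "\<And>x y. x \<in> carrier M \<Longrightarrow> y \<in> carrier N \<Longrightarrow> g (pure x y) = b x y"
proof -
  define f where "f = linear_extension R V (\<lambda>u. b (fst u) (snd u))"
  have f: "f \<in> module_hom R F V" "\<And>x y. x \<in> carrier M \<Longrightarrow> y \<in> carrier N \<Longrightarrow> f (e x y) = b x y"
  proof -
    have c: "(\<lambda>u. b (fst u) (snd u)) \<in> carrier (M \<times>\<times> N) \<rightarrow> carrier V" using bilinear_mapD(3)[OF b] by auto
    show "f \<in> module_hom R F V" unfolding f_def by (rule linear_extension(1)[OF V c])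
    show "f (e x y) = b x y" if "x \<in> carrier M" "y \<in> carrier N" for x y
      unfolding f_def using linear_extension(2)[OF V c, of "(x, y)"] that by simp
  qed
  have "bilinear_map R M N V (\<lambda>x y. f (e x y))"
    using b f(2) by (auto simp: bilinear_map_def module_hom_def Pi_iff)
  then obtain g where "g \<in> module_hom R (quotient_module F (tensor_kernel R M N)) V"
      "\<And>x. x \<in> carrier F \<Longrightarrow> g (Q.cls x) = f x"
    using Q.quotient_lift[OF V f(1) vanish_on_kernel[OF V f(1)]] by blast
  then show ?thesis using that f(2) e_closed by (auto simp: T_alt pure_alt)
qed

text \<open>Induction on the support of a representative. The coefficient of a generator is absorbed
  into the left factor, so the step involves pure tensors without scalars.\<close>

lemma tensor_induct [consumes 1, case_names zero add]:
  assumes Z: "Z \<in> carrier T" and P0: "P \<zero>\<^bsub>T\<^esub>"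
    and step: "\<And>Z x y. Z \<in> carrier T \<Longrightarrow> P Z \<Longrightarrow> x \<in> carrier M \<Longrightarrow> y \<in> carrier N \<Longrightarrow> P (Z \<oplus>\<^bsub>T\<^esub> pure x y)"
  shows "P Z"
proof -
  have "finite S \<Longrightarrow> (\<forall>f\<in>carrier F. {u. f u \<noteq> \<zero>} = S \<longrightarrow> P (Q.cls f))" for S
  proof (induction S rule: finite_induct)
    case empty
    have "f = \<zero>\<^bsub>F\<^esub>" if "{u. f u \<noteq> \<zero>} = {}" for f :: "'m \<times> 'n \<Rightarrow> 'a"
      using that by (auto simp: monoid_algebra_def fun_eq_iff)
    then show ?case using P0 Q.zero_quotient by (metis T_alt)
  next
    case (insert u S)
    show ?case
    proof (intro ballI impI)
      fix f assume f: "f \<in> carrier F" and S: "{u. f u \<noteq> \<zero>} = insert u S"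
      let ?g = "f(u := \<zero>)"
      have supp: "{v. ?g v \<noteq> \<zero>} = S" using S insert.hyps by (auto simp: set_eq_iff)
      have g: "?g \<in> carrier F"
      proof -
        have "\<forall>v. ?g v \<in> carrier R" "S \<subseteq> carrier (M \<times>\<times> N)" using f S by (auto simp: monoid_algebra_def)
        then show ?thesis using supp insert.hyps(1) by (simp add: monoid_algebra_def)
      qed
      obtain x y where u: "u = (x, y)" by (cases u)
      have xy: "x \<in> carrier M" "y \<in> carrier N" "f u \<in> carrier R" using f S u by (auto simp: monoid_algebra_def)
      have "f = ?g \<oplus>\<^bsub>F\<^esub> f u \<odot>\<^bsub>F\<^esub> e x y"
        using f u by (auto simp: monoid_algebra_def single_def fun_eq_iff)
      then have "Q.cls f = Q.cls (?g \<oplus>\<^bsub>F\<^esub> f u \<odot>\<^bsub>F\<^esub> e x y)" by (rule arg_cong)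
      also have "\<dots> = Q.cls ?g \<oplus>\<^bsub>T\<^esub> f u \<odot>\<^bsub>T\<^esub> pure x y"
        using g xy e_closed by (simp add: module_homD[OF cls_hom] pure_alt)
      also have "f u \<odot>\<^bsub>T\<^esub> pure x y = pure (f u \<odot>\<^bsub>M\<^esub> x) y"
        using module_homD(3)[OF pure_homs(1)] xy by simp
      finally have eq: "Q.cls f = Q.cls ?g \<oplus>\<^bsub>T\<^esub> pure (f u \<odot>\<^bsub>M\<^esub> x) y" .
      show "P (Q.cls f)"
        unfolding eq using g supp insert.IH xy module_homD(1)[OF cls_hom] by (intro step) auto
    qed
  qed
  moreover obtain f where "f \<in> carrier F" "Z = Q.cls f" using Z by (auto simp: T_alt Q.carrier_quotient)
  ultimately show ?thesis by (auto simp: monoid_algebra_def)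
qed

lemma tensor_hom_eq:
  assumes V: "module R V" and g: "g \<in> module_hom R T V" and h: "h \<in> module_hom R T V"
    and eq: "\<And>x y. x \<in> carrier M \<Longrightarrow> y \<in> carrier N \<Longrightarrow> g (pure x y) = h (pure x y)" and Z: "Z \<in> carrier T"
  shows "g Z = h Z"
  using Z
proof (induction rule: tensor_induct)
  case zero
  show ?case unfolding module_hom_zero[OF T_module V g] module_hom_zero[OF T_module V h] by (rule refl)
next
  case (add Z x y)
  then show ?case using eq pure_closed by (simp add: module_homD(2)[OF g] module_homD(2)[OF h])
qed

lemma tensor_as_sum:
  assumes "Z \<in> carrier T"
  shows "\<exists>p x y. (\<forall>i<(p::nat). x i \<in> carrier M \<and> y i \<in> carrier N) \<and> Z = (\<Oplus>\<^bsub>T\<^esub>i\<in>{..<p}. pure (x i) (y i))"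
  using assms
proof (induction rule: tensor_induct)
  case zero
  show ?case by (intro exI[of _ 0]) simp
next
  case (add Z a b)
  then obtain p :: nat and x y where xy: "\<And>i. i < p \<Longrightarrow> x i \<in> carrier M \<and> y i \<in> carrier N"
      and Z: "Z = (\<Oplus>\<^bsub>T\<^esub>i\<in>{..<p}. pure (x i) (y i))" by blast
  have "(\<Oplus>\<^bsub>T\<^esub>i\<in>{..<p}. pure ((x(p := a)) i) ((y(p := b)) i)) = Z"
    unfolding Z using xy pure_closed by (intro T.M.finsum_cong') auto
  then have "(\<Oplus>\<^bsub>T\<^esub>i\<in>{..<Suc p}. pure ((x(p := a)) i) ((y(p := b)) i)) = pure a b \<oplus>\<^bsub>T\<^esub> Z"
    using xy pure_closed add by (simp add: lessThan_Suc Pi_iff)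
  also have "\<dots> = Z \<oplus>\<^bsub>T\<^esub> pure a b" using add pure_closed by (intro T.M.a_comm) auto
  finally show ?case using xy add
    by (intro exI[of _ "Suc p"] exI[of _ "x(p := a)"] exI[of _ "y(p := b)"]) (auto simp: less_Suc_eq)
qed

end

lemma tensor_presented:
  assumes M: "module R M" and N: "coordinates R N q n l"
  shows "\<exists>\<pi>. presented R q (\<lambda>i j. l i (n j)) M (tensor R M N) (\<lambda>i m. pure_tensor R M N m (n i)) \<pi>"
proof -
  interpret N: coordinates R N q n l by fact
  interpret M: module R M by fact
  interpret T: tensor_modules R M N by unfold_locales
  have "\<exists>g. g \<in> module_hom R T.T M \<and> (\<forall>m\<in>carrier M. \<forall>x\<in>carrier N. g (T.pure m x) = l i x \<odot>\<^bsub>M\<^esub> m)" if i: "i < q" for i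
  proof -
    have "bilinear_map R M N M (\<lambda>m x. l i x \<odot>\<^bsub>M\<^esub> m)"
      unfolding bilinear_map_def using N.l_closed[OF i] module_homD(2,3)[OF N.l_hom[OF i]]
      by (intro conjI ballI module_homI)
        (simp_all add: M.smult_r_distr M.smult_l_distr M.smult_assoc1[symmetric] N.R.m_comm)
    from T.tensor_lift[OF M this] show ?thesis by metis
  qed
  then obtain \<pi> where \<pi>: "\<And>i. i < q \<Longrightarrow> \<pi> i \<in> module_hom R T.T M"
    "\<And>i m x. i < q \<Longrightarrow> m \<in> carrier M \<Longrightarrow> x \<in> carrier N \<Longrightarrow> \<pi> i (T.pure m x) = l i x \<odot>\<^bsub>M\<^esub> m"
    by metis
  have \<iota>: "(\<lambda>m. T.pure m (n i)) \<in> module_hom R M T.T" if "i < q" for i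
    by (rule T.pure_homs(1)[OF N.n_closed[OF that]])
  have "(\<Oplus>\<^bsub>T.T\<^esub>i\<in>{..<q}. T.pure (\<pi> i Z) (n i)) = Z" if Z: "Z \<in> carrier T.T" for Z
  proof (rule T.tensor_hom_eq[OF T.T_module _ module_hom_id _ Z])
    show "(\<lambda>Z. \<Oplus>\<^bsub>T.T\<^esub>i\<in>{..<q}. T.pure (\<pi> i Z) (n i)) \<in> module_hom R T.T T.T"
      by (rule module_hom_finsum[OF T.T_module], rule module_hom_compose[OF \<pi>(1) \<iota>]) auto
    fix m x assume m: "m \<in> carrier M" and x: "x \<in> carrier N"
    have "(\<Oplus>\<^bsub>T.T\<^esub>i\<in>{..<q}. T.pure (\<pi> i (T.pure m x)) (n i)) = (\<Oplus>\<^bsub>T.T\<^esub>i\<in>{..<q}. l i x \<odot>\<^bsub>T.T\<^esub> T.pure m (n i))"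
      using m x N.l_closed N.n_closed T.pure_closed \<pi>(2) module_homD(3)[OF T.pure_homs(1)]
      by (intro T.T.M.finsum_cong') auto
    also have "\<dots> = T.pure m (\<Oplus>\<^bsub>N\<^esub>i\<in>{..<q}. l i x \<odot>\<^bsub>N\<^esub> n i)"
      using m x N.l_closed N.n_closed
      by (intro module_hom_lincomb[OF N.mod T.T_module T.pure_homs(2), symmetric]) auto
    finally show "(\<Oplus>\<^bsub>T.T\<^esub>i\<in>{..<q}. T.pure (\<pi> i (T.pure m x)) (n i)) = T.pure m x"
      using N.expand[OF x] by simp
  qed
  then show ?thesis using \<pi> \<iota> N.n_closed by (intro exI[of _ \<pi>]) (auto simp: presented_def)
qed

text \<open>Faithfulness of \<open>N\<close> enters through \<open>trace_ideal\<close>, which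
  supplies the weights \<open>s\<close> needed both for averaging and for the descent to
  \<open>M1\<close> and \<open>M2\<close>.\<close>

lemma tensor_cancel:
  assumes LG: "LG_ring R" and fp: "finite_projective R M1" "finite_projective R M2"
    and N: "faithfully_projective R N" and iso: "module_iso R (tensor R M1 N) (tensor R M2 N)"
  shows "module_iso R M1 M2"
proof -
  have fpN: "finite_projective R N" "faithful R N" using N by (auto simp: faithfully_projective_def)
  obtain q n l where C: "coordinates R N q n l" using module_coordinates[OF fpN(1)] .
  interpret N: coordinates R N q n l by (rule C)
  have M: "module R M1" "module R M2" using fp by (auto simp: finite_projective_def projective_def)
  interpret M1: module R M1 by (rule M)
  interpret M2: module R M2 by (rule M)
  interpret T1: tensor_modules R M1 N by unfold_locales
  interpret T2: tensor_modules R M2 N by unfold_locales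
  obtain s where s: "\<And>c. s c \<in> carrier R"
      "(\<Oplus>\<^bsub>R\<^esub>c\<in>{..<q} \<times> {..<q}. s c \<otimes>\<^bsub>R\<^esub> l (fst c) (n (snd c))) = \<one>\<^bsub>R\<^esub>"
    using N.trace_ideal[OF fpN(2)] by blast
  obtain \<pi>1 \<pi>2 where
    "presented R q (\<lambda>i j. l i (n j)) M1 (tensor R M1 N) (\<lambda>i m. pure_tensor R M1 N m (n i)) \<pi>1"
    "presented R q (\<lambda>i j. l i (n j)) M2 (tensor R M2 N) (\<lambda>i m. pure_tensor R M2 N m (n i)) \<pi>2"
    using tensor_presented[OF M(1) C] tensor_presented[OF M(2) C] by blast
  from presented_cancel[OF LG fp(1) M(2) T1.T_module T2.T_module this _ s iso] show ?thesis
    using N.l_closed N.n_closed by blast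
qed


section \<open>The convolution product\<close>

lemma module_hom_cong:
  assumes "module R M" "h \<in> module_hom R M N" "\<And>x. x \<in> carrier M \<Longrightarrow> h x = g x"
  shows "g \<in> module_hom R M N"
proof -
  interpret module R M by fact
  show ?thesis
  proof (rule module_homI)
    show "g x \<in> carrier N" if "x \<in> carrier M" for x
      using module_homD(1)[OF assms(2) that] assms(3)[OF that] by simp
    show "g (x \<oplus>\<^bsub>M\<^esub> y) = g x \<oplus>\<^bsub>N\<^esub> g y" if "x \<in> carrier M" "y \<in> carrier M" for x y
      using module_homD(2)[OF assms(2) that] that assms(3) by simp
    show "g (r \<odot>\<^bsub>M\<^esub> x) = r \<odot>\<^bsub>N\<^esub> g x" if "r \<in> carrier R" "x \<in> carrier M" for r x
      using module_homD(3)[OF assms(2) that] that assms(3) by simp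
  qed
qed

text \<open>Supports of products are awkward to handle; as a double linear extension the convolution
  is closed and linear in each factor almost at sight. The equality is checked at each
  \<open>w\<close>, where evaluation is a linear functional.\<close>

lemma monoid_algebra_mult_alt:
  fixes R :: "('a, 'r) ring_scheme" and G :: "('g, 'k) monoid_scheme"
  assumes R: "cring R" and G: "\<And>u v. u \<in> carrier G \<Longrightarrow> v \<in> carrier G \<Longrightarrow> u \<otimes>\<^bsub>G\<^esub> v \<in> carrier G"
    and f: "f \<in> carrier (monoid_algebra R G)" and g: "g \<in> carrier (monoid_algebra R G)"
  shows "f \<otimes>\<^bsub>monoid_algebra R G\<^esub> g = linear_extension R (monoid_algebra R G)
    (\<lambda>u. linear_extension R (monoid_algebra R G) (\<lambda>v. single R (u \<otimes>\<^bsub>G\<^esub> v)) g) f"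
proof
  fix w
  let ?F = "monoid_algebra R G"
  interpret R: cring R by fact
  have F: "module R ?F" by (rule monoid_algebra_module[OF R])
  interpret F: module R ?F by (rule F)
  have ev: "(\<lambda>h. h w) \<in> module_hom R ?F (reg_module R)"
    by (rule module_homI) (auto simp: monoid_algebra_def)
  let ?Sf = "{u. f u \<noteq> \<zero>\<^bsub>R\<^esub>}" and ?Sg = "{v. g v \<noteq> \<zero>\<^bsub>R\<^esub>}"
  have fg: "finite ?Sf" "finite ?Sg" "\<And>u. f u \<in> carrier R" "\<And>u. g u \<in> carrier R"
    "\<And>u. f u \<noteq> \<zero>\<^bsub>R\<^esub> \<Longrightarrow> u \<in> carrier G" "\<And>u. g u \<noteq> \<zero>\<^bsub>R\<^esub> \<Longrightarrow> u \<in> carrier G"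
    using f g by (auto simp: monoid_algebra_def)
  have s1: "single R u w \<in> carrier R" for u by (simp add: single_def)
  have sc: "single R (u \<otimes>\<^bsub>G\<^esub> v) \<in> carrier ?F" if "u \<in> carrier G" "v \<in> carrier G" for u v
    by (rule single_closed[OF R G[OF that]])
  define L where "L = (\<lambda>u. linear_extension R ?F (\<lambda>v. single R (u \<otimes>\<^bsub>G\<^esub> v)) g)"
  have L: "L u \<in> carrier ?F" if "u \<in> carrier G" for u
    unfolding L_def using sc that by (intro module_homD(1)[OF linear_extension(1)[OF F] g]) auto
  have Lw: "L u w = (\<Oplus>\<^bsub>R\<^esub>v\<in>?Sg. g v \<otimes>\<^bsub>R\<^esub> single R (u \<otimes>\<^bsub>G\<^esub> v) w)" if u: "u \<in> carrier G" for u
  proof -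
    have "L u w = (\<Oplus>\<^bsub>reg_module R\<^esub>v\<in>?Sg. g v \<odot>\<^bsub>reg_module R\<^esub> single R (u \<otimes>\<^bsub>G\<^esub> v) w)"
      unfolding L_def linear_extension_def
      by (rule module_hom_lincomb[OF F R.reg_module ev]) (use fg sc u in auto)
    then show ?thesis by (simp add: R.finsum_reg_module)
  qed
  have "linear_extension R ?F L f w = (\<Oplus>\<^bsub>reg_module R\<^esub>u\<in>?Sf. f u \<odot>\<^bsub>reg_module R\<^esub> L u w)"
    unfolding linear_extension_def
    by (rule module_hom_lincomb[OF F R.reg_module ev]) (use fg L in auto)
  also have "\<dots> = (\<Oplus>\<^bsub>R\<^esub>u\<in>?Sf. f u \<otimes>\<^bsub>R\<^esub> L u w)" by (simp add: R.finsum_reg_module)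
  also have "\<dots> = (\<Oplus>\<^bsub>R\<^esub>u\<in>?Sf. \<Oplus>\<^bsub>R\<^esub>v\<in>?Sg. f u \<otimes>\<^bsub>R\<^esub> (g v \<otimes>\<^bsub>R\<^esub> single R (u \<otimes>\<^bsub>G\<^esub> v) w))"
  proof (rule R.finsum_cong'[OF refl])
    fix u assume "u \<in> ?Sf"
    then show "f u \<otimes>\<^bsub>R\<^esub> L u w = (\<Oplus>\<^bsub>R\<^esub>v\<in>?Sg. f u \<otimes>\<^bsub>R\<^esub> (g v \<otimes>\<^bsub>R\<^esub> single R (u \<otimes>\<^bsub>G\<^esub> v) w))"
      using fg s1 Lw by (simp add: R.finsum_rdistr Pi_iff)
  qed (use fg s1 in \<open>auto intro!: R.finsum_closed\<close>)
  also have "\<dots> = (\<Oplus>\<^bsub>R\<^esub>p\<in>?Sf \<times> ?Sg. f (fst p) \<otimes>\<^bsub>R\<^esub> (g (snd p) \<otimes>\<^bsub>R\<^esub> single R (fst p \<otimes>\<^bsub>G\<^esub> snd p) w))"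
    using fg s1
    by (intro R.finsum_cartesian[where f = "\<lambda>u v. f u \<otimes>\<^bsub>R\<^esub> (g v \<otimes>\<^bsub>R\<^esub> single R (u \<otimes>\<^bsub>G\<^esub> v) w)", symmetric]) auto
  \<comment> \<open>The value at \<open>w\<close> of \<open>single R (u \<otimes> v)\<close> is 1 or
    0 and leaves exactly the pairs with product \<open>w\<close>, the index set of the
    convolution.\<close>
  also have "\<dots> = (\<Oplus>\<^bsub>R\<^esub>p\<in>{(u, v). f u \<noteq> \<zero>\<^bsub>R\<^esub> \<and> g v \<noteq> \<zero>\<^bsub>R\<^esub> \<and> u \<otimes>\<^bsub>G\<^esub> v = w}. f (fst p) \<otimes>\<^bsub>R\<^esub> g (snd p))"
    using fg by (intro R.add.finprod_mono_neutral_cong_right) (auto simp: single_def)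
  finally show "(f \<otimes>\<^bsub>?F\<^esub> g) w = linear_extension R ?F
      (\<lambda>u. linear_extension R ?F (\<lambda>v. single R (u \<otimes>\<^bsub>G\<^esub> v)) g) f w"
    by (simp add: monoid_algebra_def L_def)
qed

lemma monoid_algebra_mult_hom:
  fixes R :: "('a, 'r) ring_scheme" and G :: "('g, 'k) monoid_scheme"
  assumes R: "cring R" and G: "\<And>u v. u \<in> carrier G \<Longrightarrow> v \<in> carrier G \<Longrightarrow> u \<otimes>\<^bsub>G\<^esub> v \<in> carrier G"
  defines "F \<equiv> monoid_algebra R G"
  shows "bilinear_map R F F F (\<lambda>f g. f \<otimes>\<^bsub>F\<^esub> g)"
    and "u \<in> carrier G \<Longrightarrow> v \<in> carrier G \<Longrightarrow> single R u \<otimes>\<^bsub>F\<^esub> single R v = single R (u \<otimes>\<^bsub>G\<^esub> v)"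
proof -
  have F: "module R F" unfolding F_def by (rule monoid_algebra_module[OF R])
  have sc: "single R (u \<otimes>\<^bsub>G\<^esub> v) \<in> carrier F" if "u \<in> carrier G" "v \<in> carrier G" for u v
    unfolding F_def by (rule single_closed[OF R G[OF that]])
  define L where "L = (\<lambda>g u. linear_extension R F (\<lambda>v. single R (u \<otimes>\<^bsub>G\<^esub> v)) g)"
  have L: "(\<lambda>g. L g u) \<in> module_hom R F F" if "u \<in> carrier G" for u
    unfolding L_def F_def using sc that by (intro linear_extension(1) F[unfolded F_def]) (auto simp: F_def)
  have eq: "f \<otimes>\<^bsub>F\<^esub> g = linear_extension R F (L g) f" if "f \<in> carrier F" "g \<in> carrier F" for f g
    unfolding F_def L_def by (rule monoid_algebra_mult_alt[OF R G]) (use that in \<open>auto simp: F_def\<close>)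
  have LG: "L g \<in> carrier G \<rightarrow> carrier F" if "g \<in> carrier F" for g using module_homD(1)[OF L that] by auto
  show "bilinear_map R F F F (\<lambda>f g. f \<otimes>\<^bsub>F\<^esub> g)"
    unfolding bilinear_map_def
  proof (intro conjI ballI)
    fix g assume g: "g \<in> carrier F"
    have "linear_extension R F (L g) \<in> module_hom R F F"
      using linear_extension(1)[OF F LG[OF g]] by (simp add: F_def)
    then show "(\<lambda>f. f \<otimes>\<^bsub>F\<^esub> g) \<in> module_hom R F F"
      by (rule module_hom_cong[OF F]) (simp add: eq g)
  next
    fix f assume f: "f \<in> carrier F"
    have "(\<lambda>g. linear_extension R F (L g) f) \<in> module_hom R F F"
      unfolding linear_extension_def
      by (rule module_hom_finsum[OF F], rule module_hom_smult[OF F L])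
        (use f in \<open>auto simp: F_def monoid_algebra_def\<close>)
    then show "(\<lambda>g. f \<otimes>\<^bsub>F\<^esub> g) \<in> module_hom R F F"
      by (rule module_hom_cong[OF F]) (simp add: eq f)
  qed
  fix u v assume u: "u \<in> carrier G" and v: "v \<in> carrier G"
  have s: "single R u \<in> carrier F" "single R v \<in> carrier F"
    unfolding F_def using u v by (auto intro!: single_closed[OF R])
  have "single R u \<otimes>\<^bsub>F\<^esub> single R v = L (single R v) u"
    unfolding eq[OF s] by (rule linear_extension(2)[OF F LG[OF s(2)] u])
  also have "\<dots> = single R (u \<otimes>\<^bsub>G\<^esub> v)"
    unfolding L_def by (rule linear_extension(2)[OF F _ v]) (use sc u in auto)
  finally show "single R u \<otimes>\<^bsub>F\<^esub> single R v = single R (u \<otimes>\<^bsub>G\<^esub> v)" .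
qed


section \<open>Tensor products of algebras\<close>

lemma R_algebraD:
  assumes "R_algebra R A"
  shows "module R A" "ring A"
    "x \<in> carrier A \<Longrightarrow> (\<lambda>y. x \<otimes>\<^bsub>A\<^esub> y) \<in> module_hom R A A"
    "y \<in> carrier A \<Longrightarrow> (\<lambda>x. x \<otimes>\<^bsub>A\<^esub> y) \<in> module_hom R A A"
proof -
  show "module R A" "ring A" using assms by (auto simp: R_algebra_def)
  then interpret A: ring A by simp
  show "x \<in> carrier A \<Longrightarrow> (\<lambda>y. x \<otimes>\<^bsub>A\<^esub> y) \<in> module_hom R A A"
    "y \<in> carrier A \<Longrightarrow> (\<lambda>x. x \<otimes>\<^bsub>A\<^esub> y) \<in> module_hom R A A"
    using assms by (auto simp: R_algebra_def module_hom_def A.l_distr A.r_distr)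
qed

locale tensor_algebras = tensor_modules R A C
  for R :: "('a, 'r) ring_scheme" (structure) and A :: "('a, 'm) module" and C :: "('a, 'n) module" +
  assumes algs: "R_algebra R A" "R_algebra R C"
begin

lemma rings: "ring A" "ring C" using algs R_algebraD(2) by auto

lemma G_closed: "u \<in> carrier (A \<times>\<times> C) \<Longrightarrow> v \<in> carrier (A \<times>\<times> C) \<Longrightarrow> u \<otimes>\<^bsub>A \<times>\<times> C\<^esub> v \<in> carrier (A \<times>\<times> C)"
  using ring.ring_simprules(5)[OF rings(1)] ring.ring_simprules(5)[OF rings(2)]
  by (cases u; cases v) auto

lemma F_mult: "bilinear_map R F F F (\<lambda>f g. f \<otimes>\<^bsub>F\<^esub> g)"
  "u \<in> carrier (A \<times>\<times> C) \<Longrightarrow> v \<in> carrier (A \<times>\<times> C) \<Longrightarrow> single R u \<otimes>\<^bsub>F\<^esub> single R v = single R (u \<otimes>\<^bsub>A \<times>\<times> C\<^esub> v)"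
  by (rule monoid_algebra_mult_hom[OF mods(3)]; (rule G_closed)?; assumption)+

lemma e_mult: "x \<in> carrier A \<Longrightarrow> y \<in> carrier C \<Longrightarrow> x' \<in> carrier A \<Longrightarrow> y' \<in> carrier C \<Longrightarrow>
    e x y \<otimes>\<^bsub>F\<^esub> e x' y' = e (x \<otimes>\<^bsub>A\<^esub> x') (y \<otimes>\<^bsub>C\<^esub> y')"
  using F_mult(2)[of "(x, y)" "(x', y')"] by simp

lemma F_mult_closed: "f \<in> carrier F \<Longrightarrow> g \<in> carrier F \<Longrightarrow> f \<otimes>\<^bsub>F\<^esub> g \<in> carrier F"
  by (rule bilinear_mapD(3)[OF F_mult(1)])

lemma kernel_subset: "tensor_kernel R A C \<subseteq> carrier F"
  by (rule Q.KE(1))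

lemma bilinear_compose:
  assumes "a \<in> module_hom R A A" "c \<in> module_hom R C C"
  shows "bilinear_map R A C T (\<lambda>x y. pure (a x) (c y))"
  unfolding bilinear_map_def
  using module_hom_compose[OF assms(1) pure_homs(1)] module_hom_compose[OF assms(2) pure_homs(2)]
    module_homD(1)[OF assms(1)] module_homD(1)[OF assms(2)]
  by auto

text \<open>For \<open>k\<close> in the kernel the map \<open>g \<mapsto> k g\<close> vanishes modulo the kernel on the generators \<open>g\<close>,
  because \<open>(x, y) \<mapsto> x x' \<otimes> y y'\<close> is bilinear; hence it vanishes everywhere.\<close>

lemma kernel_ideal:
  assumes k: "k \<in> tensor_kernel R A C" and f: "f \<in> carrier F"
  shows "k \<otimes>\<^bsub>F\<^esub> f \<in> tensor_kernel R A C" "f \<otimes>\<^bsub>F\<^esub> k \<in> tensor_kernel R A C"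
proof -
  have kF: "k \<in> carrier F" using k kernel_subset by blast
  note fh = bilinear_mapD(1,2)[OF F_mult(1)]
  have zero_hom: "(\<lambda>_. \<zero>\<^bsub>T\<^esub>) \<in> module_hom R F T" by (rule module_hom_zero_map[OF T_module])
  have "Q.cls (k \<otimes>\<^bsub>F\<^esub> f) = \<zero>\<^bsub>T\<^esub>"
  proof (rule module_hom_eqI[OF T_module module_hom_compose[OF fh(2)[OF kF] cls_hom] zero_hom _ f])
    fix u assume "u \<in> carrier (A \<times>\<times> C)"
    then obtain x' y' where u: "u = (x', y')" "x' \<in> carrier A" "y' \<in> carrier C" by auto
    have "bilinear_map R A C T (\<lambda>x y. pure (x \<otimes>\<^bsub>A\<^esub> x') (y \<otimes>\<^bsub>C\<^esub> y'))"
      by (rule bilinear_compose[OF R_algebraD(4)[OF algs(1)] R_algebraD(4)[OF algs(2)]]) (use u in auto)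
    then have "bilinear_map R A C T (\<lambda>x y. Q.cls (e x y \<otimes>\<^bsub>F\<^esub> e x' y'))"
      unfolding bilinear_map_def
      by (auto simp: e_mult u pure_alt elim!: module_hom_cong[OF mods(1)] module_hom_cong[OF mods(2)])
    then show "Q.cls (k \<otimes>\<^bsub>F\<^esub> single R u) = \<zero>\<^bsub>T\<^esub>"
      unfolding u(1)
      by (rule vanish_on_kernel[OF T_module module_hom_compose[OF fh(1)[OF e_closed[OF u(2,3)]] cls_hom] _ k])
  qed
  then show "k \<otimes>\<^bsub>F\<^esub> f \<in> tensor_kernel R A C"
    using Q.cls_zero_iff[OF F_mult_closed[OF kF f]] by (simp add: T_alt)
  have "Q.cls (f \<otimes>\<^bsub>F\<^esub> k) = \<zero>\<^bsub>T\<^esub>"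
  proof (rule module_hom_eqI[OF T_module module_hom_compose[OF fh(1)[OF kF] cls_hom] zero_hom _ f])
    fix u assume "u \<in> carrier (A \<times>\<times> C)"
    then obtain x' y' where u: "u = (x', y')" "x' \<in> carrier A" "y' \<in> carrier C" by auto
    have "bilinear_map R A C T (\<lambda>x y. pure (x' \<otimes>\<^bsub>A\<^esub> x) (y' \<otimes>\<^bsub>C\<^esub> y))"
      by (rule bilinear_compose[OF R_algebraD(3)[OF algs(1)] R_algebraD(3)[OF algs(2)]]) (use u in auto)
    then have "bilinear_map R A C T (\<lambda>x y. Q.cls (e x' y' \<otimes>\<^bsub>F\<^esub> e x y))"
      unfolding bilinear_map_def
      by (auto simp: e_mult u pure_alt elim!: module_hom_cong[OF mods(1)] module_hom_cong[OF mods(2)])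
    then show "Q.cls (single R u \<otimes>\<^bsub>F\<^esub> k) = \<zero>\<^bsub>T\<^esub>"
      unfolding u(1)
      by (rule vanish_on_kernel[OF T_module module_hom_compose[OF fh(2)[OF e_closed[OF u(2,3)]] cls_hom] _ k])
  qed
  then show "f \<otimes>\<^bsub>F\<^esub> k \<in> tensor_kernel R A C"
    using Q.cls_zero_iff[OF F_mult_closed[OF f kF]] by (simp add: T_alt)
qed

text \<open>The product of two cosets is by definition a union over all pairs of representatives;
  since the kernel is a two-sided ideal, every pair contributes the same coset.\<close>

lemma cls_mult:
  assumes f: "f \<in> carrier F" and g: "g \<in> carrier F"
  shows "Q.cls f \<otimes>\<^bsub>T\<^esub> Q.cls g = Q.cls (f \<otimes>\<^bsub>F\<^esub> g)"
proof -
  have "Q.cls (f' \<otimes>\<^bsub>F\<^esub> g') = Q.cls (f \<otimes>\<^bsub>F\<^esub> g)" if f': "f' \<in> Q.cls f" and g': "g' \<in> Q.cls g" for f' g'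
  proof -
    obtain k where k: "k \<in> tensor_kernel R A C" "f' = k \<oplus>\<^bsub>F\<^esub> f" using f' by (auto simp: Q.mem_cls)
    obtain k' where k': "k' \<in> tensor_kernel R A C" "g' = k' \<oplus>\<^bsub>F\<^esub> g" using g' by (auto simp: Q.mem_cls)
    have kF: "k \<in> carrier F" "k' \<in> carrier F" using k k' kernel_subset by auto
    then have cl: "f' \<in> carrier F" "g' \<in> carrier F" using k k' f g by auto
    have "f' \<otimes>\<^bsub>F\<^esub> g' = k \<otimes>\<^bsub>F\<^esub> g' \<oplus>\<^bsub>F\<^esub> f \<otimes>\<^bsub>F\<^esub> g'"
      unfolding k(2) using module_homD(2)[OF bilinear_mapD(1)[OF F_mult(1) cl(2)] kF(1) f] by simp
    also have "f \<otimes>\<^bsub>F\<^esub> g' = f \<otimes>\<^bsub>F\<^esub> k' \<oplus>\<^bsub>F\<^esub> f \<otimes>\<^bsub>F\<^esub> g"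
      unfolding k'(2) using module_homD(2)[OF bilinear_mapD(2)[OF F_mult(1) f] kF(2) g] by simp
    finally have "Q.cls (f' \<otimes>\<^bsub>F\<^esub> g') = Q.cls (k \<otimes>\<^bsub>F\<^esub> g' \<oplus>\<^bsub>F\<^esub> (f \<otimes>\<^bsub>F\<^esub> k' \<oplus>\<^bsub>F\<^esub> f \<otimes>\<^bsub>F\<^esub> g))" by simp
    also have "\<dots> = Q.cls (f \<otimes>\<^bsub>F\<^esub> k' \<oplus>\<^bsub>F\<^esub> f \<otimes>\<^bsub>F\<^esub> g)"
      using kernel_ideal(1)[OF k(1) cl(2)] F_mult_closed f g kF by (intro Q.cls_eq) auto
    also have "\<dots> = Q.cls (f \<otimes>\<^bsub>F\<^esub> g)"
      using kernel_ideal(2)[OF k'(1) f] F_mult_closed f g by (intro Q.cls_eq) auto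
    finally show ?thesis .
  qed
  moreover have "Q.cls f \<otimes>\<^bsub>T\<^esub> Q.cls g = (\<Union>f'\<in>Q.cls f. \<Union>g'\<in>Q.cls g. Q.cls (f' \<otimes>\<^bsub>F\<^esub> g'))"
    by (simp add: T_alt quotient_module_def FactRing_def rcoset_mult_def Q.cls_def)
  ultimately show ?thesis using Q.cls_self[OF f] Q.cls_self[OF g] by blast
qed

lemma T_cases: "Z \<in> carrier T \<Longrightarrow> \<exists>f\<in>carrier F. Z = Q.cls f"
  by (auto simp: T_alt Q.carrier_quotient)

lemma T_mult: "bilinear_map R T T T (\<lambda>Z W. Z \<otimes>\<^bsub>T\<^esub> W)"
  unfolding bilinear_map_def
proof (intro conjI ballI)
  note fh = bilinear_mapD(1,2)[OF F_mult(1)]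
  note ch = module_homD[OF cls_hom]
  fix Z assume "Z \<in> carrier T"
  then obtain f where f: "f \<in> carrier F" "Z = Q.cls f" using T_cases by blast
  show "(\<lambda>W. W \<otimes>\<^bsub>T\<^esub> Z) \<in> module_hom R T T"
  proof (rule module_homI)
    fix W assume "W \<in> carrier T"
    then obtain g where g: "g \<in> carrier F" "W = Q.cls g" using T_cases by blast
    show "W \<otimes>\<^bsub>T\<^esub> Z \<in> carrier T" using f g by (simp add: cls_mult ch F_mult_closed)
    show "r \<odot>\<^bsub>T\<^esub> W \<otimes>\<^bsub>T\<^esub> Z = r \<odot>\<^bsub>T\<^esub> (W \<otimes>\<^bsub>T\<^esub> Z)" if r: "r \<in> carrier R" for r
      using f g r module_homD(3)[OF fh(1)] by (simp add: cls_mult ch(3)[symmetric] F_mult_closed)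
    fix V assume "V \<in> carrier T"
    then obtain h where h: "h \<in> carrier F" "V = Q.cls h" using T_cases by blast
    show "(W \<oplus>\<^bsub>T\<^esub> V) \<otimes>\<^bsub>T\<^esub> Z = W \<otimes>\<^bsub>T\<^esub> Z \<oplus>\<^bsub>T\<^esub> V \<otimes>\<^bsub>T\<^esub> Z"
      using f g h module_homD(2)[OF fh(1)] by (simp add: cls_mult ch(2)[symmetric] F_mult_closed)
  qed
  show "(\<lambda>W. Z \<otimes>\<^bsub>T\<^esub> W) \<in> module_hom R T T"
  proof (rule module_homI)
    fix W assume "W \<in> carrier T"
    then obtain g where g: "g \<in> carrier F" "W = Q.cls g" using T_cases by blast
    show "Z \<otimes>\<^bsub>T\<^esub> W \<in> carrier T" using f g by (simp add: cls_mult ch F_mult_closed)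
    show "Z \<otimes>\<^bsub>T\<^esub> (r \<odot>\<^bsub>T\<^esub> W) = r \<odot>\<^bsub>T\<^esub> (Z \<otimes>\<^bsub>T\<^esub> W)" if r: "r \<in> carrier R" for r
      using f g r module_homD(3)[OF fh(2)] by (simp add: cls_mult ch(3)[symmetric] F_mult_closed)
    fix V assume "V \<in> carrier T"
    then obtain h where h: "h \<in> carrier F" "V = Q.cls h" using T_cases by blast
    show "Z \<otimes>\<^bsub>T\<^esub> (W \<oplus>\<^bsub>T\<^esub> V) = Z \<otimes>\<^bsub>T\<^esub> W \<oplus>\<^bsub>T\<^esub> Z \<otimes>\<^bsub>T\<^esub> V"
      using f g h module_homD(2)[OF fh(2)] by (simp add: cls_mult ch(2)[symmetric] F_mult_closed)
  qed
qed

lemma pure_mult: "x \<in> carrier A \<Longrightarrow> y \<in> carrier C \<Longrightarrow> x' \<in> carrier A \<Longrightarrow> y' \<in> carrier C \<Longrightarrow>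
    pure x y \<otimes>\<^bsub>T\<^esub> pure x' y' = pure (x \<otimes>\<^bsub>A\<^esub> x') (y \<otimes>\<^bsub>C\<^esub> y')"
  unfolding pure_alt by (simp add: cls_mult e_closed e_mult)

lemma T_one: "\<one>\<^bsub>T\<^esub> = pure \<one>\<^bsub>A\<^esub> \<one>\<^bsub>C\<^esub>"
proof -
  have "\<one>\<^bsub>F\<^esub> = e \<one>\<^bsub>A\<^esub> \<one>\<^bsub>C\<^esub>" by (simp add: monoid_algebra_def)
  then show ?thesis by (simp add: pure_alt T_alt quotient_module_def FactRing_def Q.cls_def)
qed

text \<open>Both sides of associativity are linear in each argument, so pure tensors are replaced by
  arbitrary elements one argument at a time, beginning with the last.\<close>

lemma T_R_algebra: "R_algebra R T"
proof -
  interpret A: ring A by (rule rings)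
  interpret C: ring C by (rule rings)
  note Th = bilinear_mapD(1,2)[OF T_mult] and Tc = bilinear_mapD(3)[OF T_mult]
  have pp: "pure x y \<otimes>\<^bsub>T\<^esub> pure x' y' \<otimes>\<^bsub>T\<^esub> pure x'' y'' = pure x y \<otimes>\<^bsub>T\<^esub> (pure x' y' \<otimes>\<^bsub>T\<^esub> pure x'' y'')"
    if "x \<in> carrier A" "x' \<in> carrier A" "x'' \<in> carrier A" "y \<in> carrier C" "y' \<in> carrier C" "y'' \<in> carrier C"
    for x x' x'' y y' y''
    using that by (simp add: pure_mult A.m_assoc C.m_assoc)
  have 1: "pure x y \<otimes>\<^bsub>T\<^esub> pure x' y' \<otimes>\<^bsub>T\<^esub> Z = pure x y \<otimes>\<^bsub>T\<^esub> (pure x' y' \<otimes>\<^bsub>T\<^esub> Z)"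
    if xy: "x \<in> carrier A" "x' \<in> carrier A" "y \<in> carrier C" "y' \<in> carrier C" and Z: "Z \<in> carrier T"
    for x x' y y' Z
    by (rule tensor_hom_eq[OF T_module Th(2) module_hom_compose[OF Th(2) Th(2)] _ Z])
      (simp_all add: xy Tc pure_closed pp)
  have 2: "pure x y \<otimes>\<^bsub>T\<^esub> W \<otimes>\<^bsub>T\<^esub> Z = pure x y \<otimes>\<^bsub>T\<^esub> (W \<otimes>\<^bsub>T\<^esub> Z)"
    if xy: "x \<in> carrier A" "y \<in> carrier C" and Z: "Z \<in> carrier T" and W: "W \<in> carrier T" for x y Z W
    by (rule tensor_hom_eq[OF T_module module_hom_compose[OF Th(2) Th(1)] module_hom_compose[OF Th(1) Th(2)] _ W])
      (simp_all add: xy Z Tc pure_closed 1)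
  have assoc: "V \<otimes>\<^bsub>T\<^esub> W \<otimes>\<^bsub>T\<^esub> Z = V \<otimes>\<^bsub>T\<^esub> (W \<otimes>\<^bsub>T\<^esub> Z)"
    if V: "V \<in> carrier T" and Z: "Z \<in> carrier T" and W: "W \<in> carrier T" for V Z W
    by (rule tensor_hom_eq[OF T_module module_hom_compose[OF Th(1) Th(1)] Th(1) _ V])
      (simp_all add: W Z Tc pure_closed 2)
  have one: "\<one>\<^bsub>T\<^esub> \<in> carrier T" unfolding T_one by (rule pure_closed) auto
  have lone: "\<one>\<^bsub>T\<^esub> \<otimes>\<^bsub>T\<^esub> Z = Z" if Z: "Z \<in> carrier T" for Z
    by (rule tensor_hom_eq[OF T_module Th(2)[OF one] module_hom_id _ Z]) (simp add: T_one pure_mult)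
  have rone: "Z \<otimes>\<^bsub>T\<^esub> \<one>\<^bsub>T\<^esub> = Z" if Z: "Z \<in> carrier T" for Z
    by (rule tensor_hom_eq[OF T_module Th(1)[OF one] module_hom_id _ Z]) (simp add: T_one pure_mult)
  have "ring T"
    by (intro ringI T.M.abelian_group_axioms monoidI)
      (auto simp: Tc one lone rone assoc module_homD(2)[OF Th(1)] module_homD(2)[OF Th(2)])
  then show ?thesis
    using T_module by (auto simp: R_algebra_def module_homD(3)[OF Th(1)] module_homD(3)[OF Th(2)])
qed

end

section \<open>Separability of Azumaya algebras\<close>

lemma opposite_algebra_simps [simp]:
  "carrier (opposite_algebra A) = carrier A" "zero (opposite_algebra A) = zero A" "one (opposite_algebra A) = one A"
  "add (opposite_algebra A) = add A" "module.smult (opposite_algebra A) = module.smult A"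
  "x \<otimes>\<^bsub>opposite_algebra A\<^esub> y = y \<otimes>\<^bsub>A\<^esub> x"
  by (simp_all add: opposite_algebra_def)

lemma module_hom_opposite [simp]:
  "module_hom R (opposite_algebra A) N = module_hom R A N" "module_hom R N (opposite_algebra A) = module_hom R N A"
  by (simp_all add: module_hom_def)

lemma bilinear_map_opposite [simp]: "bilinear_map R M (opposite_algebra A) V b = bilinear_map R M A V b"
  by (simp add: bilinear_map_def)

lemma module_opposite: "module R A \<Longrightarrow> module R (opposite_algebra A)"
proof -
  assume "module R A"
  then interpret module R A .
  show ?thesis
    by (intro moduleI abelian_groupI R.is_cring)
      (auto simp: M.a_ac smult_l_distr smult_r_distr smult_assoc1 intro: bexI[of _ "\<ominus>\<^bsub>A\<^esub> _"] M.l_neg)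
qed

text \<open>The families describe \<open>\<theta>\<^sub>j = \<Sum>\<^sub>i x\<^sub>j\<^sub>i \<otimes> y\<^sub>j\<^sub>i\<close>, the elements of \<open>A \<otimes> A\<^sup>o\<^sup>p\<close> that act on \<open>A\<close> as \<open>z \<mapsto> \<mu>\<^sub>j(z) 1\<close>
  for a dual basis \<open>t\<^sub>j, \<mu>\<^sub>j\<close> of \<open>A\<close>. The first two equations mean \<open>c \<theta>\<^sub>j = \<theta>\<^sub>j c\<close> and
  \<open>\<Sum>\<^sub>j t\<^sub>j \<theta>\<^sub>j = 1 \<otimes> 1\<close>.\<close>

definition separable_families ::
    "('a, 'r) ring_scheme \<Rightarrow> ('a, 'b) module \<Rightarrow> nat \<Rightarrow> (nat \<Rightarrow> nat) \<Rightarrow> (nat \<Rightarrow> nat \<Rightarrow> 'b) \<Rightarrow> (nat \<Rightarrow> nat \<Rightarrow> 'b) \<Rightarrow>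
     (nat \<Rightarrow> 'b) \<Rightarrow> (nat \<Rightarrow> 'a) \<Rightarrow> (nat \<Rightarrow> 'b \<Rightarrow> 'a) \<Rightarrow> bool" where
  "separable_families R A q p x y t s \<mu> \<longleftrightarrow>
     (\<forall>j<q. t j \<in> carrier A \<and> s j \<in> carrier R \<and> \<mu> j \<in> module_hom R A (reg_module R) \<and>
        (\<forall>i<p j. x j i \<in> carrier A \<and> y j i \<in> carrier A)) \<and>
     (\<forall>c\<in>carrier A. \<forall>j<q.
        (\<Oplus>\<^bsub>tensor R A (opposite_algebra A)\<^esub>i\<in>{..<p j}. pure_tensor R A (opposite_algebra A) (c \<otimes>\<^bsub>A\<^esub> x j i) (y j i)) =
        (\<Oplus>\<^bsub>tensor R A (opposite_algebra A)\<^esub>i\<in>{..<p j}. pure_tensor R A (opposite_algebra A) (x j i) (y j i \<otimes>\<^bsub>A\<^esub> c))) \<and>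
     (\<Oplus>\<^bsub>tensor R A (opposite_algebra A)\<^esub>j\<in>{..<q}. \<Oplus>\<^bsub>tensor R A (opposite_algebra A)\<^esub>i\<in>{..<p j}.
        pure_tensor R A (opposite_algebra A) (t j \<otimes>\<^bsub>A\<^esub> x j i) (y j i)) = pure_tensor R A (opposite_algebra A) \<one>\<^bsub>A\<^esub> \<one>\<^bsub>A\<^esub> \<and>
     (\<forall>j<q. \<forall>z\<in>carrier A. (\<Oplus>\<^bsub>A\<^esub>i\<in>{..<p j}. x j i \<otimes>\<^bsub>A\<^esub> z \<otimes>\<^bsub>A\<^esub> y j i) = \<mu> j z \<odot>\<^bsub>A\<^esub> \<one>\<^bsub>A\<^esub>) \<and>
     (\<Oplus>\<^bsub>R\<^esub>j\<in>{..<q}. s j \<otimes>\<^bsub>R\<^esub> \<mu> j \<one>\<^bsub>A\<^esub>) = \<one>\<^bsub>R\<^esub>"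

text \<open>The coordinates of the unit generate the unit ideal: from n_k = 1 n_k = \<Sum> l_j(1)
  n_j n_k, each generator l_i(n_k) of the trace ideal is a combination of the l_j(1), and the trace
  ideal contains 1.\<close>

lemma (in coordinates) unit_functional:
  assumes alg: "R_algebra R M" and faithful: "faithful R M"
  obtains s where "\<And>j. s j \<in> carrier R" "(\<Oplus>j\<in>{..<q}. s j \<otimes> l j \<one>\<^bsub>M\<^esub>) = \<one>"
proof -
  interpret A: ring M by (rule R_algebraD(2)[OF alg])
  let ?K = "{..<q} \<times> {..<q}"
  obtain s where s: "\<And>c. s c \<in> carrier R" "(\<Oplus>c\<in>?K. s c \<otimes> l (fst c) (n (snd c))) = \<one>"
    using trace_ideal[OF faithful] by blast
  \<comment> \<open>The coefficient of \<open>l j \<one>\<close> after substituting that expansion;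
    the default zero keeps every value in the carrier.\<close>
  define s' where "s' = (\<lambda>j. if j < q then \<Oplus>c\<in>?K. s c \<otimes> l (fst c) (n j \<otimes>\<^bsub>M\<^esub> n (snd c)) else \<zero>)"
  have cl: "l (fst c) (n j \<otimes>\<^bsub>M\<^esub> n (snd c)) \<in> carrier R" if "c \<in> ?K" "j < q" for c j
    using that l_closed n_closed by auto
  have s'R: "s' j \<in> carrier R" for j unfolding s'_def using cl s(1) by (auto intro!: R.finsum_closed)
  have l1: "l j \<one>\<^bsub>M\<^esub> \<in> carrier R" if "j < q" for j using l_closed that by auto
  have "(\<Oplus>j\<in>{..<q}. s' j \<otimes> l j \<one>\<^bsub>M\<^esub>) =
      (\<Oplus>j\<in>{..<q}. \<Oplus>c\<in>?K. s c \<otimes> (l j \<one>\<^bsub>M\<^esub> \<otimes> l (fst c) (n j \<otimes>\<^bsub>M\<^esub> n (snd c))))"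
  proof (rule R.finsum_cong'[OF refl])
    fix j assume j: "j \<in> {..<q}"
    then have "s' j \<otimes> l j \<one>\<^bsub>M\<^esub> = (\<Oplus>c\<in>?K. s c \<otimes> l (fst c) (n j \<otimes>\<^bsub>M\<^esub> n (snd c)) \<otimes> l j \<one>\<^bsub>M\<^esub>)"
      using cl s(1) l1 by (simp add: s'_def R.finsum_ldistr Pi_iff)
    also have "\<dots> = (\<Oplus>c\<in>?K. s c \<otimes> (l j \<one>\<^bsub>M\<^esub> \<otimes> l (fst c) (n j \<otimes>\<^bsub>M\<^esub> n (snd c))))"
    proof (rule R.finsum_cong'[OF refl])
      fix c assume c: "c \<in> ?K"
      then show "s c \<otimes> l (fst c) (n j \<otimes>\<^bsub>M\<^esub> n (snd c)) \<otimes> l j \<one>\<^bsub>M\<^esub> =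
          s c \<otimes> (l j \<one>\<^bsub>M\<^esub> \<otimes> l (fst c) (n j \<otimes>\<^bsub>M\<^esub> n (snd c)))"
        using cl[OF c, of j] s(1)[of c] l1[of j] j by (simp add: R.m_assoc R.m_comm R.m_lcomm)
    qed (use cl s(1) l1 j in auto)
    finally show "s' j \<otimes> l j \<one>\<^bsub>M\<^esub> = (\<Oplus>c\<in>?K. s c \<otimes> (l j \<one>\<^bsub>M\<^esub> \<otimes> l (fst c) (n j \<otimes>\<^bsub>M\<^esub> n (snd c))))" .
  qed (use cl s(1) l1 in \<open>auto intro!: R.finsum_closed\<close>)
  also have "\<dots> = (\<Oplus>c\<in>?K. \<Oplus>j\<in>{..<q}. s c \<otimes> (l j \<one>\<^bsub>M\<^esub> \<otimes> l (fst c) (n j \<otimes>\<^bsub>M\<^esub> n (snd c))))"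
    using cl s(1) l1 by (intro R.finsum_swap) auto
  also have "\<dots> = (\<Oplus>c\<in>?K. s c \<otimes> l (fst c) (n (snd c)))"
  proof (rule R.finsum_cong'[OF refl])
    fix c assume c: "c \<in> ?K"
    then have nc: "fst c < q" "n (snd c) \<in> carrier M" using n_closed by auto
    have "n (snd c) = (\<Oplus>\<^bsub>M\<^esub>j\<in>{..<q}. l j \<one>\<^bsub>M\<^esub> \<odot>\<^bsub>M\<^esub> n j) \<otimes>\<^bsub>M\<^esub> n (snd c)"
      using expand[of "\<one>\<^bsub>M\<^esub>"] nc by simp
    also have "\<dots> = (\<Oplus>\<^bsub>M\<^esub>j\<in>{..<q}. l j \<one>\<^bsub>M\<^esub> \<odot>\<^bsub>M\<^esub> (n j \<otimes>\<^bsub>M\<^esub> n (snd c)))"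
      using n_closed l1 by (intro module_hom_lincomb[OF mod mod R_algebraD(4)[OF alg nc(2)]]) auto
    finally have "l (fst c) (n (snd c)) = l (fst c) (\<Oplus>\<^bsub>M\<^esub>j\<in>{..<q}. l j \<one>\<^bsub>M\<^esub> \<odot>\<^bsub>M\<^esub> (n j \<otimes>\<^bsub>M\<^esub> n (snd c)))"
      by (rule arg_cong)
    also have "\<dots> = (\<Oplus>j\<in>{..<q}. l j \<one>\<^bsub>M\<^esub> \<otimes> l (fst c) (n j \<otimes>\<^bsub>M\<^esub> n (snd c)))"
      using nc n_closed l1 by (intro l_lincomb) auto
    finally have e: "l (fst c) (n (snd c)) = (\<Oplus>j\<in>{..<q}. l j \<one>\<^bsub>M\<^esub> \<otimes> l (fst c) (n j \<otimes>\<^bsub>M\<^esub> n (snd c)))" .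
    show "(\<Oplus>j\<in>{..<q}. s c \<otimes> (l j \<one>\<^bsub>M\<^esub> \<otimes> l (fst c) (n j \<otimes>\<^bsub>M\<^esub> n (snd c)))) = s c \<otimes> l (fst c) (n (snd c))"
      unfolding e using cl[OF c] s(1) l1 by (intro R.finsum_rdistr[symmetric]) auto
  qed (use s(1) l_closed n_closed in auto)
  finally show thesis unfolding s(2) by (rule that[of s', OF s'R])
qed

text \<open>Each \<theta>_j is the preimage under \<open>\<phi>\<close> of the map
  \<open>z \<mapsto> l j z \<odot> \<one>\<close>, written as a sum of pure tensors. Since
  \<open>\<phi>\<close> is injective, the identities are verified as operators on \<open>A\<close>:
  both c \<theta>_j and \<theta>_j c act as \<open>z \<mapsto> l j z \<odot> c\<close>, and with t_j
  = n_j the sum of the t_j \<theta>_j acts as the dual basis expansion, that is, as the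
  identity.\<close>

lemma azumaya_separable_families:
  assumes az: "azumaya R A"
  shows "\<exists>q p x y t s \<mu>. separable_families R A q p x y t s \<mu>"
proof -
  let ?A' = "opposite_algebra A"
  have alg: "R_algebra R A" and fp: "finite_projective R A" "faithful R A"
    using az by (auto simp: azumaya_def faithfully_projective_def)
  obtain \<phi> where "\<phi> \<in> algebra_isos R (tensor R A ?A') (endo_algebra R A)"
    and \<phi>p: "\<And>a b z. a \<in> carrier A \<Longrightarrow> b \<in> carrier A \<Longrightarrow> z \<in> carrier A \<Longrightarrow>
      \<phi> (pure_tensor R A ?A' a b) z = a \<otimes>\<^bsub>A\<^esub> z \<otimes>\<^bsub>A\<^esub> b"
    using az unfolding azumaya_def by blast
  then have \<phi>: "\<phi> \<in> module_hom R (tensor R A ?A') (endo_algebra R A)"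
    and bij: "bij_betw \<phi> (carrier (tensor R A ?A')) (carrier (endo_algebra R A))"
    by (auto simp: algebra_isos_def ring_iso_def)
  obtain q n l where "coordinates R A q n l" using module_coordinates[OF fp(1)] .
  then interpret C: coordinates R A q n l .
  interpret A: ring A by (rule R_algebraD(2)[OF alg])
  interpret M: module R A by (rule R_algebraD(1)[OF alg])
  interpret O: module R ?A' by (rule module_opposite[OF C.mod])
  interpret T: tensor_modules R A ?A' by unfold_locales
  have pc: "T.pure a b \<in> carrier T.T" if "a \<in> carrier A" "b \<in> carrier A" for a b
    using T.pure_closed that by simp
  have ev: "(\<lambda>Z. \<phi> Z z) \<in> module_hom R T.T A" if z: "z \<in> carrier A" for z
  proof (rule module_homI)
    show "\<phi> Z z \<in> carrier A" if "Z \<in> carrier T.T" for Z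
      using module_homD(1)[OF \<phi> that] z by (auto simp: endo_algebra_def module_hom_def)
  qed (use z in \<open>simp_all add: module_homD[OF \<phi>] endo_algebra_def\<close>)
  have ev_sum: "\<phi> (\<Oplus>\<^bsub>T.T\<^esub>i\<in>I. f i) z = (\<Oplus>\<^bsub>A\<^esub>i\<in>I. \<phi> (f i) z)"
    if "z \<in> carrier A" "\<And>i. i \<in> I \<Longrightarrow> f i \<in> carrier T.T" for I z and f :: "nat \<Rightarrow> _"
    by (rule module_hom_sum[OF T.T_module C.mod ev[OF that(1)] that(2)])
  \<comment> \<open>Members of \<open>endo_algebra\<close> are extensional, so agreement on
    \<open>carrier A\<close> already gives equality of the images.\<close>
  have inj: "Z = W" if Z: "Z \<in> carrier T.T" and W: "W \<in> carrier T.T"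
    and eq: "\<And>z. z \<in> carrier A \<Longrightarrow> \<phi> Z z = \<phi> W z" for Z W
  proof -
    have "\<phi> Z \<in> extensional (carrier A)" "\<phi> W \<in> extensional (carrier A)"
      using module_homD(1)[OF \<phi> Z] module_homD(1)[OF \<phi> W] by (auto simp: endo_algebra_def)
    then have "\<phi> Z = \<phi> W" using eq by (rule extensionalityI)
    then show ?thesis using bij Z W by (auto simp: bij_betw_def inj_on_def)
  qed
  define family where "family = (\<lambda>j (p::nat) x y. (\<forall>i<p. x i \<in> carrier A \<and> y i \<in> carrier A) \<and>
      (\<forall>z\<in>carrier A. (\<Oplus>\<^bsub>A\<^esub>i\<in>{..<p}. x i \<otimes>\<^bsub>A\<^esub> z \<otimes>\<^bsub>A\<^esub> y i) = l j z \<odot>\<^bsub>A\<^esub> \<one>\<^bsub>A\<^esub>))"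
  have "\<exists>p x y. family j p x y" if j: "j < q" for j
  proof -
    have "(\<lambda>z. l j z \<odot>\<^bsub>A\<^esub> \<one>\<^bsub>A\<^esub>) \<in> module_hom R A A"
      using module_homD[OF C.l_hom[OF j]] by (intro module_homI) (auto simp: C.smult_l_distr C.smult_assoc1)
    then have "restrict (\<lambda>z. l j z \<odot>\<^bsub>A\<^esub> \<one>\<^bsub>A\<^esub>) (carrier A) \<in> module_hom R A A"
      by (rule module_hom_cong[OF C.mod]) simp
    then have "restrict (\<lambda>z. l j z \<odot>\<^bsub>A\<^esub> \<one>\<^bsub>A\<^esub>) (carrier A) \<in> carrier (endo_algebra R A)"
      by (simp add: endo_algebra_def)
    then have "restrict (\<lambda>z. l j z \<odot>\<^bsub>A\<^esub> \<one>\<^bsub>A\<^esub>) (carrier A) \<in> \<phi> ` carrier T.T"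
      using bij by (simp only: bij_betw_def)
    then obtain \<theta> where \<theta>: "\<theta> \<in> carrier T.T" "\<phi> \<theta> = restrict (\<lambda>z. l j z \<odot>\<^bsub>A\<^esub> \<one>\<^bsub>A\<^esub>) (carrier A)"
      by (elim imageE) simp
    obtain p :: nat and x y where xy: "\<And>i. i < p \<Longrightarrow> x i \<in> carrier A \<and> y i \<in> carrier A"
        and sum: "\<theta> = (\<Oplus>\<^bsub>T.T\<^esub>i\<in>{..<p}. T.pure (x i) (y i))"
      using T.tensor_as_sum[OF \<theta>(1)] by auto
    have a: "\<forall>z\<in>carrier A. (\<Oplus>\<^bsub>A\<^esub>i\<in>{..<p}. x i \<otimes>\<^bsub>A\<^esub> z \<otimes>\<^bsub>A\<^esub> y i) = l j z \<odot>\<^bsub>A\<^esub> \<one>\<^bsub>A\<^esub>"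
    proof
      fix z assume z: "z \<in> carrier A"
      have "(\<Oplus>\<^bsub>A\<^esub>i\<in>{..<p}. x i \<otimes>\<^bsub>A\<^esub> z \<otimes>\<^bsub>A\<^esub> y i) = (\<Oplus>\<^bsub>A\<^esub>i\<in>{..<p}. \<phi> (T.pure (x i) (y i)) z)"
        using xy z \<phi>p by (intro C.M.finsum_cong') auto
      also have "\<dots> = \<phi> \<theta> z" unfolding sum using xy z pc by (intro ev_sum[symmetric]) auto
      finally show "(\<Oplus>\<^bsub>A\<^esub>i\<in>{..<p}. x i \<otimes>\<^bsub>A\<^esub> z \<otimes>\<^bsub>A\<^esub> y i) = l j z \<odot>\<^bsub>A\<^esub> \<one>\<^bsub>A\<^esub>" using \<theta>(2) z by simp
    qed
    have b: "\<forall>i<p. x i \<in> carrier A \<and> y i \<in> carrier A" using xy by blast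
    show ?thesis
      unfolding family_def by (rule exI[of _ p], rule exI[of _ x], rule exI[of _ y], rule conjI[OF b a])
  qed
  then obtain p x y where "\<And>j. j < q \<Longrightarrow> family j (p j) (x j) (y j)" by metis
  then have xy: "\<And>j i. j < q \<Longrightarrow> i < p j \<Longrightarrow> x j i \<in> carrier A"
      "\<And>j i. j < q \<Longrightarrow> i < p j \<Longrightarrow> y j i \<in> carrier A"
    and l: "\<And>j z. j < q \<Longrightarrow> z \<in> carrier A \<Longrightarrow> (\<Oplus>\<^bsub>A\<^esub>i\<in>{..<p j}. x j i \<otimes>\<^bsub>A\<^esub> z \<otimes>\<^bsub>A\<^esub> y j i) = l j z \<odot>\<^bsub>A\<^esub> \<one>\<^bsub>A\<^esub>"
    unfolding family_def by blast+
  have left: "\<phi> (\<Oplus>\<^bsub>T.T\<^esub>i\<in>{..<p j}. T.pure (c \<otimes>\<^bsub>A\<^esub> x j i) (y j i)) z = l j z \<odot>\<^bsub>A\<^esub> c"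
    if c: "c \<in> carrier A" and j: "j < q" and z: "z \<in> carrier A" for c j z
  proof -
    have "\<phi> (\<Oplus>\<^bsub>T.T\<^esub>i\<in>{..<p j}. T.pure (c \<otimes>\<^bsub>A\<^esub> x j i) (y j i)) z = (\<Oplus>\<^bsub>A\<^esub>i\<in>{..<p j}. \<phi> (T.pure (c \<otimes>\<^bsub>A\<^esub> x j i) (y j i)) z)"
      using z c xy[OF j] pc by (intro ev_sum) auto
    also have "\<dots> = (\<Oplus>\<^bsub>A\<^esub>i\<in>{..<p j}. c \<otimes>\<^bsub>A\<^esub> (x j i \<otimes>\<^bsub>A\<^esub> z \<otimes>\<^bsub>A\<^esub> y j i))"
      using z c xy[OF j] \<phi>p by (intro C.M.finsum_cong') (auto simp: A.m_assoc)
    also have "\<dots> = c \<otimes>\<^bsub>A\<^esub> (l j z \<odot>\<^bsub>A\<^esub> \<one>\<^bsub>A\<^esub>)"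
      unfolding l[OF j z, symmetric] using z c xy[OF j]
      by (intro module_hom_sum[OF C.mod C.mod R_algebraD(3)[OF alg c], symmetric]) auto
    also have "\<dots> = l j z \<odot>\<^bsub>A\<^esub> c"
      using module_homD(3)[OF R_algebraD(3)[OF alg c]] C.l_closed[OF j z] c by simp
    finally show ?thesis .
  qed
  have right: "\<phi> (\<Oplus>\<^bsub>T.T\<^esub>i\<in>{..<p j}. T.pure (x j i) (y j i \<otimes>\<^bsub>A\<^esub> c)) z = l j z \<odot>\<^bsub>A\<^esub> c"
    if c: "c \<in> carrier A" and j: "j < q" and z: "z \<in> carrier A" for c j z
  proof -
    have "\<phi> (\<Oplus>\<^bsub>T.T\<^esub>i\<in>{..<p j}. T.pure (x j i) (y j i \<otimes>\<^bsub>A\<^esub> c)) z = (\<Oplus>\<^bsub>A\<^esub>i\<in>{..<p j}. \<phi> (T.pure (x j i) (y j i \<otimes>\<^bsub>A\<^esub> c)) z)"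
      using z c xy[OF j] pc by (intro ev_sum) auto
    also have "\<dots> = (\<Oplus>\<^bsub>A\<^esub>i\<in>{..<p j}. x j i \<otimes>\<^bsub>A\<^esub> z \<otimes>\<^bsub>A\<^esub> y j i \<otimes>\<^bsub>A\<^esub> c)"
      using z c xy[OF j] \<phi>p by (intro C.M.finsum_cong') (auto simp: A.m_assoc)
    also have "\<dots> = (l j z \<odot>\<^bsub>A\<^esub> \<one>\<^bsub>A\<^esub>) \<otimes>\<^bsub>A\<^esub> c"
      unfolding l[OF j z, symmetric] using z c xy[OF j]
      by (intro module_hom_sum[OF C.mod C.mod R_algebraD(4)[OF alg c], symmetric]) auto
    also have "\<dots> = l j z \<odot>\<^bsub>A\<^esub> c"
      using module_homD(3)[OF R_algebraD(4)[OF alg c]] C.l_closed[OF j z] c by simp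
    finally show ?thesis .
  qed
  have sumc: "(\<Oplus>\<^bsub>T.T\<^esub>i\<in>{..<p j}. T.pure (c \<otimes>\<^bsub>A\<^esub> x j i) (y j i)) \<in> carrier T.T"
    "(\<Oplus>\<^bsub>T.T\<^esub>i\<in>{..<p j}. T.pure (x j i) (y j i \<otimes>\<^bsub>A\<^esub> c)) \<in> carrier T.T" if "c \<in> carrier A" "j < q" for c j
    using that xy pc by (auto intro!: T.T.M.finsum_closed)
  have P1: "(\<Oplus>\<^bsub>T.T\<^esub>i\<in>{..<p j}. T.pure (c \<otimes>\<^bsub>A\<^esub> x j i) (y j i)) = (\<Oplus>\<^bsub>T.T\<^esub>i\<in>{..<p j}. T.pure (x j i) (y j i \<otimes>\<^bsub>A\<^esub> c))"
    if "c \<in> carrier A" "j < q" for c j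
    by (rule inj) (use that sumc left right in auto)
  have P2: "(\<Oplus>\<^bsub>T.T\<^esub>j\<in>{..<q}. \<Oplus>\<^bsub>T.T\<^esub>i\<in>{..<p j}. T.pure (n j \<otimes>\<^bsub>A\<^esub> x j i) (y j i)) = T.pure \<one>\<^bsub>A\<^esub> \<one>\<^bsub>A\<^esub>"
  proof (rule inj)
    fix z assume z: "z \<in> carrier A"
    have "\<phi> (\<Oplus>\<^bsub>T.T\<^esub>j\<in>{..<q}. \<Oplus>\<^bsub>T.T\<^esub>i\<in>{..<p j}. T.pure (n j \<otimes>\<^bsub>A\<^esub> x j i) (y j i)) z =
        (\<Oplus>\<^bsub>A\<^esub>j\<in>{..<q}. \<phi> (\<Oplus>\<^bsub>T.T\<^esub>i\<in>{..<p j}. T.pure (n j \<otimes>\<^bsub>A\<^esub> x j i) (y j i)) z)"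
      using z sumc C.n_closed by (intro ev_sum) auto
    also have "\<dots> = (\<Oplus>\<^bsub>A\<^esub>j\<in>{..<q}. l j z \<odot>\<^bsub>A\<^esub> n j)"
      using z C.n_closed left C.l_closed by (intro C.M.finsum_cong') auto
    also have "\<dots> = z" by (rule C.expand[OF z])
    also have "z = \<phi> (T.pure \<one>\<^bsub>A\<^esub> \<one>\<^bsub>A\<^esub>) z" using \<phi>p z by simp
    finally show "\<phi> (\<Oplus>\<^bsub>T.T\<^esub>j\<in>{..<q}. \<Oplus>\<^bsub>T.T\<^esub>i\<in>{..<p j}. T.pure (n j \<otimes>\<^bsub>A\<^esub> x j i) (y j i)) z =
        \<phi> (T.pure \<one>\<^bsub>A\<^esub> \<one>\<^bsub>A\<^esub>) z" .
  qed (use sumc C.n_closed pc in \<open>auto intro!: T.T.M.finsum_closed\<close>)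
  obtain s where s: "\<And>j. s j \<in> carrier R" "(\<Oplus>\<^bsub>R\<^esub>j\<in>{..<q}. s j \<otimes>\<^bsub>R\<^esub> l j \<one>\<^bsub>A\<^esub>) = \<one>\<^bsub>R\<^esub>"
    using C.unit_functional[OF alg fp(2)] by blast
  have "separable_families R A q p x y n s l"
    unfolding separable_families_def
    using C.n_closed s C.l_hom xy P1 P2 l by blast
  then show ?thesis by blast
qed

text \<open>The identities hold in the tensor product, so every bilinear map turns them into
  identities between sums. This is the form in which they reach operators.\<close>

lemma separable_families_bilinear:
  assumes alg: "R_algebra R A" and sf: "separable_families R A q p x y t s \<mu>"
    and V: "module R V" and b: "bilinear_map R A A V b"
  shows "c \<in> carrier A \<Longrightarrow> j < q \<Longrightarrow>
      (\<Oplus>\<^bsub>V\<^esub>i\<in>{..<p j}. b (c \<otimes>\<^bsub>A\<^esub> x j i) (y j i)) = (\<Oplus>\<^bsub>V\<^esub>i\<in>{..<p j}. b (x j i) (y j i \<otimes>\<^bsub>A\<^esub> c))"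
    and "(\<Oplus>\<^bsub>V\<^esub>j\<in>{..<q}. \<Oplus>\<^bsub>V\<^esub>i\<in>{..<p j}. b (t j \<otimes>\<^bsub>A\<^esub> x j i) (y j i)) = b \<one>\<^bsub>A\<^esub> \<one>\<^bsub>A\<^esub>"
proof -
  let ?A' = "opposite_algebra A"
  interpret A: ring A by (rule R_algebraD(2)[OF alg])
  interpret M: module R A by (rule R_algebraD(1)[OF alg])
  interpret V: module R V by (rule V)
  interpret O: module R ?A' by (rule module_opposite[OF R_algebraD(1)[OF alg]])
  interpret T: tensor_modules R A ?A' by unfold_locales
  have b': "bilinear_map R A ?A' V b" using b by simp
  obtain g where g: "g \<in> module_hom R T.T V" "\<And>a c. a \<in> carrier A \<Longrightarrow> c \<in> carrier ?A' \<Longrightarrow> g (T.pure a c) = b a c"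
    using T.tensor_lift[OF V b'] by blast
  have gp: "g (T.pure a c) = b a c" if "a \<in> carrier A" "c \<in> carrier A" for a c using g(2) that by simp
  have pc: "T.pure a b \<in> carrier T.T" if "a \<in> carrier A" "b \<in> carrier A" for a b
    using T.pure_closed that by simp
  have bc: "b a c \<in> carrier V" if "a \<in> carrier A" "c \<in> carrier A" for a c using bilinear_mapD(3)[OF b that] .
  have xy: "x j i \<in> carrier A" "y j i \<in> carrier A" if "j < q" "i < p j" for i j
    using sf that by (auto simp: separable_families_def)
  have tc: "t j \<in> carrier A" if "j < q" for j using sf that by (auto simp: separable_families_def)
  have sum: "(\<Oplus>\<^bsub>V\<^esub>i\<in>{..<k}. b (u i) (v i)) = g (\<Oplus>\<^bsub>T.T\<^esub>i\<in>{..<k}. T.pure (u i) (v i))"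
    if uv: "\<And>i. i < k \<Longrightarrow> u i \<in> carrier A" "\<And>i. i < k \<Longrightarrow> v i \<in> carrier A" for k :: nat and u v
  proof -
    have "(\<Oplus>\<^bsub>V\<^esub>i\<in>{..<k}. b (u i) (v i)) = (\<Oplus>\<^bsub>V\<^esub>i\<in>{..<k}. g (T.pure (u i) (v i)))"
      using uv bc gp by (intro V.finsum_cong') auto
    also have "\<dots> = g (\<Oplus>\<^bsub>T.T\<^esub>i\<in>{..<k}. T.pure (u i) (v i))"
      using uv pc by (intro module_hom_sum[OF T.T_module V g(1), symmetric]) auto
    finally show ?thesis .
  qed
  show "(\<Oplus>\<^bsub>V\<^esub>i\<in>{..<p j}. b (c \<otimes>\<^bsub>A\<^esub> x j i) (y j i)) = (\<Oplus>\<^bsub>V\<^esub>i\<in>{..<p j}. b (x j i) (y j i \<otimes>\<^bsub>A\<^esub> c))"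
    if c: "c \<in> carrier A" and j: "j < q"
  proof -
    have "(\<Oplus>\<^bsub>T.T\<^esub>i\<in>{..<p j}. T.pure (c \<otimes>\<^bsub>A\<^esub> x j i) (y j i)) = (\<Oplus>\<^bsub>T.T\<^esub>i\<in>{..<p j}. T.pure (x j i) (y j i \<otimes>\<^bsub>A\<^esub> c))"
      using sf c j unfolding separable_families_def by blast
    then show ?thesis using c xy[OF j] by (simp add: sum)
  qed
  have "(\<Oplus>\<^bsub>V\<^esub>j\<in>{..<q}. \<Oplus>\<^bsub>V\<^esub>i\<in>{..<p j}. b (t j \<otimes>\<^bsub>A\<^esub> x j i) (y j i)) =
      (\<Oplus>\<^bsub>V\<^esub>j\<in>{..<q}. g (\<Oplus>\<^bsub>T.T\<^esub>i\<in>{..<p j}. T.pure (t j \<otimes>\<^bsub>A\<^esub> x j i) (y j i)))"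
    using tc xy pc by (intro V.finsum_cong' sum) (auto intro!: module_homD(1)[OF g(1)] T.T.M.finsum_closed)
  also have "\<dots> = g (\<Oplus>\<^bsub>T.T\<^esub>j\<in>{..<q}. \<Oplus>\<^bsub>T.T\<^esub>i\<in>{..<p j}. T.pure (t j \<otimes>\<^bsub>A\<^esub> x j i) (y j i))"
    using tc xy pc by (intro module_hom_sum[OF T.T_module V g(1), symmetric]) (auto intro!: T.T.M.finsum_closed)
  also have "\<dots> = b \<one>\<^bsub>A\<^esub> \<one>\<^bsub>A\<^esub>"
    using sf gp unfolding separable_families_def by simp
  finally show "(\<Oplus>\<^bsub>V\<^esub>j\<in>{..<q}. \<Oplus>\<^bsub>V\<^esub>i\<in>{..<p j}. b (t j \<otimes>\<^bsub>A\<^esub> x j i) (y j i)) = b \<one>\<^bsub>A\<^esub> \<one>\<^bsub>A\<^esub>" .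
qed

text \<open>Matrices with entries in the factor \<open>R\<close>, made a module so that the
  universal property of the tensor product applies to \<open>\<rho>' a * h * \<rho> c\<close>. The
  values of \<open>mult\<close> and \<open>one\<close> are fillers.\<close>

definition finmat_module :: "('a, 'r) ring_scheme \<Rightarrow> ('a, 'a prodring finmat) module" where
  "finmat_module R = \<lparr>carrier = {H. smul (emb R \<one>\<^bsub>R\<^esub>) H = H}, monoid.mult = (*), one = 0, zero = 0, add = (+),
     module.smult = (\<lambda>r H. smul (emb R r) H)\<rparr>"

lemma finmat_module_simps [simp]:
  "H \<in> carrier (finmat_module R) \<longleftrightarrow> smul (emb R \<one>\<^bsub>R\<^esub>) H = H" "zero (finmat_module R) = 0"
  "H \<oplus>\<^bsub>finmat_module R\<^esub> G = H + G" "r \<odot>\<^bsub>finmat_module R\<^esub> H = smul (emb R r) H"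
  by (simp_all add: finmat_module_def)

lemma (in cring) finmat_module: "module R (finmat_module R)"
proof (intro moduleI abelian_groupI is_cring)
  fix H assume H: "H \<in> carrier (finmat_module R)"
  have "smul u (- H) = - smul u H" for u by (rule finmat_eqI) simp
  then show "\<exists>G\<in>carrier (finmat_module R). G \<oplus>\<^bsub>finmat_module R\<^esub> H = \<zero>\<^bsub>finmat_module R\<^esub>"
    using H by (intro bexI[of _ "- H"]) simp_all
qed (simp_all add: smul_simps emb_hom emb_one_mult add.assoc add.commute)

lemma (in cring) finsum_finmat_module:
  "(\<And>i. i \<in> I \<Longrightarrow> f i \<in> carrier (finmat_module R)) \<Longrightarrow> (\<Oplus>\<^bsub>finmat_module R\<^esub>i\<in>I. f i) = (\<Sum>i\<in>I. f i)"
proof (induction I rule: infinite_finite_induct)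
  interpret V: module R "finmat_module R" by (rule finmat_module)
  case (insert a I)
  have "(\<Oplus>\<^bsub>finmat_module R\<^esub>i\<in>insert a I. f i) = f a \<oplus>\<^bsub>finmat_module R\<^esub> (\<Oplus>\<^bsub>finmat_module R\<^esub>i\<in>I. f i)"
    using insert by (intro V.finsum_insert) auto
  then show ?case using insert by simp
next
  interpret V: module R "finmat_module R" by (rule finmat_module)
  case (infinite I)
  then show ?case by (simp add: V.finsum_infinite)
next
  interpret V: module R "finmat_module R" by (rule finmat_module)
  case empty
  show ?case by simp
qed

text \<open>Multiplicativity is left to the later lemmas, so that left multiplications, which
  preserve products, and right multiplications, which reverse them, are both instances.\<close>

locale matrix_action = cring R for R :: "('a, 'r) ring_scheme" (structure) +
  fixes A :: "('a, 'b) module" and e and \<rho> :: "'b \<Rightarrow> 'a prodring finmat"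
  assumes alg: "R_algebra R A" and lin: "\<rho> \<in> module_hom R A (finmat_module R)" and one: "\<rho> \<one>\<^bsub>A\<^esub> = e"
    and corner: "a \<in> carrier A \<Longrightarrow> e * \<rho> a = \<rho> a" "a \<in> carrier A \<Longrightarrow> \<rho> a * e = \<rho> a"
begin

lemma linD: "a \<in> carrier A \<Longrightarrow> smul (emb R \<one>) (\<rho> a) = \<rho> a"
  "a \<in> carrier A \<Longrightarrow> b \<in> carrier A \<Longrightarrow> \<rho> (a \<oplus>\<^bsub>A\<^esub> b) = \<rho> a + \<rho> b"
  "r \<in> carrier R \<Longrightarrow> a \<in> carrier A \<Longrightarrow> \<rho> (r \<odot>\<^bsub>A\<^esub> a) = smul (emb R r) (\<rho> a)"
  using module_homD[OF lin] by simp_all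

lemma normalized:
  assumes sf: "separable_families R A q p x y t s \<mu>"
  shows "(\<Sum>j<q. smul (emb R (s j)) (\<Sum>i<p j. \<rho> (x j i \<otimes>\<^bsub>A\<^esub> y j i))) = e"
proof -
  interpret A: ring A by (rule R_algebraD(2)[OF alg])
  have M: "module R A" by (rule R_algebraD(1)[OF alg])
  have xy: "x j i \<in> carrier A" "y j i \<in> carrier A" if "j < q" "i < p j" for i j
    using sf that by (auto simp: separable_families_def)
  have s: "s j \<in> carrier R" and \<mu>: "\<mu> j \<one>\<^bsub>A\<^esub> \<in> carrier R" if "j < q" for j
  proof -
    show "s j \<in> carrier R" using sf that by (auto simp: separable_families_def)
    have "\<mu> j \<in> module_hom R A (reg_module R)" using sf that by (auto simp: separable_families_def)
    then show "\<mu> j \<one>\<^bsub>A\<^esub> \<in> carrier R" using module_homD(1) by fastforce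
  qed
  have "smul (emb R (s j)) (\<Sum>i<p j. \<rho> (x j i \<otimes>\<^bsub>A\<^esub> y j i)) = smul (emb R (s j \<otimes> \<mu> j \<one>\<^bsub>A\<^esub>)) e" if j: "j < q" for j
  proof -
    have "(\<Sum>i<p j. \<rho> (x j i \<otimes>\<^bsub>A\<^esub> y j i)) = (\<Oplus>\<^bsub>finmat_module R\<^esub>i\<in>{..<p j}. \<rho> (x j i \<otimes>\<^bsub>A\<^esub> y j i))"
      using xy[OF j] linD(1) by (intro finsum_finmat_module[symmetric]) simp
    also have "\<dots> = \<rho> (\<Oplus>\<^bsub>A\<^esub>i\<in>{..<p j}. x j i \<otimes>\<^bsub>A\<^esub> y j i)"
      using xy[OF j] by (intro module_hom_sum[OF M finmat_module lin, symmetric]) simp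
    also have "(\<Oplus>\<^bsub>A\<^esub>i\<in>{..<p j}. x j i \<otimes>\<^bsub>A\<^esub> y j i) = (\<Oplus>\<^bsub>A\<^esub>i\<in>{..<p j}. x j i \<otimes>\<^bsub>A\<^esub> \<one>\<^bsub>A\<^esub> \<otimes>\<^bsub>A\<^esub> y j i)"
      using xy[OF j] by (intro A.finsum_cong') auto
    also have "\<dots> = \<mu> j \<one>\<^bsub>A\<^esub> \<odot>\<^bsub>A\<^esub> \<one>\<^bsub>A\<^esub>" using sf j unfolding separable_families_def by blast
    also have "\<rho> \<dots> = smul (emb R (\<mu> j \<one>\<^bsub>A\<^esub>)) e" using linD(3) \<mu>[OF j] one by simp
    finally show ?thesis using s[OF j] \<mu>[OF j] by (simp add: smul_simps emb_hom)
  qed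
  then have "(\<Sum>j<q. smul (emb R (s j)) (\<Sum>i<p j. \<rho> (x j i \<otimes>\<^bsub>A\<^esub> y j i))) = smul (\<Sum>j<q. emb R (s j \<otimes> \<mu> j \<one>\<^bsub>A\<^esub>)) e"
    by (simp add: smul_sum_left)
  also have "(\<Sum>j<q. emb R (s j \<otimes> \<mu> j \<one>\<^bsub>A\<^esub>)) = emb R (\<Oplus>j\<in>{..<q}. s j \<otimes> \<mu> j \<one>\<^bsub>A\<^esub>)"
    using s \<mu> by (intro emb_sum[symmetric]) simp
  also have "(\<Oplus>j\<in>{..<q}. s j \<otimes> \<mu> j \<one>\<^bsub>A\<^esub>) = \<one>" using sf unfolding separable_families_def by blast
  also have "smul (emb R \<one>) e = e" using linD(1)[of "\<one>\<^bsub>A\<^esub>"] one by simp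
  finally show ?thesis .
qed

end

text \<open>The separability identities pushed through the bilinear map
  \<open>\<rho>' a * h * \<rho> c\<close> and through its flip
  \<open>\<rho>' c * h * \<rho> a\<close>. The first two identities suit actions that preserve
  products, the last two those that reverse them.\<close>

lemma sandwich_identities:
  assumes \<rho>': "matrix_action R A e \<rho>'" and \<rho>: "matrix_action R A e \<rho>"
    and sf: "separable_families R A q p x y t s \<mu>"
  shows "c \<in> carrier A \<Longrightarrow> j < q \<Longrightarrow>
      (\<Sum>i<p j. \<rho>' (c \<otimes>\<^bsub>A\<^esub> x j i) * h * \<rho> (y j i)) = (\<Sum>i<p j. \<rho>' (x j i) * h * \<rho> (y j i \<otimes>\<^bsub>A\<^esub> c))"
    "(\<Sum>j<q. \<Sum>i<p j. \<rho>' (t j \<otimes>\<^bsub>A\<^esub> x j i) * h * \<rho> (y j i)) = e * h * e"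
    "c \<in> carrier A \<Longrightarrow> j < q \<Longrightarrow>
      (\<Sum>i<p j. \<rho>' (y j i) * h * \<rho> (c \<otimes>\<^bsub>A\<^esub> x j i)) = (\<Sum>i<p j. \<rho>' (y j i \<otimes>\<^bsub>A\<^esub> c) * h * \<rho> (x j i))"
    "(\<Sum>j<q. \<Sum>i<p j. \<rho>' (y j i) * h * \<rho> (t j \<otimes>\<^bsub>A\<^esub> x j i)) = e * h * e"
proof -
  interpret P': matrix_action R A e \<rho>' by fact
  interpret P: matrix_action R A e \<rho> by fact
  interpret A: ring A by (rule R_algebraD(2)[OF P.alg])
  have xy: "x j i \<in> carrier A" "y j i \<in> carrier A" if "j < q" "i < p j" for i j
    using sf that by (auto simp: separable_families_def)
  have t: "t j \<in> carrier A" if "j < q" for j using sf that by (auto simp: separable_families_def)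
  have b: "bilinear_map R A A (finmat_module R) (\<lambda>a c. \<rho>' a * h * \<rho> c)"
    "bilinear_map R A A (finmat_module R) (\<lambda>a c. \<rho>' c * h * \<rho> a)"
  proof -
    have one: "smul (emb R \<one>\<^bsub>R\<^esub>) (\<rho>' a * h * \<rho> c) = \<rho>' a * h * \<rho> c" if "a \<in> carrier A" for a c
    proof -
      have "smul (emb R \<one>\<^bsub>R\<^esub>) (\<rho>' a * h * \<rho> c) = smul (emb R \<one>\<^bsub>R\<^esub>) (\<rho>' a) * h * \<rho> c"
        by (simp only: smul_simps(5))
      then show ?thesis by (simp only: P'.linD(1)[OF that])
    qed
    have s: "smul u Y * h * Z = smul u (Y * h * Z)" "Y * h * smul u Z = smul u (Y * h * Z)" for u Y Z
      by (simp_all only: smul_simps(5,6))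
    show "bilinear_map R A A (finmat_module R) (\<lambda>a c. \<rho>' a * h * \<rho> c)"
      "bilinear_map R A A (finmat_module R) (\<lambda>a c. \<rho>' c * h * \<rho> a)"
      unfolding bilinear_map_def
      by (intro conjI ballI module_homI;
          simp add: one P.linD(2,3) P'.linD(2,3) s distrib_left distrib_right)+
  qed
  have V: "module R (finmat_module R)" by (rule P'.finmat_module)
  have cl: "\<rho>' a * h * \<rho> c \<in> carrier (finmat_module R)" if "a \<in> carrier A" "c \<in> carrier A" for a c
    using bilinear_mapD(3)[OF b(1) that] .
  have sum: "(\<Oplus>\<^bsub>finmat_module R\<^esub>i\<in>{..<k}. \<rho>' (u i) * h * \<rho> (v i)) = (\<Sum>i<k. \<rho>' (u i) * h * \<rho> (v i))"
    if "\<And>i. i < k \<Longrightarrow> u i \<in> carrier A" "\<And>i. i < k \<Longrightarrow> v i \<in> carrier A" for k :: nat and u v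
    using that cl by (intro P'.finsum_finmat_module) auto
  have sumc: "(\<Sum>i<k. \<rho>' (u i) * h * \<rho> (v i)) \<in> carrier (finmat_module R)"
    if "\<And>i. i < k \<Longrightarrow> u i \<in> carrier A" "\<And>i. i < k \<Longrightarrow> v i \<in> carrier A" for k :: nat and u v
    using that cl by (simp add: smul_sum)
  note B = separable_families_bilinear[OF P.alg sf V]
  show "(\<Sum>i<p j. \<rho>' (c \<otimes>\<^bsub>A\<^esub> x j i) * h * \<rho> (y j i)) = (\<Sum>i<p j. \<rho>' (x j i) * h * \<rho> (y j i \<otimes>\<^bsub>A\<^esub> c))"
    if c: "c \<in> carrier A" and j: "j < q"
    using B(1)[OF b(1) c j] xy[OF j] c by (simp add: sum)
  show "(\<Sum>i<p j. \<rho>' (y j i) * h * \<rho> (c \<otimes>\<^bsub>A\<^esub> x j i)) = (\<Sum>i<p j. \<rho>' (y j i \<otimes>\<^bsub>A\<^esub> c) * h * \<rho> (x j i))"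
    if c: "c \<in> carrier A" and j: "j < q"
    using B(1)[OF b(2) c j] xy[OF j] c by (simp add: sum)
  have sum2: "(\<Oplus>\<^bsub>finmat_module R\<^esub>j\<in>{..<q}. \<Oplus>\<^bsub>finmat_module R\<^esub>i\<in>{..<p j}. \<rho>' (u j i) * h * \<rho> (v j i)) =
      (\<Sum>j<q. \<Sum>i<p j. \<rho>' (u j i) * h * \<rho> (v j i))"
    if uv: "\<And>j i. j < q \<Longrightarrow> i < p j \<Longrightarrow> u j i \<in> carrier A" "\<And>j i. j < q \<Longrightarrow> i < p j \<Longrightarrow> v j i \<in> carrier A" for u v
  proof -
    have "(\<Oplus>\<^bsub>finmat_module R\<^esub>j\<in>{..<q}. \<Oplus>\<^bsub>finmat_module R\<^esub>i\<in>{..<p j}. \<rho>' (u j i) * h * \<rho> (v j i)) =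
        (\<Oplus>\<^bsub>finmat_module R\<^esub>j\<in>{..<q}. \<Sum>i<p j. \<rho>' (u j i) * h * \<rho> (v j i))"
      by (rule abelian_monoid.finsum_cong'[OF module.axioms(2)[OF V, THEN abelian_group.axioms(1)] refl])
        (use uv sumc in \<open>auto simp: sum simp del: finmat_module_simps\<close>)
    also have "\<dots> = (\<Sum>j<q. \<Sum>i<p j. \<rho>' (u j i) * h * \<rho> (v j i))"
      by (rule P'.finsum_finmat_module) (use uv sumc in \<open>auto simp del: finmat_module_simps\<close>)
    finally show ?thesis .
  qed
  have "(\<Sum>j<q. \<Sum>i<p j. \<rho>' (t j \<otimes>\<^bsub>A\<^esub> x j i) * h * \<rho> (y j i)) =
      (\<Oplus>\<^bsub>finmat_module R\<^esub>j\<in>{..<q}. \<Oplus>\<^bsub>finmat_module R\<^esub>i\<in>{..<p j}. \<rho>' (t j \<otimes>\<^bsub>A\<^esub> x j i) * h * \<rho> (y j i))"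
    using xy t by (intro sum2[symmetric]) auto
  also have "\<dots> = e * h * e" unfolding B(2)[OF b(1)] P.one P'.one by (rule refl)
  finally show "(\<Sum>j<q. \<Sum>i<p j. \<rho>' (t j \<otimes>\<^bsub>A\<^esub> x j i) * h * \<rho> (y j i)) = e * h * e" .
  have "(\<Sum>j<q. \<Sum>i<p j. \<rho>' (y j i) * h * \<rho> (t j \<otimes>\<^bsub>A\<^esub> x j i)) =
      (\<Oplus>\<^bsub>finmat_module R\<^esub>j\<in>{..<q}. \<Oplus>\<^bsub>finmat_module R\<^esub>i\<in>{..<p j}. \<rho>' (y j i) * h * \<rho> (t j \<otimes>\<^bsub>A\<^esub> x j i))"
    using xy t by (intro sum2[symmetric]) auto
  also have "\<dots> = e * h * e" unfolding B(2)[OF b(2)] P.one P'.one by (rule refl)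
  finally show "(\<Sum>j<q. \<Sum>i<p j. \<rho>' (y j i) * h * \<rho> (t j \<otimes>\<^bsub>A\<^esub> x j i)) = e * h * e" .
qed

lemma separating_hom:
  assumes \<rho>': "matrix_action R A e \<rho>'" and \<rho>: "matrix_action R A e \<rho>"
    and mult': "\<And>a b. a \<in> carrier A \<Longrightarrow> b \<in> carrier A \<Longrightarrow> \<rho>' (a \<otimes>\<^bsub>A\<^esub> b) = \<rho>' a * \<rho>' b"
    and mult: "\<And>a b. a \<in> carrier A \<Longrightarrow> b \<in> carrier A \<Longrightarrow> \<rho> (a \<otimes>\<^bsub>A\<^esub> b) = \<rho> a * \<rho> b"
    and sf: "separable_families R A q p x y t s \<mu>"
  shows "separating e (carrier A) {..<q} (\<lambda>j. {..<p j}) x y t (\<lambda>j. emb R (s j)) \<rho>' \<rho>"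
proof -
  interpret P: matrix_action R A e \<rho> by fact
  note I = sandwich_identities[OF \<rho>' \<rho> sf]
  have xyt: "x j i \<in> carrier A" "y j i \<in> carrier A" "t j \<in> carrier A" if "j < q" "i < p j" for i j
    using sf that by (auto simp: separable_families_def)
  have t: "t j \<in> carrier A" if "j < q" for j using sf that by (auto simp: separable_families_def)
  have left: "\<rho>' c * average (\<lambda>j. {..<p j}) x y \<rho>' \<rho> j h = (\<Sum>i<p j. \<rho>' (c \<otimes>\<^bsub>A\<^esub> x j i) * h * \<rho> (y j i))"
    if "c \<in> carrier A" "j < q" for c j h
    unfolding average_def sum_distrib_left
    by (rule sum.cong) (use that xyt in \<open>auto simp: mult' mult.assoc\<close>)
  have right: "average (\<lambda>j. {..<p j}) x y \<rho>' \<rho> j h * \<rho> c = (\<Sum>i<p j. \<rho>' (x j i) * h * \<rho> (y j i \<otimes>\<^bsub>A\<^esub> c))"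
    if "c \<in> carrier A" "j < q" for c j h
    unfolding average_def sum_distrib_right
    by (rule sum.cong) (use that xyt in \<open>auto simp: mult mult.assoc\<close>)
  have "(\<Sum>j<q. \<rho>' (t j) * average (\<lambda>j. {..<p j}) x y \<rho>' \<rho> j h) = e * h * e" for h
    unfolding I(2)[symmetric] by (rule sum.cong) (use t left in auto)
  moreover have "(\<Sum>j<q. smul (emb R (s j)) (\<Sum>i<p j. \<rho> (x j i) * \<rho> (y j i))) = e"
    unfolding P.normalized[OF sf, symmetric]
    by (intro sum.cong refl arg_cong[where f = "smul _"]) (use xyt in \<open>auto simp: mult\<close>)
  ultimately show ?thesis
    unfolding separating_def using xyt t left right I(1) by (intro conjI ballI allI impI) simp_all
qed

text \<open>Reversal of products exchanges the roles of \<open>x\<close> and \<open>y\<close>: the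
  averages are sums of \<open>\<rho> (y j i) * h * \<rho> (x j i)\<close>, and normalization still
  involves the products of \<open>x j i\<close> with \<open>y j i\<close> in this order.\<close>

lemma separating_antihom:
  assumes \<rho>: "matrix_action R A e \<rho>"
    and mult: "\<And>a b. a \<in> carrier A \<Longrightarrow> b \<in> carrier A \<Longrightarrow> \<rho> (a \<otimes>\<^bsub>A\<^esub> b) = \<rho> b * \<rho> a"
    and sf: "separable_families R A q p x y t s \<mu>"
  shows "separating e (carrier A) {..<q} (\<lambda>j. {..<p j}) y x t (\<lambda>j. emb R (s j)) \<rho> \<rho>"
proof -
  interpret P: matrix_action R A e \<rho> by fact
  note I = sandwich_identities[OF \<rho> \<rho> sf]
  have xyt: "x j i \<in> carrier A" "y j i \<in> carrier A" "t j \<in> carrier A" if "j < q" "i < p j" for i j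
    using sf that by (auto simp: separable_families_def)
  have t: "t j \<in> carrier A" if "j < q" for j using sf that by (auto simp: separable_families_def)
  have left: "\<rho> c * average (\<lambda>j. {..<p j}) y x \<rho> \<rho> j h = (\<Sum>i<p j. \<rho> (y j i \<otimes>\<^bsub>A\<^esub> c) * h * \<rho> (x j i))"
    if "c \<in> carrier A" "j < q" for c j h
    unfolding average_def sum_distrib_left
    by (rule sum.cong) (use that xyt in \<open>auto simp: mult mult.assoc\<close>)
  have right: "average (\<lambda>j. {..<p j}) y x \<rho> \<rho> j h * \<rho> c = (\<Sum>i<p j. \<rho> (y j i) * h * \<rho> (c \<otimes>\<^bsub>A\<^esub> x j i))"
    if "c \<in> carrier A" "j < q" for c j h
    unfolding average_def sum_distrib_right
    by (rule sum.cong) (use that xyt in \<open>auto simp: mult mult.assoc\<close>)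
  have "(\<Sum>j<q. \<rho> (t j) * average (\<lambda>j. {..<p j}) y x \<rho> \<rho> j h) = e * h * e" for h
    unfolding I(4)[symmetric] by (rule sum.cong) (use t left I(3) in auto)
  moreover have "(\<Sum>j<q. smul (emb R (s j)) (\<Sum>i<p j. \<rho> (y j i) * \<rho> (x j i))) = e"
    unfolding P.normalized[OF sf, symmetric]
    by (intro sum.cong refl arg_cong[where f = "smul _"]) (use xyt in \<open>auto simp: mult\<close>)
  ultimately show ?thesis
    unfolding separating_def using xyt t left right I(3) by (intro conjI ballI allI impI) simp_all
qed


section \<open>Actions by multiplication\<close>

definition algebra_homs :: "('a, 'r) ring_scheme \<Rightarrow> ('a, 'b) module \<Rightarrow> ('a, 'c) module \<Rightarrow> ('b \<Rightarrow> 'c) set" where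
  "algebra_homs R A B = ring_hom A B \<inter> module_hom R A B"

lemma algebra_homsD:
  assumes "h \<in> algebra_homs R A B"
  shows "h \<in> module_hom R A B" "x \<in> carrier A \<Longrightarrow> h x \<in> carrier B"
    "x \<in> carrier A \<Longrightarrow> y \<in> carrier A \<Longrightarrow> h (x \<otimes>\<^bsub>A\<^esub> y) = h x \<otimes>\<^bsub>B\<^esub> h y" "h \<one>\<^bsub>A\<^esub> = \<one>\<^bsub>B\<^esub>"
  using assms by (auto simp: algebra_homs_def ring_hom_def Pi_iff)

locale algebra_coordinates = coordinates R M q n l
  for R :: "('a, 'r) ring_scheme" (structure) and M :: "('a, 'm) module" (structure) and q n l +
  assumes algM: "R_algebra R M"
begin

sublocale A: ring M by (rule R_algebraD(2)[OF algM])

definition left_mat :: "'m \<Rightarrow> 'a prodring finmat" where "left_mat a = mat_of (\<lambda>v. a \<otimes>\<^bsub>M\<^esub> v)"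
definition right_mat :: "'m \<Rightarrow> 'a prodring finmat" where "right_mat a = mat_of (\<lambda>v. v \<otimes>\<^bsub>M\<^esub> a)"

lemmas lh = R_algebraD(3)[OF algM] and rh = R_algebraD(4)[OF algM]

lemma actions:
  assumes C: "R_algebra R C" and \<gamma>: "\<gamma> \<in> algebra_homs R C M"
  shows "matrix_action R C unit_mat (\<lambda>c. left_mat (\<gamma> c))" "matrix_action R C unit_mat (\<lambda>c. right_mat (\<gamma> c))"
proof -
  interpret C: ring C by (rule R_algebraD(2)[OF C])
  note g = algebra_homsD[OF \<gamma>]
  have L: "left_mat (\<gamma> (a \<oplus>\<^bsub>C\<^esub> b)) = left_mat (\<gamma> a) + left_mat (\<gamma> b)"
    if "a \<in> carrier C" "b \<in> carrier C" for a b
  proof -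
    have "left_mat (\<gamma> (a \<oplus>\<^bsub>C\<^esub> b)) = mat_of (\<lambda>v. \<gamma> a \<otimes>\<^bsub>M\<^esub> v \<oplus>\<^bsub>M\<^esub> \<gamma> b \<otimes>\<^bsub>M\<^esub> v)"
      unfolding left_mat_def using that g(2) by (intro mat_of_cong) (simp add: module_homD(2)[OF g(1)] A.l_distr)
    then show ?thesis unfolding left_mat_def using mat_of_add[OF lh lh] that g(2) by simp
  qed
  have L2: "left_mat (\<gamma> (r \<odot>\<^bsub>C\<^esub> a)) = smul (emb R r) (left_mat (\<gamma> a))" if "r \<in> carrier R" "a \<in> carrier C" for r a
  proof -
    have "left_mat (\<gamma> (r \<odot>\<^bsub>C\<^esub> a)) = mat_of (\<lambda>v. r \<odot>\<^bsub>M\<^esub> (\<gamma> a \<otimes>\<^bsub>M\<^esub> v))"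
      unfolding left_mat_def using that g(2)
      by (intro mat_of_cong) (simp add: module_homD(3)[OF g(1)] module_homD(3)[OF rh])
    then show ?thesis unfolding left_mat_def using mat_of_smult[OF lh] that g(2) by simp
  qed
  have R: "right_mat (\<gamma> (a \<oplus>\<^bsub>C\<^esub> b)) = right_mat (\<gamma> a) + right_mat (\<gamma> b)"
    if "a \<in> carrier C" "b \<in> carrier C" for a b
  proof -
    have "right_mat (\<gamma> (a \<oplus>\<^bsub>C\<^esub> b)) = mat_of (\<lambda>v. v \<otimes>\<^bsub>M\<^esub> \<gamma> a \<oplus>\<^bsub>M\<^esub> v \<otimes>\<^bsub>M\<^esub> \<gamma> b)"
      unfolding right_mat_def using that g(2) by (intro mat_of_cong) (simp add: module_homD(2)[OF g(1)] A.r_distr)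
    then show ?thesis unfolding right_mat_def using mat_of_add[OF rh rh] that g(2) by simp
  qed
  have R2: "right_mat (\<gamma> (r \<odot>\<^bsub>C\<^esub> a)) = smul (emb R r) (right_mat (\<gamma> a))" if "r \<in> carrier R" "a \<in> carrier C" for r a
  proof -
    have "right_mat (\<gamma> (r \<odot>\<^bsub>C\<^esub> a)) = mat_of (\<lambda>v. r \<odot>\<^bsub>M\<^esub> (v \<otimes>\<^bsub>M\<^esub> \<gamma> a))"
      unfolding right_mat_def using that g(2)
      by (intro mat_of_cong) (simp add: module_homD(3)[OF g(1)] module_homD(3)[OF lh])
    then show ?thesis unfolding right_mat_def using mat_of_smult[OF rh] that g(2) by simp
  qed
  have 1: "left_mat (\<gamma> \<one>\<^bsub>C\<^esub>) = unit_mat" "right_mat (\<gamma> \<one>\<^bsub>C\<^esub>) = unit_mat"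
    unfolding left_mat_def right_mat_def unit_mat_def g(4) by (rule mat_of_cong; simp)+
  have cor: "unit_mat * left_mat a = left_mat a" "left_mat a * unit_mat = left_mat a"
    "unit_mat * right_mat a = right_mat a" "right_mat a * unit_mat = right_mat a"
    "smul (emb R \<one>) (left_mat a) = left_mat a" "smul (emb R \<one>) (right_mat a) = right_mat a" if "a \<in> carrier M" for a
    using that by (simp_all add: left_mat_def right_mat_def mat_of_corner lh rh smul_one_mat_of)
  show "matrix_action R C unit_mat (\<lambda>c. left_mat (\<gamma> c))"
    by (intro matrix_action.intro matrix_action_axioms.intro module_homI R.is_cring C)
      (simp_all add: L L2 1 g(2) cor)
  show "matrix_action R C unit_mat (\<lambda>c. right_mat (\<gamma> c))"
    by (intro matrix_action.intro matrix_action_axioms.intro module_homI R.is_cring C)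
      (simp_all add: R R2 1 g(2) cor)
qed

lemma left_mat_mult: "a \<in> carrier M \<Longrightarrow> b \<in> carrier M \<Longrightarrow> left_mat (a \<otimes>\<^bsub>M\<^esub> b) = left_mat a * left_mat b"
  unfolding left_mat_def mat_of_compose[OF lh lh] by (rule mat_of_cong) (simp add: A.m_assoc)

lemma right_mat_mult: "a \<in> carrier M \<Longrightarrow> b \<in> carrier M \<Longrightarrow> right_mat (a \<otimes>\<^bsub>M\<^esub> b) = right_mat b * right_mat a"
  unfolding right_mat_def mat_of_compose[OF rh rh] by (rule mat_of_cong) (simp add: A.m_assoc)

lemma left_right_commute: "a \<in> carrier M \<Longrightarrow> b \<in> carrier M \<Longrightarrow> right_mat b * left_mat a = left_mat a * right_mat b"
  unfolding right_mat_def left_mat_def mat_of_compose[OF rh lh] mat_of_compose[OF lh rh]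
  by (rule mat_of_cong) (simp add: A.m_assoc)

lemma left_mat_corner: "a \<in> carrier M \<Longrightarrow> unit_mat * left_mat a * unit_mat = left_mat a"
  "a \<in> carrier M \<Longrightarrow> unit_mat * right_mat a * unit_mat = right_mat a"
  unfolding left_mat_def right_mat_def by (simp_all add: mat_of_corner lh rh)

lemma commute_right_mat:
  assumes h: "h \<in> module_hom R M M" and a: "a \<in> carrier M" and c: "right_mat a * mat_of h = mat_of h * right_mat a"
    and v: "v \<in> carrier M"
  shows "h (v \<otimes>\<^bsub>M\<^esub> a) = h v \<otimes>\<^bsub>M\<^esub> a"
  using mat_of_inject[OF module_hom_compose[OF h rh[OF a]] module_hom_compose[OF rh[OF a] h] _ v] c
    mat_of_compose[OF rh[OF a] h] mat_of_compose[OF h rh[OF a]] by (simp add: right_mat_def)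

text \<open>An intertwining automorphism that commutes with all right multiplications is left
  multiplication by a unit.\<close>

lemma conjugating_unit:
  assumes LG: "LG_ring R" and good: "good_order unit_mat (proj_maximals R) S"
    and sep: "separating unit_mat K J I x y t s (\<lambda>c. left_mat (\<tau> c)) (\<lambda>c. left_mat (\<sigma> c))"
      "separating unit_mat K J I x y t s (\<lambda>c. left_mat (\<sigma> c)) (\<lambda>c. left_mat (\<tau> c))"
    and in_S: "\<And>a. a \<in> carrier M \<Longrightarrow> left_mat a \<in> S"
    and cl: "\<And>c. c \<in> K \<Longrightarrow> \<sigma> c \<in> carrier M" "\<And>c. c \<in> K \<Longrightarrow> \<tau> c \<in> carrier M"
    and right_linear: "\<And>h v. h \<in> module_hom R M M \<Longrightarrow> mat_of h \<in> S \<Longrightarrow> v \<in> carrier M \<Longrightarrow> h v = h \<one>\<^bsub>M\<^esub> \<otimes>\<^bsub>M\<^esub> v"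
  obtains w w' where "w \<in> carrier M" "w' \<in> carrier M" "w \<otimes>\<^bsub>M\<^esub> w' = \<one>\<^bsub>M\<^esub>" "w' \<otimes>\<^bsub>M\<^esub> w = \<one>\<^bsub>M\<^esub>"
    "\<And>c. c \<in> K \<Longrightarrow> w \<otimes>\<^bsub>M\<^esub> \<sigma> c = \<tau> c \<otimes>\<^bsub>M\<^esub> w"
proof -
  have "\<exists>h\<in>module_hom R M M. \<exists>g\<in>module_hom R M M. mat_of h \<in> S \<and>
      (\<forall>v\<in>carrier M. g (h v) = v \<and> h (g v) = v) \<and>
      (\<forall>c\<in>K. \<forall>v\<in>carrier M. \<tau> c \<otimes>\<^bsub>M\<^esub> h v = h (\<sigma> c \<otimes>\<^bsub>M\<^esub> v))"
    by (rule intertwining_automorphism[OF LG good sep[unfolded left_mat_def]])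
      (use in_S cl lh in \<open>auto simp: left_mat_def\<close>)
  then obtain h g where h: "h \<in> module_hom R M M" "mat_of h \<in> S" and g: "g \<in> module_hom R M M"
    and gh: "\<And>v. v \<in> carrier M \<Longrightarrow> g (h v) = v" and hg: "\<And>v. v \<in> carrier M \<Longrightarrow> h (g v) = v"
    and comm: "\<And>c v. c \<in> K \<Longrightarrow> v \<in> carrier M \<Longrightarrow> \<tau> c \<otimes>\<^bsub>M\<^esub> h v = h (\<sigma> c \<otimes>\<^bsub>M\<^esub> v)"
    by blast
  define w where "w = h \<one>\<^bsub>M\<^esub>"
  define w' where "w' = g \<one>\<^bsub>M\<^esub>"
  have w: "w \<in> carrier M" "w' \<in> carrier M" 
    unfolding w_def w'_def by (rule module_homD(1)[OF h(1) A.one_closed], rule module_homD(1)[OF g A.one_closed])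
  have hw: "h v = w \<otimes>\<^bsub>M\<^esub> v" if "v \<in> carrier M" for v unfolding w_def by (rule right_linear[OF h that])
  have ww': "w \<otimes>\<^bsub>M\<^esub> w' = \<one>\<^bsub>M\<^esub>" using hw[OF w(2)] hg[OF A.one_closed] by (simp add: w'_def)
  have h1: "h (w' \<otimes>\<^bsub>M\<^esub> w) = h \<one>\<^bsub>M\<^esub>" using w ww' by (simp add: hw A.m_assoc[symmetric])
  have "w' \<otimes>\<^bsub>M\<^esub> w = g (h (w' \<otimes>\<^bsub>M\<^esub> w))" by (rule gh[symmetric]) (rule A.m_closed[OF w(2,1)])
  also have "\<dots> = \<one>\<^bsub>M\<^esub>" unfolding h1 by (rule gh[OF A.one_closed])
  finally have w'w: "w' \<otimes>\<^bsub>M\<^esub> w = \<one>\<^bsub>M\<^esub>" .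
  have "w \<otimes>\<^bsub>M\<^esub> \<sigma> c = \<tau> c \<otimes>\<^bsub>M\<^esub> w" if c: "c \<in> K" for c
    using comm[OF c, of "\<one>\<^bsub>M\<^esub>"] cl[OF c] hw[of "\<sigma> c"] by (simp add: w_def)
  then show thesis using that w ww' w'w by blast
qed

end

text \<open>\<open>\<theta>\<close> followed by conjugation with \<open>w\<close> is an isomorphism
  from \<open>S1\<close> to \<open>S2\<close> carrying \<open>\<gamma>1\<close> to
  \<open>\<gamma>2\<close>, hence one centralizer to the other. These centralizers are the embedded
  copies of \<open>A\<close> and \<open>B\<close>.\<close>

lemma algebra_iso_of_conjugate:
  assumes S2: "R_algebra R S2" and M: "module R A" "module R B" "ring A" "ring B"
    and jA: "jA \<in> algebra_homs R A S1" "inj_on jA (carrier A)"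
    and jB: "jB \<in> algebra_homs R B S2" "inj_on jB (carrier B)"
    and cA: "jA ` carrier A = {x \<in> carrier S1. \<forall>c\<in>K. x \<otimes>\<^bsub>S1\<^esub> \<gamma>1 c = \<gamma>1 c \<otimes>\<^bsub>S1\<^esub> x}"
    and cB: "jB ` carrier B = {x \<in> carrier S2. \<forall>c\<in>K. x \<otimes>\<^bsub>S2\<^esub> \<gamma>2 c = \<gamma>2 c \<otimes>\<^bsub>S2\<^esub> x}"
    and \<gamma>: "\<And>c. c \<in> K \<Longrightarrow> \<gamma>1 c \<in> carrier S1" "\<And>c. c \<in> K \<Longrightarrow> \<gamma>2 c \<in> carrier S2"
    and \<theta>: "\<theta> \<in> algebra_homs R S1 S2" "bij_betw \<theta> (carrier S1) (carrier S2)" and S1: "R_algebra R S1"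
    and w: "w \<in> carrier S2" "w' \<in> carrier S2" "w \<otimes>\<^bsub>S2\<^esub> w' = \<one>\<^bsub>S2\<^esub>" "w' \<otimes>\<^bsub>S2\<^esub> w = \<one>\<^bsub>S2\<^esub>"
    and conj: "\<And>c. c \<in> K \<Longrightarrow> w \<otimes>\<^bsub>S2\<^esub> \<theta> (\<gamma>1 c) = \<gamma>2 c \<otimes>\<^bsub>S2\<^esub> w"
  shows "algebra_iso R A B"
proof -
  interpret S2: ring S2 by (rule R_algebraD(2)[OF S2])
  interpret S1: ring S1 by (rule R_algebraD(2)[OF S1])
  interpret A: ring A by (rule M)
  interpret B: ring B by (rule M)
  interpret MA: module R A by (rule M)
  note t = algebra_homsD[OF \<theta>(1)] and a = algebra_homsD[OF jA(1)] and b = algebra_homsD[OF jB(1)]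
  define \<psi> where "\<psi> = (\<lambda>x. w \<otimes>\<^bsub>S2\<^esub> \<theta> x \<otimes>\<^bsub>S2\<^esub> w')"
  have cancel: "w' \<otimes>\<^bsub>S2\<^esub> (w \<otimes>\<^bsub>S2\<^esub> z) = z" "w \<otimes>\<^bsub>S2\<^esub> (w' \<otimes>\<^bsub>S2\<^esub> z) = z" if "z \<in> carrier S2" for z
    using w that by (simp_all add: S2.m_assoc[symmetric])
  have \<psi>_hom: "\<psi> \<in> module_hom R S1 S2"
    unfolding \<psi>_def
    by (rule module_hom_compose[OF module_hom_compose[OF t(1) R_algebraD(3)[OF S2 w(1)]] R_algebraD(4)[OF S2 w(2)]])
  have \<psi>_mult: "\<psi> (x \<otimes>\<^bsub>S1\<^esub> y) = \<psi> x \<otimes>\<^bsub>S2\<^esub> \<psi> y" if "x \<in> carrier S1" "y \<in> carrier S1" for x y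
    using that t w by (simp add: \<psi>_def S2.m_assoc cancel)
  have \<psi>_one: "\<psi> \<one>\<^bsub>S1\<^esub> = \<one>\<^bsub>S2\<^esub>" using t w by (simp add: \<psi>_def)
  have \<psi>_c: "\<psi> x \<in> carrier S2" if "x \<in> carrier S1" for x using module_homD(1)[OF \<psi>_hom that] .
  have \<psi>_inj: "x = y" if "x \<in> carrier S1" "y \<in> carrier S1" "\<psi> x = \<psi> y" for x y
  proof -
    have "\<theta> z = w' \<otimes>\<^bsub>S2\<^esub> \<psi> z \<otimes>\<^bsub>S2\<^esub> w" if "z \<in> carrier S1" for z
      using that t w by (simp add: \<psi>_def S2.m_assoc cancel)
    then have "\<theta> x = \<theta> y" using that by simp
    then show ?thesis using \<theta>(2) that by (auto simp: bij_betw_def inj_on_def)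
  qed
  have \<psi>_surj: "\<exists>x\<in>carrier S1. \<psi> x = z" if z: "z \<in> carrier S2" for z
  proof -
    have "w' \<otimes>\<^bsub>S2\<^esub> z \<otimes>\<^bsub>S2\<^esub> w \<in> \<theta> ` carrier S1" using \<theta>(2) z w by (simp add: bij_betw_def)
    then obtain x where x: "x \<in> carrier S1" "\<theta> x = w' \<otimes>\<^bsub>S2\<^esub> z \<otimes>\<^bsub>S2\<^esub> w" by (elim imageE) simp
    have "\<psi> x = z" unfolding \<psi>_def x(2) using w z by (simp add: S2.m_assoc cancel)
    then show ?thesis using x by blast
  qed
  have \<psi>\<gamma>: "\<psi> (\<gamma>1 c) = \<gamma>2 c" if c: "c \<in> K" for c
    unfolding \<psi>_def conj[OF c] using w \<gamma>(2)[OF c] by (simp add: S2.m_assoc)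
  have to_B: "\<exists>y\<in>carrier B. jB y = \<psi> (jA x)" if x: "x \<in> carrier A" for x
  proof -
    have xc: "jA x \<in> carrier S1" "\<forall>c\<in>K. jA x \<otimes>\<^bsub>S1\<^esub> \<gamma>1 c = \<gamma>1 c \<otimes>\<^bsub>S1\<^esub> jA x" using cA x by blast+
    have "\<psi> (jA x) \<otimes>\<^bsub>S2\<^esub> \<gamma>2 c = \<gamma>2 c \<otimes>\<^bsub>S2\<^esub> \<psi> (jA x)" if c: "c \<in> K" for c
      using xc c \<psi>_mult[of "jA x" "\<gamma>1 c"] \<psi>_mult[of "\<gamma>1 c" "jA x"] \<gamma>(1)[OF c] \<psi>\<gamma>[OF c] by simp
    then have "\<psi> (jA x) \<in> jB ` carrier B" using cB \<psi>_c[OF xc(1)] by blast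
    then show ?thesis by (elim imageE) auto
  qed
  then obtain f where f: "\<And>x. x \<in> carrier A \<Longrightarrow> f x \<in> carrier B" "\<And>x. x \<in> carrier A \<Longrightarrow> jB (f x) = \<psi> (jA x)"
    by metis
  have eqB: "y = z" if "y \<in> carrier B" "z \<in> carrier B" "jB y = jB z" for y z
    using jB(2) that by (auto simp: inj_on_def)
  have fm: "f \<in> module_hom R A B"
  proof (rule module_homI)
    show "f x \<in> carrier B" if "x \<in> carrier A" for x using f that by simp
    show "f (x \<oplus>\<^bsub>A\<^esub> y) = f x \<oplus>\<^bsub>B\<^esub> f y" if "x \<in> carrier A" "y \<in> carrier A" for x y
      using that by (intro eqB) (simp_all add: f module_homD(2)[OF a(1)] module_homD(2)[OF b(1)]
          module_homD(2)[OF \<psi>_hom] a(2))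
    show "f (r \<odot>\<^bsub>A\<^esub> x) = r \<odot>\<^bsub>B\<^esub> f x" if r: "r \<in> carrier R" and x: "x \<in> carrier A" for r x
    proof (rule eqB)
      interpret MB: module R B by (rule M)
      show "r \<odot>\<^bsub>B\<^esub> f x \<in> carrier B" using r f(1)[OF x] by simp
    qed (use r x in \<open>simp_all add: f module_homD(3)[OF a(1)] module_homD(3)[OF b(1)] module_homD(3)[OF \<psi>_hom] a(2)\<close>)
  qed
  have fr: "f \<in> ring_hom A B"
  proof (rule ring_hom_memI)
    show "f (x \<otimes>\<^bsub>A\<^esub> y) = f x \<otimes>\<^bsub>B\<^esub> f y" if "x \<in> carrier A" "y \<in> carrier A" for x y
      using that by (intro eqB) (simp_all add: f a b(3) \<psi>_mult)
    show "f (x \<oplus>\<^bsub>A\<^esub> y) = f x \<oplus>\<^bsub>B\<^esub> f y" if "x \<in> carrier A" "y \<in> carrier A" for x y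
      by (rule module_homD(2)[OF fm that])
    show "f \<one>\<^bsub>A\<^esub> = \<one>\<^bsub>B\<^esub>" by (rule eqB) (simp_all add: f a(4) b(4) \<psi>_one)
  qed (use f in auto)
  have "inj_on f (carrier A)"
  proof (rule inj_onI)
    fix x y assume xy: "x \<in> carrier A" "y \<in> carrier A" "f x = f y"
    then have "\<psi> (jA x) = \<psi> (jA y)" using f(2) by metis
    then have "jA x = jA y" using \<psi>_inj a(2) xy by blast
    then show "x = y" using jA(2) xy by (auto simp: inj_on_def)
  qed
  moreover have "f ` carrier A = carrier B"
  proof (intro subset_antisym subsetI)
    fix y assume y: "y \<in> carrier B"
    then have yc: "jB y \<in> carrier S2" "\<forall>c\<in>K. jB y \<otimes>\<^bsub>S2\<^esub> \<gamma>2 c = \<gamma>2 c \<otimes>\<^bsub>S2\<^esub> jB y" using cB by blast+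
    obtain z where z: "z \<in> carrier S1" "\<psi> z = jB y" using \<psi>_surj[OF yc(1)] by blast
    have "z \<otimes>\<^bsub>S1\<^esub> \<gamma>1 c = \<gamma>1 c \<otimes>\<^bsub>S1\<^esub> z" if c: "c \<in> K" for c
      using yc c z \<gamma>(1)[OF c] by (intro \<psi>_inj) (simp_all add: \<psi>_mult \<psi>\<gamma>)
    then have "z \<in> jA ` carrier A" using cA z by blast
    then obtain x where x: "x \<in> carrier A" "z = jA x" by blast
    then have "f x = y" using z f y by (intro eqB) simp_all
    then show "y \<in> f ` carrier A" using x by blast
  qed (use f in auto)
  ultimately have "f \<in> ring_iso A B" using fr by (simp add: ring_iso_def bij_betw_def)
  then show ?thesis using fm unfolding algebra_iso_def algebra_isos_def by blast
qed

section \<open>Cancellation of Azumaya algebras in tensor products\<close>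

context tensor_algebras
begin

lemma embeddings: "(\<lambda>x. pure x \<one>\<^bsub>C\<^esub>) \<in> algebra_homs R A T" "(\<lambda>y. pure \<one>\<^bsub>A\<^esub> y) \<in> algebra_homs R C T"
proof -
  interpret A: ring A by (rule rings)
  interpret C: ring C by (rule rings)
  show "(\<lambda>x. pure x \<one>\<^bsub>C\<^esub>) \<in> algebra_homs R A T"
    unfolding algebra_homs_def using pure_homs(1)[OF C.one_closed] module_homD[OF pure_homs(1)[OF C.one_closed]]
    by (intro IntI ring_hom_memI) (auto simp: pure_mult T_one)
  show "(\<lambda>y. pure \<one>\<^bsub>A\<^esub> y) \<in> algebra_homs R C T"
    unfolding algebra_homs_def using pure_homs(2)[OF A.one_closed] module_homD[OF pure_homs(2)[OF A.one_closed]]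
    by (intro IntI ring_hom_memI) (auto simp: pure_mult T_one)
qed

lemma separable_functional:
  assumes sf: "separable_families R C q p x y t s \<mu>"
  shows "(\<lambda>c. \<Oplus>\<^bsub>R\<^esub>j\<in>{..<q}. s j \<otimes> \<mu> j c) \<in> module_hom R C (reg_module R)"
proof -
  have "(\<lambda>c. \<Oplus>\<^bsub>reg_module R\<^esub>j\<in>{..<q}. s j \<odot>\<^bsub>reg_module R\<^esub> \<mu> j c) \<in> module_hom R C (reg_module R)"
    using sf by (intro module_hom_finsum[OF cring.reg_module[OF mods(3)]] module_hom_smult[OF cring.reg_module[OF mods(3)]])
      (auto simp: separable_families_def)
  then show ?thesis by (simp add: cring.finsum_reg_module[OF mods(3)])
qed

text \<open>The functional \<Sum> s_j \<mu>_j on \<open>C\<close> takes the value 1 at the unit.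
  Tensoring the identity of \<open>A\<close> with it gives a left inverse of the embedding.\<close>

lemma inj_left_embedding:
  assumes sf: "separable_families R C q p x y t s \<mu>"
  shows "inj_on (\<lambda>a. pure a \<one>\<^bsub>C\<^esub>) (carrier A)"
proof (rule inj_onI)
  interpret C: ring C by (rule rings)
  fix a b assume a: "a \<in> carrier A" and b: "b \<in> carrier A" and eq: "pure a \<one>\<^bsub>C\<^esub> = pure b \<one>\<^bsub>C\<^esub>"
  define m where "m = (\<lambda>c. \<Oplus>\<^bsub>R\<^esub>j\<in>{..<q}. s j \<otimes> \<mu> j c)"
  have m: "m \<in> module_hom R C (reg_module R)" unfolding m_def by (rule separable_functional[OF sf])
  have m1: "m \<one>\<^bsub>C\<^esub> = \<one>" using sf unfolding m_def separable_families_def by blast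
  have mc: "m c \<in> carrier R" if "c \<in> carrier C" for c using module_homD(1)[OF m that] by simp
  have "bilinear_map R A C A (\<lambda>a c. m c \<odot>\<^bsub>A\<^esub> a)"
    unfolding bilinear_map_def
  proof (intro conjI ballI)
    show "(\<lambda>a. m c \<odot>\<^bsub>A\<^esub> a) \<in> module_hom R A A" if "c \<in> carrier C" for c
      by (rule module_hom_smult[OF mods(1) module_hom_id mc[OF that]])
    show "(\<lambda>c. m c \<odot>\<^bsub>A\<^esub> a) \<in> module_hom R C A" if a: "a \<in> carrier A" for a
    proof (rule module_homI)
      show "m (c \<oplus>\<^bsub>C\<^esub> d) \<odot>\<^bsub>A\<^esub> a = m c \<odot>\<^bsub>A\<^esub> a \<oplus>\<^bsub>A\<^esub> m d \<odot>\<^bsub>A\<^esub> a" if "c \<in> carrier C" "d \<in> carrier C" for c d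
        unfolding module_homD(2)[OF m that] using a mc that by (simp add: M.smult_l_distr)
      show "m (r \<odot>\<^bsub>C\<^esub> c) \<odot>\<^bsub>A\<^esub> a = r \<odot>\<^bsub>A\<^esub> (m c \<odot>\<^bsub>A\<^esub> a)" if "r \<in> carrier R" "c \<in> carrier C" for r c
        unfolding module_homD(3)[OF m that] using a mc that by (simp add: M.smult_assoc1)
    qed (use a mc in simp)
  qed
  then obtain g where "g \<in> module_hom R T A" "\<And>a c. a \<in> carrier A \<Longrightarrow> c \<in> carrier C \<Longrightarrow> g (pure a c) = m c \<odot>\<^bsub>A\<^esub> a"
    using tensor_lift[OF mods(1)] by blast
  then have g1: "g (pure a \<one>\<^bsub>C\<^esub>) = a" if "a \<in> carrier A" for a using that m1 by simp
  show "a = b" using arg_cong[OF eq, of g] unfolding g1[OF a] g1[OF b] .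
qed

text \<open>The average \<open>\<Psi>\<close> over the copy of \<open>C\<close> sends a \<otimes> c
  to m(c) a \<otimes> 1, where m = \<Sum> s_j \<mu>_j, and so maps everything into the copy of
  \<open>A\<close>. On elements commuting with \<open>C\<close> it is the identity, because m(1) =
  1.\<close>

lemma centralizer_right_factor:
  assumes sf: "separable_families R C q p x y t s \<mu>"
  shows "(\<lambda>a. pure a \<one>\<^bsub>C\<^esub>) ` carrier A =
    {z \<in> carrier T. \<forall>c\<in>carrier C. z \<otimes>\<^bsub>T\<^esub> pure \<one>\<^bsub>A\<^esub> c = pure \<one>\<^bsub>A\<^esub> c \<otimes>\<^bsub>T\<^esub> z}"
proof (intro subset_antisym subsetI)
  interpret A: ring A by (rule rings)
  interpret C: ring C by (rule rings)
  fix z assume "z \<in> (\<lambda>a. pure a \<one>\<^bsub>C\<^esub>) ` carrier A"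
  then obtain a where "a \<in> carrier A" "z = pure a \<one>\<^bsub>C\<^esub>" by blast
  then show "z \<in> {z \<in> carrier T. \<forall>c\<in>carrier C. z \<otimes>\<^bsub>T\<^esub> pure \<one>\<^bsub>A\<^esub> c = pure \<one>\<^bsub>A\<^esub> c \<otimes>\<^bsub>T\<^esub> z}"
    by (simp add: pure_mult pure_closed)
next
  interpret A: ring A by (rule rings)
  interpret C: ring C by (rule rings)
  interpret TR: ring T by (rule R_algebraD(2)[OF T_R_algebra])
  note lh = R_algebraD(3)[OF T_R_algebra] and rh = R_algebraD(4)[OF T_R_algebra]
  fix z assume "z \<in> {z \<in> carrier T. \<forall>c\<in>carrier C. z \<otimes>\<^bsub>T\<^esub> pure \<one>\<^bsub>A\<^esub> c = pure \<one>\<^bsub>A\<^esub> c \<otimes>\<^bsub>T\<^esub> z}"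
  then have z: "z \<in> carrier T" and zc: "\<And>c. c \<in> carrier C \<Longrightarrow> pure \<one>\<^bsub>A\<^esub> c \<otimes>\<^bsub>T\<^esub> z = z \<otimes>\<^bsub>T\<^esub> pure \<one>\<^bsub>A\<^esub> c"
    by simp_all
  have xy: "x j i \<in> carrier C" "y j i \<in> carrier C" if "j < q" "i < p j" for i j
    using sf that by (auto simp: separable_families_def)
  have s: "s j \<in> carrier R" and \<mu>: "\<mu> j \<in> module_hom R C (reg_module R)" if "j < q" for j
    using sf that by (auto simp: separable_families_def)
  have \<mu>c: "\<mu> j c \<in> carrier R" if "j < q" "c \<in> carrier C" for j c using module_homD(1)[OF \<mu>[OF that(1)] that(2)] by simp
  have xcy: "(\<Oplus>\<^bsub>C\<^esub>i\<in>{..<p j}. x j i \<otimes>\<^bsub>C\<^esub> c \<otimes>\<^bsub>C\<^esub> y j i) = \<mu> j c \<odot>\<^bsub>C\<^esub> \<one>\<^bsub>C\<^esub>" if "j < q" "c \<in> carrier C" for j c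
    using sf that unfolding separable_families_def by blast
  define \<Psi> where "\<Psi> = (\<lambda>z. \<Oplus>\<^bsub>T\<^esub>j\<in>{..<q}. s j \<odot>\<^bsub>T\<^esub> (\<Oplus>\<^bsub>T\<^esub>i\<in>{..<p j}. pure \<one>\<^bsub>A\<^esub> (x j i) \<otimes>\<^bsub>T\<^esub> z \<otimes>\<^bsub>T\<^esub> pure \<one>\<^bsub>A\<^esub> (y j i)))"
  have p1: "pure \<one>\<^bsub>A\<^esub> c \<in> carrier T" if "c \<in> carrier C" for c using that by (simp add: pure_closed)
  have \<Psi>: "\<Psi> \<in> module_hom R T T"
    unfolding \<Psi>_def
  proof (rule module_hom_finsum[OF T_module], rule module_hom_smult[OF T_module], rule module_hom_finsum[OF T_module])
    fix j i assume "j \<in> {..<q}" "i \<in> {..<p j}"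
    then show "(\<lambda>z. pure \<one>\<^bsub>A\<^esub> (x j i) \<otimes>\<^bsub>T\<^esub> z \<otimes>\<^bsub>T\<^esub> pure \<one>\<^bsub>A\<^esub> (y j i)) \<in> module_hom R T T"
      using p1 xy by (intro module_hom_compose[OF lh rh]) auto
  qed (use s in auto)
  have key: "\<Psi> Z = (\<Oplus>\<^bsub>R\<^esub>j\<in>{..<q}. s j \<otimes> \<mu> j c) \<odot>\<^bsub>T\<^esub> W"
    if c: "c \<in> carrier C" and W: "W \<in> carrier T"
      and eq: "\<And>j. j < q \<Longrightarrow> (\<Oplus>\<^bsub>T\<^esub>i\<in>{..<p j}. pure \<one>\<^bsub>A\<^esub> (x j i) \<otimes>\<^bsub>T\<^esub> Z \<otimes>\<^bsub>T\<^esub> pure \<one>\<^bsub>A\<^esub> (y j i)) = \<mu> j c \<odot>\<^bsub>T\<^esub> W" for Z W c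
  proof -
    have "\<Psi> Z = (\<Oplus>\<^bsub>T\<^esub>j\<in>{..<q}. (s j \<otimes> \<mu> j c) \<odot>\<^bsub>T\<^esub> W)"
      unfolding \<Psi>_def using eq s \<mu>c c W by (intro T.M.finsum_cong') (auto simp: T.smult_assoc1)
    also have "\<dots> = (\<Oplus>\<^bsub>R\<^esub>j\<in>{..<q}. s j \<otimes> \<mu> j c) \<odot>\<^bsub>T\<^esub> W"
      using s \<mu>c c W by (intro T.finsum_smult_rdistr) auto
    finally show ?thesis .
  qed
  have mR: "(\<Oplus>\<^bsub>R\<^esub>j\<in>{..<q}. s j \<otimes> \<mu> j c) \<in> carrier R" if "c \<in> carrier C" for c
    using module_homD(1)[OF separable_functional[OF sf] that] by simp
  have \<Psi>p: "\<Psi> (pure a c) = pure ((\<Oplus>\<^bsub>R\<^esub>j\<in>{..<q}. s j \<otimes> \<mu> j c) \<odot>\<^bsub>A\<^esub> a) \<one>\<^bsub>C\<^esub>"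
    if a: "a \<in> carrier A" and c: "c \<in> carrier C" for a c
  proof -
    have "\<Psi> (pure a c) = (\<Oplus>\<^bsub>R\<^esub>j\<in>{..<q}. s j \<otimes> \<mu> j c) \<odot>\<^bsub>T\<^esub> pure a \<one>\<^bsub>C\<^esub>"
    proof (rule key[OF c])
      fix j assume j: "j < q"
      have "(\<Oplus>\<^bsub>T\<^esub>i\<in>{..<p j}. pure \<one>\<^bsub>A\<^esub> (x j i) \<otimes>\<^bsub>T\<^esub> pure a c \<otimes>\<^bsub>T\<^esub> pure \<one>\<^bsub>A\<^esub> (y j i)) =
          (\<Oplus>\<^bsub>T\<^esub>i\<in>{..<p j}. pure a (x j i \<otimes>\<^bsub>C\<^esub> c \<otimes>\<^bsub>C\<^esub> y j i))"
        using a c xy[OF j] by (intro T.M.finsum_cong') (auto simp: pure_mult pure_closed)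
      also have "\<dots> = pure a (\<Oplus>\<^bsub>C\<^esub>i\<in>{..<p j}. x j i \<otimes>\<^bsub>C\<^esub> c \<otimes>\<^bsub>C\<^esub> y j i)"
        using c xy[OF j] by (intro module_hom_sum[OF mods(2) T_module pure_homs(2)[OF a], symmetric]) auto
      also have "\<dots> = \<mu> j c \<odot>\<^bsub>T\<^esub> pure a \<one>\<^bsub>C\<^esub>"
        unfolding xcy[OF j c] using module_homD(3)[OF pure_homs(2)[OF a]] \<mu>c[OF j c] by simp
      finally show "(\<Oplus>\<^bsub>T\<^esub>i\<in>{..<p j}. pure \<one>\<^bsub>A\<^esub> (x j i) \<otimes>\<^bsub>T\<^esub> pure a c \<otimes>\<^bsub>T\<^esub> pure \<one>\<^bsub>A\<^esub> (y j i)) = \<mu> j c \<odot>\<^bsub>T\<^esub> pure a \<one>\<^bsub>C\<^esub>" .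
    qed (use a in \<open>simp add: pure_closed\<close>)
    then show ?thesis using module_homD(3)[OF pure_homs(1)[OF C.one_closed] mR[OF c] a] by simp
  qed
  have "\<Psi> z = (\<Oplus>\<^bsub>R\<^esub>j\<in>{..<q}. s j \<otimes> \<mu> j \<one>\<^bsub>C\<^esub>) \<odot>\<^bsub>T\<^esub> z"
  proof (rule key[OF C.one_closed z])
    fix j assume j: "j < q"
    have "(\<Oplus>\<^bsub>T\<^esub>i\<in>{..<p j}. pure \<one>\<^bsub>A\<^esub> (x j i) \<otimes>\<^bsub>T\<^esub> z \<otimes>\<^bsub>T\<^esub> pure \<one>\<^bsub>A\<^esub> (y j i)) =
        (\<Oplus>\<^bsub>T\<^esub>i\<in>{..<p j}. z \<otimes>\<^bsub>T\<^esub> pure \<one>\<^bsub>A\<^esub> (x j i \<otimes>\<^bsub>C\<^esub> \<one>\<^bsub>C\<^esub> \<otimes>\<^bsub>C\<^esub> y j i))"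
      using z xy[OF j] p1 by (intro T.M.finsum_cong') (auto simp: zc TR.m_assoc pure_mult)
    also have "\<dots> = z \<otimes>\<^bsub>T\<^esub> pure \<one>\<^bsub>A\<^esub> (\<Oplus>\<^bsub>C\<^esub>i\<in>{..<p j}. x j i \<otimes>\<^bsub>C\<^esub> \<one>\<^bsub>C\<^esub> \<otimes>\<^bsub>C\<^esub> y j i)"
      using xy[OF j] by (intro module_hom_sum[OF mods(2) T_module module_hom_compose[OF pure_homs(2)[OF A.one_closed] lh[OF z]], symmetric]) auto
    also have "\<dots> = \<mu> j \<one>\<^bsub>C\<^esub> \<odot>\<^bsub>T\<^esub> z"
      unfolding xcy[OF j C.one_closed]
      using module_homD(3)[OF module_hom_compose[OF pure_homs(2)[OF A.one_closed] lh[OF z]] \<mu>c[OF j C.one_closed] C.one_closed] z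
      by (simp add: T_one[symmetric])
    finally show "(\<Oplus>\<^bsub>T\<^esub>i\<in>{..<p j}. pure \<one>\<^bsub>A\<^esub> (x j i) \<otimes>\<^bsub>T\<^esub> z \<otimes>\<^bsub>T\<^esub> pure \<one>\<^bsub>A\<^esub> (y j i)) = \<mu> j \<one>\<^bsub>C\<^esub> \<odot>\<^bsub>T\<^esub> z" .
  qed
  moreover have "(\<Oplus>\<^bsub>R\<^esub>j\<in>{..<q}. s j \<otimes> \<mu> j \<one>\<^bsub>C\<^esub>) = \<one>" using sf unfolding separable_families_def by blast
  ultimately have \<Psi>z: "\<Psi> z = z" using z by simp
  have "\<exists>a\<in>carrier A. \<Psi> z = pure a \<one>\<^bsub>C\<^esub>"
    using z
  proof (induction rule: tensor_induct)
    case zero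
    have "\<Psi> \<zero>\<^bsub>T\<^esub> = pure \<zero>\<^bsub>A\<^esub> \<one>\<^bsub>C\<^esub>"
      unfolding module_hom_zero[OF T_module T_module \<Psi>] module_hom_zero[OF mods(1) T_module pure_homs(1)[OF C.one_closed]]
      by (rule refl)
    then show ?case by blast
  next
    case (add Z a c)
    then obtain b where b: "b \<in> carrier A" "\<Psi> Z = pure b \<one>\<^bsub>C\<^esub>" by blast
    define d where "d = (\<Oplus>\<^bsub>R\<^esub>j\<in>{..<q}. s j \<otimes> \<mu> j c) \<odot>\<^bsub>A\<^esub> a"
    have d: "d \<in> carrier A" unfolding d_def using mR add by simp
    have "\<Psi> (Z \<oplus>\<^bsub>T\<^esub> pure a c) = pure b \<one>\<^bsub>C\<^esub> \<oplus>\<^bsub>T\<^esub> pure d \<one>\<^bsub>C\<^esub>"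
      using module_homD(2)[OF \<Psi> add(1) pure_closed[OF add(2,3)]] \<Psi>p[OF add(2,3)] b by (simp add: d_def)
    also have "\<dots> = pure (b \<oplus>\<^bsub>A\<^esub> d) \<one>\<^bsub>C\<^esub>" using module_homD(2)[OF pure_homs(1)[OF C.one_closed] b(1) d] by simp
    finally show ?case using b d by blast
  qed
  then show "z \<in> (\<lambda>a. pure a \<one>\<^bsub>C\<^esub>) ` carrier A" using \<Psi>z by auto
qed

end

lemma azumayaD:
  assumes "azumaya R A"
  shows "R_algebra R A" "finite_projective R A" "faithful R A" "module R A" "ring A"
  using assms R_algebraD by (auto simp: azumaya_def faithfully_projective_def)

text \<open>Everything takes place in \<open>?S\<close>, the tensor product of \<open>B\<close> and
  \<open>C\<close>. The operators commuting with all right multiplications are reached in two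
  commutant steps, one for \<open>B\<close> and one for \<open>C\<close>, each using the separable
  families of one factor; in this way the tensor product does not have to be shown to be Azumaya
  itself.\<close>

theorem azumaya_tensor_cancel:
  assumes LG: "LG_ring R" and A: "azumaya R A" and B: "azumaya R B" and C: "azumaya R C"
    and iso: "algebra_iso R (tensor R A C) (tensor R B C)"
  shows "algebra_iso R A B"
proof -
  interpret A: module R A by (rule azumayaD(4)[OF A])
  interpret B: module R B by (rule azumayaD(4)[OF B])
  interpret C: module R C by (rule azumayaD(4)[OF C])
  interpret TA: tensor_algebras R A C
    by (intro tensor_algebras.intro tensor_modules.intro tensor_algebras_axioms.intro azumayaD(1,4) A C)
  interpret TB: tensor_algebras R B C
    by (intro tensor_algebras.intro tensor_modules.intro tensor_algebras_axioms.intro azumayaD(1,4) B C)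
  let ?S = "tensor R B C"
  obtain qc nc lc where "coordinates R C qc nc lc" using module_coordinates[OF azumayaD(2)[OF C]] .
  then obtain \<pi> where pr: "presented R qc (\<lambda>i j. lc i (nc j)) B ?S (\<lambda>i m. TB.pure m (nc i)) \<pi>"
    using tensor_presented[OF azumayaD(4)[OF B]] by blast
  obtain k n l where co: "coordinates R ?S k n l"
    using presented_coordinates[OF azumayaD(2)[OF B] TB.T_module pr] .
  interpret S: algebra_coordinates R ?S k n l
    by (rule algebra_coordinates.intro[OF co algebra_coordinates_axioms.intro[OF TB.T_R_algebra]])
  obtain \<theta> where "\<theta> \<in> algebra_isos R (tensor R A C) ?S" using iso by (auto simp: algebra_iso_def)
  then have \<theta>: "\<theta> \<in> algebra_homs R TA.T ?S" "bij_betw \<theta> (carrier TA.T) (carrier ?S)"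
    by (auto simp: algebra_isos_def algebra_homs_def ring_iso_def)
  obtain qB pB xB yB tB sB \<mu>B where sfB: "separable_families R B qB pB xB yB tB sB \<mu>B"
    using azumaya_separable_families[OF B] by blast
  obtain qC pC xC yC tC sC \<mu>C where sfC: "separable_families R C qC pC xC yC tC sC \<mu>C"
    using azumaya_separable_families[OF C] by blast
  define jB where "jB = (\<lambda>b. TB.pure b \<one>\<^bsub>C\<^esub>)"
  define jC where "jC = (\<lambda>c. TB.pure \<one>\<^bsub>B\<^esub> c)"
  \<comment> \<open>The copy of \<open>C\<close> that comes from the tensor product with
    \<open>A\<close>; it is to be conjugated to the native copy \<open>jC\<close>.\<close>
  define kC where "kC = (\<lambda>c. \<theta> (TA.pure \<one>\<^bsub>A\<^esub> c))"
  have jB: "jB \<in> algebra_homs R B ?S" and jC: "jC \<in> algebra_homs R C ?S"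
    unfolding jB_def jC_def by (rule TB.embeddings)+
  note TAe = algebra_homsD[OF TA.embeddings(2)] and th = algebra_homsD[OF \<theta>(1)]
  have kC: "kC \<in> algebra_homs R C ?S"
    unfolding algebra_homs_def kC_def
    using module_hom_compose[OF TAe(1) th(1)] module_homD[OF module_hom_compose[OF TAe(1) th(1)]]
    by (intro IntI ring_hom_memI) (simp_all add: TAe th)
  note b = algebra_homsD[OF jB] and c = algebra_homsD[OF jC] and k = algebra_homsD[OF kC]
  interpret RB: ring B by (rule azumayaD(5)[OF B])
  interpret RC: ring C by (rule azumayaD(5)[OF C])
  have bc: "jB u \<otimes>\<^bsub>?S\<^esub> jC v = TB.pure u v" "jC v \<otimes>\<^bsub>?S\<^esub> jB u = TB.pure u v"
    if "u \<in> carrier B" "v \<in> carrier C" for u v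
    using that by (simp_all add: jB_def jC_def TB.pure_mult)
  let ?M = "proj_maximals R"
  let ?G0 = "{H. S.unit_mat * H * S.unit_mat = H}"
  let ?G1 = "{H \<in> ?G0. \<forall>u\<in>carrier B. S.right_mat (jB u) * H = H * S.right_mat (jB u)}"
  let ?G2 = "{H \<in> ?G1. \<forall>v\<in>carrier C. S.right_mat (jC v) * H = H * S.right_mat (jC v)}"
  have G1: "good_order S.unit_mat ?M ?G1"
    by (rule good_order_commutant[OF S.good_order_unit_mat cring.proj_maximalsD[OF TB.mods(3)]
        separating_antihom[OF S.actions(2)[OF azumayaD(1)[OF B] jB] _ sfB]])
      (simp_all add: b S.right_mat_mult S.left_mat_corner)
  \<comment> \<open>The images of \<open>B\<close> and \<open>C\<close> commute, so \<open>C\<close>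
    acts from the right by operators in the first commutant \<open>?G1\<close>, and averaging can be
    repeated there.\<close>
  have comm: "S.right_mat (jB u) * S.right_mat (jC v) = S.right_mat (jC v) * S.right_mat (jB u)"
    if "u \<in> carrier B" "v \<in> carrier C" for u v
    using that b(2) c(2) bc by (simp flip: S.right_mat_mult)
  have G2: "good_order S.unit_mat ?M ?G2"
  proof (rule good_order_commutant[OF G1 cring.proj_maximalsD[OF TB.mods(3)]
        separating_antihom[OF S.actions(2)[OF azumayaD(1)[OF C] jC] _ sfC]])
    show "S.right_mat (jC v) \<in> ?G1" if "v \<in> carrier C" for v
      using that c(2) by (simp add: S.left_mat_corner comm)
  qed (simp_all add: c S.right_mat_mult)
  have sep: "separating S.unit_mat (carrier C) {..<qC} (\<lambda>j. {..<pC j}) xC yC tC (\<lambda>j. emb R (sC j))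
      (\<lambda>v. S.left_mat (f v)) (\<lambda>v. S.left_mat (g v))"
    if "f \<in> algebra_homs R C ?S" "g \<in> algebra_homs R C ?S" for f g
    by (rule separating_hom[OF S.actions(1)[OF azumayaD(1)[OF C] that(1)] S.actions(1)[OF azumayaD(1)[OF C] that(2)] _ _ sfC])
      (simp_all add: algebra_homsD[OF that(1)] algebra_homsD[OF that(2)] S.left_mat_mult)
  \<comment> \<open>Commuting with right multiplication by b \<otimes> 1 and by 1 \<otimes> c
    suffices, since their products are the pure tensors.\<close>
  have lin: "h v = h \<one>\<^bsub>?S\<^esub> \<otimes>\<^bsub>?S\<^esub> v" if h: "h \<in> module_hom R ?S ?S" "S.mat_of h \<in> ?G2" and v: "v \<in> carrier ?S" for h v
  proof (rule TB.tensor_hom_eq[OF TB.T_module h(1) S.lh _ v])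
    show h1: "h \<one>\<^bsub>?S\<^esub> \<in> carrier ?S" using module_homD(1)[OF h(1)] by simp
    fix u w assume u: "u \<in> carrier B" and w: "w \<in> carrier C"
    have "h (jB u \<otimes>\<^bsub>?S\<^esub> jC w) = h (jB u) \<otimes>\<^bsub>?S\<^esub> jC w"
      using h w u b(2) c(2) by (intro S.commute_right_mat) auto
    moreover have "h (\<one>\<^bsub>?S\<^esub> \<otimes>\<^bsub>?S\<^esub> jB u) = h \<one>\<^bsub>?S\<^esub> \<otimes>\<^bsub>?S\<^esub> jB u"
      using h u b(2) by (intro S.commute_right_mat) auto
    ultimately have "h (jB u \<otimes>\<^bsub>?S\<^esub> jC w) = h \<one>\<^bsub>?S\<^esub> \<otimes>\<^bsub>?S\<^esub> (jB u \<otimes>\<^bsub>?S\<^esub> jC w)"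
      using u w b(2) c(2) h1 by (simp add: S.A.m_assoc)
    then show "h (TB.pure u w) = h \<one>\<^bsub>?S\<^esub> \<otimes>\<^bsub>?S\<^esub> TB.pure u w" unfolding bc(1)[OF u w] .
  qed
  have in_G2: "S.left_mat a \<in> ?G2" if "a \<in> carrier ?S" for a
    using that by (simp add: S.left_mat_corner S.left_right_commute b c)
  obtain w w' where w: "w \<in> carrier ?S" "w' \<in> carrier ?S" "w \<otimes>\<^bsub>?S\<^esub> w' = \<one>\<^bsub>?S\<^esub>" "w' \<otimes>\<^bsub>?S\<^esub> w = \<one>\<^bsub>?S\<^esub>"
    "\<And>v. v \<in> carrier C \<Longrightarrow> w \<otimes>\<^bsub>?S\<^esub> kC v = jC v \<otimes>\<^bsub>?S\<^esub> w"
  proof (rule S.conjugating_unit[OF LG G2 sep[OF jC kC] sep[OF kC jC] in_G2 k(2) c(2)])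
    show "h v = h \<one>\<^bsub>?S\<^esub> \<otimes>\<^bsub>?S\<^esub> v" if "h \<in> module_hom R ?S ?S" "S.mat_of h \<in> ?G2" "v \<in> carrier ?S" for h v
      by (rule lin[OF that])
  qed (assumption | rule that)+
  show ?thesis
    by (rule algebra_iso_of_conjugate[OF TB.T_R_algebra azumayaD(4)[OF A] azumayaD(4)[OF B] azumayaD(5)[OF A]
        azumayaD(5)[OF B] TA.embeddings(1) TA.inj_left_embedding[OF sfC] TB.embeddings(1)
        TB.inj_left_embedding[OF sfC] TA.centralizer_right_factor[OF sfC] TB.centralizer_right_factor[OF sfC]
        _ _ \<theta> TA.T_R_algebra w(1-4)])
      (use w(5) TAe(2) c(2) in \<open>auto simp: kC_def jC_def\<close>)
qed

section \<open>Matrix algebras\<close>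

locale matrix_algebras = module R A for R :: "('a, 'r) ring_scheme" (structure) and A :: "('a, 'b) module" +
  fixes n :: nat
  assumes alg: "R_algebra R A"
begin

sublocale A: ring A by (rule R_algebraD(2)[OF alg])

abbreviation "S \<equiv> matrix_algebra n A"
abbreviation "table f \<equiv> \<lambda>(i, j)\<in>{..<n} \<times> {..<n}. f i j"

lemma mod_A: "module R A" by unfold_locales

lemmas lh = R_algebraD(3)[OF alg] and rh = R_algebraD(4)[OF alg]

lemma S_entry: "f \<in> carrier S \<Longrightarrow> i < n \<Longrightarrow> j < n \<Longrightarrow> f (i, j) \<in> carrier A"
  by (auto simp: matrix_algebra_def PiE_def)

lemma S_eqI: "f \<in> carrier S \<Longrightarrow> g \<in> carrier S \<Longrightarrow> (\<And>i j. i < n \<Longrightarrow> j < n \<Longrightarrow> f (i, j) = g (i, j)) \<Longrightarrow> f = g"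
  by (rule PiE_ext[of _ "{..<n} \<times> {..<n}" "\<lambda>_. carrier A"]) (auto simp: matrix_algebra_def)

lemma table_closed: "(\<And>i j. i < n \<Longrightarrow> j < n \<Longrightarrow> f i j \<in> carrier A) \<Longrightarrow> table f \<in> carrier S"
  by (auto simp: matrix_algebra_def)

lemma S_entries:
  assumes "i < n" "j < n"
  shows "(f \<otimes>\<^bsub>S\<^esub> g) (i, j) = (\<Oplus>\<^bsub>A\<^esub>k\<in>{..<n}. f (i, k) \<otimes>\<^bsub>A\<^esub> g (k, j))"
    "(f \<oplus>\<^bsub>S\<^esub> g) (i, j) = f (i, j) \<oplus>\<^bsub>A\<^esub> g (i, j)" "(r \<odot>\<^bsub>S\<^esub> f) (i, j) = r \<odot>\<^bsub>A\<^esub> f (i, j)"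
    "\<zero>\<^bsub>S\<^esub> (i, j) = \<zero>\<^bsub>A\<^esub>" "\<one>\<^bsub>S\<^esub> (i, j) = (if i = j then \<one>\<^bsub>A\<^esub> else \<zero>\<^bsub>A\<^esub>)"
  using assms by (simp_all add: matrix_algebra_def)

lemma S_closed:
  "f \<in> carrier S \<Longrightarrow> g \<in> carrier S \<Longrightarrow> f \<otimes>\<^bsub>S\<^esub> g \<in> carrier S"
  "f \<in> carrier S \<Longrightarrow> g \<in> carrier S \<Longrightarrow> f \<oplus>\<^bsub>S\<^esub> g \<in> carrier S"
  "r \<in> carrier R \<Longrightarrow> f \<in> carrier S \<Longrightarrow> r \<odot>\<^bsub>S\<^esub> f \<in> carrier S"
  "\<zero>\<^bsub>S\<^esub> \<in> carrier S" "\<one>\<^bsub>S\<^esub> \<in> carrier S"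
  by (auto simp: matrix_algebra_def PiE_def Pi_def intro!: M.finsum_closed)

lemma S_module: "module R S"
proof (intro moduleI abelian_groupI R.is_cring)
  fix f assume f: "f \<in> carrier S"
  show "\<exists>g\<in>carrier S. g \<oplus>\<^bsub>S\<^esub> f = \<zero>\<^bsub>S\<^esub>"
  proof (rule bexI)
    show "table (\<lambda>i j. \<ominus>\<^bsub>A\<^esub> f (i, j)) \<in> carrier S" using f by (intro table_closed) (simp add: S_entry)
    then show "table (\<lambda>i j. \<ominus>\<^bsub>A\<^esub> f (i, j)) \<oplus>\<^bsub>S\<^esub> f = \<zero>\<^bsub>S\<^esub>"
      using f by (intro S_eqI) (simp_all add: S_closed S_entries S_entry M.l_neg)
  qed
qed (use S_closed in \<open>auto intro!: S_eqI simp: S_entries S_entry M.a_ac smult_l_distr smult_r_distr smult_assoc1\<close>)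

lemma entry_hom: "i < n \<Longrightarrow> j < n \<Longrightarrow> (\<lambda>f. f (i, j)) \<in> module_hom R S A"
  by (intro module_homI) (simp_all add: S_entry S_entries)

lemma S_homI:
  assumes V: "module R V" and cl: "\<And>v. v \<in> carrier V \<Longrightarrow> h v \<in> carrier S"
    and ent: "\<And>i j. i < n \<Longrightarrow> j < n \<Longrightarrow> (\<lambda>v. h v (i, j)) \<in> module_hom R V A"
  shows "h \<in> module_hom R V S"
proof -
  interpret V: module R V by fact
  show ?thesis
  proof (rule module_homI[OF cl]; (assumption)?)
    show "h (v \<oplus>\<^bsub>V\<^esub> w) = h v \<oplus>\<^bsub>S\<^esub> h w" if "v \<in> carrier V" "w \<in> carrier V" for v w
      using that module_homD(2)[OF ent that] by (intro S_eqI S_closed cl) (simp_all add: S_entries)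
    show "h (r \<odot>\<^bsub>V\<^esub> v) = r \<odot>\<^bsub>S\<^esub> h v" if "r \<in> carrier R" "v \<in> carrier V" for r v
      using that module_homD(3)[OF ent that] by (intro S_eqI S_closed cl) (simp_all add: S_entries)
  qed
qed

lemma S_mult_hom: "g \<in> carrier S \<Longrightarrow> (\<lambda>f. f \<otimes>\<^bsub>S\<^esub> g) \<in> module_hom R S S"
  "f \<in> carrier S \<Longrightarrow> (\<lambda>g. f \<otimes>\<^bsub>S\<^esub> g) \<in> module_hom R S S"
proof -
  show "(\<lambda>f. f \<otimes>\<^bsub>S\<^esub> g) \<in> module_hom R S S" if g: "g \<in> carrier S"
  proof (rule S_homI[OF S_module S_closed(1)[OF _ g]])
    fix i j assume ij: "i < n" "j < n"
    show "(\<lambda>f. (f \<otimes>\<^bsub>S\<^esub> g) (i, j)) \<in> module_hom R S A"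
      unfolding S_entries[OF ij]
      by (intro module_hom_finsum[OF mod_A] module_hom_compose[OF entry_hom rh]) (use g ij in \<open>auto simp: S_entry\<close>)
  qed
  show "(\<lambda>g. f \<otimes>\<^bsub>S\<^esub> g) \<in> module_hom R S S" if f: "f \<in> carrier S"
  proof (rule S_homI[OF S_module S_closed(1)[OF f]])
    fix i j assume ij: "i < n" "j < n"
    show "(\<lambda>g. (f \<otimes>\<^bsub>S\<^esub> g) (i, j)) \<in> module_hom R S A"
      unfolding S_entries[OF ij]
      by (intro module_hom_finsum[OF mod_A] module_hom_compose[OF entry_hom lh]) (use f ij in \<open>auto simp: S_entry\<close>)
  qed
qed

lemma finsum_pick:
  fixes f :: "nat \<Rightarrow> 'b"
  assumes "a < k" "\<And>i. i < k \<Longrightarrow> f i \<in> carrier A" "\<And>i. i < k \<Longrightarrow> i \<noteq> a \<Longrightarrow> f i = \<zero>\<^bsub>A\<^esub>"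
  shows "(\<Oplus>\<^bsub>A\<^esub>i\<in>{..<k}. f i) = f a"
proof -
  have "(\<Oplus>\<^bsub>A\<^esub>i\<in>{..<k}. f i) = (\<Oplus>\<^bsub>A\<^esub>i\<in>{..<k}. if a = i then f i else \<zero>\<^bsub>A\<^esub>)"
    using assms by (intro M.finsum_cong') auto
  also have "\<dots> = f a" using assms by (intro M.add.finprod_singleton) auto
  finally show ?thesis .
qed

definition diag :: "'b \<Rightarrow> nat \<times> nat \<Rightarrow> 'b" where "diag b = table (\<lambda>i j. if i = j then b else \<zero>\<^bsub>A\<^esub>)"
definition single_entry :: "nat \<times> nat \<Rightarrow> 'b \<Rightarrow> nat \<times> nat \<Rightarrow> 'b" where
  "single_entry c b = table (\<lambda>i j. if (i, j) = c then b else \<zero>\<^bsub>A\<^esub>)"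
abbreviation "unit_entry c \<equiv> single_entry c \<one>\<^bsub>A\<^esub>"

lemma diag_closed: "b \<in> carrier A \<Longrightarrow> diag b \<in> carrier S"
  unfolding diag_def by (rule table_closed) simp

lemma single_entry_closed: "b \<in> carrier A \<Longrightarrow> single_entry c b \<in> carrier S"
  unfolding single_entry_def by (rule table_closed) simp

lemma diag_entry: "i < n \<Longrightarrow> j < n \<Longrightarrow> diag b (i, j) = (if i = j then b else \<zero>\<^bsub>A\<^esub>)"
  by (simp add: diag_def)

lemma single_entry_entry: "i < n \<Longrightarrow> j < n \<Longrightarrow> single_entry c b (i, j) = (if (i, j) = c then b else \<zero>\<^bsub>A\<^esub>)"
  by (simp add: single_entry_def)

lemma mult_entries:
  assumes f: "f \<in> carrier S" and ij: "i < n" "j < n"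
  shows "b \<in> carrier A \<Longrightarrow> (f \<otimes>\<^bsub>S\<^esub> diag b) (i, j) = f (i, j) \<otimes>\<^bsub>A\<^esub> b"
    "b \<in> carrier A \<Longrightarrow> (diag b \<otimes>\<^bsub>S\<^esub> f) (i, j) = b \<otimes>\<^bsub>A\<^esub> f (i, j)"
    "k < n \<Longrightarrow> l < n \<Longrightarrow> (f \<otimes>\<^bsub>S\<^esub> unit_entry (k, l)) (i, j) = (if j = l then f (i, k) else \<zero>\<^bsub>A\<^esub>)"
    "k < n \<Longrightarrow> l < n \<Longrightarrow> (unit_entry (k, l) \<otimes>\<^bsub>S\<^esub> f) (i, j) = (if i = k then f (l, j) else \<zero>\<^bsub>A\<^esub>)"
proof -
  note fc = S_entry[OF f]
  show "(f \<otimes>\<^bsub>S\<^esub> diag b) (i, j) = f (i, j) \<otimes>\<^bsub>A\<^esub> b" if b: "b \<in> carrier A"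
    unfolding S_entries[OF ij] using finsum_pick[of j n "\<lambda>k. f (i, k) \<otimes>\<^bsub>A\<^esub> diag b (k, j)"] ij b
    by (simp add: fc diag_entry)
  show "(diag b \<otimes>\<^bsub>S\<^esub> f) (i, j) = b \<otimes>\<^bsub>A\<^esub> f (i, j)" if b: "b \<in> carrier A"
    unfolding S_entries[OF ij] using finsum_pick[of i n "\<lambda>k. diag b (i, k) \<otimes>\<^bsub>A\<^esub> f (k, j)"] ij b
    by (simp add: fc diag_entry)
  show "(f \<otimes>\<^bsub>S\<^esub> unit_entry (k, l)) (i, j) = (if j = l then f (i, k) else \<zero>\<^bsub>A\<^esub>)" if "k < n" "l < n"
    unfolding S_entries[OF ij] using finsum_pick[of k n "\<lambda>m. f (i, m) \<otimes>\<^bsub>A\<^esub> unit_entry (k, l) (m, j)"] ij that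
    by (simp add: fc single_entry_entry)
  show "(unit_entry (k, l) \<otimes>\<^bsub>S\<^esub> f) (i, j) = (if i = k then f (l, j) else \<zero>\<^bsub>A\<^esub>)" if "k < n" "l < n"
    unfolding S_entries[OF ij] using finsum_pick[of l n "\<lambda>m. unit_entry (k, l) (i, m) \<otimes>\<^bsub>A\<^esub> f (m, j)"] ij that
    by (simp add: fc single_entry_entry)
qed

lemma S_R_algebra: "R_algebra R S"
proof -
  interpret S: module R S by (rule S_module)
  have one: "\<one>\<^bsub>S\<^esub> = diag \<one>\<^bsub>A\<^esub>" by (rule S_eqI) (simp_all add: S_closed diag_closed S_entries diag_entry)
  have "f \<otimes>\<^bsub>S\<^esub> g \<otimes>\<^bsub>S\<^esub> h = f \<otimes>\<^bsub>S\<^esub> (g \<otimes>\<^bsub>S\<^esub> h)"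
    if f: "f \<in> carrier S" and g: "g \<in> carrier S" and h: "h \<in> carrier S" for f g h
  proof (rule S_eqI)
    fix i j assume ij: "i < n" "j < n"
    note cl = S_entry[OF f] S_entry[OF g] S_entry[OF h]
    have "(f \<otimes>\<^bsub>S\<^esub> g \<otimes>\<^bsub>S\<^esub> h) (i, j) = (\<Oplus>\<^bsub>A\<^esub>k\<in>{..<n}. \<Oplus>\<^bsub>A\<^esub>l\<in>{..<n}. f (i, l) \<otimes>\<^bsub>A\<^esub> (g (l, k) \<otimes>\<^bsub>A\<^esub> h (k, j)))"
      unfolding S_entries(1)[OF ij]
    proof (rule M.finsum_cong')
      fix k assume "k \<in> {..<n}"
      then have k: "k < n" by simp
      show "(f \<otimes>\<^bsub>S\<^esub> g) (i, k) \<otimes>\<^bsub>A\<^esub> h (k, j) = (\<Oplus>\<^bsub>A\<^esub>l\<in>{..<n}. f (i, l) \<otimes>\<^bsub>A\<^esub> (g (l, k) \<otimes>\<^bsub>A\<^esub> h (k, j)))"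
        unfolding S_entries(1)[OF ij(1) k] using cl k ij
        by (subst module_hom_sum[OF mod_A mod_A rh]) (auto intro!: M.finsum_cong' simp: A.m_assoc)
    qed (use cl ij in \<open>auto intro!: M.finsum_closed\<close>)
    also have "\<dots> = (\<Oplus>\<^bsub>A\<^esub>l\<in>{..<n}. \<Oplus>\<^bsub>A\<^esub>k\<in>{..<n}. f (i, l) \<otimes>\<^bsub>A\<^esub> (g (l, k) \<otimes>\<^bsub>A\<^esub> h (k, j)))"
      using cl ij by (intro M.finsum_swap) auto
    also have "\<dots> = (f \<otimes>\<^bsub>S\<^esub> (g \<otimes>\<^bsub>S\<^esub> h)) (i, j)"
      unfolding S_entries(1)[OF ij]
    proof (rule M.finsum_cong')
      fix l assume "l \<in> {..<n}"
      then have l: "l < n" by simp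
      show "(\<Oplus>\<^bsub>A\<^esub>k\<in>{..<n}. f (i, l) \<otimes>\<^bsub>A\<^esub> (g (l, k) \<otimes>\<^bsub>A\<^esub> h (k, j))) = f (i, l) \<otimes>\<^bsub>A\<^esub> (g \<otimes>\<^bsub>S\<^esub> h) (l, j)"
        unfolding S_entries(1)[OF l ij(2)] using cl l ij
        by (intro module_hom_sum[OF mod_A mod_A lh, symmetric]) auto
    qed (use cl ij S_entry[OF S_closed(1)[OF g h]] in auto)
    finally show "(f \<otimes>\<^bsub>S\<^esub> g \<otimes>\<^bsub>S\<^esub> h) (i, j) = (f \<otimes>\<^bsub>S\<^esub> (g \<otimes>\<^bsub>S\<^esub> h)) (i, j)" .
  qed (simp_all add: S_closed f g h)
  moreover have "\<one>\<^bsub>S\<^esub> \<otimes>\<^bsub>S\<^esub> f = f" "f \<otimes>\<^bsub>S\<^esub> \<one>\<^bsub>S\<^esub> = f" if f: "f \<in> carrier S" for f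
    unfolding one using f by (auto intro!: S_eqI simp: S_closed diag_closed mult_entries S_entry)
  ultimately have "ring S"
    by (intro ringI S.M.abelian_group_axioms monoidI)
      (simp_all add: S_closed module_homD(2)[OF S_mult_hom(1)] module_homD(2)[OF S_mult_hom(2)])
  then show ?thesis
    using S_module by (simp add: R_algebra_def module_homD(3)[OF S_mult_hom(1)] module_homD(3)[OF S_mult_hom(2)])
qed

lemma diag_hom: "diag \<in> algebra_homs R A S"
proof -
  have "diag \<in> module_hom R A S"
    by (rule module_homI)
      (auto intro!: S_eqI simp: S_closed diag_closed S_entries diag_entry)
  moreover have "diag \<in> ring_hom A S"
    by (rule ring_hom_memI)
      (auto intro!: S_eqI simp: S_closed diag_closed S_entries(2-5) diag_entry mult_entries)
  ultimately show ?thesis by (simp add: algebra_homs_def)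
qed

lemma inj_diag: "0 < n \<Longrightarrow> inj_on diag (carrier A)"
  by (rule inj_onI) (metis diag_entry)

lemma unit_entry_mult:
  "i < n \<Longrightarrow> j < n \<Longrightarrow> k < n \<Longrightarrow> l < n \<Longrightarrow>
    unit_entry (i, j) \<otimes>\<^bsub>S\<^esub> unit_entry (k, l) = (if j = k then unit_entry (i, l) else \<zero>\<^bsub>S\<^esub>)"
  by (rule S_eqI) (auto simp: S_closed single_entry_closed mult_entries S_entries(2-5) single_entry_entry)

lemma unit_entry_sum: "(\<Oplus>\<^bsub>S\<^esub>i\<in>{..<n}. unit_entry (i, i)) = \<one>\<^bsub>S\<^esub>"
proof -
  interpret S: module R S by (rule S_module)
  show ?thesis
  proof (rule S_eqI)
    fix i j assume ij: "i < n" "j < n"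
    have "(\<Oplus>\<^bsub>S\<^esub>k\<in>{..<n}. unit_entry (k, k)) (i, j) = (\<Oplus>\<^bsub>A\<^esub>k\<in>{..<n}. unit_entry (k, k) (i, j))"
      by (rule module_hom_sum[OF S_module mod_A entry_hom[OF ij]]) (simp add: single_entry_closed)
    also have "\<dots> = unit_entry (i, i) (i, j)"
      by (rule finsum_pick) (use ij in \<open>auto simp: single_entry_entry\<close>)
    finally show "(\<Oplus>\<^bsub>S\<^esub>k\<in>{..<n}. unit_entry (k, k)) (i, j) = \<one>\<^bsub>S\<^esub> (i, j)"
      using ij by (simp add: single_entry_entry S_entries)
  qed (auto intro!: S.finsum_closed simp: single_entry_closed S_closed)
qed

lemma single_entry_mult: "b \<in> carrier A \<Longrightarrow> k < n \<Longrightarrow> l < n \<Longrightarrow> diag b \<otimes>\<^bsub>S\<^esub> unit_entry (k, l) = single_entry (k, l) b"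
  by (rule S_eqI) (auto simp: S_closed single_entry_closed diag_closed mult_entries diag_entry single_entry_entry)

lemma centralizer_unit_entries:
  assumes n: "0 < n"
  shows "diag ` carrier A = {z \<in> carrier S. \<forall>c\<in>{..<n} \<times> {..<n}. z \<otimes>\<^bsub>S\<^esub> unit_entry c = unit_entry c \<otimes>\<^bsub>S\<^esub> z}"
proof (intro subset_antisym subsetI)
  fix z assume "z \<in> diag ` carrier A"
  then obtain b where b: "b \<in> carrier A" "z = diag b" by blast
  then show "z \<in> {z \<in> carrier S. \<forall>c\<in>{..<n} \<times> {..<n}. z \<otimes>\<^bsub>S\<^esub> unit_entry c = unit_entry c \<otimes>\<^bsub>S\<^esub> z}"
    by (auto intro!: S_eqI simp: S_closed single_entry_closed diag_closed mult_entries diag_entry single_entry_entry)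
next
  fix z assume z: "z \<in> {z \<in> carrier S. \<forall>c\<in>{..<n} \<times> {..<n}. z \<otimes>\<^bsub>S\<^esub> unit_entry c = unit_entry c \<otimes>\<^bsub>S\<^esub> z}"
  then have zc: "z \<in> carrier S" by simp
  have "z = diag (z (0, 0))"
  proof (rule S_eqI[OF zc])
    fix i k assume ik: "i < n" "k < n"
    \<comment> \<open>The left side is \<open>z (i, k)\<close>; the right side is
      \<open>z (0, 0)\<close> if \<open>i = k\<close> and zero otherwise. One column of units thus
      determines \<open>z\<close>.\<close>
    have "(z \<otimes>\<^bsub>S\<^esub> unit_entry (k, 0)) (i, 0) = (unit_entry (k, 0) \<otimes>\<^bsub>S\<^esub> z) (i, 0)" using z ik n by simp
    then show "z (i, k) = diag (z (0, 0)) (i, k)" using ik n by (simp add: mult_entries zc diag_entry split: if_splits)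
  qed (simp add: diag_closed S_entry zc n)
  then show "z \<in> diag ` carrier A" using S_entry[OF zc n n] by blast
qed

text \<open>The matrix algebra as a direct sum of \<open>n * n\<close> copies of \<open>A\<close>,
  with position (a, b) numbered a n + b because presentations are indexed by numbers. It provides
  the dual basis of the matrix algebra and the expansion of a matrix into single entries.\<close>

lemma presented_S:
  "presented R (n * n) (\<lambda>i j. if i = j then \<one> else \<zero>) A S (\<lambda>i. single_entry (i div n, i mod n)) (\<lambda>i v. v (i div n, i mod n))"
  unfolding presented_def
proof (intro conjI allI impI ballI)
  interpret S: module R S by (rule S_module)
  have pos: "i div n < n" "i mod n < n" if "i < n * n" for i
    using that by (auto simp: less_mult_imp_div_less) (metis gr_implies_not0 mod_less_divisor mult_0 neq0_conv)
  show "(\<lambda>v. v (i div n, i mod n)) \<in> module_hom R S A" if "i < n * n" for i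
    by (rule entry_hom[OF pos[OF that]])
  show "single_entry (i div n, i mod n) \<in> module_hom R A S" for i
    by (rule module_homI) (auto intro!: S_eqI simp: S_closed single_entry_closed S_entries single_entry_entry)
  show "single_entry (j div n, j mod n) m (i div n, i mod n) = (if i = j then \<one> else \<zero>) \<odot>\<^bsub>A\<^esub> m"
    if "i < n * n" "j < n * n" "m \<in> carrier A" for i j m
    using pos[OF that(1)] that(3) by (auto simp: single_entry_entry) (metis div_mult_mod_eq)
  show "(\<Oplus>\<^bsub>S\<^esub>i\<in>{..<n * n}. single_entry (i div n, i mod n) (v (i div n, i mod n))) = v" if v: "v \<in> carrier S" for v
  proof (rule S_eqI[OF _ v])
    have cl: "single_entry (i div n, i mod n) (v (i div n, i mod n)) \<in> carrier S" if "i < n * n" for i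
      using pos[OF that] v by (intro single_entry_closed S_entry)
    then show "(\<Oplus>\<^bsub>S\<^esub>i\<in>{..<n * n}. single_entry (i div n, i mod n) (v (i div n, i mod n))) \<in> carrier S"
      by (auto intro!: S.finsum_closed)
    fix a b assume ab: "a < n" "b < n"
    have lt: "a * n + b < n * n"
    proof -
      have "a * n + b < Suc a * n" using ab by simp
      also have "\<dots> \<le> n * n" using ab by (intro mult_le_mono1) simp
      finally show ?thesis .
    qed
    have pos_ab: "(a * n + b) div n = a" "(a * n + b) mod n = b" using ab by simp_all
    have inj: "i = a * n + b" if "i div n = a" "i mod n = b" for i using that by (metis div_mult_mod_eq)
    have "(\<Oplus>\<^bsub>S\<^esub>i\<in>{..<n * n}. single_entry (i div n, i mod n) (v (i div n, i mod n))) (a, b) =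
        (\<Oplus>\<^bsub>A\<^esub>i\<in>{..<n * n}. single_entry (i div n, i mod n) (v (i div n, i mod n)) (a, b))"
      by (rule module_hom_sum[OF S_module mod_A entry_hom[OF ab]]) (simp add: cl)
    also have "\<dots> = single_entry ((a * n + b) div n, (a * n + b) mod n) (v ((a * n + b) div n, (a * n + b) mod n)) (a, b)"
    proof (rule finsum_pick[OF lt])
      show "single_entry (i div n, i mod n) (v (i div n, i mod n)) (a, b) \<in> carrier A" if "i < n * n" for i
        by (rule S_entry[OF cl[OF that] ab])
      show "single_entry (i div n, i mod n) (v (i div n, i mod n)) (a, b) = \<zero>\<^bsub>A\<^esub>" if "i \<noteq> a * n + b" for i
        using inj[of i] that ab by (auto simp: single_entry_entry)
    qed
    also have "\<dots> = v (a, b)" unfolding pos_ab using ab by (simp add: single_entry_entry)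
    finally show "(\<Oplus>\<^bsub>S\<^esub>i\<in>{..<n * n}. single_entry (i div n, i mod n) (v (i div n, i mod n))) (a, b) = v (a, b)" .
  qed
qed

end

text \<open>Right multiplication reverses products, so it gives matrix units only after the two
  indices are exchanged.\<close>

lemma (in algebra_coordinates) unit_systems:
  assumes cl: "\<And>i j. i < k \<Longrightarrow> j < k \<Longrightarrow> E (i, j) \<in> carrier M"
    and mult: "\<And>i j a b. i < k \<Longrightarrow> j < k \<Longrightarrow> a < k \<Longrightarrow> b < k \<Longrightarrow>
      E (i, j) \<otimes>\<^bsub>M\<^esub> E (a, b) = (if j = a then E (i, b) else \<zero>\<^bsub>M\<^esub>)"
    and sum: "(\<Oplus>\<^bsub>M\<^esub>i\<in>{..<k}. E (i, i)) = \<one>\<^bsub>M\<^esub>"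
  shows "unit_system k (\<lambda>i j. emb R (if i = j then \<one> else \<zero>)) unit_mat (\<lambda>c. left_mat (E c))"
    "unit_system k (\<lambda>i j. emb R (if i = j then \<one> else \<zero>)) unit_mat (\<lambda>c. right_mat (E (snd c, fst c)))"
proof -
  have "smul (emb R \<zero>) H = 0" for H by (rule finmat_eqI) (simp add: emb_hom(1))
  moreover have "left_mat \<zero>\<^bsub>M\<^esub> = 0" "right_mat \<zero>\<^bsub>M\<^esub> = 0"
    unfolding left_mat_def right_mat_def mat_of_zero[symmetric] by (rule mat_of_cong; simp)+
  ultimately have zero: "left_mat \<zero>\<^bsub>M\<^esub> = smul (emb R \<zero>) H" "right_mat \<zero>\<^bsub>M\<^esub> = smul (emb R \<zero>) H" for H
    by (simp_all only:)
  have one: "smul (emb R \<one>) (left_mat a) = left_mat a" "smul (emb R \<one>) (right_mat a) = right_mat a" if "a \<in> carrier M" for a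
    using that by (simp_all add: left_mat_def right_mat_def lh rh smul_one_mat_of)
  have cor: "unit_mat * left_mat a = left_mat a" "left_mat a * unit_mat = left_mat a"
    "unit_mat * right_mat a = right_mat a" "right_mat a * unit_mat = right_mat a" if "a \<in> carrier M" for a
    using that by (simp_all add: left_mat_def right_mat_def mat_of_corner lh rh)
  have "(\<Sum>i<k. left_mat (E (i, i))) = mat_of (\<lambda>v. \<Oplus>\<^bsub>M\<^esub>i\<in>{..<k}. E (i, i) \<otimes>\<^bsub>M\<^esub> v)"
    unfolding left_mat_def by (rule mat_of_finsum[symmetric]) (simp add: cl lh)
  also have "\<dots> = unit_mat" unfolding unit_mat_def
  proof (rule mat_of_cong)
    fix v assume v: "v \<in> carrier M"
    have "(\<Oplus>\<^bsub>M\<^esub>i\<in>{..<k}. E (i, i)) \<otimes>\<^bsub>M\<^esub> v = (\<Oplus>\<^bsub>M\<^esub>i\<in>{..<k}. E (i, i) \<otimes>\<^bsub>M\<^esub> v)"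
      by (rule module_hom_sum[OF mod mod rh[OF v]]) (simp add: cl)
    then show "(\<Oplus>\<^bsub>M\<^esub>i\<in>{..<k}. E (i, i) \<otimes>\<^bsub>M\<^esub> v) = v" using v by (simp add: sum)
  qed
  finally have sl: "(\<Sum>i<k. left_mat (E (i, i))) = unit_mat" .
  have "(\<Sum>i<k. right_mat (E (i, i))) = mat_of (\<lambda>v. \<Oplus>\<^bsub>M\<^esub>i\<in>{..<k}. v \<otimes>\<^bsub>M\<^esub> E (i, i))"
    unfolding right_mat_def by (rule mat_of_finsum[symmetric]) (simp add: cl rh)
  also have "\<dots> = unit_mat" unfolding unit_mat_def
  proof (rule mat_of_cong)
    fix v assume v: "v \<in> carrier M"
    have "v \<otimes>\<^bsub>M\<^esub> (\<Oplus>\<^bsub>M\<^esub>i\<in>{..<k}. E (i, i)) = (\<Oplus>\<^bsub>M\<^esub>i\<in>{..<k}. v \<otimes>\<^bsub>M\<^esub> E (i, i))"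
      by (rule module_hom_sum[OF mod mod lh[OF v]]) (simp add: cl)
    then show "(\<Oplus>\<^bsub>M\<^esub>i\<in>{..<k}. v \<otimes>\<^bsub>M\<^esub> E (i, i)) = v" using v by (simp add: sum)
  qed
  finally have sr: "(\<Sum>i<k. right_mat (E (i, i))) = unit_mat" .
  show "unit_system k (\<lambda>i j. emb R (if i = j then \<one> else \<zero>)) unit_mat (\<lambda>c. left_mat (E c))"
    unfolding unit_system_def
  proof (intro conjI allI impI)
    fix i j a b assume ij: "i < k" "j < k" "a < k" "b < k"
    show "left_mat (E (i, j)) * left_mat (E (a, b)) = smul (emb R (if j = a then \<one> else \<zero>)) (left_mat (E (i, b)))"
      using ij zero(1)[of "left_mat (E (i, b))"]
      unfolding left_mat_mult[OF cl cl, OF ij, symmetric] mult[OF ij] by (simp add: cl one)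
  qed (simp_all add: cl cor sl)
  show "unit_system k (\<lambda>i j. emb R (if i = j then \<one> else \<zero>)) unit_mat (\<lambda>c. right_mat (E (snd c, fst c)))"
    unfolding unit_system_def fst_conv snd_conv
  proof (intro conjI allI impI)
    fix i j a b assume ij: "i < k" "j < k" "a < k" "b < k"
    show "right_mat (E (j, i)) * right_mat (E (b, a)) = smul (emb R (if j = a then \<one> else \<zero>)) (right_mat (E (b, i)))"
      using ij zero(2)[of "right_mat (E (b, i))"]
      unfolding right_mat_mult[OF cl cl, OF ij(4,3,2,1), symmetric] mult[OF ij(4,3,2,1)] by (auto simp: cl one)
  qed (simp_all add: cl cor sr)
qed

text \<open>The same scheme as for tensor products, with matrix units in place of \<open>C\<close>.
  They enter directly as a unit system with the identity as \<open>P\<close>, which spares an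
  isomorphism between the matrix algebra and a tensor product; only \<open>B\<close> contributes
  separable families.\<close>

theorem azumaya_matrix_cancel:
  fixes R :: "('a, 'r) ring_scheme" and A :: "('a, 'b) module" and B :: "('a, 'c) module"
  assumes LG: "LG_ring R" and A: "azumaya R A" and B: "azumaya R B" and n: "0 < n"
    and iso: "algebra_iso R (matrix_algebra n A) (matrix_algebra n B)"
  shows "algebra_iso R A B"
proof -
  interpret TA: matrix_algebras R A n
    by (intro matrix_algebras.intro matrix_algebras_axioms.intro azumayaD(1,4) A)
  interpret TB: matrix_algebras R B n
    by (intro matrix_algebras.intro matrix_algebras_axioms.intro azumayaD(1,4) B)
  let ?S = "matrix_algebra n B" and ?K = "{..<n} \<times> {..<n}"
  have R: "cring R" by (rule module.axioms(1)[OF azumayaD(4)[OF A]])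
  obtain k m l where co: "coordinates R ?S k m l"
    using presented_coordinates[OF azumayaD(2)[OF B] TB.S_module TB.presented_S] .
  interpret S: algebra_coordinates R ?S k m l
    by (rule algebra_coordinates.intro[OF co algebra_coordinates_axioms.intro[OF TB.S_R_algebra]])
  obtain \<theta> where "\<theta> \<in> algebra_isos R TA.S ?S" using iso by (auto simp: algebra_iso_def)
  then have \<theta>: "\<theta> \<in> algebra_homs R TA.S ?S" "bij_betw \<theta> (carrier TA.S) (carrier ?S)"
    by (auto simp: algebra_isos_def algebra_homs_def ring_iso_def)
  note th = algebra_homsD[OF \<theta>(1)]
  obtain q p x y t s \<mu> where sf: "separable_families R B q p x y t s \<mu>"
    using azumaya_separable_families[OF B] by blast
  let ?E = "\<lambda>c. TB.unit_entry c" and ?E' = "\<lambda>c. \<theta> (TA.unit_entry c)"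
  note b = algebra_homsD[OF TB.diag_hom]
  have Ec: "?E c \<in> carrier ?S" "?E' c \<in> carrier ?S" for c
    by (simp_all add: TB.single_entry_closed TA.single_entry_closed th(2))
  let ?P = "\<lambda>i j. emb R (if i = j then \<one>\<^bsub>R\<^esub> else \<zero>\<^bsub>R\<^esub>)"
  have us: "unit_system n ?P S.unit_mat (\<lambda>c. S.left_mat (?E c))"
    "unit_system n ?P S.unit_mat (\<lambda>c. S.right_mat (?E (snd c, fst c)))"
    by (rule S.unit_systems[OF Ec(1) TB.unit_entry_mult TB.unit_entry_sum]; assumption)+
  have us': "unit_system n ?P S.unit_mat (\<lambda>c. S.left_mat (?E' c))"
  proof (rule S.unit_systems(1))
    show "?E' (i, j) \<otimes>\<^bsub>?S\<^esub> ?E' (a, b) = (if j = a then ?E' (i, b) else \<zero>\<^bsub>?S\<^esub>)"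
      if "i < n" "j < n" "a < n" "b < n" for i j a b
      using TA.unit_entry_mult[OF that] th(3)[of "TA.unit_entry (i, j)" "TA.unit_entry (a, b)"]
        module_hom_zero[OF TA.S_module TB.S_module th(1)]
      by (simp add: TA.single_entry_closed split: if_splits)
    have "\<theta> (\<Oplus>\<^bsub>TA.S\<^esub>i\<in>{..<n}. TA.unit_entry (i, i)) = (\<Oplus>\<^bsub>?S\<^esub>i\<in>{..<n}. ?E' (i, i))"
      by (rule module_hom_sum[OF TA.S_module TB.S_module th(1)]) (simp add: TA.single_entry_closed)
    then show "(\<Oplus>\<^bsub>?S\<^esub>i\<in>{..<n}. ?E' (i, i)) = \<one>\<^bsub>?S\<^esub>" unfolding TA.unit_entry_sum th(4) by (rule sym)
  qed (rule Ec)
  \<comment> \<open>Again the single weight at (0, 0), available because \<open>n\<close> is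
    positive.\<close>
  have s: "smul (\<Sum>p\<in>?K. (if p = (0, 0) then emb R \<one>\<^bsub>R\<^esub> else 0) * ?P (fst p) (snd p)) S.unit_mat = S.unit_mat"
  proof -
    have "(\<Sum>p\<in>?K. (if p = (0, 0) then emb R \<one>\<^bsub>R\<^esub> else 0) * ?P (fst p) (snd p)) =
        (\<Sum>p\<in>?K. if p = (0, 0) then emb R \<one>\<^bsub>R\<^esub> * emb R \<one>\<^bsub>R\<^esub> else 0)"
      by (rule sum.cong) auto
    also have "\<dots> = emb R \<one>\<^bsub>R\<^esub>"
      using n cring.emb_one_mult[OF R] cring.cring_simprules(6)[OF R] by simp
    finally show ?thesis using S.smul_one_unit_mat by simp
  qed
  let ?M = "proj_maximals R"
  let ?G0 = "{H. S.unit_mat * H * S.unit_mat = H}"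
  let ?G1 = "{H \<in> ?G0. \<forall>u\<in>carrier B. S.right_mat (TB.diag u) * H = H * S.right_mat (TB.diag u)}"
  let ?G2 = "{H \<in> ?G1. \<forall>c\<in>?K. S.right_mat (?E (snd c, fst c)) * H = H * S.right_mat (?E (snd c, fst c))}"
  have G1: "good_order S.unit_mat ?M ?G1"
    by (rule good_order_commutant[OF S.good_order_unit_mat cring.proj_maximalsD[OF R]
        separating_antihom[OF S.actions(2)[OF azumayaD(1)[OF B] TB.diag_hom] _ sf]])
      (simp_all add: b S.right_mat_mult S.left_mat_corner)
  have swap: "TB.diag u \<otimes>\<^bsub>?S\<^esub> ?E c = ?E c \<otimes>\<^bsub>?S\<^esub> TB.diag u" if "u \<in> carrier B" "c \<in> ?K" for u c
    using TB.centralizer_unit_entries[OF n] that by blast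
  \<comment> \<open>Diagonal matrices commute with the matrix units, so the right multiplications by
    units lie in the commutant \<open>?G1\<close> of those by \<open>B\<close>.\<close>
  have comm: "S.right_mat (TB.diag u) * S.right_mat (?E c) = S.right_mat (?E c) * S.right_mat (TB.diag u)"
    if "u \<in> carrier B" "c \<in> ?K" for u c
    using S.right_mat_mult[OF Ec(1) b(2)[OF that(1)], of c] S.right_mat_mult[OF b(2)[OF that(1)] Ec(1), of c]
      swap[OF that] by simp
  have G2: "good_order S.unit_mat ?M ?G2"
  proof (rule good_order_commutant[OF G1 cring.proj_maximalsD[OF R] separating_unit_system[OF us(2) us(2) s]])
    show "S.right_mat (?E (snd c, fst c)) \<in> ?G1" if "c \<in> ?K" for c
      using that by (auto simp: S.left_mat_corner Ec comm)
  qed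
  have in_G2: "S.left_mat a \<in> ?G2" if "a \<in> carrier ?S" for a
    using that by (simp add: S.left_mat_corner S.left_right_commute b Ec)
  have lin: "h v = h \<one>\<^bsub>?S\<^esub> \<otimes>\<^bsub>?S\<^esub> v" if h: "h \<in> module_hom R ?S ?S" "S.mat_of h \<in> ?G2" and v: "v \<in> carrier ?S" for h v
  proof -
    have h1: "h \<one>\<^bsub>?S\<^esub> \<in> carrier ?S" using module_homD(1)[OF h(1)] by simp
    have eq: "h (TB.diag u \<otimes>\<^bsub>?S\<^esub> ?E (i, j)) = h \<one>\<^bsub>?S\<^esub> \<otimes>\<^bsub>?S\<^esub> (TB.diag u \<otimes>\<^bsub>?S\<^esub> ?E (i, j))"
      if "u \<in> carrier B" "i < n" "j < n" for u i j
    proof -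
      have "S.right_mat (?E (i, j)) * S.mat_of h = S.mat_of h * S.right_mat (?E (i, j))"
        using h(2) that by force
      then have "h (TB.diag u \<otimes>\<^bsub>?S\<^esub> ?E (i, j)) = h (TB.diag u) \<otimes>\<^bsub>?S\<^esub> ?E (i, j)"
        by (rule S.commute_right_mat[OF h(1) Ec(1) _ b(2)[OF that(1)]])
      moreover have "h (\<one>\<^bsub>?S\<^esub> \<otimes>\<^bsub>?S\<^esub> TB.diag u) = h \<one>\<^bsub>?S\<^esub> \<otimes>\<^bsub>?S\<^esub> TB.diag u"
        using h that b(2) by (intro S.commute_right_mat) auto
      ultimately show ?thesis using b(2)[OF that(1)] Ec(1) h1 by (simp add: S.A.m_assoc)
    qed
    \<comment> \<open>A matrix is the sum of its single entries, each a product of a diagonal matrix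
      and a matrix unit; on such products \<open>h\<close> is already known to be left
      multiplication by \<open>h \<one>\<close>.\<close>
    define w where "w = (\<lambda>i. TB.single_entry (i div n, i mod n) (v (i div n, i mod n)))"
    have pos: "i div n < n" "i mod n < n" if "i < n * n" for i
      using that n by (auto simp: less_mult_imp_div_less)
    have wc: "w i \<in> carrier ?S" and hw: "h (w i) = h \<one>\<^bsub>?S\<^esub> \<otimes>\<^bsub>?S\<^esub> w i" if "i < n * n" for i
    proof -
      have u: "v (i div n, i mod n) \<in> carrier B" by (rule TB.S_entry[OF v pos[OF that]])
      then show "w i \<in> carrier ?S" unfolding w_def by (rule TB.single_entry_closed)
      show "h (w i) = h \<one>\<^bsub>?S\<^esub> \<otimes>\<^bsub>?S\<^esub> w i"
        using eq[OF u pos[OF that]] unfolding TB.single_entry_mult[OF u pos[OF that]] w_def .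
    qed
    have sum: "(\<Oplus>\<^bsub>?S\<^esub>i\<in>{..<n * n}. w i) = v" using TB.presented_S v unfolding presented_def w_def by blast
    have "h v = (\<Oplus>\<^bsub>?S\<^esub>i\<in>{..<n * n}. h (w i))"
      unfolding sum[symmetric] by (rule module_hom_sum[OF TB.S_module TB.S_module h(1)]) (simp add: wc)
    also have "\<dots> = (\<Oplus>\<^bsub>?S\<^esub>i\<in>{..<n * n}. h \<one>\<^bsub>?S\<^esub> \<otimes>\<^bsub>?S\<^esub> w i)"
      using hw wc h1 by (intro S.M.finsum_cong') auto
    also have "\<dots> = h \<one>\<^bsub>?S\<^esub> \<otimes>\<^bsub>?S\<^esub> (\<Oplus>\<^bsub>?S\<^esub>i\<in>{..<n * n}. w i)"
      by (rule module_hom_sum[OF TB.S_module TB.S_module S.lh[OF h1], symmetric]) (simp add: wc)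
    finally show ?thesis unfolding sum .
  qed
  obtain w w' where w: "w \<in> carrier ?S" "w' \<in> carrier ?S" "w \<otimes>\<^bsub>?S\<^esub> w' = \<one>\<^bsub>?S\<^esub>" "w' \<otimes>\<^bsub>?S\<^esub> w = \<one>\<^bsub>?S\<^esub>"
    "\<And>c. c \<in> ?K \<Longrightarrow> w \<otimes>\<^bsub>?S\<^esub> ?E' c = ?E c \<otimes>\<^bsub>?S\<^esub> w"
  proof (rule S.conjugating_unit[OF LG G2 separating_unit_system[OF us(1) us' s] separating_unit_system[OF us' us(1) s] in_G2])
    show "h v = h \<one>\<^bsub>?S\<^esub> \<otimes>\<^bsub>?S\<^esub> v" if "h \<in> module_hom R ?S ?S" "S.mat_of h \<in> ?G2" "v \<in> carrier ?S" for h v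
      by (rule lin[OF that])
  qed (assumption | rule that | rule Ec)+
  show ?thesis
    by (rule algebra_iso_of_conjugate[OF TB.S_R_algebra azumayaD(4)[OF A] azumayaD(4)[OF B] azumayaD(5)[OF A]
        azumayaD(5)[OF B] TA.diag_hom TA.inj_diag[OF n] TB.diag_hom TB.inj_diag[OF n]
        TA.centralizer_unit_entries[OF n] TB.centralizer_unit_entries[OF n] _ _ \<theta> TA.S_R_algebra w(1-4)])
      (use w(5) in \<open>auto simp: TA.single_entry_closed TB.single_entry_closed\<close>)
qed

theorem mainTheorem7:
  fixes R :: "('a, 'r) ring_scheme"
    and M1 :: "('a, 'm1) module" and M2 :: "('a, 'm2) module" and N :: "('a, 'n) module"
    and A :: "('a, 'b) module" and B :: "('a, 'c) module" and C :: "('a, 'd) module"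
  assumes "LG_ring R"
  shows
    "(finite_projective R M1 \<and> finite_projective R M2 \<longrightarrow>
        (faithfully_projective R N \<longrightarrow>
           module_iso R (tensor R M1 N) (tensor R M2 N) \<longrightarrow> module_iso R M1 M2) \<and>
        (\<forall>n>0. module_iso R (direct_power n M1) (direct_power n M2) \<longrightarrow> module_iso R M1 M2)) \<and>
     (azumaya R A \<and> azumaya R B \<longrightarrow>
        (azumaya R C \<longrightarrow>
           algebra_iso R (tensor R A C) (tensor R B C) \<longrightarrow> algebra_iso R A B) \<and>
        (\<forall>n>0. algebra_iso R (matrix_algebra n A) (matrix_algebra n B) \<longrightarrow> algebra_iso R A B))"
  using tensor_cancel[OF assms] direct_power_cancel[OF assms] azumaya_tensor_cancel[OF assms]
    azumaya_matrix_cancel[OF assms]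
  by blast

end
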